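(* Let $r\geq 1$ and $\mathbf n=(n_1,\dots,n_r)\in\mathbb Z_{\geq0}^r\setminus\{\mathbf 0\}$. Then the poset $W_{\mathbf n}^{\mathrm{tree}}$ of stable tree-pairs of type $\mathbf n$ and the poset $W_{\mathbf n}^{\mathrm{br}}$ of 2-bracketings of $\mathbf n$ are isomorphic as posets.
   Context: **Rooted ribbon trees.** A rooted ribbon tree (RRT) is a finite tree $T$ with a chosen root $\alpha_{\mathrm{root}}$, edges oriented toward the root, together with a linear order $<_\alpha$ on the set $\mathrm{in}(\alpha)$ of incoming neighbors of each vertex $\alpha$ (so $\mathrm{in}(\alpha)$ is a finite sequence). A vertex is interior if $\mathrm{in}(\alpha)\neq\emptyset$, otherwise a leaf. The leaves are numbered $\lambda_1,\lambda_2,\dots$ in the left-to-right order induced by the orders $<_\alpha$. $T$ is stable if every interior vertex has at least 2 incoming neighbors. $K_r^{\mathrm{tree}}$ is the set of isomorphism classes of stable RRTs with $r$ leaves ($K_1^{\mathrm{tree}}$ consists of the one-vertex tree). **Stable tree-pairs.** A stable tree-pair of type $\mathbf n$ is a datum $2T=(T_b\xrightarrow{f}T_s)$ as follows. (i) The bubble tree $T_b$ is an RRT whose edges are each solid or dashed. Its vertices are partitioned as $V_{\mathrm{comp}}\sqcup V_{\mathrm{seam}}\sqcup V_{\mathrm{mark}}$, where: each $\alpha\in V_{\mathrm{comp}}$ has at least one solid incoming edge, no dashed incoming edge, and either a dashed outgoing edge or no outgoing edge; each $\alpha\in V_{\mathrm{seam}}$ has $\ge0$ dashed incoming edges, no solid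 incoming edge, and a solid outgoing edge; each $\alpha\in V_{\mathrm{mark}}$ has no incoming edge and either a dashed outgoing edge or no outgoing edge. Write $V_{\mathrm{comp}}=V_{\mathrm{comp}}^1\sqcup V_{\mathrm{comp}}^{\ge2}$ according to the number of incoming edges. Stability: if $\alpha\in V^1_{\mathrm{comp}}$ has $\mathrm{in}(\alpha)=(\beta)$ then $\#\mathrm{in}(\beta)\ge2$; if $\alpha\in V_{\mathrm{comp}}^{\ge2}$ has $\mathrm{in}(\alpha)=(\beta_1,\dots,\beta_\ell)$ then some $\#\mathrm{in}(\beta_j)\ge1$. (ii) The seam tree $T_s$ is an element of $K_r^{\mathrm{tree}}$. (iii) The coherence map $f\colon T_b\to T_s$ is a map of vertex sets such that: $f$ sends root to root, and if $\beta\in\mathrm{in}(\alpha)$ then $f(\beta)\in\mathrm{in}(f(\alpha))$ or $f(\beta)=f(\alpha)$; $f$ contracts (sends both endpoints to the same vertex) all dashed edges and every solid edge whose terminal vertex (the endpoint closer to the root) lies in $V^1_{\mathrm{comp}}$; for $\alpha\in V_{\mathrm{comp}}^{\ge2}$, $f$ maps $\mathrm{in}(\alpha)$ bijectively and order-preservingly onto $\mathrm{in}(f(\alpha))$; $f$ sends every element of $V_{\mathrm{mark}}$ to a leaf of $T_s$, and $f^{-1}\{\lambda_i\}$ contains exactly $n_i$ elements of $V_{\mathrm{mark}}$, denoted $\mu_{i1},\dots,\mu_{in_i}$ in left-to-right order. $W^{\mathrm{tree}}_{\mathbf n}$ is the set of isomorphism classes of stable tree-pairs of type $\mathbf n$ (isomorphisms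 are pairs of isomorphisms of bubble trees and of seam trees, respecting all structure and commuting with the coherence maps). **Moves.** Three types of moves can be applied to $2T$. Type 1: choose $\alpha\in V_{\mathrm{comp}}(T_b)$, $\beta\in\mathrm{in}(\alpha)$ with $\mathrm{in}(\beta)=(\gamma_1,\dots,\gamma_k)$, and a consecutive block $(\gamma_{p+1},\dots,\gamma_{p+l})$ with $2\le l<k$ if $\#\mathrm{in}(\alpha)=1$ and $2\le l\le k$ if $\#\mathrm{in}(\alpha)\ge2$. Replace the block in $\mathrm{in}(\beta)$ by one new vertex $\delta\in V_{\mathrm{comp}}$ (dashed edge to $\beta$), which has a single incoming neighbor, a new vertex $\epsilon\in V_{\mathrm{seam}}$ (solid edge), with $\mathrm{in}(\epsilon)=(\gamma_{p+1},\dots,\gamma_{p+l})$ (dashed edges). $T_s$ is unchanged; $f(\delta)=f(\epsilon)=f(\beta)$. Type 2: choose an interior vertex $\alpha$ of $T_s$ with $\mathrm{in}(\alpha)=(\gamma_1,\dots,\gamma_k)$ and a consecutive block $(\gamma_{p+1},\dots,\gamma_{p+l})$, $2\le l<k$. In $T_s$, replace this block in $\mathrm{in}(\alpha)$ by a new vertex $v$ with $\mathrm{in}(v)=(\gamma_{p+1},\dots,\gamma_{p+l})$. For every $\tilde\alpha\in V_{\mathrm{comp}}^{\ge2}(T_b)\cap f^{-1}\{\alpha\}$, with $\mathrm{in}(\tilde\alpha)=(\beta_1,\dots,\beta_k)$, put $\mathbf a=(\#\mathrm{in}(\beta_{p+i}))_{i=1}^l$ and choose $q\ge0$ and $\mathbf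 b^1,\dots,\mathbf b^q\in\mathbb Z_{\ge0}^l\setminus\{\mathbf0\}$ with $\mathbf a=\sum_j\mathbf b^j$. Replace $\beta_{p+1},\dots,\beta_{p+l}$ in $\mathrm{in}(\tilde\alpha)$ by one new seam vertex $\epsilon$, with $\mathrm{in}(\epsilon)=(\delta_1,\dots,\delta_q)$ new vertices in $V_{\mathrm{comp}}$ (dashed edges), each with $\mathrm{in}(\delta_j)=(\epsilon_{j1},\dots,\epsilon_{jl})$ new seam vertices (solid edges); for each $i$, the sequence $\mathrm{in}(\beta_{p+i})$ is cut, in order, into consecutive blocks of lengths $b^1_i,\dots,b^q_i$, the $j$-th of which becomes $\mathrm{in}(\epsilon_{ji})$. Set $f(\epsilon)=f(\delta_j)=v$ and $f(\epsilon_{ji})=\gamma_{p+i}$. Type 3: choose $\alpha\in V^{\ge2}_{\mathrm{comp}}(T_b)$ with $\mathrm{in}(\alpha)=(\beta_1,\dots,\beta_k)$, put $\mathbf a=(\#\mathrm{in}(\beta_i))_{i=1}^k$ and choose $q\ge2$ and $\mathbf b^1,\dots,\mathbf b^q\in\mathbb Z_{\ge0}^k\setminus\{\mathbf0\}$ with $\mathbf a=\sum_j\mathbf b^j$. Replace $\mathrm{in}(\alpha)$ by a single new seam vertex $\epsilon$ with $\mathrm{in}(\epsilon)=(\delta_1,\dots,\delta_q)$ new vertices in $V_{\mathrm{comp}}$, each with $\mathrm{in}(\delta_j)=(\epsilon_{j1},\dots,\epsilon_{jk})$ new seam vertices; for each $i$, $\mathrm{in}(\beta_i)$ is cut in order into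 consecutive blocks of lengths $b^1_i,\dots,b^q_i$, the $j$-th becoming $\mathrm{in}(\epsilon_{ji})$. $T_s$ is unchanged; $f(\epsilon)=f(\delta_j)=f(\alpha)$, $f(\epsilon_{ji})=f(\beta_i)$ (old value). The partial order on $W_{\mathbf n}^{\mathrm{tree}}$: $2T'\le 2T$ iff $2T'$ is obtained from $2T$ by a finite (possibly empty) sequence of moves. **2-bracketings.** A 1-bracket of $r$ is a nonempty consecutive subset $B\subset\{1,\dots,r\}$. A 1-bracketing of $r$ is a collection $\mathscr B$ of 1-brackets containing $\{1,\dots,r\}$ and every $\{i\}$, such that if $B,B'\in\mathscr B$ meet then $B\subset B'$ or $B'\subset B$. A 2-bracket of $\mathbf n$ is a pair $\mathbf{2B}=(B,(2B_i)_{i\in B})$ of a 1-bracket $B$ of $r$ and consecutive (possibly empty) subsets $2B_i\subset\{1,\dots,n_i\}$, $i\in B$, at least one nonempty. Write $\pi(\mathbf{2B})=B$, and $\mathbf{2B}'\subset\mathbf{2B}$ if $B'\subset B$ and $2B_i'\subset2B_i$ for all $i\in B'$. A 2-bracketing of $\mathbf n$ is a pair $(\mathscr B,2\mathscr B)$ with $\mathscr B$ a 1-bracketing of $r$ and $2\mathscr B$ a collection of 2-brackets of $\mathbf n$ such that, writing $2\mathscr B_{B_0}=\{\mathbf{2B}\in2\mathscr B : \pi(\mathbf{2B})=B_0\}$: (1) $\pi(\mathbf{2B})\in\mathscr B$ for all $\mathbf{2B}\in2\mathscr B$; (2) if $\mathbf{2B},\mathbf{2B}'\in2\mathscr B$ satisfy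 $2B_{i_0}\cap2B'_{i_0}\neq\emptyset$ for some $i_0\in\pi(\mathbf{2B})\cap\pi(\mathbf{2B}')$, then $\mathbf{2B}\subset\mathbf{2B}'$ or $\mathbf{2B}'\subset\mathbf{2B}$; (3) $2\mathscr B$ contains $(\{1,\dots,r\},(\{1,\dots,n_1\},\dots,\{1,\dots,n_r\}))$ and every $(\{i\},(\{j\}))$, $1\le i\le r$, $1\le j\le n_i$; (4) for every $B_0\in\mathscr B$ and $i\in B_0$, $\bigcup_{\mathbf{2B}\in2\mathscr B_{B_0}}2B_i=\{1,\dots,n_i\}$; and for every $\mathbf{2B}\in2\mathscr B_{B_0}$ for which some $\mathbf{2B}'\in2\mathscr B_{B_0}$ has $\mathbf{2B}'\subsetneq\mathbf{2B}$, and every $i\in B_0$, $j\in2B_i$, there is $\mathbf{2B}''\in2\mathscr B_{B_0}$ with $\mathbf{2B}''\subsetneq\mathbf{2B}$ and $j\in2B_i''$; (5) for every $B_0\in\mathscr B$, $2\mathscr B_{B_0}$ is endowed (as part of the data) with a strict partial order such that: $\mathbf{2B},\mathbf{2B}'\in2\mathscr B_{B_0}$ are comparable iff $2B_i\cap2B_i'=\emptyset$ for every $i\in B_0$; $(\{i\},(\{j\}))<(\{i\},(\{j'\}))$ whenever $j<j'$; and for $\mathbf{2B}^1,\mathbf{2B}^2\in2\mathscr B_{B_0}$ and $\widetilde{\mathbf{2B}}{}^1,\widetilde{\mathbf{2B}}{}^2\in2\mathscr B_{\widetilde B_0}$ with $\widetilde{\mathbf{2B}}{}^j\subset\mathbf{2B}^j$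 ($j=1,2$), $\mathbf{2B}^1<\mathbf{2B}^2$ implies $\widetilde{\mathbf{2B}}{}^1<\widetilde{\mathbf{2B}}{}^2$. $W^{\mathrm{br}}_{\mathbf n}$ is the set of 2-bracketings of $\mathbf n$, with $(\mathscr B',2\mathscr B')<(\mathscr B,2\mathscr B)$ iff $\mathscr B'\supset\mathscr B$ and $2\mathscr B'\supset2\mathscr B$ (where the latter means containment of collections such that the partial orders on the $2\mathscr B_{B_0}$ are the restrictions of those on the $2\mathscr B'_{B_0}$), with at least one containment proper. *)

theory Defs
  imports Main
begin

section \<open>Rooted ribbon trees\<close>

text \<open>
  The list \<open>inc T \<alpha>\<close> is the sequence in(\<alpha>) of incoming neighbours, in the order \<open><\<^sub>\<alpha>\<close>.
  The values of \<open>inc T\<close> outside of \<open>verts T\<close> carry no meaning; isomorphisms ignore them.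
\<close>

record 'v rrt =
  verts :: "'v set"
  rt :: 'v
  inc :: "'v \<Rightarrow> 'v list"

text \<open>An edge is a pair \<open>(\<beta>, \<alpha>)\<close> with \<open>\<alpha>\<close> its terminal vertex, the endpoint closer to the root.\<close>

definition edges :: "'v rrt \<Rightarrow> ('v \<times> 'v) set" where
  "edges T = {(\<beta>, \<alpha>). \<alpha> \<in> verts T \<and> \<beta> \<in> set (inc T \<alpha>)}"

definition is_rrt :: "'v rrt \<Rightarrow> bool" where
  "is_rrt T \<longleftrightarrow>
     finite (verts T) \<and> rt T \<in> verts T \<and>
     (\<forall>\<alpha>\<in>verts T. distinct (inc T \<alpha>) \<and> set (inc T \<alpha>) \<subseteq> verts T) \<and>
     (\<forall>\<alpha>. (rt T, \<alpha>) \<notin> edges T) \<and>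
     (\<forall>\<beta>\<in>verts T - {rt T}. \<exists>!\<alpha>. (\<beta>, \<alpha>) \<in> edges T) \<and>
     (\<forall>\<beta>\<in>verts T. (\<beta>, rt T) \<in> (edges T)\<^sup>*)"

definition interior :: "'v rrt \<Rightarrow> 'v set" where
  "interior T = {\<alpha> \<in> verts T. inc T \<alpha> \<noteq> []}"

definition leaves :: "'v rrt \<Rightarrow> 'v set" where
  "leaves T = {\<alpha> \<in> verts T. inc T \<alpha> = []}"

definition left_of :: "'v rrt \<Rightarrow> 'v \<Rightarrow> 'v \<Rightarrow> bool" where
  "left_of T x y \<longleftrightarrow>
     (\<exists>\<alpha>\<in>verts T. \<exists>i j. i < j \<and> j < length (inc T \<alpha>) \<and>
        (x, inc T \<alpha> ! i) \<in> (edges T)\<^sup>* \<and> (y, inc T \<alpha> ! j) \<in> (edges T)\<^sup>*)"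

text \<open>The number \<open>i\<close> with \<open>x = \<lambda>\<^sub>i\<close>, for a leaf \<open>x\<close>; numbering starts at 1.\<close>

definition leaf_no :: "'v rrt \<Rightarrow> 'v \<Rightarrow> nat" where
  "leaf_no T x = card {y \<in> leaves T. y = x \<or> left_of T y x}"

definition stable_rrt :: "nat \<Rightarrow> 'v rrt \<Rightarrow> bool" where
  "stable_rrt r T \<longleftrightarrow>
     is_rrt T \<and> (\<forall>\<alpha>\<in>interior T. 2 \<le> length (inc T \<alpha>)) \<and> card (leaves T) = r"

definition rrt_iso :: "('v \<Rightarrow> 'w) \<Rightarrow> 'v rrt \<Rightarrow> 'w rrt \<Rightarrow> bool" where
  "rrt_iso \<phi> T T' \<longleftrightarrow>
     bij_betw \<phi> (verts T) (verts T') \<and> \<phi> (rt T) = rt T' \<and>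
     (\<forall>\<alpha>\<in>verts T. inc T' (\<phi> \<alpha>) = map \<phi> (inc T \<alpha>))"


section \<open>Stable tree-pairs\<close>

record ('v, 'w) tree_pair =
  bub :: "'v rrt"
  solid :: "('v \<times> 'v) set"
  Vcomp :: "'v set"
  Vseam :: "'v set"
  Vmark :: "'v set"
  stree :: "'w rrt"
  coh :: "'v \<Rightarrow> 'w"

abbreviation inb :: "('v, 'w) tree_pair \<Rightarrow> 'v \<Rightarrow> 'v list" where
  "inb P \<equiv> inc (bub P)"

abbreviation ins :: "('v, 'w) tree_pair \<Rightarrow> 'w \<Rightarrow> 'w list" where
  "ins P \<equiv> inc (stree P)"

definition dashed :: "('v, 'w) tree_pair \<Rightarrow> ('v \<times> 'v) set" where
  "dashed P = edges (bub P) - solid P"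

definition Vcomp1 :: "('v, 'w) tree_pair \<Rightarrow> 'v set" where
  "Vcomp1 P = {\<alpha> \<in> Vcomp P. length (inb P \<alpha>) = 1}"

definition Vcomp2 :: "('v, 'w) tree_pair \<Rightarrow> 'v set" where
  "Vcomp2 P = {\<alpha> \<in> Vcomp P. 2 \<le> length (inb P \<alpha>)}"

definition bubble_tree :: "('v, 'w) tree_pair \<Rightarrow> bool" where
  "bubble_tree P \<longleftrightarrow>
     is_rrt (bub P) \<and> solid P \<subseteq> edges (bub P) \<and>
     verts (bub P) = Vcomp P \<union> Vseam P \<union> Vmark P \<and>
     Vcomp P \<inter> Vseam P = {} \<and> Vcomp P \<inter> Vmark P = {} \<and> Vseam P \<inter> Vmark P = {} \<and>
     (\<forall>\<alpha>\<in>Vcomp P.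
        (\<exists>\<beta>. (\<beta>, \<alpha>) \<in> solid P) \<and> (\<nexists>\<beta>. (\<beta>, \<alpha>) \<in> dashed P) \<and>
        ((\<exists>\<beta>. (\<alpha>, \<beta>) \<in> dashed P) \<or> (\<nexists>\<beta>. (\<alpha>, \<beta>) \<in> edges (bub P)))) \<and>
     (\<forall>\<alpha>\<in>Vseam P.
        (\<nexists>\<beta>. (\<beta>, \<alpha>) \<in> solid P) \<and> (\<exists>\<beta>. (\<alpha>, \<beta>) \<in> solid P)) \<and>
     (\<forall>\<alpha>\<in>Vmark P.
        (\<nexists>\<beta>. (\<beta>, \<alpha>) \<in> edges (bub P)) \<and>
        ((\<exists>\<beta>. (\<alpha>, \<beta>) \<in> dashed P) \<or> (\<nexists>\<beta>. (\<alpha>, \<beta>) \<in> edges (bub P)))) \<and>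
     (\<forall>\<alpha>\<in>Vcomp1 P. \<forall>\<beta>\<in>set (inb P \<alpha>). 2 \<le> length (inb P \<beta>)) \<and>
     (\<forall>\<alpha>\<in>Vcomp2 P. \<exists>\<beta>\<in>set (inb P \<alpha>). 1 \<le> length (inb P \<beta>))"

definition coherence_map :: "nat \<Rightarrow> (nat \<Rightarrow> nat) \<Rightarrow> ('v, 'w) tree_pair \<Rightarrow> bool" where
  "coherence_map r n P \<longleftrightarrow>
     coh P ` verts (bub P) \<subseteq> verts (stree P) \<and>
     coh P (rt (bub P)) = rt (stree P) \<and>
     (\<forall>(\<beta>, \<alpha>)\<in>edges (bub P). coh P \<beta> \<in> set (ins P (coh P \<alpha>)) \<or> coh P \<beta> = coh P \<alpha>) \<and>
     (\<forall>(\<beta>, \<alpha>)\<in>dashed P. coh P \<beta> = coh P \<alpha>) \<and>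
     (\<forall>(\<beta>, \<alpha>)\<in>solid P. \<alpha> \<in> Vcomp1 P \<longrightarrow> coh P \<beta> = coh P \<alpha>) \<and>
     (\<forall>\<alpha>\<in>Vcomp2 P. map (coh P) (inb P \<alpha>) = ins P (coh P \<alpha>)) \<and>
     coh P ` Vmark P \<subseteq> leaves (stree P) \<and>
     (\<forall>x\<in>leaves (stree P). card {\<mu> \<in> Vmark P. coh P \<mu> = x} = n (leaf_no (stree P) x))"

definition stable_tree_pair :: "nat \<Rightarrow> (nat \<Rightarrow> nat) \<Rightarrow> ('v, 'w) tree_pair \<Rightarrow> bool" where
  "stable_tree_pair r n P \<longleftrightarrow>
     bubble_tree P \<and> stable_rrt r (stree P) \<and> coherence_map r n P"

definition tree_pair_iso ::
  "('v \<Rightarrow> 'x) \<Rightarrow> ('w \<Rightarrow> 'y) \<Rightarrow> ('v, 'w) tree_pair \<Rightarrow> ('x, 'y) tree_pair \<Rightarrow> bool" where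
  "tree_pair_iso \<phi> \<psi> P P' \<longleftrightarrow>
     rrt_iso \<phi> (bub P) (bub P') \<and> rrt_iso \<psi> (stree P) (stree P') \<and>
     (\<forall>(\<beta>, \<alpha>)\<in>edges (bub P). (\<beta>, \<alpha>) \<in> solid P \<longleftrightarrow> (\<phi> \<beta>, \<phi> \<alpha>) \<in> solid P') \<and>
     \<phi> ` Vcomp P = Vcomp P' \<and> \<phi> ` Vseam P = Vseam P' \<and> \<phi> ` Vmark P = Vmark P' \<and>
     (\<forall>\<alpha>\<in>verts (bub P). coh P' (\<phi> \<alpha>) = \<psi> (coh P \<alpha>))"

text \<open>Every finite tree is isomorphic to one whose vertices are natural numbers.\<close>

definition tree_pair_iso_rel ::
  "nat \<Rightarrow> (nat \<Rightarrow> nat) \<Rightarrow> ((nat, nat) tree_pair \<times> (nat, nat) tree_pair) set" where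
  "tree_pair_iso_rel r n =
     {(P, P'). stable_tree_pair r n P \<and> stable_tree_pair r n P' \<and>
               (\<exists>\<phi> \<psi>. tree_pair_iso \<phi> \<psi> P P')}"

definition W_tree :: "nat \<Rightarrow> (nat \<Rightarrow> nat) \<Rightarrow> (nat, nat) tree_pair set set" where
  "W_tree r n = {P. stable_tree_pair r n P} // tree_pair_iso_rel r n"


section \<open>Moves\<close>

text \<open>
  Throughout, \<open>P'\<close> is the result of applying a move to \<open>P\<close>.
  Lists are indexed from 0, so the block \<open>x\<^sub>p\<^sub>+\<^sub>1, \<dots>, x\<^sub>p\<^sub>+\<^sub>l\<close> of a sequence \<open>x\<^sub>1, \<dots>, x\<^sub>k\<close>
  stored as a list \<open>xs\<close> is \<open>block p l xs\<close> and consists of \<open>xs ! (p + i)\<close> for \<open>i < l\<close>.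
\<close>

definition block :: "nat \<Rightarrow> nat \<Rightarrow> 'a list \<Rightarrow> 'a list" where
  "block p l xs = take l (drop p xs)"

definition replace_block :: "nat \<Rightarrow> nat \<Rightarrow> 'a \<Rightarrow> 'a list \<Rightarrow> 'a list" where
  "replace_block p l y xs = take p xs @ y # drop (p + l) xs"

definition move1 :: "('v, 'w) tree_pair \<Rightarrow> ('v, 'w) tree_pair \<Rightarrow> bool" where
  "move1 P P' \<longleftrightarrow>
     (\<exists>\<alpha> \<beta> p l \<delta> \<epsilon>.
        \<alpha> \<in> Vcomp P \<and> \<beta> \<in> set (inb P \<alpha>) \<and>
        2 \<le> l \<and> p + l \<le> length (inb P \<beta>) \<and>
        (length (inb P \<alpha>) = 1 \<longrightarrow> l < length (inb P \<beta>)) \<and>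
        \<delta> \<notin> verts (bub P) \<and> \<epsilon> \<notin> verts (bub P) \<and> \<delta> \<noteq> \<epsilon> \<and>
        verts (bub P') = verts (bub P) \<union> {\<delta>, \<epsilon>} \<and>
        rt (bub P') = rt (bub P) \<and>
        inb P' \<beta> = replace_block p l \<delta> (inb P \<beta>) \<and>
        inb P' \<delta> = [\<epsilon>] \<and>
        inb P' \<epsilon> = block p l (inb P \<beta>) \<and>
        (\<forall>x\<in>verts (bub P) - {\<beta>}. inb P' x = inb P x) \<and>
        solid P' = solid P \<union> {(\<epsilon>, \<delta>)} \<and>
        Vcomp P' = Vcomp P \<union> {\<delta>} \<and>
        Vseam P' = Vseam P \<union> {\<epsilon>} \<and>
        Vmark P' = Vmark P \<and>
        stree P' = stree P \<and>
        coh P' \<delta> = coh P \<beta> \<and> coh P' \<epsilon> = coh P \<beta> \<and>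
        (\<forall>x\<in>verts (bub P). coh P' x = coh P x))"

text \<open>
  The operation on bubble trees that is common to the moves of types 2 and 3, performed
  simultaneously at every \<open>a \<in> A\<close>.  The new vertices at \<open>a\<close> are \<open>\<epsilon> = \<nu> (Eps a)\<close>,
  \<open>\<delta>\<^sub>j\<^sub>+\<^sub>1 = \<nu> (Del a j)\<close> and \<open>\<epsilon>\<^sub>j\<^sub>+\<^sub>1\<^sub>,\<^sub>i\<^sub>+\<^sub>1 = \<nu> (Sub a j i)\<close>; the vectors \<open>\<^bold>b\<close> at \<open>a\<close> have the
  entries \<open>b a j i\<close>, where \<open>j < q a\<close> and \<open>i < l\<close>.
\<close>

datatype 'v new_vertex = Eps 'v | Del 'v nat | Sub 'v nat nat

definition splitting_data ::
  "('v, 'w) tree_pair \<Rightarrow> 'v \<Rightarrow> nat \<Rightarrow> nat \<Rightarrow> nat \<Rightarrow> (nat \<Rightarrow> nat \<Rightarrow> nat) \<Rightarrow> bool" where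
  "splitting_data P a p l q b \<longleftrightarrow>
     (\<forall>i<l. length (inb P (inb P a ! (p + i))) = (\<Sum>j<q. b j i)) \<and>
     (\<forall>j<q. \<exists>i<l. b j i \<noteq> 0)"

definition split_bubble ::
  "('v, 'w) tree_pair \<Rightarrow> ('v, 'w) tree_pair \<Rightarrow> 'v set \<Rightarrow> nat \<Rightarrow> nat \<Rightarrow>
   ('v \<Rightarrow> nat) \<Rightarrow> ('v \<Rightarrow> nat \<Rightarrow> nat \<Rightarrow> nat) \<Rightarrow> ('v new_vertex \<Rightarrow> 'v) \<Rightarrow> bool" where
  "split_bubble P P' A p l q b \<nu> \<longleftrightarrow>
     (let removed = {inb P a ! (p + i) | a i. a \<in> A \<and> i < l};
          new_eps = {\<nu> (Eps a) | a. a \<in> A};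
          new_del = {\<nu> (Del a j) | a j. a \<in> A \<and> j < q a};
          new_sub = {\<nu> (Sub a j i) | a j i. a \<in> A \<and> j < q a \<and> i < l}
      in
        inj \<nu> \<and> range \<nu> \<inter> verts (bub P) = {} \<and>
        verts (bub P') = (verts (bub P) - removed) \<union> new_eps \<union> new_del \<union> new_sub \<and>
        rt (bub P') = rt (bub P) \<and>
        (\<forall>a\<in>A.
           inb P' a = replace_block p l (\<nu> (Eps a)) (inb P a) \<and>
           inb P' (\<nu> (Eps a)) = map (\<lambda>j. \<nu> (Del a j)) [0..<q a] \<and>
           (\<forall>j<q a.
              inb P' (\<nu> (Del a j)) = map (\<lambda>i. \<nu> (Sub a j i)) [0..<l] \<and>
              (\<forall>i<l. inb P' (\<nu> (Sub a j i)) =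
                 block (\<Sum>m<j. b a m i) (b a j i) (inb P (inb P a ! (p + i)))))) \<and>
        (\<forall>x\<in>verts (bub P) - removed - A. inb P' x = inb P x) \<and>
        solid P' = {(x, y) \<in> solid P. x \<notin> removed} \<union>
                   {(\<nu> (Eps a), a) | a. a \<in> A} \<union>
                   {(\<nu> (Sub a j i), \<nu> (Del a j)) | a j i. a \<in> A \<and> j < q a \<and> i < l} \<and>
        Vcomp P' = Vcomp P \<union> new_del \<and>
        Vseam P' = (Vseam P - removed) \<union> new_eps \<union> new_sub \<and>
        Vmark P' = Vmark P \<and>
        (\<forall>x\<in>verts (bub P) - removed. coh P' x = coh P x))"

definition move2 :: "('v, 'w) tree_pair \<Rightarrow> ('v, 'w) tree_pair \<Rightarrow> bool" where
  "move2 P P' \<longleftrightarrow>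
     (\<exists>\<alpha> p l v A q b \<nu>.
        \<alpha> \<in> interior (stree P) \<and>
        2 \<le> l \<and> l < length (ins P \<alpha>) \<and> p + l \<le> length (ins P \<alpha>) \<and>
        v \<notin> verts (stree P) \<and>
        verts (stree P') = verts (stree P) \<union> {v} \<and>
        rt (stree P') = rt (stree P) \<and>
        ins P' \<alpha> = replace_block p l v (ins P \<alpha>) \<and>
        ins P' v = block p l (ins P \<alpha>) \<and>
        (\<forall>x\<in>verts (stree P) - {\<alpha>}. ins P' x = ins P x) \<and>
        A = {a \<in> Vcomp2 P. coh P a = \<alpha>} \<and>
        (\<forall>a\<in>A. splitting_data P a p l (q a) (b a)) \<and>
        split_bubble P P' A p l q b \<nu> \<and>
        (\<forall>a\<in>A.
           coh P' (\<nu> (Eps a)) = v \<and>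
           (\<forall>j<q a.
              coh P' (\<nu> (Del a j)) = v \<and>
              (\<forall>i<l. coh P' (\<nu> (Sub a j i)) = ins P \<alpha> ! (p + i)))))"

definition move3 :: "('v, 'w) tree_pair \<Rightarrow> ('v, 'w) tree_pair \<Rightarrow> bool" where
  "move3 P P' \<longleftrightarrow>
     (\<exists>\<alpha> k q b \<nu>.
        \<alpha> \<in> Vcomp2 P \<and> k = length (inb P \<alpha>) \<and> 2 \<le> q \<and>
        splitting_data P \<alpha> 0 k q b \<and>
        split_bubble P P' {\<alpha>} 0 k (\<lambda>_. q) (\<lambda>_. b) \<nu> \<and>
        stree P' = stree P \<and>
        coh P' (\<nu> (Eps \<alpha>)) = coh P \<alpha> \<and>
        (\<forall>j<q.
           coh P' (\<nu> (Del \<alpha> j)) = coh P \<alpha> \<and>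
           (\<forall>i<k. coh P' (\<nu> (Sub \<alpha> j i)) = coh P (inb P \<alpha> ! i))))"

definition move :: "('v, 'w) tree_pair \<Rightarrow> ('v, 'w) tree_pair \<Rightarrow> bool" where
  "move P P' \<longleftrightarrow> move1 P P' \<or> move2 P P' \<or> move3 P P'"

text \<open>As for all orders below, \<open>(X', X)\<close> in the relation means \<open>X' \<le> X\<close>.\<close>

definition W_tree_step ::
  "nat \<Rightarrow> (nat \<Rightarrow> nat) \<Rightarrow> ((nat, nat) tree_pair set \<times> (nat, nat) tree_pair set) set" where
  "W_tree_step r n =
     {(X', X). X' \<in> W_tree r n \<and> X \<in> W_tree r n \<and> (\<exists>P\<in>X. \<exists>P'\<in>X'. move P P')}"

definition W_tree_le ::
  "nat \<Rightarrow> (nat \<Rightarrow> nat) \<Rightarrow> ((nat, nat) tree_pair set \<times> (nat, nat) tree_pair set) set" where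
  "W_tree_le r n = {(X', X). X' \<in> W_tree r n \<and> X \<in> W_tree r n \<and> (X', X) \<in> (W_tree_step r n)\<^sup>*}"


section \<open>2-bracketings\<close>

definition consecutive :: "nat set \<Rightarrow> bool" where
  "consecutive S \<longleftrightarrow> (\<exists>a b. S = {a..b})"

definition one_bracket :: "nat \<Rightarrow> nat set \<Rightarrow> bool" where
  "one_bracket r B \<longleftrightarrow> B \<noteq> {} \<and> B \<subseteq> {1..r} \<and> consecutive B"

definition one_bracketing :: "nat \<Rightarrow> nat set set \<Rightarrow> bool" where
  "one_bracketing r \<B> \<longleftrightarrow>
     (\<forall>B\<in>\<B>. one_bracket r B) \<and> {1..r} \<in> \<B> \<and> (\<forall>i\<in>{1..r}. {i} \<in> \<B>) \<and>
     (\<forall>B\<in>\<B>. \<forall>B'\<in>\<B>. B \<inter> B' \<noteq> {} \<longrightarrow> B \<subseteq> B' \<or> B' \<subseteq> B)"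

text \<open>
  A 2-bracket is a pair \<open>X = (B, (2B\<^sub>i)\<^sub>i)\<close>.  The family is indexed by \<open>B\<close> only; it is stored
  as a function on all of \<open>nat\<close> whose value outside of \<open>B\<close> is normalized to the empty set.
\<close>

type_synonym two_bracket = "nat set \<times> (nat \<Rightarrow> nat set)"

abbreviation (input) base :: "two_bracket \<Rightarrow> nat set" where
  "base X \<equiv> fst X"

abbreviation (input) part :: "two_bracket \<Rightarrow> nat \<Rightarrow> nat set" where
  "part X \<equiv> snd X"

definition is_two_bracket :: "nat \<Rightarrow> (nat \<Rightarrow> nat) \<Rightarrow> two_bracket \<Rightarrow> bool" where
  "is_two_bracket r n X \<longleftrightarrow>
     one_bracket r (base X) \<and>
     (\<forall>i\<in>base X. part X i \<subseteq> {1..n i} \<and> consecutive (part X i)) \<and>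
     (\<exists>i\<in>base X. part X i \<noteq> {}) \<and>
     (\<forall>i. i \<notin> base X \<longrightarrow> part X i = {})"

definition tb_subset :: "two_bracket \<Rightarrow> two_bracket \<Rightarrow> bool" where
  "tb_subset X' X \<longleftrightarrow> base X' \<subseteq> base X \<and> (\<forall>i\<in>base X'. part X' i \<subseteq> part X i)"

definition tb_psubset :: "two_bracket \<Rightarrow> two_bracket \<Rightarrow> bool" where
  "tb_psubset X' X \<longleftrightarrow> tb_subset X' X \<and> X' \<noteq> X"

definition full_bracket :: "nat \<Rightarrow> (nat \<Rightarrow> nat) \<Rightarrow> two_bracket" where
  "full_bracket r n = ({1..r}, \<lambda>i. if i \<in> {1..r} then {1..n i} else {})"

definition point_bracket :: "nat \<Rightarrow> nat \<Rightarrow> two_bracket" where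
  "point_bracket i j = ({i}, \<lambda>m. if m = i then {j} else {})"

definition over :: "two_bracket set \<Rightarrow> nat set \<Rightarrow> two_bracket set" where
  "over \<X> B = {X \<in> \<X>. base X = B}"

text \<open>
  The strict orders on the sets \<open>over \<X> B\<close> are given by their union, which is a relation
  that relates only 2-brackets with the same base.
\<close>

record two_bracketing =
  ones :: "nat set set"
  twos :: "two_bracket set"
  tb_lt :: "(two_bracket \<times> two_bracket) set"

definition is_two_bracketing :: "nat \<Rightarrow> (nat \<Rightarrow> nat) \<Rightarrow> two_bracketing \<Rightarrow> bool" where
  "is_two_bracketing r n \<Z> \<longleftrightarrow>
     (let \<B> = ones \<Z>; \<X> = twos \<Z>; R = tb_lt \<Z> in
      one_bracketing r \<B> \<and> (\<forall>X\<in>\<X>. is_two_bracket r n X) \<and>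
      (\<forall>X\<in>\<X>. base X \<in> \<B>) \<and>
      (\<forall>X\<in>\<X>. \<forall>X'\<in>\<X>.
         (\<exists>i\<in>base X \<inter> base X'. part X i \<inter> part X' i \<noteq> {}) \<longrightarrow>
         tb_subset X X' \<or> tb_subset X' X) \<and>
      full_bracket r n \<in> \<X> \<and>
      (\<forall>i\<in>{1..r}. \<forall>j\<in>{1..n i}. point_bracket i j \<in> \<X>) \<and>
      (\<forall>B\<in>\<B>. \<forall>i\<in>B. (\<Union>X\<in>over \<X> B. part X i) = {1..n i}) \<and>
      (\<forall>B\<in>\<B>. \<forall>X\<in>over \<X> B. (\<exists>X'\<in>over \<X> B. tb_psubset X' X) \<longrightarrow>
         (\<forall>i\<in>B. \<forall>j\<in>part X i. \<exists>X''\<in>over \<X> B. tb_psubset X'' X \<and> j \<in> part X'' i)) \<and>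
      R \<subseteq> (\<Union>B\<in>\<B>. over \<X> B \<times> over \<X> B) \<and> irrefl R \<and> trans R \<and>
      (\<forall>B\<in>\<B>. \<forall>X\<in>over \<X> B. \<forall>X'\<in>over \<X> B.
         (X, X') \<in> R \<or> (X', X) \<in> R \<longleftrightarrow> (\<forall>i\<in>B. part X i \<inter> part X' i = {})) \<and>
      (\<forall>i\<in>{1..r}. \<forall>j\<in>{1..n i}. \<forall>j'\<in>{1..n i}.
         j < j' \<longrightarrow> (point_bracket i j, point_bracket i j') \<in> R) \<and>
      (\<forall>B\<in>\<B>. \<forall>B'\<in>\<B>.
         \<forall>X1\<in>over \<X> B. \<forall>X2\<in>over \<X> B. \<forall>Y1\<in>over \<X> B'. \<forall>Y2\<in>over \<X> B'.
           tb_subset Y1 X1 \<and> tb_subset Y2 X2 \<and> (X1, X2) \<in> R \<longrightarrow> (Y1, Y2) \<in> R))"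

definition W_br :: "nat \<Rightarrow> (nat \<Rightarrow> nat) \<Rightarrow> two_bracketing set" where
  "W_br r n = {\<Z>. is_two_bracketing r n \<Z>}"

definition W_br_less :: "nat \<Rightarrow> (nat \<Rightarrow> nat) \<Rightarrow> (two_bracketing \<times> two_bracketing) set" where
  "W_br_less r n =
     {(\<Z>', \<Z>). \<Z>' \<in> W_br r n \<and> \<Z> \<in> W_br r n \<and>
        ones \<Z> \<subseteq> ones \<Z>' \<and> twos \<Z> \<subseteq> twos \<Z>' \<and>
        tb_lt \<Z> = tb_lt \<Z>' \<inter> (twos \<Z> \<times> twos \<Z>) \<and>
        (ones \<Z> \<noteq> ones \<Z>' \<or> twos \<Z> \<noteq> twos \<Z>')}"

definition W_br_le :: "nat \<Rightarrow> (nat \<Rightarrow> nat) \<Rightarrow> (two_bracketing \<times> two_bracketing) set" where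
  "W_br_le r n = W_br_less r n \<union> Id_on (W_br r n)"


section \<open>Isomorphism of posets\<close>

definition poset_isomorphic :: "'a set \<Rightarrow> 'a rel \<Rightarrow> 'b set \<Rightarrow> 'b rel \<Rightarrow> bool" where
  "poset_isomorphic A le B le' \<longleftrightarrow>
     partial_order_on A le \<and> partial_order_on B le' \<and>
     (\<exists>\<phi>. bij_betw \<phi> A B \<and> (\<forall>x\<in>A. \<forall>y\<in>A. (x, y) \<in> le \<longleftrightarrow> (\<phi> x, \<phi> y) \<in> le'))"

end

theory Submission
  imports Defs "HOL-Library.Multiset" "HOL-Library.Nat_Bijection"
begin

text \<open>
  A vertex \<open>s\<close> of the seam tree is labelled by the set of leaf numbers below it, and a component or mark
  vertex \<open>\<alpha>\<close> of the bubble tree by the 2-bracket that consists of the label of its image and of the sets of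
  mark numbers below \<open>\<alpha>\<close>. The labels form a 2-bracketing, ordered by left-to-right position, and they
  determine the tree-pair up to isomorphism, because the children of a vertex are the maximal smaller
  brackets. Moves keep the old labels and add new ones. Conversely, if a 2-bracketing \<open>Z\<close> properly refines
  that of a tree-pair \<open>P\<close>, then some move on \<open>P\<close> stays coarser than \<open>Z\<close>: a new 1-bracket gives a move of
  type 2, and a new 2-bracket, inspected at the smallest component that contains it, gives one of type 1 or 3.
  As every 2-bracketing refines that of the tree-pair without proper brackets, a chain of moves that starts
  there realizes it; this also yields surjectivity without a direct construction of trees from brackets.
\<close>

section \<open>Blocks of lists\<close>

text \<open>Leaves and marks are numbered by counting over a whole tree, and such counts are hard to
  follow when a tree is cut and reassembled. The labels are therefore characterized by local
  conditions, collected in \<open>lbl\<close>, that have at most one solution; after a move they are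
  verified by extending the old labels to the new vertices. Seams resist labelling: one without
  children carries no marks, and the only seam of a component repeats the bracket of that component.
  So just components and marks receive brackets, and a seam is recovered from its parent. In the
  realization new 1-brackets come first. Once the 1-brackets agree, the base of a new 2-bracket is
  the label of a vertex of the seam tree, and only two positions relative to the smallest component
  around it remain, which are those that moves of type 1 and type 3 create. A move of type 2 has to
  cut all components over a vertex at once, and the finer 2-bracketing prescribes the cutting at
  each of them.\<close>

lemma set_block: "set (block p l xs) \<subseteq> set xs"
  by (auto simp: block_def dest: in_set_takeD in_set_dropD)

lemma length_block: "p + l \<le> length xs \<Longrightarrow> length (block p l xs) = l"
  by (simp add: block_def)

lemma nth_block: "i < l \<Longrightarrow> p + l \<le> length xs \<Longrightarrow> block p l xs ! i = xs ! (p + i)"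
  by (simp add: block_def)

lemma set_block_conv: "p + l \<le> length xs \<Longrightarrow> set (block p l xs) = (\<lambda>i. xs ! (p + i)) ` {..<l}"
proof -
  assume a: "p + l \<le> length xs"
  have "set (block p l xs) = (\<lambda>i. block p l xs ! i) ` {..<l}"
    using length_block[OF a] by (auto simp: set_conv_nth)
  then show ?thesis using a by (auto simp: nth_block)
qed

lemma block_conv_map: "p + l \<le> length xs \<Longrightarrow> block p l xs = map (\<lambda>i. xs ! (p + i)) [0..<l]"
  by (rule nth_equalityI) (auto simp: nth_block length_block)

lemma block_split: "p + l \<le> length xs \<Longrightarrow> xs = take p xs @ block p l xs @ drop (p + l) xs"
  by (metis append_take_drop_id block_def drop_drop add.commute)

lemma map_block: "map f (block p l xs) = block p l (map f xs)"
  by (simp add: block_def take_map drop_map)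

lemma length_replace_block: "p + l \<le> length xs \<Longrightarrow> length (replace_block p l y xs) = length xs - l + 1"
  by (simp add: replace_block_def)

lemma set_replace_block:
  "p + l \<le> length xs \<Longrightarrow> insert y (set xs) = set (replace_block p l y xs) \<union> set (block p l xs)"
proof -
  assume "p + l \<le> length xs"
  then have "set xs = set (take p xs @ block p l xs @ drop (p + l) xs)" using block_split by metis
  then show ?thesis by (auto simp: replace_block_def)
qed

lemma set_replace_block_distinct:
  "p + l \<le> length xs \<Longrightarrow> distinct xs \<Longrightarrow> y \<notin> set xs \<Longrightarrow>
    set (replace_block p l y xs) = insert y (set xs - set (block p l xs))"
proof -
  assume a: "p + l \<le> length xs" "distinct xs" "y \<notin> set xs"
  have e: "xs = take p xs @ block p l xs @ drop (p + l) xs" using a(1) by (rule block_split)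
  then have "set xs = set (take p xs) \<union> set (block p l xs) \<union> set (drop (p + l) xs)"
    by (metis set_append sup_assoc)
  moreover have "distinct (take p xs @ block p l xs @ drop (p + l) xs)" using e a(2) by metis
  ultimately show ?thesis by (auto simp: replace_block_def)
qed

lemma mset_replace_block:
  "p + l \<le> length xs \<Longrightarrow>
    mset (replace_block p l y xs) + mset (block p l xs) = add_mset y (mset xs)"
proof -
  assume "p + l \<le> length xs"
  then have "mset xs = mset (take p xs @ block p l xs @ drop (p + l) xs)" using block_split by metis
  then show ?thesis by (simp add: replace_block_def)
qed

text \<open>The prefix sums of \<open>c\<close> are the starting points of the pieces. This is the
  form in which the vectors \<open>b\<close> of a move cut a list of children.\<close>

lemma concat_blocks:
  "concat (map (\<lambda>j. block (\<Sum>m<j. c m) (c j) xs) [0..<q]) = take (\<Sum>j<q. c j) xs"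
  by (induction q) (simp_all add: block_def take_add)

text \<open>Converse direction: if a list is given as a concatenation of pieces, the lengths of the
  pieces recover them as blocks. In this way the vectors \<open>b\<close> of a move are read off
  from a desired cutting.\<close>

lemma blocks_of_concat:
  assumes "xs = concat (map g [0..<q])" "\<And>j. j < q \<Longrightarrow> c j = length (g j)" "j < q"
  shows "block (\<Sum>m<j. c m) (c j) xs = g j"
proof -
  have "[0..<q] = [0..<j] @ j # [Suc j..<q]"
    using assms(3) upt_add_eq_append[of 0 j "q - j"] by (simp add: upt_conv_Cons)
  then have x: "xs = concat (map g [0..<j]) @ g j @ concat (map g [Suc j..<q])"
    using assms(1) by simp
  have "length (concat (map g [0..<j])) = (\<Sum>m<j. c m)"
    using assms(2,3) by (auto simp: length_concat comp_def interv_sum_list_conv_sum_set_nat atLeast0LessThan)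
  then show ?thesis using x assms(2,3) by (simp add: block_def)
qed

text \<open>Along a list on which \<open>g\<close> is nondecreasing, the fibres of \<open>g\<close>
  are consecutive segments in the order of their values, and the induction splits off the last
  fibre. In the application \<open>g\<close> sends a vertex to the index of the new bracket that is
  to contain it.\<close>

lemma concat_filter_sorted:
  fixes g :: "'a \<Rightarrow> nat"
  shows "sorted (map g xs) \<Longrightarrow> \<forall>x\<in>set xs. g x < q \<Longrightarrow> concat (map (\<lambda>j. filter (\<lambda>x. g x = j) xs) [0..<q]) = xs"
proof (induction q arbitrary: xs)
  case (Suc q)
  define ys where "ys = filter (\<lambda>x. g x < q) xs"
  define zs where "zs = filter (\<lambda>x. g x = q) xs"
  have "xs = ys @ zs"
  proof -
    have "sorted (map g xs) \<Longrightarrow> \<forall>x\<in>set xs. g x \<le> q \<Longrightarrow>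
        xs = filter (\<lambda>x. g x < q) xs @ filter (\<lambda>x. g x = q) xs" for xs :: "'a list"
    proof (induction xs)
      case (Cons x xs)
      show ?case
      proof (cases "g x < q")
        case False
        then have "g x = q" using Cons.prems by auto
        then have "\<forall>y\<in>set xs. g y = q" using Cons.prems by fastforce
        then show ?thesis using \<open>g x = q\<close> by (simp add: filter_True filter_False)
      qed (use Cons in auto)
    qed simp
    then show ?thesis using Suc.prems unfolding ys_def zs_def by (simp add: less_Suc_eq_le)
  qed
  moreover have "concat (map (\<lambda>j. filter (\<lambda>x. g x = j) ys) [0..<q]) = ys"
    using Suc.prems by (intro Suc.IH) (auto simp: ys_def sorted_map sorted_wrt_filter)
  moreover have "map (\<lambda>j. filter (\<lambda>x. g x = j) xs) [0..<q] = map (\<lambda>j. filter (\<lambda>x. g x = j) ys) [0..<q]"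
  proof (intro map_cong refl)
    fix j assume "j \<in> set [0..<q]"
    then show "filter (\<lambda>x. g x = j) xs = filter (\<lambda>x. g x = j) ys"
      unfolding ys_def by (auto intro!: filter_cong)
  qed
  ultimately have "concat (map (\<lambda>j. filter (\<lambda>x. g x = j) xs) [0..<Suc q]) = ys @ zs"
    by (simp only: upt_Suc_append map_append concat_append le0) (simp add: zs_def)
  with \<open>xs = ys @ zs\<close> show ?case by simp
qed simp

text \<open>Distinct heads would be related in both directions. This upgrades an equality of sets of
  children to one of lists.\<close>

lemma sorted_wrt_unique:
  assumes "sorted_wrt R xs" "sorted_wrt R ys" "set xs = set ys"
    and asym: "\<And>x y. x \<in> set xs \<Longrightarrow> y \<in> set xs \<Longrightarrow> R x y \<Longrightarrow> \<not> R y x"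
  shows "xs = ys"
  using assms
proof (induction xs arbitrary: ys)
  case (Cons x xs)
  have "set ys \<noteq> {}" using Cons.prems(3) by auto
  then obtain y ys' where ys: "ys = y # ys'" by (cases ys) simp_all
  have "x = y"
  proof (rule ccontr)
    assume "x \<noteq> y"
    then have "R x y" "R y x" using Cons.prems(1,2,3) ys by auto
    then show False using Cons.prems(4)[of x y] Cons.prems(3) ys by auto
  qed
  have "\<not> R x x" using Cons.prems(4)[of x x] by auto
  then have "x \<notin> set xs" "x \<notin> set ys'" using Cons.prems(1,2) ys \<open>x = y\<close> by auto
  then have "set xs = set ys'" using Cons.prems(3) ys \<open>x = y\<close> by auto
  moreover have "sorted_wrt R xs" "sorted_wrt R ys'" using Cons.prems(1,2) ys by simp_all
  ultimately have "xs = ys'" using Cons.prems(4) by (intro Cons.IH) simp_all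
  then show ?case using ys \<open>x = y\<close> by simp
qed simp

text \<open>The set is the interval from its minimum to its maximum; the parameters are those of
  \<open>block p l\<close>.\<close>

lemma convex_index_set:
  assumes "I \<subseteq> {..<k}" "I \<noteq> {}" "\<And>a b c. a \<in> I \<Longrightarrow> c \<in> I \<Longrightarrow> a < b \<Longrightarrow> b < c \<Longrightarrow> b \<in> I"
  obtains p l :: nat where "I = {p..<p + l}" "1 \<le> l" "p + l \<le> k"
proof -
  have fin: "finite I" using assms(1) finite_subset by blast
  define p where "p = Min I"
  define m where "m = Max I"
  have pm: "p \<in> I" "m \<in> I" "\<And>x. x \<in> I \<Longrightarrow> p \<le> x \<and> x \<le> m"
    using fin assms(2) by (auto simp: p_def m_def)
  have "I = {p..<p + (m + 1 - p)}"
  proof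
    show "I \<subseteq> {p..<p + (m + 1 - p)}" using pm(3) by force
    show "{p..<p + (m + 1 - p)} \<subseteq> I"
    proof
      fix x assume "x \<in> {p..<p + (m + 1 - p)}"
      then have "p \<le> x" "x \<le> m" by auto
      then show "x \<in> I" using assms(3)[OF pm(1,2)] pm by (metis le_neq_implies_less)
    qed
  qed
  moreover have "p \<le> m" "m < k" using pm assms(1) by auto
  ultimately show thesis by (intro that[of p "m + 1 - p"]) auto
qed


section \<open>Rooted ribbon trees\<close>

abbreviation below :: "'v rrt \<Rightarrow> 'v \<Rightarrow> 'v \<Rightarrow> bool" where
  "below T x y \<equiv> (x, y) \<in> (edges T)\<^sup>*"

lemma edgeI: "v \<in> verts T \<Longrightarrow> c \<in> set (inc T v) \<Longrightarrow> (c, v) \<in> edges T"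
  by (simp add: edges_def)

lemma below_child: "v \<in> verts T \<Longrightarrow> c \<in> set (inc T v) \<Longrightarrow> below T c v"
  by (simp add: edgeI r_into_rtrancl)

locale ribbon_tree =
  fixes T :: "'v rrt"
  assumes rrt: "is_rrt T"
begin

lemma fin [simp]: "finite (verts T)" and rt_in [simp]: "rt T \<in> verts T"
  using rrt by (auto simp: is_rrt_def)

lemma dist: "v \<in> verts T \<Longrightarrow> distinct (inc T v)"
  using rrt by (auto simp: is_rrt_def)

lemma child_in: "v \<in> verts T \<Longrightarrow> c \<in> set (inc T v) \<Longrightarrow> c \<in> verts T"
  using rrt by (auto simp: is_rrt_def)

lemma nth_in: "v \<in> verts T \<Longrightarrow> i < length (inc T v) \<Longrightarrow> inc T v ! i \<in> verts T"
  using child_in nth_mem by blast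

lemma edge_verts: "(x, y) \<in> edges T \<Longrightarrow> x \<in> verts T \<and> y \<in> verts T"
  using child_in by (auto simp: edges_def)

lemma rt_no_parent: "(rt T, y) \<notin> edges T"
  using rrt by (auto simp: is_rrt_def)

lemma below_rt: "v \<in> verts T \<Longrightarrow> below T v (rt T)"
  using rrt by (auto simp: is_rrt_def)

lemma edge_unique: "(x, a) \<in> edges T \<Longrightarrow> (x, b) \<in> edges T \<Longrightarrow> a = b"
  using rrt rt_no_parent edge_verts unfolding is_rrt_def by (metis DiffI singletonD)

lemma parent_unique:
  "a \<in> verts T \<Longrightarrow> b \<in> verts T \<Longrightarrow> x \<in> set (inc T a) \<Longrightarrow> x \<in> set (inc T b) \<Longrightarrow> a = b"
  using edge_unique edgeI by metis

lemma parent_ex: "v \<in> verts T \<Longrightarrow> v \<noteq> rt T \<Longrightarrow> \<exists>a\<in>verts T. v \<in> set (inc T a)"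
  using rrt by (auto simp: is_rrt_def edges_def)

lemma rt_not_child: "v \<in> verts T \<Longrightarrow> rt T \<notin> set (inc T v)"
  using rt_no_parent edgeI by metis

text \<open>The edge relation is single-valued, so there is only one path upwards from
  \<open>x\<close>, and both vertices lie on it.\<close>

lemma chain: "below T x y \<Longrightarrow> below T x z \<Longrightarrow> below T y z \<or> below T z y"
  using edge_unique by (intro single_valued_confluent) (auto simp: single_valued_def)

text \<open>Outgoing edges are unique, so the successor of a vertex on a cycle lies on a cycle
  again. Following the path to the root would put the root on a cycle, although it has no outgoing
  edge.\<close>

lemma acyc: "(x, x) \<notin> (edges T)\<^sup>+"
proof
  assume a: "(x, x) \<in> (edges T)\<^sup>+"
  then have "x \<in> verts T" by (metis edge_verts tranclD)
  then have "below T x (rt T)" by (rule below_rt)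
  then have "(rt T, rt T) \<in> (edges T)\<^sup>+"
  proof (induction rule: rtrancl_induct)
    case (step y z)
    obtain w where "(y, w) \<in> edges T" "below T w y" using step.IH by (metis tranclD)
    then show ?case using step.hyps(2) edge_unique by (metis rtrancl_into_trancl1)
  qed (rule a)
  then show False by (metis tranclD rt_no_parent)
qed

lemma below_antisym: "below T x y \<Longrightarrow> below T y x \<Longrightarrow> x = y"
  using acyc by (metis rtranclD trancl_rtrancl_trancl)

lemma wf_edges: "wf (edges T)"
proof (rule finite_acyclic_wf)
  show "finite (edges T)"
    by (rule finite_subset[of _ "verts T \<times> verts T"]) (auto dest: edge_verts)
  show "acyclic (edges T)" using acyc by (auto simp: acyclic_def)
qed

lemma bottom_up [consumes 1, case_names step]:
  assumes "v \<in> verts T"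
    and "\<And>v. v \<in> verts T \<Longrightarrow> (\<And>c. c \<in> set (inc T v) \<Longrightarrow> Q c) \<Longrightarrow> Q v"
  shows "Q v"
proof -
  have "v \<in> verts T \<longrightarrow> Q v"
    by (induction rule: wf_induct_rule[OF wf_edges]) (metis assms(2) child_in edgeI)
  then show ?thesis using assms(1) by blast
qed

lemma top_down [consumes 1, case_names root step]:
  assumes "v \<in> verts T" "Q (rt T)"
    and "\<And>v c. v \<in> verts T \<Longrightarrow> Q v \<Longrightarrow> c \<in> set (inc T v) \<Longrightarrow> Q c"
  shows "Q v"
  using below_rt[OF assms(1)]
proof (induction rule: converse_rtrancl_induct)
  case (step y z)
  then show ?case using assms(3) by (auto simp: edges_def)
qed (rule assms(2))

lemma below_cases:
  assumes "below T x v" "x \<noteq> v"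
  obtains c where "c \<in> set (inc T v)" "below T x c" "v \<in> verts T"
proof -
  have "(x, v) \<in> (edges T)\<^sup>+" using assms by (metis rtranclD)
  then obtain c where "below T x c" "(c, v) \<in> edges T" by (metis tranclD2)
  then show thesis using that by (auto simp: edges_def)
qed

lemma not_above_child: "v \<in> verts T \<Longrightarrow> c \<in> set (inc T v) \<Longrightarrow> \<not> below T v c"
  using acyc edgeI by (metis rtrancl_into_trancl1)

text \<open>The path from \<open>c\<close> to \<open>y\<close> has to begin with the only outgoing
  edge of \<open>c\<close>, which ends in \<open>v\<close>.\<close>

lemma below_parent:
  assumes "c \<in> set (inc T v)" "v \<in> verts T" "below T c y" "c \<noteq> y"
  shows "below T v y"
  using assms by (metis converse_rtranclE edgeI edge_unique)

lemma siblings_not_below: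
  assumes "v \<in> verts T" "c \<in> set (inc T v)" "d \<in> set (inc T v)" "below T c d"
  shows "c = d"
  using assms by (metis below_parent not_above_child)

lemma siblings_disjoint:
  assumes "v \<in> verts T" "c \<in> set (inc T v)" "d \<in> set (inc T v)" "below T x c" "below T x d"
  shows "c = d"
  using assms chain siblings_not_below by metis

lemma below_leaf: "v \<in> verts T \<Longrightarrow> \<exists>x\<in>leaves T. below T x v"
proof (induction rule: bottom_up)
  case (step v)
  show ?case
  proof (cases "inc T v")
    case Nil
    then show ?thesis using step(1) by (auto simp: leaves_def)
  next
    case (Cons c cs)
    then have "c \<in> set (inc T v)" by simp
    then show ?thesis using step below_child by (meson rtrancl_trans)
  qed
qed

lemma below_leaf_eq: "x \<in> leaves T \<Longrightarrow> below T y x \<Longrightarrow> y = x"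
  by (cases "y = x") (auto simp: leaves_def elim: below_cases)

lemma left_of_mono: "left_of T x y \<Longrightarrow> below T x' x \<Longrightarrow> below T y' y \<Longrightarrow> left_of T x' y'"
  unfolding left_of_def by (meson rtrancl_trans)

lemma left_of_child:
  "v \<in> verts T \<Longrightarrow> i < j \<Longrightarrow> j < length (inc T v) \<Longrightarrow> left_of T (inc T v ! i) (inc T v ! j)"
  unfolding left_of_def by blast

lemma left_of_not_below:
  assumes "left_of T x y"
  shows "\<not> below T x y" "\<not> below T y x"
proof -
  obtain v i j where v: "v \<in> verts T" "i < j" "j < length (inc T v)"
    "below T x (inc T v ! i)" "below T y (inc T v ! j)"
    using assms unfolding left_of_def by blast
  have ne: "inc T v ! i \<noteq> inc T v ! j"
    using dist[OF v(1)] v(2,3) by (simp add: nth_eq_iff_index_eq)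
  have mem: "inc T v ! i \<in> set (inc T v)" "inc T v ! j \<in> set (inc T v)" using v by auto
  show "\<not> below T x y" using siblings_disjoint[OF v(1) mem] v ne by (meson rtrancl_trans)
  show "\<not> below T y x" using siblings_disjoint[OF v(1) mem] v ne by (meson rtrancl_trans)
qed

lemma left_of_irrefl: "\<not> left_of T x x"
  using left_of_not_below by blast

text \<open>The vertices \<open>v\<close> and \<open>w\<close> at which the two pairs branch both
  lie above \<open>y\<close>, hence are comparable. The lower one sits in a single branch of the
  higher one, and the higher one then separates \<open>x\<close> from \<open>z\<close>.\<close>

lemma left_of_trans:
  assumes "left_of T x y" "left_of T y z"
  shows "left_of T x z"
proof -
  obtain v i j where v: "v \<in> verts T" "i < j" "j < length (inc T v)"
    "below T x (inc T v ! i)" "below T y (inc T v ! j)"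
    using assms(1) unfolding left_of_def by blast
  obtain w i' j' where w: "w \<in> verts T" "i' < j'" "j' < length (inc T w)"
    "below T y (inc T w ! i')" "below T z (inc T w ! j')"
    using assms(2) unfolding left_of_def by blast
  have memv: "inc T v ! i \<in> set (inc T v)" "inc T v ! j \<in> set (inc T v)" using v by auto
  have memw: "inc T w ! i' \<in> set (inc T w)" "inc T w ! j' \<in> set (inc T w)" using w by auto
  have yv: "below T y v" using v memv below_child by (meson rtrancl_trans)
  have yw: "below T y w" using w memw below_child by (meson rtrancl_trans)
  consider "v = w" | "v \<noteq> w" "below T v w" | "v \<noteq> w" "below T w v" using chain[OF yv yw] by blast
  then show ?thesis
  proof cases
    case 1
    then have "inc T v ! j = inc T v ! i'" using siblings_disjoint[OF v(1)] v w memv memw by metis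
    then have "j = i'" using dist[OF v(1)] v w 1 by (simp add: nth_eq_iff_index_eq)
    then show ?thesis unfolding left_of_def using v w 1 by (intro bexI[of _ v] exI[of _ i] exI[of _ j']) auto
  next
    case 2
    then obtain c where c: "c \<in> set (inc T w)" "below T v c" by (metis below_cases)
    then have "c = inc T w ! i'" using siblings_disjoint[OF w(1) c(1) memw(1)] w yv by (meson rtrancl_trans)
    moreover have "below T x v" using v memv below_child by (meson rtrancl_trans)
    ultimately have "below T x (inc T w ! i')" using c by (meson rtrancl_trans)
    then show ?thesis unfolding left_of_def using w by blast
  next
    case 3
    then obtain c where c: "c \<in> set (inc T v)" "below T w c" by (metis below_cases)
    then have "c = inc T v ! j" using siblings_disjoint[OF v(1) c(1) memv(2)] v yw by (meson rtrancl_trans)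
    moreover have "below T z w" using w memw below_child by (meson rtrancl_trans)
    ultimately have "below T z (inc T v ! j)" using c by (meson rtrancl_trans)
    then show ?thesis unfolding left_of_def using v by blast
  qed
qed

lemma left_of_asym: "left_of T x y \<Longrightarrow> \<not> left_of T y x"
  using left_of_trans left_of_irrefl by blast

text \<open>Induction on a common upper bound \<open>v\<close>, with the root as initial choice: as
  long as both vertices lie in the same branch at \<open>v\<close>, the bound moves down; once they
  lie in different branches, the order of the children decides.\<close>

lemma left_of_total:
  assumes "x \<in> verts T" "y \<in> verts T"
  shows "below T x y \<or> below T y x \<or> left_of T x y \<or> left_of T y x"
proof -
  have "below T x v \<Longrightarrow> below T y v \<Longrightarrow> below T x y \<or> below T y x \<or> left_of T x y \<or> left_of T y x"
    if "v \<in> verts T" for v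
    using that
  proof (induction rule: bottom_up)
    case (step v)
    show ?case
    proof (cases "x = v \<or> y = v")
      case True
      then show ?thesis using step.prems by blast
    next
      case False
      then obtain c d where cd: "c \<in> set (inc T v)" "d \<in> set (inc T v)" "below T x c" "below T y d"
        using step.prems by (metis below_cases)
      then obtain i j where ij: "i < length (inc T v)" "j < length (inc T v)" "c = inc T v ! i" "d = inc T v ! j"
        by (metis in_set_conv_nth)
      consider "i = j" | "i < j" | "j < i" by linarith
      then show ?thesis
      proof cases
        case 1
        then show ?thesis using step(2)[OF cd(1)] cd ij by simp
      qed (use step(1) cd ij in \<open>auto simp: left_of_def\<close>)
    qed
  qed
  then show ?thesis using below_rt assms rt_in by metis
qed

end

lemma sum_count: "count (\<Sum>a\<in>A. f a) x = (\<Sum>a\<in>A. count (f a) x)"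
  by (induction A rule: infinite_finite_induct) auto

lemma mset_children:
  assumes "is_rrt T"
  shows "(\<Sum>a\<in>verts T. mset (inc T a)) = mset_set (verts T - {rt T})"
proof -
  interpret ribbon_tree T by standard (rule assms)
  show ?thesis
  proof (rule multiset_eqI)
    fix x
    show "count (\<Sum>a\<in>verts T. mset (inc T a)) x = count (mset_set (verts T - {rt T})) x"
    proof (cases "x \<in> verts T - {rt T}")
      case True
      then obtain a where a: "a \<in> verts T" "x \<in> set (inc T a)" using parent_ex by blast
      then have "count (mset (inc T b)) x = (if b = a then 1 else 0)" if "b \<in> verts T" for b
        using parent_unique[OF that a(1)] dist[OF a(1)] by (auto simp: distinct_count_atmost_1 count_mset_0_iff)
      then have "(\<Sum>b\<in>verts T. count (mset (inc T b)) x) = (\<Sum>b\<in>verts T. if b = a then 1 else 0)" by simp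
      then show ?thesis using a True by (simp add: sum_count)
    next
      case False
      then have "x \<notin> set (inc T b)" if "b \<in> verts T" for b using that child_in rt_not_child by blast
      then show ?thesis using False by (simp add: sum_count)
    qed
  qed
qed

text \<open>The multiset equation says at once that children lists are distinct, and that each vertex except for
  the root has a unique parent. Unlike these conditions it is verified for a modified tree by a calculation.\<close>

lemma is_rrtI:
  assumes "finite (verts T)" "rt T \<in> verts T"
    and m: "(\<Sum>a\<in>verts T. mset (inc T a)) = mset_set (verts T - {rt T})"
    and "\<And>v. v \<in> verts T \<Longrightarrow> below T v (rt T)"
  shows "is_rrt T"
proof -
  have c: "(\<Sum>a\<in>verts T. count (mset (inc T a)) x) = (if x \<in> verts T - {rt T} then 1 else 0)" for x
    using m assms(1) by (simp add: sum_count[symmetric] count_mset_set')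
  have le: "count (mset (inc T a)) x \<le> (if x \<in> verts T - {rt T} then 1 else 0)" if "a \<in> verts T" for a x
    using member_le_sum[OF that, of "\<lambda>a. count (mset (inc T a)) x"] assms(1) c by simp
  have cnt0: "count (mset (inc T a)) x = 0 \<longleftrightarrow> x \<notin> set (inc T a)" for a x
    by (simp add: count_mset_0_iff)
  have d: "distinct (inc T a) \<and> set (inc T a) \<subseteq> verts T - {rt T}" if a: "a \<in> verts T" for a
  proof
    show s: "set (inc T a) \<subseteq> verts T - {rt T}"
    proof
      fix x assume "x \<in> set (inc T a)"
      then show "x \<in> verts T - {rt T}" using le[OF a, of x] cnt0[of a x] by (auto split: if_splits)
    qed
    show "distinct (inc T a)" unfolding distinct_count_atmost_1
    proof
      fix x show "count (mset (inc T a)) x = (if x \<in> set (inc T a) then 1 else 0)"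
        using le[OF a, of x] cnt0[of a x] by (cases "count (mset (inc T a)) x") (auto split: if_splits)
    qed
  qed
  have u: "\<exists>!a. (x, a) \<in> edges T" if "x \<in> verts T - {rt T}" for x
  proof -
    have s: "(\<Sum>a\<in>verts T. count (mset (inc T a)) x) = 1" using c that by simp
    have "\<exists>a\<in>verts T. x \<in> set (inc T a)"
    proof (rule ccontr)
      assume "\<not> (\<exists>a\<in>verts T. x \<in> set (inc T a))"
      then have "\<And>a. a \<in> verts T \<Longrightarrow> count (mset (inc T a)) x = 0" by (simp only: cnt0) blast
      with s show False by simp
    qed
    then obtain a where a: "a \<in> verts T" "x \<in> set (inc T a)" by blast
    have uniq: "b = a" if b: "b \<in> verts T" "x \<in> set (inc T b)" for b
    proof (rule ccontr)
      assume ne: "b \<noteq> a"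
      \<comment> \<open>Two parents would contribute at least 2 to a sum whose value is 1.\<close>
      have "(\<Sum>c\<in>{a, b}. count (mset (inc T c)) x) \<le> (\<Sum>c\<in>verts T. count (mset (inc T c)) x)"
        using a b assms(1) by (intro sum_mono2) auto
      moreover have "count (mset (inc T b)) x \<noteq> 0" "count (mset (inc T a)) x \<noteq> 0"
        using a b by (simp_all only: cnt0 not_not)
      ultimately show False using s ne by simp
    qed
    show ?thesis
    proof (rule ex1I[of _ a])
      show "(x, a) \<in> edges T" using a by (rule edgeI)
      show "b = a" if "(x, b) \<in> edges T" for b using that uniq[of b] unfolding edges_def by simp
    qed
  qed
  have "(rt T, a) \<notin> edges T" for a using d by (auto simp: edges_def)
  moreover have "\<forall>a\<in>verts T. distinct (inc T a) \<and> set (inc T a) \<subseteq> verts T" using d by blast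
  moreover have "\<forall>x\<in>verts T - {rt T}. \<exists>!a. (x, a) \<in> edges T" using u by (rule ballI)
  moreover have "\<forall>v\<in>verts T. below T v (rt T)" using assms(4) by (rule ballI)
  ultimately show ?thesis unfolding is_rrt_def using assms(1,2) by (intro conjI allI)
qed


section \<open>Interval labellings of trees\<close>

definition slt :: "nat set \<Rightarrow> nat set \<Rightarrow> bool" where
  "slt A B \<longleftrightarrow> (\<forall>a\<in>A. \<forall>b\<in>B. a < b)"

lemma slt_mono: "slt A B \<Longrightarrow> A' \<subseteq> A \<Longrightarrow> B' \<subseteq> B \<Longrightarrow> slt A' B'"
  by (auto simp: slt_def)

lemma slt_disjoint: "slt A B \<Longrightarrow> A \<inter> B = {}"
  by (auto simp: slt_def)

text \<open>\<open>M\<close> consists of those leaves that may carry a number; all other labels, in particular those of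
  leaves outside of \<open>M\<close>, are unions over the children. Such a labelling with root label \<open>{1..N}\<close> is unique,
  so that the left-to-right numbering of leaves can be recognized by local conditions.\<close>

definition ilab :: "'v rrt \<Rightarrow> 'v set \<Rightarrow> ('v \<Rightarrow> nat set) \<Rightarrow> bool" where
  "ilab T M l \<longleftrightarrow>
     (\<forall>v\<in>verts T - M. l v = (\<Union>c\<in>set (inc T v). l c) \<and>
        sorted_wrt (\<lambda>x y. slt (l x) (l y)) (inc T v)) \<and>
     (\<forall>v\<in>M. l v = {} \<or> (\<exists>k. l v = {k}))"

text \<open>If \<open>A\<close> consists of all leaves of the seam tree, this is
  \<open>leaf_no\<close>. If \<open>A\<close> consists of the marks over the leaf number
  \<open>i\<close>, it is the second index of the mark \<open>\<mu>\<^sub>i\<^sub>j\<close>.\<close>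

definition leaf_rank :: "'v rrt \<Rightarrow> 'v set \<Rightarrow> 'v \<Rightarrow> nat" where
  "leaf_rank T A x = card {y \<in> A. y = x \<or> left_of T y x}"

definition rank_label :: "'v rrt \<Rightarrow> 'v set \<Rightarrow> 'v \<Rightarrow> nat set" where
  "rank_label T A v = leaf_rank T A ` {x \<in> A. below T x v}"

lemma consecutive_iff:
  assumes "finite S"
  shows "consecutive S \<longleftrightarrow> (\<forall>a\<in>S. \<forall>c\<in>S. \<forall>b. a < b \<longrightarrow> b < c \<longrightarrow> b \<in> S)"
proof
  assume "consecutive S"
  then show "\<forall>a\<in>S. \<forall>c\<in>S. \<forall>b. a < b \<longrightarrow> b < c \<longrightarrow> b \<in> S" by (auto simp: consecutive_def)
next
  assume h: "\<forall>a\<in>S. \<forall>c\<in>S. \<forall>b. a < b \<longrightarrow> b < c \<longrightarrow> b \<in> S"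
  show "consecutive S"
  proof (cases "S = {}")
    case True
    then have "S = {1..0}" by simp
    then show ?thesis unfolding consecutive_def by blast
  next
    case False
    have "S = {Min S..Max S}"
    proof
      show "{Min S..Max S} \<subseteq> S"
      proof
        fix b assume b: "b \<in> {Min S..Max S}"
        have "Min S \<in> S" "Max S \<in> S" using assms False by auto
        moreover have "Min S \<le> b" "b \<le> Max S" using b by auto
        ultimately show "b \<in> S" using h by (metis le_neq_implies_less)
      qed
    qed (use assms in auto)
    then show ?thesis unfolding consecutive_def by blast
  qed
qed

lemma consecutive_between: "consecutive S \<Longrightarrow> a \<in> S \<Longrightarrow> c \<in> S \<Longrightarrow> a \<le> b \<Longrightarrow> b \<le> c \<Longrightarrow> b \<in> S"
  by (auto simp: consecutive_def)

section \<open>Existence of interval labellings: labels by rank\<close>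

context ribbon_tree
begin

lemma leaf_rank_less:
  assumes "finite A" "y \<in> A" "left_of T x y"
  shows "leaf_rank T A x < leaf_rank T A y"
  unfolding leaf_rank_def
proof (rule psubset_card_mono)
  show "finite {z \<in> A. z = y \<or> left_of T z y}" using assms(1) by simp
  show "{z \<in> A. z = x \<or> left_of T z x} \<subset> {z \<in> A. z = y \<or> left_of T z y}"
  proof
    show "{z \<in> A. z = x \<or> left_of T z x} \<subseteq> {z \<in> A. z = y \<or> left_of T z y}"
      using assms(3) left_of_trans by blast
    have "y \<notin> {z \<in> A. z = x \<or> left_of T z x}"
      using assms(3) left_of_irrefl left_of_asym by blast
    then show "{z \<in> A. z = x \<or> left_of T z x} \<noteq> {z \<in> A. z = y \<or> left_of T z y}"
      using assms(2) by blast
  qed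
qed

lemma leaves_total:
  "x \<in> leaves T \<Longrightarrow> y \<in> leaves T \<Longrightarrow> x \<noteq> y \<Longrightarrow> left_of T x y \<or> left_of T y x"
  using left_of_total[of x y] below_leaf_eq by (auto simp: leaves_def)

lemma finite_leaves: "finite (leaves T)"
  by (simp add: leaves_def)

lemma leaf_rank_inj:
  assumes "A \<subseteq> leaves T"
  shows "inj_on (leaf_rank T A) A"
proof (rule inj_onI)
  have fA: "finite A" using assms finite_leaves by (rule finite_subset)
  fix x y assume h: "x \<in> A" "y \<in> A" "leaf_rank T A x = leaf_rank T A y"
  show "x = y"
  proof (rule ccontr)
    assume "x \<noteq> y"
    then have "left_of T x y \<or> left_of T y x" using leaves_total h assms by blast
    then show False using leaf_rank_less[OF fA] h by (metis less_irrefl)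
  qed
qed

text \<open>Ranks are injective because any two leaves are ordered by \<open>left_of\<close>, and
  they lie between 1 and the number of leaves counted; equal cardinalities give
  surjectivity.\<close>

lemma leaf_rank_image:
  assumes "A \<subseteq> leaves T"
  shows "leaf_rank T A ` A = {1..card A}"
proof (rule card_subset_eq)
  have fA: "finite A" using assms finite_leaves by (rule finite_subset)
  show "leaf_rank T A ` A \<subseteq> {1..card A}"
  proof
    fix k assume "k \<in> leaf_rank T A ` A"
    then obtain x where x: "x \<in> A" "k = leaf_rank T A x" by blast
    have "card {x} \<le> k" unfolding x(2) leaf_rank_def using fA x(1) by (intro card_mono) auto
    moreover have "k \<le> card A" unfolding x(2) leaf_rank_def using fA by (intro card_mono) auto
    ultimately show "k \<in> {1..card A}" by simp
  qed
  show "card (leaf_rank T A ` A) = card {1..card A}"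
    using card_image[OF leaf_rank_inj[OF assms]] by simp
qed simp

lemma rank_label_root:
  assumes "A \<subseteq> leaves T"
  shows "rank_label T A (rt T) = {1..card A}"
proof -
  have "{x \<in> A. below T x (rt T)} = A" using assms below_rt by (auto simp: leaves_def)
  then show ?thesis by (simp add: rank_label_def leaf_rank_image[OF assms])
qed

lemma rank_label_leaf:
  assumes "M \<subseteq> leaves T" "A \<subseteq> M" "v \<in> M"
  shows "rank_label T A v = (if v \<in> A then {leaf_rank T A v} else {})"
proof -
  have "{x \<in> A. below T x v} = (if v \<in> A then {v} else {})"
    using assms below_leaf_eq by auto
  then show ?thesis by (simp add: rank_label_def)
qed

lemma slt_rank_label:
  assumes "finite A" "left_of T x y"
  shows "slt (rank_label T A x) (rank_label T A y)"
  unfolding slt_def rank_label_def using leaf_rank_less[OF assms(1)] left_of_mono[OF assms(2)] by blast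

text \<open>A leaf of \<open>A\<close> below \<open>v\<close> is below exactly one child of
  \<open>v\<close>, unless \<open>v\<close> itself is a mark, and siblings are separated because
  ranks increase from left to right.\<close>

lemma rank_label_ilab:
  assumes "M \<subseteq> leaves T" "A \<subseteq> M"
  shows "ilab T M (rank_label T A)"
  unfolding ilab_def
proof (intro conjI ballI)
  have A1: "A \<subseteq> leaves T" using assms by simp
  have A: "finite A" using finite_subset[OF A1 finite_leaves] .
  fix v assume v: "v \<in> verts T - M"
  show "rank_label T A v = (\<Union>c\<in>set (inc T v). rank_label T A c)"
  proof -
    have "{x \<in> A. below T x v} = (\<Union>c\<in>set (inc T v). {x \<in> A. below T x c})"
    proof
      show "{x \<in> A. below T x v} \<subseteq> (\<Union>c\<in>set (inc T v). {x \<in> A. below T x c})"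
      proof
        fix x assume x: "x \<in> {x \<in> A. below T x v}"
        then have "x \<noteq> v" using v assms by auto
        then show "x \<in> (\<Union>c\<in>set (inc T v). {x \<in> A. below T x c})" using x below_cases by blast
      qed
      show "(\<Union>c\<in>set (inc T v). {x \<in> A. below T x c}) \<subseteq> {x \<in> A. below T x v}"
      proof
        fix x assume "x \<in> (\<Union>c\<in>set (inc T v). {x \<in> A. below T x c})"
        then obtain c where c: "c \<in> set (inc T v)" "x \<in> A" "below T x c" by blast
        have "below T c v" using below_child[OF _ c(1)] v by blast
        then show "x \<in> {x \<in> A. below T x v}" using rtrancl_trans[OF c(3)] c(2) by blast
      qed
    qed
    then show ?thesis unfolding rank_label_def by (simp only: image_UN)
  qed
  show "sorted_wrt (\<lambda>x y. slt (rank_label T A x) (rank_label T A y)) (inc T v)"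
    unfolding sorted_wrt_iff_nth_less using slt_rank_label[OF A] left_of_child v by blast
next
  fix v assume "v \<in> M"
  then show "rank_label T A v = {} \<or> (\<exists>k. rank_label T A v = {k})"
    using rank_label_leaf[OF assms] by auto
qed

end

section \<open>Uniqueness of interval labellings\<close>

locale labelled_tree = ribbon_tree T for T :: "'v rrt" +
  fixes M :: "'v set" and l :: "'v \<Rightarrow> nat set"
  assumes ilab: "ilab T M l" and M_leaves: "M \<subseteq> leaves T"
begin

lemma l_children: "v \<in> verts T \<Longrightarrow> v \<notin> M \<Longrightarrow> l v = (\<Union>c\<in>set (inc T v). l c)"
  using ilab by (auto simp: ilab_def)

lemma child_not_M: "c \<in> set (inc T v) \<Longrightarrow> v \<notin> M"
  using M_leaves by (auto simp: leaves_def)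

lemma l_child_mono:
  assumes "v \<in> verts T" "c \<in> set (inc T v)"
  shows "l c \<subseteq> l v"
  using l_children[OF assms(1) child_not_M[OF assms(2)]] assms(2) by blast

lemma l_mono: "below T x y \<Longrightarrow> l x \<subseteq> l y"
proof (induction rule: rtrancl_induct)
  case (step y z)
  then show ?case using l_child_mono[of z y] by (auto simp: edges_def)
qed simp

lemma l_sorted:
  assumes "v \<in> verts T" "i < j" "j < length (inc T v)"
  shows "slt (l (inc T v ! i)) (l (inc T v ! j))"
proof -
  have "inc T v ! i \<in> set (inc T v)" using assms by simp
  then have "v \<notin> M" by (rule child_not_M)
  then show ?thesis using ilab assms by (auto simp: ilab_def sorted_wrt_iff_nth_less)
qed

lemma l_left_of: "left_of T x y \<Longrightarrow> slt (l x) (l y)"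
proof -
  assume "left_of T x y"
  then obtain v i j where v: "v \<in> verts T" "i < j" "j < length (inc T v)"
    "below T x (inc T v ! i)" "below T y (inc T v ! j)"
    unfolding left_of_def by blast
  show ?thesis using l_sorted[OF v(1-3)] l_mono[OF v(4)] l_mono[OF v(5)] by (rule slt_mono)
qed

text \<open>Incomparable vertices lie side by side, and then their labels are separated.\<close>

lemma l_meet:
  assumes "x \<in> verts T" "y \<in> verts T" "l x \<inter> l y \<noteq> {}"
  shows "below T x y \<or> below T y x"
  using left_of_total[OF assms(1,2)] assms(3) l_left_of slt_disjoint by blast

lemma l_mark: "v \<in> M \<Longrightarrow> k \<in> l v \<Longrightarrow> l v = {k}"
  using ilab by (auto simp: ilab_def)

lemma l_mark_below: "v \<in> verts T \<Longrightarrow> k \<in> l v \<Longrightarrow> \<exists>x\<in>M. below T x v \<and> l x = {k}"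
proof (induction arbitrary: rule: bottom_up)
  case (step v)
  show ?case
  proof (cases "v \<in> M")
    case True
    then show ?thesis using l_mark step by blast
  next
    case False
    then obtain c where c: "c \<in> set (inc T v)" "k \<in> l c" using step l_children by blast
    then obtain x where "x \<in> M" "below T x c" "l x = {k}" using step(2) by blast
    then show ?thesis using below_child[OF step(1) c(1)] by (meson rtrancl_trans)
  qed
qed

lemma l_finite: "l (rt T) = {1..N} \<Longrightarrow> v \<in> verts T \<Longrightarrow> l v \<subseteq> {1..N}"
  using l_mono[OF below_rt] by simp

text \<open>Descent from the root: a number between two elements of \<open>l c\<close> belongs to
  the label of the parent, hence to that of some child, and the separation of siblings leaves only
  \<open>c\<close>.\<close>

lemma l_consecutive:
  assumes "l (rt T) = {1..N}" "v \<in> verts T"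
  shows "consecutive (l v)"
  using assms(2)
proof (induction rule: top_down)
  case root
  then show ?case using assms(1) by (auto simp: consecutive_def)
next
  case (step v c)
  have cv: "c \<in> verts T" using step by (auto intro: child_in)
  have "finite (l c)" using l_finite[OF assms(1) cv] finite_subset by blast
  moreover have "b \<in> l c" if "a \<in> l c" "d \<in> l c" "a < b" "b < d" for a b d
  proof -
    have "l c \<subseteq> l v" using step by (intro l_child_mono)
    then have "b \<in> l v" using that consecutive_between[OF step.IH, of a d b] by auto
    then obtain e where e: "e \<in> set (inc T v)" "b \<in> l e" using l_children[OF step.hyps(1)] child_not_M step.hyps(2) by blast
    obtain i j where ij: "i < length (inc T v)" "j < length (inc T v)" "c = inc T v ! i" "e = inc T v ! j"
      using e step.hyps(2) by (metis in_set_conv_nth)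
    consider "i = j" | "i < j" | "j < i" by linarith
    then show ?thesis
    proof cases
      case 2
      then have "slt (l c) (l e)" using ij l_sorted[OF step.hyps(1)] by simp
      then show ?thesis using that e unfolding slt_def by (meson less_asym)
    next
      case 3
      then have "slt (l e) (l c)" using ij l_sorted[OF step.hyps(1)] by simp
      then show ?thesis using that e unfolding slt_def by (meson less_asym)
    qed (use ij e in simp)
  qed
  ultimately show ?case by (subst consecutive_iff) blast+
qed

text \<open>Numbers increase from left to right, and each number from 1 to \<open>N\<close> is
  carried by some mark. Hence the marks weakly to the left of \<open>x\<close> carry precisely the
  numbers up to that of \<open>x\<close>, and counting them gives this number.\<close>

lemma leaf_rank_eq:
  assumes "l (rt T) = {1..N}" "x \<in> M" "l x \<noteq> {}"
  shows "l x = {leaf_rank T {y \<in> M. l y \<noteq> {}} x}"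
proof -
  let ?A = "{y \<in> M. l y \<noteq> {}}"
  obtain k where k: "l x = {k}" using l_mark[OF assms(2)] assms(3) by blast
  define num where "num y = the_elem (l y)" for y
  have num: "l y = {num y}" if "y \<in> ?A" for y using that l_mark num_def by fastforce
  have lt: "num y < num z" if "y \<in> ?A" "z \<in> ?A" "left_of T y z" for y z
    using l_left_of[OF that(3)] num[OF that(1)] num[OF that(2)] by (simp add: slt_def)
  have xA: "x \<in> ?A" using assms by simp
  have total: "y = z \<or> left_of T y z \<or> left_of T z y" if "y \<in> ?A" "z \<in> ?A" for y z
    using that leaves_total M_leaves by blast
  have inj: "inj_on num ?A"
  proof (rule inj_onI)
    fix y z assume yz: "y \<in> ?A" "z \<in> ?A" "num y = num z"
    show "y = z" using total[OF yz(1,2)] lt[OF yz(1,2)] lt[OF yz(2,1)] yz(3) by linarith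
  qed
  have im: "num ` {y \<in> ?A. y = x \<or> left_of T y x} = {1..num x}"
  proof
    show "num ` {y \<in> ?A. y = x \<or> left_of T y x} \<subseteq> {1..num x}"
    proof
      fix m assume "m \<in> num ` {y \<in> ?A. y = x \<or> left_of T y x}"
      then obtain y where y: "y \<in> ?A" "y = x \<or> left_of T y x" "m = num y" by blast
      then have "m \<le> num x" using lt[OF y(1) xA] by auto
      moreover have "y \<in> verts T" using y(1) M_leaves by (auto simp: leaves_def)
      then have "m \<in> {1..N}" using l_finite[OF assms(1), of y] num[OF y(1)] y(3) by blast
      ultimately show "m \<in> {1..num x}" by simp
    qed
    show "{1..num x} \<subseteq> num ` {y \<in> ?A. y = x \<or> left_of T y x}"
    proof
      fix m assume m: "m \<in> {1..num x}"
      have "x \<in> verts T" using xA M_leaves by (auto simp: leaves_def)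
      then have "num x \<in> {1..N}" using l_finite[OF assms(1), of x] num[OF xA] by blast
      then have "m \<in> l (rt T)" using m assms(1) by simp
      then obtain y where y: "y \<in> M" "l y = {m}" using l_mark_below rt_in by blast
      then have yA: "y \<in> ?A" and ym: "num y = m" using num[of y] by auto
      have "\<not> left_of T x y" using lt[OF xA yA] ym m by auto
      then have "y = x \<or> left_of T y x" using total[OF xA yA] by blast
      then show "m \<in> num ` {y \<in> ?A. y = x \<or> left_of T y x}" using yA ym by blast
    qed
  qed
  have "card {y \<in> ?A. y = x \<or> left_of T y x} = num x"
  proof -
    have "card (num ` {y \<in> ?A. y = x \<or> left_of T y x}) = card {y \<in> ?A. y = x \<or> left_of T y x}"
      by (intro card_image inj_on_subset[OF inj]) blast
    then show ?thesis unfolding im by simp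
  qed
  then show ?thesis using num[OF xA] by (simp add: leaf_rank_def)
qed

text \<open>The labels of marks are forced by counting and the remaining ones are unions over
  children, so the labelling is determined by the tree and by the set of marks with nonempty
  label.\<close>

lemma l_eq_rank_label:
  assumes "l (rt T) = {1..N}" "v \<in> verts T"
  shows "l v = rank_label T {y \<in> M. l y \<noteq> {}} v"
  using assms(2)
proof (induction rule: bottom_up)
  case (step v)
  let ?A = "{y \<in> M. l y \<noteq> {}}"
  have r: "ilab T M (rank_label T ?A)" by (rule rank_label_ilab[OF M_leaves]) auto
  show ?case
  proof (cases "v \<in> M")
    case True
    have "rank_label T ?A v = (if v \<in> ?A then {leaf_rank T ?A v} else {})"
      by (rule rank_label_leaf[OF M_leaves _ True]) auto
    then show ?thesis using leaf_rank_eq[OF assms(1) True] True by auto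
  next
    case False
    then have "rank_label T ?A v = (\<Union>c\<in>set (inc T v). rank_label T ?A c)"
      using r step(1) unfolding ilab_def by blast
    then show ?thesis using step l_children False by simp
  qed
qed

lemma card_marks:
  assumes "l (rt T) = {1..N}"
  shows "card {y \<in> M. l y \<noteq> {}} = N"
proof -
  have "{y \<in> M. l y \<noteq> {}} \<subseteq> leaves T" using M_leaves by auto
  then have "rank_label T {y \<in> M. l y \<noteq> {}} (rt T) = {1..card {y \<in> M. l y \<noteq> {}}}" by (rule rank_label_root)
  then have "{1..card {y \<in> M. l y \<noteq> {}}} = {1..N}" using l_eq_rank_label[OF assms rt_in] assms by metis
  then have "card {1..card {y \<in> M. l y \<noteq> {}}} = card {1..N}" by (rule arg_cong)
  then show ?thesis by (simp only: card_atLeastAtMost diff_Suc_1)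
qed

end


section \<open>Labels of stable tree-pairs\<close>

text \<open>Stability without the prescribed numbers of leaves and marks. That the solid edges are the edges
  into component vertices, and that \<open>coh P\<close> maps into \<open>stree P\<close>, follow from the original conditions.\<close>

definition good :: "('v, 'w) tree_pair \<Rightarrow> bool" where
  "good P \<longleftrightarrow>
     is_rrt (bub P) \<and> is_rrt (stree P) \<and>
     verts (bub P) = Vcomp P \<union> Vseam P \<union> Vmark P \<and>
     Vcomp P \<inter> Vseam P = {} \<and> Vcomp P \<inter> Vmark P = {} \<and> Vseam P \<inter> Vmark P = {} \<and>
     rt (bub P) \<notin> Vseam P \<and>
     solid P = {(\<beta>, \<alpha>). \<alpha> \<in> Vcomp P \<and> \<beta> \<in> set (inb P \<alpha>)} \<and>
     (\<forall>\<alpha>\<in>Vcomp P. inb P \<alpha> \<noteq> [] \<and> set (inb P \<alpha>) \<subseteq> Vseam P) \<and>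
     (\<forall>\<alpha>\<in>Vseam P. set (inb P \<alpha>) \<subseteq> Vcomp P \<union> Vmark P) \<and>
     (\<forall>\<alpha>\<in>Vmark P. inb P \<alpha> = []) \<and>
     (\<forall>\<alpha>\<in>Vcomp P. \<forall>\<beta>. inb P \<alpha> = [\<beta>] \<longrightarrow> 2 \<le> length (inb P \<beta>) \<and> coh P \<beta> = coh P \<alpha>) \<and>
     (\<forall>\<alpha>\<in>Vcomp P. 2 \<le> length (inb P \<alpha>) \<longrightarrow>
        (\<exists>\<beta>\<in>set (inb P \<alpha>). inb P \<beta> \<noteq> []) \<and> map (coh P) (inb P \<alpha>) = ins P (coh P \<alpha>)) \<and>
     (\<forall>\<beta>\<in>Vseam P. \<forall>\<gamma>\<in>set (inb P \<beta>). coh P \<gamma> = coh P \<beta>) \<and>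
     coh P (rt (bub P)) = rt (stree P) \<and>
     coh P ` Vmark P \<subseteq> leaves (stree P) \<and>
     (\<forall>\<alpha>\<in>verts (stree P). length (ins P \<alpha>) \<noteq> 1)"

locale good_pair =
  fixes P :: "('v, 'w) tree_pair"
  assumes good: "good P"
begin

sublocale B: ribbon_tree "bub P" by standard (use good in \<open>simp add: good_def\<close>)
sublocale S: ribbon_tree "stree P" by standard (use good in \<open>simp add: good_def\<close>)

lemma verts_bub: "verts (bub P) = Vcomp P \<union> Vseam P \<union> Vmark P"
  and disj: "Vcomp P \<inter> Vseam P = {}" "Vcomp P \<inter> Vmark P = {}" "Vseam P \<inter> Vmark P = {}"
  and rt_not_seam: "rt (bub P) \<notin> Vseam P"
  and solid_eq: "solid P = {(\<beta>, \<alpha>). \<alpha> \<in> Vcomp P \<and> \<beta> \<in> set (inb P \<alpha>)}"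
  and coh_rt: "coh P (rt (bub P)) = rt (stree P)"
  using good by (simp_all add: good_def)

lemma comp_ne: "\<alpha> \<in> Vcomp P \<Longrightarrow> inb P \<alpha> \<noteq> []"
  and comp_children: "\<alpha> \<in> Vcomp P \<Longrightarrow> \<beta> \<in> set (inb P \<alpha>) \<Longrightarrow> \<beta> \<in> Vseam P"
  and seam_children: "\<beta> \<in> Vseam P \<Longrightarrow> \<gamma> \<in> set (inb P \<beta>) \<Longrightarrow> \<gamma> \<in> Vcomp P \<union> Vmark P"
  and mark_leaf: "\<mu> \<in> Vmark P \<Longrightarrow> inb P \<mu> = []"
  and comp1: "\<alpha> \<in> Vcomp P \<Longrightarrow> inb P \<alpha> = [\<beta>] \<Longrightarrow> 2 \<le> length (inb P \<beta>) \<and> coh P \<beta> = coh P \<alpha>"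
  and comp2_ex: "\<alpha> \<in> Vcomp P \<Longrightarrow> 2 \<le> length (inb P \<alpha>) \<Longrightarrow> \<exists>\<beta>\<in>set (inb P \<alpha>). inb P \<beta> \<noteq> []"
  and comp2_map: "\<alpha> \<in> Vcomp P \<Longrightarrow> 2 \<le> length (inb P \<alpha>) \<Longrightarrow> map (coh P) (inb P \<alpha>) = ins P (coh P \<alpha>)"
  and coh_seam: "\<beta> \<in> Vseam P \<Longrightarrow> \<gamma> \<in> set (inb P \<beta>) \<Longrightarrow> coh P \<gamma> = coh P \<beta>"
  and coh_mark: "\<mu> \<in> Vmark P \<Longrightarrow> coh P \<mu> \<in> leaves (stree P)"
  and seam_tree_stable: "s \<in> verts (stree P) \<Longrightarrow> length (ins P s) \<noteq> 1"
  using good by (auto simp: good_def)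

lemma type_verts: "v \<in> Vcomp P \<Longrightarrow> v \<in> verts (bub P)" "v \<in> Vseam P \<Longrightarrow> v \<in> verts (bub P)"
  "v \<in> Vmark P \<Longrightarrow> v \<in> verts (bub P)" "v \<in> Vcomp P \<union> Vmark P \<Longrightarrow> v \<in> verts (bub P)"
  using verts_bub by auto

lemma marks_leaves: "Vmark P \<subseteq> leaves (bub P)"
  using mark_leaf type_verts by (auto simp: leaves_def)

lemma comp_cases:
  assumes "\<alpha> \<in> Vcomp P"
  obtains (one) \<beta> where "inb P \<alpha> = [\<beta>]" "2 \<le> length (inb P \<beta>)" "coh P \<beta> = coh P \<alpha>" "\<beta> \<in> Vseam P"
  | (two) "2 \<le> length (inb P \<alpha>)" "map (coh P) (inb P \<alpha>) = ins P (coh P \<alpha>)"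
proof (cases "length (inb P \<alpha>) = 1")
  case True
  then obtain \<beta> where b: "inb P \<alpha> = [\<beta>]" by (auto simp: length_Suc_conv)
  then have "\<beta> \<in> Vseam P" using comp_children assms by simp
  then show thesis using one[of \<beta>] comp1[OF assms b] b by simp
next
  case False
  moreover have "length (inb P \<alpha>) \<noteq> 0" using comp_ne[OF assms] by simp
  ultimately have "2 \<le> length (inb P \<alpha>)" by linarith
  then show thesis using two comp2_map assms by blast
qed

lemma seam_parent: "\<beta> \<in> Vseam P \<Longrightarrow> \<exists>\<alpha>\<in>Vcomp P. \<beta> \<in> set (inb P \<alpha>)"
proof -
  assume b: "\<beta> \<in> Vseam P"
  then have "\<beta> \<noteq> rt (bub P)" using rt_not_seam by blast
  then obtain \<alpha> where a: "\<alpha> \<in> verts (bub P)" "\<beta> \<in> set (inb P \<alpha>)"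
    using B.parent_ex type_verts(2)[OF b] by blast
  have "\<alpha> \<notin> Vmark P" using mark_leaf[of \<alpha>] a(2) by auto
  moreover have "\<alpha> \<notin> Vseam P" using seam_children[of \<alpha> \<beta>] a(2) b disj by blast
  ultimately show ?thesis using a verts_bub by blast
qed

lemma nonseam_parent: "\<gamma> \<in> Vcomp P \<union> Vmark P \<Longrightarrow> \<gamma> \<noteq> rt (bub P) \<Longrightarrow> \<exists>\<beta>\<in>Vseam P. \<gamma> \<in> set (inb P \<beta>)"
proof -
  assume g: "\<gamma> \<in> Vcomp P \<union> Vmark P" "\<gamma> \<noteq> rt (bub P)"
  then obtain \<beta> where b: "\<beta> \<in> verts (bub P)" "\<gamma> \<in> set (inb P \<beta>)"
    using B.parent_ex[OF type_verts(4)] by blast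
  have "\<beta> \<notin> Vmark P" using mark_leaf[of \<beta>] b(2) by auto
  moreover have "\<beta> \<notin> Vcomp P" using comp_children[of \<beta> \<gamma>] b(2) g disj by blast
  ultimately show ?thesis using b verts_bub by blast
qed

lemma coh_child:
  assumes "v \<in> verts (bub P)" "c \<in> set (inb P v)"
  shows "coh P c = coh P v \<or> coh P c \<in> set (ins P (coh P v))"
proof -
  have "v \<notin> Vmark P" using mark_leaf[of v] assms(2) by auto
  then consider "v \<in> Vcomp P" | "v \<in> Vseam P" using assms(1) verts_bub by blast
  then show ?thesis
  proof cases
    case 1
    then show ?thesis
    proof (cases rule: comp_cases)
      case (one \<beta>)
      then show ?thesis using assms(2) by simp
    next
      case two
      then show ?thesis using assms(2) by (metis image_eqI list.set_map)
    qed
  next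
    case 2
    then show ?thesis using coh_seam assms(2) by blast
  qed
qed

lemma coh_verts: "v \<in> verts (bub P) \<Longrightarrow> coh P v \<in> verts (stree P)"
proof (induction rule: B.top_down)
  case root
  then show ?case using coh_rt by simp
next
  case (step v c)
  then show ?case using coh_child[OF step.hyps] S.child_in by metis
qed

lemma coh_mono: "below (bub P) x y \<Longrightarrow> below (stree P) (coh P x) (coh P y)"
proof (induction rule: rtrancl_induct)
  case (step y z)
  have z: "z \<in> verts (bub P)" "y \<in> set (inb P z)" using step.hyps(2) by (auto simp: edges_def)
  then have "below (stree P) (coh P y) (coh P z)"
    using coh_child[OF z] below_child[OF coh_verts[OF z(1)]] by auto
  with step.IH show ?case by (rule rtrancl_trans)
qed simp

end

lemma leaf_no_eq: "leaf_no T x = leaf_rank T (leaves T) x"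
  by (simp add: leaf_no_def leaf_rank_def)

text \<open>The uniqueness of outgoing edges turns the conditions on solid and dashed edges into
  conditions on types. The outgoing edge of a component or mark is not solid, so the children of a
  component, which are attached by solid edges, are seams. The outgoing edge of a seam is solid, so
  no seam is a child of a seam.\<close>

lemma stable_imp_good:
  assumes "stable_tree_pair r n P"
  shows "good P"
proof -
  have bt: "bubble_tree P" and st: "stable_rrt r (stree P)" and cm: "coherence_map r n P"
    using assms by (auto simp: stable_tree_pair_def)
  interpret B: ribbon_tree "bub P" by standard (use bt in \<open>simp add: bubble_tree_def\<close>)
  have V: "verts (bub P) = Vcomp P \<union> Vseam P \<union> Vmark P"
    and D: "Vcomp P \<inter> Vseam P = {}" "Vcomp P \<inter> Vmark P = {}" "Vseam P \<inter> Vmark P = {}"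
    and sol: "solid P \<subseteq> edges (bub P)"
    using bt unfolding bubble_tree_def by blast+
  have C: "(\<exists>\<beta>. (\<beta>, \<alpha>) \<in> solid P)" "(\<nexists>\<beta>. (\<beta>, \<alpha>) \<in> dashed P)"
    "(\<exists>\<beta>. (\<alpha>, \<beta>) \<in> dashed P) \<or> (\<nexists>\<beta>. (\<alpha>, \<beta>) \<in> edges (bub P))" if "\<alpha> \<in> Vcomp P" for \<alpha>
    using bt that unfolding bubble_tree_def by blast+
  have Se: "(\<nexists>\<beta>. (\<beta>, \<alpha>) \<in> solid P)" "(\<exists>\<beta>. (\<alpha>, \<beta>) \<in> solid P)" if "\<alpha> \<in> Vseam P" for \<alpha>
    using bt that unfolding bubble_tree_def by blast+
  have M: "(\<nexists>\<beta>. (\<beta>, \<alpha>) \<in> edges (bub P))"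
    "(\<exists>\<beta>. (\<alpha>, \<beta>) \<in> dashed P) \<or> (\<nexists>\<beta>. (\<alpha>, \<beta>) \<in> edges (bub P))" if "\<alpha> \<in> Vmark P" for \<alpha>
    using bt that unfolding bubble_tree_def by blast+
  have C1: "\<forall>\<alpha>\<in>Vcomp1 P. \<forall>\<beta>\<in>set (inb P \<alpha>). 2 \<le> length (inb P \<beta>)"
    and C2: "\<forall>\<alpha>\<in>Vcomp2 P. \<exists>\<beta>\<in>set (inb P \<alpha>). 1 \<le> length (inb P \<beta>)"
    using bt unfolding bubble_tree_def by blast+
  have not_solid: "(\<beta>, \<alpha>) \<notin> solid P" if cm: "\<beta> \<in> Vcomp P \<union> Vmark P" for \<alpha> \<beta>
  proof
    assume s: "(\<beta>, \<alpha>) \<in> solid P"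
    then have e: "(\<beta>, \<alpha>) \<in> edges (bub P)" using sol by blast
    then obtain \<alpha>' where "(\<beta>, \<alpha>') \<in> dashed P" using cm C(3) M(2) by blast
    then have "(\<beta>, \<alpha>') \<in> edges (bub P)" "(\<beta>, \<alpha>') \<notin> solid P" by (auto simp: dashed_def)
    then show False using B.edge_unique[OF e, of \<alpha>'] s by blast
  qed
  have comp_edge: "\<beta> \<in> Vseam P \<and> (\<beta>, \<alpha>) \<in> solid P" if "\<alpha> \<in> Vcomp P" "\<beta> \<in> set (inb P \<alpha>)" for \<alpha> \<beta>
  proof -
    have a: "\<alpha> \<in> verts (bub P)" using that V by blast
    have e: "(\<beta>, \<alpha>) \<in> edges (bub P)" using edgeI[OF a that(2)] .
    then have s: "(\<beta>, \<alpha>) \<in> solid P" using C(2)[OF that(1)] by (auto simp: dashed_def)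
    then have "\<beta> \<notin> Vcomp P \<union> Vmark P" using not_solid by blast
    then show ?thesis using s V B.child_in[OF a that(2)] by blast
  qed
  have seam_edge: "\<gamma> \<in> Vcomp P \<union> Vmark P \<and> (\<gamma>, \<beta>) \<in> dashed P" if "\<beta> \<in> Vseam P" "\<gamma> \<in> set (inb P \<beta>)" for \<beta> \<gamma>
  proof -
    have b: "\<beta> \<in> verts (bub P)" using that V by blast
    have e: "(\<gamma>, \<beta>) \<in> edges (bub P)" using edgeI[OF b that(2)] .
    have ns: "(\<gamma>, \<beta>) \<notin> solid P" using Se(1)[OF that(1)] by blast
    have "\<gamma> \<notin> Vseam P"
    proof
      assume "\<gamma> \<in> Vseam P"
      then obtain \<beta>' where s: "(\<gamma>, \<beta>') \<in> solid P" using Se(2) by blast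
      then have "(\<gamma>, \<beta>') \<in> edges (bub P)" using sol by blast
      then show False using B.edge_unique[OF e] s ns by blast
    qed
    then show ?thesis using ns e V B.child_in[OF b that(2)] by (auto simp: dashed_def)
  qed
  have m0: "inb P \<mu> = []" if "\<mu> \<in> Vmark P" for \<mu>
  proof (rule ccontr)
    assume "inb P \<mu> \<noteq> []"
    then have "hd (inb P \<mu>) \<in> set (inb P \<mu>)" by simp
    moreover have "\<mu> \<in> verts (bub P)" using that V by blast
    ultimately have "(hd (inb P \<mu>), \<mu>) \<in> edges (bub P)" by (intro edgeI)
    then show False using M(1)[OF that] by blast
  qed
  have sol_eq: "solid P = {(\<beta>, \<alpha>). \<alpha> \<in> Vcomp P \<and> \<beta> \<in> set (inb P \<alpha>)}"
  proof (intro set_eqI iffI)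
    fix e assume e: "e \<in> solid P"
    obtain \<beta> \<alpha> where ba: "e = (\<beta>, \<alpha>)" by (cases e)
    then have "\<alpha> \<in> verts (bub P)" "\<beta> \<in> set (inb P \<alpha>)" using e sol by (auto simp: edges_def)
    moreover have "\<alpha> \<notin> Vseam P" using Se(1) e ba by blast
    moreover have "\<alpha> \<notin> Vmark P" using m0[of \<alpha>] \<open>\<beta> \<in> set (inb P \<alpha>)\<close> by auto
    ultimately show "e \<in> {(\<beta>, \<alpha>). \<alpha> \<in> Vcomp P \<and> \<beta> \<in> set (inb P \<alpha>)}" using V ba by blast
  next
    fix e assume "e \<in> {(\<beta>, \<alpha>). \<alpha> \<in> Vcomp P \<and> \<beta> \<in> set (inb P \<alpha>)}"
    then show "e \<in> solid P" using comp_edge by blast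
  qed
  have dash: "coh P \<beta> = coh P \<alpha>" if "(\<beta>, \<alpha>) \<in> dashed P" for \<alpha> \<beta>
    using cm that unfolding coherence_map_def by blast
  have sol1: "coh P \<beta> = coh P \<alpha>" if "(\<beta>, \<alpha>) \<in> solid P" "\<alpha> \<in> Vcomp1 P" for \<alpha> \<beta>
    using cm that unfolding coherence_map_def by blast
  have s1: "length (ins P \<alpha>) \<noteq> 1" if "\<alpha> \<in> verts (stree P)" for \<alpha>
    using st that unfolding stable_rrt_def interior_def by force
  show ?thesis
    unfolding good_def
  proof (intro conjI ballI allI impI)
    show "is_rrt (bub P)" "is_rrt (stree P)"
      using bt st by (auto simp: bubble_tree_def stable_rrt_def)
    show "rt (bub P) \<notin> Vseam P" using Se(2) sol B.rt_no_parent by blast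
    show "inb P \<alpha> \<noteq> []" if "\<alpha> \<in> Vcomp P" for \<alpha>
      using C(1)[OF that] sol by (auto simp: edges_def)
    show "2 \<le> length (inb P \<beta>)" if "\<alpha> \<in> Vcomp P" "inb P \<alpha> = [\<beta>]" for \<alpha> \<beta>
      using C1 that by (auto simp: Vcomp1_def)
    show "coh P \<beta> = coh P \<alpha>" if "\<alpha> \<in> Vcomp P" "inb P \<alpha> = [\<beta>]" for \<alpha> \<beta>
      using sol1 comp_edge that by (auto simp: Vcomp1_def)
    show "\<exists>\<beta>\<in>set (inb P \<alpha>). inb P \<beta> \<noteq> []" if "\<alpha> \<in> Vcomp P" "2 \<le> length (inb P \<alpha>)" for \<alpha>
    proof -
      have "\<exists>\<beta>\<in>set (inb P \<alpha>). 1 \<le> length (inb P \<beta>)" using C2 that unfolding Vcomp2_def by blast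
      then show ?thesis by (metis list.size(3) not_one_le_zero)
    qed
    show "map (coh P) (inb P \<alpha>) = ins P (coh P \<alpha>)" if "\<alpha> \<in> Vcomp P" "2 \<le> length (inb P \<alpha>)" for \<alpha>
      using cm that unfolding coherence_map_def Vcomp2_def by blast
    show "coh P (rt (bub P)) = rt (stree P)" "coh P ` Vmark P \<subseteq> leaves (stree P)"
      using cm unfolding coherence_map_def by blast+
    show "set (inb P \<alpha>) \<subseteq> Vseam P" if "\<alpha> \<in> Vcomp P" for \<alpha> using comp_edge[OF that] by blast
    show "set (inb P \<alpha>) \<subseteq> Vcomp P \<union> Vmark P" if "\<alpha> \<in> Vseam P" for \<alpha>
      using seam_edge[OF that] by blast
    show "coh P \<gamma> = coh P \<beta>" if "\<beta> \<in> Vseam P" "\<gamma> \<in> set (inb P \<beta>)" for \<beta> \<gamma>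
      using dash seam_edge[OF that] by blast
  qed (use V D sol_eq m0 s1 in simp_all)
qed

text \<open>Stability is verified for constructed pairs through the right-hand side. The numerical
  conditions are kept apart because labels deliver them in one stroke, see
  \<open>lbl_unique\<close>.\<close>

lemma stable_iff:
  "stable_tree_pair r n P \<longleftrightarrow> good P \<and> card (leaves (stree P)) = r \<and>
     (\<forall>x\<in>leaves (stree P). card {\<mu> \<in> Vmark P. coh P \<mu> = x} = n (leaf_no (stree P) x))"
proof
  assume h: "stable_tree_pair r n P"
  then show "good P \<and> card (leaves (stree P)) = r \<and>
     (\<forall>x\<in>leaves (stree P). card {\<mu> \<in> Vmark P. coh P \<mu> = x} = n (leaf_no (stree P) x))"
    using stable_imp_good[OF h] unfolding stable_tree_pair_def stable_rrt_def coherence_map_def by blast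
next
  assume h: "good P \<and> card (leaves (stree P)) = r \<and>
     (\<forall>x\<in>leaves (stree P). card {\<mu> \<in> Vmark P. coh P \<mu> = x} = n (leaf_no (stree P) x))"
  interpret good_pair P by standard (use h in simp)
  have dashed: "dashed P = {(\<gamma>, \<beta>). \<beta> \<in> Vseam P \<and> \<gamma> \<in> set (inb P \<beta>)}"
  proof -
    have "edges (bub P) = {(\<gamma>, \<beta>). \<beta> \<in> Vseam P \<and> \<gamma> \<in> set (inb P \<beta>)} \<union> solid P"
      using mark_leaf unfolding solid_eq edges_def verts_bub by force
    then show ?thesis using disj unfolding dashed_def solid_eq by blast
  qed
  have solid_edges: "solid P \<subseteq> edges (bub P)"
    unfolding solid_eq edges_def using type_verts by blast
  have out: "(\<exists>\<beta>. (\<alpha>, \<beta>) \<in> dashed P) \<or> (\<nexists>\<beta>. (\<alpha>, \<beta>) \<in> edges (bub P))" if "\<alpha> \<in> Vcomp P \<union> Vmark P" for \<alpha>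
    using nonseam_parent[OF that] B.rt_no_parent unfolding dashed by blast
  have "bubble_tree P"
    unfolding bubble_tree_def
  proof (intro conjI ballI)
    show "is_rrt (bub P)" by (rule B.rrt)
    show "\<exists>\<beta>. (\<beta>, \<alpha>) \<in> solid P" if "\<alpha> \<in> Vcomp P" for \<alpha>
      using comp_ne[OF that] that unfolding solid_eq by (cases "inb P \<alpha>") auto
    show "\<exists>\<beta>. (\<alpha>, \<beta>) \<in> solid P" if "\<alpha> \<in> Vseam P" for \<alpha>
      using seam_parent[OF that] unfolding solid_eq by blast
    show "\<nexists>\<beta>. (\<beta>, \<alpha>) \<in> edges (bub P)" if "\<alpha> \<in> Vmark P" for \<alpha>
      using mark_leaf[OF that] by (auto simp: edges_def)
    show "2 \<le> length (inb P \<beta>)" if "\<alpha> \<in> Vcomp1 P" "\<beta> \<in> set (inb P \<alpha>)" for \<alpha> \<beta>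
      using that comp1[of \<alpha>] by (auto simp: Vcomp1_def length_Suc_conv)
    show "\<exists>\<beta>\<in>set (inb P \<alpha>). 1 \<le> length (inb P \<beta>)" if a: "\<alpha> \<in> Vcomp2 P" for \<alpha>
    proof -
      obtain \<beta> where b: "\<beta> \<in> set (inb P \<alpha>)" "inb P \<beta> \<noteq> []"
        using comp2_ex a unfolding Vcomp2_def by blast
      then have "1 \<le> length (inb P \<beta>)" by (cases "inb P \<beta>") auto
      then show ?thesis using b by blast
    qed
    show "\<nexists>\<beta>. (\<beta>, \<alpha>) \<in> dashed P" if "\<alpha> \<in> Vcomp P" for \<alpha> using that disj unfolding dashed by blast
    show "\<nexists>\<beta>. (\<beta>, \<alpha>) \<in> solid P" if "\<alpha> \<in> Vseam P" for \<alpha> using that disj unfolding solid_eq by blast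
  qed (use verts_bub disj solid_edges out in blast)+
  moreover have "stable_rrt r (stree P)"
    unfolding stable_rrt_def
  proof (intro conjI ballI)
    show "2 \<le> length (ins P \<alpha>)" if "\<alpha> \<in> interior (stree P)" for \<alpha>
      using that seam_tree_stable[of \<alpha>] unfolding interior_def
      by (cases "ins P \<alpha>" rule: list.exhaust[case_product list.exhaust]; cases "tl (ins P \<alpha>)") auto
  qed (use S.rrt h in auto)
  moreover have "coherence_map r n P"
    unfolding coherence_map_def
  proof (intro conjI)
    show "coh P ` verts (bub P) \<subseteq> verts (stree P)" using coh_verts by blast
    show "\<forall>(\<beta>, \<alpha>)\<in>edges (bub P). coh P \<beta> \<in> set (ins P (coh P \<alpha>)) \<or> coh P \<beta> = coh P \<alpha>"
      using coh_child unfolding edges_def by blast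
    show "\<forall>(\<beta>, \<alpha>)\<in>dashed P. coh P \<beta> = coh P \<alpha>" unfolding dashed using coh_seam by blast
    show "\<forall>(\<beta>, \<alpha>)\<in>solid P. \<alpha> \<in> Vcomp1 P \<longrightarrow> coh P \<beta> = coh P \<alpha>"
      unfolding solid_eq Vcomp1_def using comp1 by (auto simp: length_Suc_conv)
    show "\<forall>\<alpha>\<in>Vcomp2 P. map (coh P) (inb P \<alpha>) = ins P (coh P \<alpha>)"
      using comp2_map unfolding Vcomp2_def by blast
    show "coh P ` Vmark P \<subseteq> leaves (stree P)" using coh_mark by blast
  qed (use coh_rt h in blast)+
  ultimately show "stable_tree_pair r n P" by (simp add: stable_tree_pair_def)
qed

text \<open>\<open>K s\<close> is meant to be the set of leaf numbers below \<open>s\<close>, and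
  \<open>Q v i\<close> the set of all \<open>j\<close> such that the mark
  \<open>\<mu>\<^sub>i\<^sub>j\<close> lies below \<open>v\<close>. For an index outside of
  \<open>{1..r}\<close> the root label is the empty interval \<open>{1..0}\<close>. The last
  condition ties the row of a mark to its image in the seam tree.\<close>

definition lbl :: "nat \<Rightarrow> (nat \<Rightarrow> nat) \<Rightarrow> ('v, 'w) tree_pair \<Rightarrow> ('w \<Rightarrow> nat set) \<Rightarrow> ('v \<Rightarrow> nat \<Rightarrow> nat set) \<Rightarrow> bool" where
  "lbl r n P K Q \<longleftrightarrow>
     good P \<and> ilab (stree P) (leaves (stree P)) K \<and> K (rt (stree P)) = {1..r} \<and>
     (\<forall>x\<in>leaves (stree P). K x \<noteq> {}) \<and>
     (\<forall>i. ilab (bub P) (Vmark P) (\<lambda>v. Q v i)) \<and>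
     (\<forall>i. Q (rt (bub P)) i = {1..if i \<in> {1..r} then n i else 0}) \<and>
     (\<forall>\<mu>\<in>Vmark P. \<forall>i. Q \<mu> i \<noteq> {} \<longleftrightarrow> K (coh P \<mu>) = {i})"

definition seam_label :: "('v, 'w) tree_pair \<Rightarrow> 'w \<Rightarrow> nat set" where
  "seam_label P = rank_label (stree P) (leaves (stree P))"

definition bub_label :: "('v, 'w) tree_pair \<Rightarrow> 'v \<Rightarrow> nat \<Rightarrow> nat set" where
  "bub_label P v i = rank_label (bub P) {\<mu> \<in> Vmark P. leaf_no (stree P) (coh P \<mu>) = i} v"

lemma lbl_exists:
  assumes "stable_tree_pair r n P"
  shows "lbl r n P (seam_label P) (bub_label P)"
proof -
  have h: "good P" "card (leaves (stree P)) = r"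
    "\<And>x. x \<in> leaves (stree P) \<Longrightarrow> card {\<mu> \<in> Vmark P. coh P \<mu> = x} = n (leaf_no (stree P) x)"
    using assms unfolding stable_iff by auto
  interpret good_pair P by standard (rule h(1))
  have K: "seam_label P x = {leaf_no (stree P) x}" if "x \<in> leaves (stree P)" for x
    using S.rank_label_leaf[of "leaves (stree P)" "leaves (stree P)" x] that
    by (simp add: seam_label_def leaf_no_eq)
  have im: "leaf_no (stree P) ` leaves (stree P) = {1..r}"
    using S.leaf_rank_image[of "leaves (stree P)"] h(2) by (simp add: leaf_no_eq[abs_def])
  have inj: "inj_on (leaf_no (stree P)) (leaves (stree P))"
    using S.leaf_rank_inj[of "leaves (stree P)"] by (simp add: leaf_no_eq[abs_def])
  let ?A = "\<lambda>i. {\<mu> \<in> Vmark P. leaf_no (stree P) (coh P \<mu>) = i}"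
  have AM: "?A i \<subseteq> Vmark P" for i by blast
  have cardA: "card (?A i) = (if i \<in> {1..r} then n i else 0)" for i
  proof (cases "i \<in> {1..r}")
    case True
    then obtain x where x: "x \<in> leaves (stree P)" "leaf_no (stree P) x = i"
      unfolding im[symmetric] by blast
    have "?A i = {\<mu> \<in> Vmark P. coh P \<mu> = x}"
      using inj_onD[OF inj] x coh_mark by blast
    then show ?thesis using h(3)[OF x(1)] x(2) True by simp
  next
    case False
    then have "?A i = {}" using im coh_mark by blast
    then have "card (?A i) = 0" by (simp only: card.empty)
    then show ?thesis using False by auto
  qed
  show ?thesis
    unfolding lbl_def
  proof (intro conjI allI ballI)
    show "good P" by (rule h(1))
    show "ilab (stree P) (leaves (stree P)) (seam_label P)"
      unfolding seam_label_def by (intro S.rank_label_ilab) auto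
    show "seam_label P (rt (stree P)) = {1..r}"
      using S.rank_label_root[of "leaves (stree P)"] h(2) by (simp add: seam_label_def)
    show "seam_label P x \<noteq> {}" if "x \<in> leaves (stree P)" for x using K[OF that] by simp
    fix i
    show "ilab (bub P) (Vmark P) (\<lambda>v. bub_label P v i)"
      using B.rank_label_ilab[OF marks_leaves AM[of i]] by (simp add: bub_label_def[abs_def])
    show "bub_label P (rt (bub P)) i = {1..if i \<in> {1..r} then n i else 0}"
      using B.rank_label_root[of "?A i"] AM marks_leaves cardA[of i] unfolding bub_label_def by force
    fix \<mu> assume m: "\<mu> \<in> Vmark P"
    have "bub_label P \<mu> i = (if \<mu> \<in> ?A i then {leaf_rank (bub P) (?A i) \<mu>} else {})"
      unfolding bub_label_def by (rule B.rank_label_leaf[OF marks_leaves AM m])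
    then show "bub_label P \<mu> i \<noteq> {} \<longleftrightarrow> seam_label P (coh P \<mu>) = {i}"
      using K[OF coh_mark[OF m]] m by simp
  qed
qed

text \<open>Interval labellings are unique, and the last condition of \<open>lbl\<close> identifies
  the marks that carry a number in row \<open>i\<close>. Thus exhibiting any \<open>K\<close> and
  \<open>Q\<close> with the local properties proves stability with the right numbers of leaves and
  marks, and at the same time computes the labels. All results on moves rest on this.\<close>

lemma lbl_unique:
  assumes "lbl r n P K Q"
  shows "stable_tree_pair r n P"
    and "s \<in> verts (stree P) \<Longrightarrow> seam_label P s = K s"
    and "v \<in> verts (bub P) \<Longrightarrow> bub_label P v = Q v"
proof -
  have h: "good P" "ilab (stree P) (leaves (stree P)) K" "K (rt (stree P)) = {1..r}"
    "\<And>x. x \<in> leaves (stree P) \<Longrightarrow> K x \<noteq> {}"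
    "\<And>i. ilab (bub P) (Vmark P) (\<lambda>v. Q v i)"
    "\<And>i. Q (rt (bub P)) i = {1..if i \<in> {1..r} then n i else 0}"
    "\<And>\<mu> i. \<mu> \<in> Vmark P \<Longrightarrow> Q \<mu> i \<noteq> {} \<longleftrightarrow> K (coh P \<mu>) = {i}"
    using assms unfolding lbl_def by auto
  interpret good_pair P by standard (rule h(1))
  interpret L: labelled_tree "stree P" "leaves (stree P)" K
    by standard (use h(2) in auto)
  have lv: "{y \<in> leaves (stree P). K y \<noteq> {}} = leaves (stree P)" using h(4) by blast
  show K: "seam_label P s = K s" if "s \<in> verts (stree P)" for s
    using L.l_eq_rank_label[OF h(3) that] unfolding lv seam_label_def by simp
  have Kl: "K x = {leaf_no (stree P) x}" if "x \<in> leaves (stree P)" for x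
    using L.leaf_rank_eq[OF h(3) that h(4)[OF that]] unfolding lv leaf_no_eq .
  have marks: "{\<mu> \<in> Vmark P. Q \<mu> i \<noteq> {}} = {\<mu> \<in> Vmark P. leaf_no (stree P) (coh P \<mu>) = i}" for i
    using h(7) Kl coh_mark by auto
  have QL: "labelled_tree (bub P) (Vmark P) (\<lambda>v. Q v i)" for i
    by standard (use h(5) marks_leaves in auto)
  show "bub_label P v = Q v" if "v \<in> verts (bub P)" for v
  proof
    fix i
    show "bub_label P v i = Q v i"
      using labelled_tree.l_eq_rank_label[OF QL h(6) that, of i] unfolding marks bub_label_def by simp
  qed
  show "stable_tree_pair r n P"
    unfolding stable_iff
  proof (intro conjI ballI)
    show "good P" by (rule h(1))
    show "card (leaves (stree P)) = r" using L.card_marks[OF h(3)] unfolding lv .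
    fix x assume x: "x \<in> leaves (stree P)"
    let ?i = "leaf_no (stree P) x"
    have "x \<in> verts (stree P)" using x by (auto simp: leaves_def)
    then have i: "?i \<in> {1..r}" using L.l_finite[OF h(3)] Kl[OF x] by blast
    have "{\<mu> \<in> Vmark P. coh P \<mu> = x} = {\<mu> \<in> Vmark P. leaf_no (stree P) (coh P \<mu>) = ?i}"
      using S.leaf_rank_inj[of "leaves (stree P)"] x coh_mark unfolding leaf_no_eq inj_on_def by blast
    also have "\<dots> = {\<mu> \<in> Vmark P. Q \<mu> ?i \<noteq> {}}" by (rule marks[symmetric])
    also have "card \<dots> = n ?i" using labelled_tree.card_marks[OF QL h(6), of ?i] i by simp
    finally show "card {\<mu> \<in> Vmark P. coh P \<mu> = x} = n ?i" .
  qed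
qed


section \<open>The 2-bracketing of a stable tree-pair\<close>

lemma (in ribbon_tree) child_neq: "v \<in> verts T \<Longrightarrow> c \<in> set (inc T v) \<Longrightarrow> c \<noteq> v"
  using not_above_child by blast

section \<open>Consequences of the axioms of a 2-bracketing\<close>

locale bracketing =
  fixes r :: nat and n :: "nat \<Rightarrow> nat" and Z :: two_bracketing
  assumes bracketing: "is_two_bracketing r n Z"
begin

lemma ones_one: "one_bracketing r (ones Z)"
  and twos_bracket: "X \<in> twos Z \<Longrightarrow> is_two_bracket r n X"
  and base_in: "X \<in> twos Z \<Longrightarrow> fst X \<in> ones Z"
  and full_in: "full_bracket r n \<in> twos Z"
  and points_in: "i \<in> {1..r} \<Longrightarrow> j \<in> {1..n i} \<Longrightarrow> point_bracket i j \<in> twos Z"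
  and R_irrefl: "irrefl (tb_lt Z)"
  and R_trans: "trans (tb_lt Z)"
  using bracketing unfolding is_two_bracketing_def Let_def by simp_all

lemma nested: "X \<in> twos Z \<Longrightarrow> Y \<in> twos Z \<Longrightarrow> i \<in> fst X \<Longrightarrow> i \<in> fst Y \<Longrightarrow> j \<in> snd X i \<Longrightarrow> j \<in> snd Y i \<Longrightarrow>
    tb_subset X Y \<or> tb_subset Y X"
proof -
  assume h: "X \<in> twos Z" "Y \<in> twos Z" "i \<in> fst X" "i \<in> fst Y" "j \<in> snd X i" "j \<in> snd Y i"
  have "\<forall>X\<in>twos Z. \<forall>X'\<in>twos Z.
         (\<exists>i\<in>fst X \<inter> fst X'. snd X i \<inter> snd X' i \<noteq> {}) \<longrightarrow> tb_subset X X' \<or> tb_subset X' X"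
    using bracketing unfolding is_two_bracketing_def Let_def by (elim conjE)
  moreover have "\<exists>i\<in>fst X \<inter> fst Y. snd X i \<inter> snd Y i \<noteq> {}" using h by blast
  ultimately show ?thesis using h(1,2) by blast
qed

lemma cover: "B \<in> ones Z \<Longrightarrow> i \<in> B \<Longrightarrow> j \<in> {1..n i} \<Longrightarrow> \<exists>X\<in>twos Z. fst X = B \<and> j \<in> snd X i"
proof -
  assume h: "B \<in> ones Z" "i \<in> B" "j \<in> {1..n i}"
  have "\<forall>B\<in>ones Z. \<forall>i\<in>B. (\<Union>X\<in>over (twos Z) B. snd X i) = {1..n i}"
    using bracketing unfolding is_two_bracketing_def Let_def by (elim conjE)
  then have "(\<Union>X\<in>over (twos Z) B. snd X i) = {1..n i}" using h by blast
  then have "j \<in> (\<Union>X\<in>over (twos Z) B. snd X i)" using h(3) by (simp only:)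
  then show ?thesis unfolding over_def by blast
qed

lemma subcover: "X \<in> twos Z \<Longrightarrow> X' \<in> twos Z \<Longrightarrow> fst X' = fst X \<Longrightarrow> tb_psubset X' X \<Longrightarrow> i \<in> fst X \<Longrightarrow> j \<in> snd X i \<Longrightarrow>
    \<exists>Y\<in>twos Z. fst Y = fst X \<and> tb_psubset Y X \<and> j \<in> snd Y i"
proof -
  assume h: "X \<in> twos Z" "X' \<in> twos Z" "fst X' = fst X" "tb_psubset X' X" "i \<in> fst X" "j \<in> snd X i"
  have "\<forall>B\<in>ones Z. \<forall>X\<in>over (twos Z) B. (\<exists>X'\<in>over (twos Z) B. tb_psubset X' X) \<longrightarrow>
         (\<forall>i\<in>B. \<forall>j\<in>snd X i. \<exists>X''\<in>over (twos Z) B. tb_psubset X'' X \<and> j \<in> snd X'' i)"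
    using bracketing unfolding is_two_bracketing_def Let_def by (elim conjE)
  moreover have "X \<in> over (twos Z) (fst X)" "X' \<in> over (twos Z) (fst X)" using h by (auto simp: over_def)
  ultimately have "\<exists>X''\<in>over (twos Z) (fst X). tb_psubset X'' X \<and> j \<in> snd X'' i"
    using h base_in by blast
  then show ?thesis unfolding over_def by blast
qed

lemma R_base: "(X, Y) \<in> tb_lt Z \<Longrightarrow> X \<in> twos Z \<and> Y \<in> twos Z \<and> fst X = fst Y"
proof -
  assume h: "(X, Y) \<in> tb_lt Z"
  have "tb_lt Z \<subseteq> (\<Union>B\<in>ones Z. over (twos Z) B \<times> over (twos Z) B)"
    using bracketing unfolding is_two_bracketing_def Let_def by (elim conjE)
  then have "(X, Y) \<in> (\<Union>B\<in>ones Z. over (twos Z) B \<times> over (twos Z) B)" using h by blast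
  then show ?thesis unfolding over_def by blast
qed

lemma R_iff: "X \<in> twos Z \<Longrightarrow> Y \<in> twos Z \<Longrightarrow> fst X = fst Y \<Longrightarrow>
    (X, Y) \<in> tb_lt Z \<or> (Y, X) \<in> tb_lt Z \<longleftrightarrow> (\<forall>i\<in>fst X. snd X i \<inter> snd Y i = {})"
proof -
  assume h: "X \<in> twos Z" "Y \<in> twos Z" "fst X = fst Y"
  have a: "\<forall>B\<in>ones Z. \<forall>X\<in>over (twos Z) B. \<forall>X'\<in>over (twos Z) B.
         (X, X') \<in> tb_lt Z \<or> (X', X) \<in> tb_lt Z \<longleftrightarrow> (\<forall>i\<in>B. snd X i \<inter> snd X' i = {})"
    using bracketing unfolding is_two_bracketing_def Let_def by (elim conjE)
  have "X \<in> over (twos Z) (fst X)" "Y \<in> over (twos Z) (fst X)" using h by (simp_all add: over_def)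
  then show ?thesis by (rule a[THEN bspec, OF base_in[OF h(1)], THEN bspec, THEN bspec])
qed

lemma R_asym: "(X, Y) \<in> tb_lt Z \<Longrightarrow> (Y, X) \<notin> tb_lt Z"
  using R_irrefl R_trans by (meson irreflD transD)

lemma R_inherit: "(X1, X2) \<in> tb_lt Z \<Longrightarrow> Y1 \<in> twos Z \<Longrightarrow> Y2 \<in> twos Z \<Longrightarrow> fst Y1 = fst Y2 \<Longrightarrow>
    tb_subset Y1 X1 \<Longrightarrow> tb_subset Y2 X2 \<Longrightarrow> (Y1, Y2) \<in> tb_lt Z"
proof -
  assume h: "(X1, X2) \<in> tb_lt Z" "Y1 \<in> twos Z" "Y2 \<in> twos Z" "fst Y1 = fst Y2"
    "tb_subset Y1 X1" "tb_subset Y2 X2"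
  have a: "\<forall>B\<in>ones Z. \<forall>B'\<in>ones Z.
         \<forall>X1\<in>over (twos Z) B. \<forall>X2\<in>over (twos Z) B. \<forall>Y1\<in>over (twos Z) B'. \<forall>Y2\<in>over (twos Z) B'.
           tb_subset Y1 X1 \<and> tb_subset Y2 X2 \<and> (X1, X2) \<in> tb_lt Z \<longrightarrow> (Y1, Y2) \<in> tb_lt Z"
    using bracketing unfolding is_two_bracketing_def Let_def by (elim conjE)
  have x: "X1 \<in> over (twos Z) (fst X1)" "X2 \<in> over (twos Z) (fst X1)" "fst X1 \<in> ones Z"
    using R_base[OF h(1)] base_in[of X1] by (simp_all add: over_def)
  have y: "Y1 \<in> over (twos Z) (fst Y1)" "Y2 \<in> over (twos Z) (fst Y1)" "fst Y1 \<in> ones Z"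
    using h base_in[of Y1] by (simp_all add: over_def)
  show ?thesis
    using a[THEN bspec, OF x(3), THEN bspec, OF y(3), THEN bspec, OF x(1), THEN bspec, OF x(2),
        THEN bspec, OF y(1), THEN bspec, OF y(2)] h(1,5,6) by simp
qed

lemma bracket_ext:
  assumes "X \<in> twos Z" "Y \<in> twos Z" "fst X = fst Y" "\<And>i. i \<in> fst X \<Longrightarrow> snd X i = snd Y i"
  shows "X = Y"
proof (rule prod_eqI)
  show "snd X = snd Y"
  proof
    fix i show "snd X i = snd Y i"
      using assms twos_bracket[OF assms(1)] twos_bracket[OF assms(2)]
      by (cases "i \<in> fst X") (auto simp: is_two_bracket_def)
  qed
qed (rule assms(3))

lemma bracket_ne: "X \<in> twos Z \<Longrightarrow> \<exists>i\<in>fst X. \<exists>j. j \<in> snd X i"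
  using twos_bracket[of X] by (auto simp: is_two_bracket_def)

lemma bracket_supp: "X \<in> twos Z \<Longrightarrow> j \<in> snd X i \<Longrightarrow> i \<in> fst X"
  using twos_bracket[of X] by (auto simp: is_two_bracket_def)

lemma bracket_range: "X \<in> twos Z \<Longrightarrow> j \<in> snd X i \<Longrightarrow> j \<in> {1..n i}"
  using twos_bracket[of X] bracket_supp[of X j i] unfolding is_two_bracket_def by blast

lemma tb_subset_antisym: "X \<in> twos Z \<Longrightarrow> Y \<in> twos Z \<Longrightarrow> tb_subset X Y \<Longrightarrow> tb_subset Y X \<Longrightarrow> X = Y"
  by (rule bracket_ext) (auto simp: tb_subset_def)

lemma ones_nested: "B \<in> ones Z \<Longrightarrow> C \<in> ones Z \<Longrightarrow> i \<in> B \<Longrightarrow> i \<in> C \<Longrightarrow> B \<subseteq> C \<or> C \<subseteq> B"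
  using ones_one unfolding one_bracketing_def by blast

end

lemma tb_subset_trans: "tb_subset X Y \<Longrightarrow> tb_subset Y W \<Longrightarrow> tb_subset X W"
  unfolding tb_subset_def by blast

lemma tb_subset_refl: "tb_subset X X"
  by (simp add: tb_subset_def)

definition brk :: "('v, 'w) tree_pair \<Rightarrow> 'v \<Rightarrow> two_bracket" where
  "brk P v = (seam_label P (coh P v), bub_label P v)"

abbreviation nodes :: "('v, 'w) tree_pair \<Rightarrow> 'v set" where
  "nodes P \<equiv> Vcomp P \<union> Vmark P"

definition brackets :: "('v, 'w) tree_pair \<Rightarrow> two_bracketing" where
  "brackets P = \<lparr>ones = seam_label P ` verts (stree P), twos = brk P ` nodes P,
     tb_lt = {(brk P x, brk P y) | x y.
       x \<in> nodes P \<and> y \<in> nodes P \<and> coh P x = coh P y \<and> left_of (bub P) x y}\<rparr>"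

lemma brackets_simps [simp]:
  "ones (brackets P) = seam_label P ` verts (stree P)"
  "twos (brackets P) = brk P ` nodes P"
  by (simp_all add: brackets_def)

section \<open>The labels as an order embedding, and the axioms of a 2-bracketing for them\<close>

locale stable_pair =
  fixes r :: nat and n :: "nat \<Rightarrow> nat" and P :: "('v, 'w) tree_pair"
  assumes stable: "stable_tree_pair r n P"
begin

sublocale good_pair P by standard (rule stable_imp_good[OF stable])

abbreviation K where "K \<equiv> seam_label P"
abbreviation Q where "Q \<equiv> bub_label P"

lemma lbl: "lbl r n P K Q"
  by (rule lbl_exists[OF stable])

sublocale KL: labelled_tree "stree P" "leaves (stree P)" K
  by standard (use lbl in \<open>auto simp: lbl_def\<close>)

lemma QL: "labelled_tree (bub P) (Vmark P) (\<lambda>v. Q v i)"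
  by standard (use lbl marks_leaves in \<open>auto simp: lbl_def\<close>)

lemma K_rt: "K (rt (stree P)) = {1..r}"
  and Q_rt: "Q (rt (bub P)) i = {1..if i \<in> {1..r} then n i else 0}"
  and Q_mark: "\<mu> \<in> Vmark P \<Longrightarrow> Q \<mu> i \<noteq> {} \<longleftrightarrow> K (coh P \<mu>) = {i}"
  using lbl unfolding lbl_def by blast+

lemmas Q_mono = labelled_tree.l_mono[OF QL]
  and Q_left_of = labelled_tree.l_left_of[OF QL]
  and Q_meet = labelled_tree.l_meet[OF QL]
  and Q_consecutive = labelled_tree.l_consecutive[OF QL Q_rt]
  and Q_mark_below = labelled_tree.l_mark_below[OF QL]
  and Q_mark_single = labelled_tree.l_mark[OF QL]
  and Q_children = labelled_tree.l_children[OF QL]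

lemma K_leaf: "x \<in> leaves (stree P) \<Longrightarrow> \<exists>i. K x = {i}"
proof -
  assume x: "x \<in> leaves (stree P)"
  have "\<forall>v\<in>leaves (stree P). K v = {} \<or> (\<exists>k. K v = {k})"
    using KL.ilab unfolding ilab_def by (elim conjE)
  moreover have "\<forall>v\<in>leaves (stree P). K v \<noteq> {}" using lbl unfolding lbl_def by (elim conjE)
  ultimately show ?thesis using x by blast
qed

lemma K_ne: "s \<in> verts (stree P) \<Longrightarrow> K s \<noteq> {}"
proof -
  assume "s \<in> verts (stree P)"
  then obtain x where x: "x \<in> leaves (stree P)" "below (stree P) x s" using S.below_leaf by blast
  then show ?thesis using K_leaf[OF x(1)] KL.l_mono[OF x(2)] by auto
qed

lemma K_sub: "s \<in> verts (stree P) \<Longrightarrow> K s \<subseteq> {1..r}"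
  using KL.l_finite[OF K_rt] .

lemma Q_range: "v \<in> verts (bub P) \<Longrightarrow> j \<in> Q v i \<Longrightarrow> i \<in> {1..r} \<and> j \<in> {1..n i}"
proof -
  assume h: "v \<in> verts (bub P)" "j \<in> Q v i"
  have "j \<in> Q (rt (bub P)) i" using Q_mono[OF B.below_rt[OF h(1)]] h(2) by blast
  then show ?thesis using Q_rt[of i] by (auto split: if_splits)
qed

lemma K_sibling:
  assumes "s \<in> verts (stree P)" "c \<in> set (ins P s)" "d \<in> set (ins P s)" "i \<in> K c" "i \<in> K d"
  shows "c = d"
proof -
  have "below (stree P) c d \<or> below (stree P) d c"
    using KL.l_meet S.child_in[OF assms(1)] assms(2-5) by blast
  then show ?thesis using S.siblings_not_below[OF assms(1)] assms(2,3) by metis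
qed

lemma other_child:
  assumes "s \<in> verts (stree P)" "c \<in> set (ins P s)"
  obtains d where "d \<in> set (ins P s)" "d \<noteq> c"
proof -
  have "length (ins P s) \<noteq> 1" "length (ins P s) \<noteq> 0"
    using seam_tree_stable[OF assms(1)] assms(2) by auto
  then have "2 \<le> card (set (ins P s))" using distinct_card[OF S.dist[OF assms(1)]] by linarith
  then have "\<not> set (ins P s) \<subseteq> {c}" using card_mono[of "{c}" "set (ins P s)"] by fastforce
  then show thesis using that by blast
qed

text \<open>By stability \<open>s\<close> has a second child beside the one above \<open>t\<close>.
  Its label is nonempty and disjoint from that of the first.\<close>

lemma K_strict:
  assumes "below (stree P) t s" "t \<noteq> s"
  shows "\<not> K s \<subseteq> K t"
proof
  assume sub: "K s \<subseteq> K t"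
  obtain c where c: "c \<in> set (ins P s)" "below (stree P) t c" "s \<in> verts (stree P)"
    using S.below_cases[OF assms] by blast
  obtain d where d: "d \<in> set (ins P s)" "d \<noteq> c" using other_child[OF c(3,1)] by blast
  obtain i where i: "i \<in> K d" using K_ne[OF S.child_in[OF c(3) d(1)]] by blast
  have "i \<in> K s" using KL.l_child_mono[OF c(3) d(1)] i by blast
  then have "i \<in> K c" using sub KL.l_mono[OF c(2)] by blast
  then show False using K_sibling[OF c(3) d(1) c(1)] i d(2) by blast
qed

text \<open>Vertices with meeting labels are comparable, and \<open>K_strict\<close> excludes the
  wrong direction.\<close>

lemma K_below:
  assumes "s \<in> verts (stree P)" "t \<in> verts (stree P)" "K s \<subseteq> K t"
  shows "below (stree P) s t"
proof -
  have "K s \<inter> K t \<noteq> {}" using K_ne[OF assms(1)] assms(3) by blast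
  then consider "below (stree P) s t" | "below (stree P) t s" using KL.l_meet[OF assms(1,2)] by blast
  then show ?thesis
  proof cases
    case 2
    then have "t = s" using K_strict assms(3) by blast
    then show ?thesis by simp
  qed
qed

lemma K_inj: "s \<in> verts (stree P) \<Longrightarrow> t \<in> verts (stree P) \<Longrightarrow> K s = K t \<Longrightarrow> s = t"
  using K_below[of s t] K_below[of t s] S.below_antisym[of s t] by simp

lemma node_verts: "v \<in> nodes P \<Longrightarrow> v \<in> verts (bub P)"
  by (rule type_verts(4))

lemma Q_supp: "v \<in> verts (bub P) \<Longrightarrow> j \<in> Q v i \<Longrightarrow> i \<in> K (coh P v)"
proof -
  assume h: "v \<in> verts (bub P)" "j \<in> Q v i"
  obtain \<mu> where m: "\<mu> \<in> Vmark P" "below (bub P) \<mu> v" "Q \<mu> i = {j}" using Q_mark_below[OF h] by blast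
  then have "K (coh P \<mu>) = {i}" using Q_mark[OF m(1)] by blast
  then show ?thesis using KL.l_mono[OF coh_mono[OF m(2)]] by blast
qed

lemma Q_child:
  assumes "v \<in> verts (bub P)" "v \<notin> Vmark P" "j \<in> Q v i"
  obtains c where "c \<in> set (inb P v)" "j \<in> Q c i"
  using Q_children[OF assms(1,2)] assms(3) by blast

text \<open>The only vertices that may have no mark below them are seams without children, so the
  induction is run for all vertices with this exception. At a component, stability provides a seam
  that has children.\<close>

lemma node_ne: "v \<in> nodes P \<Longrightarrow> \<exists>i j. j \<in> Q v i"
proof -
  have "v \<in> Vseam P \<and> inb P v = [] \<or> (\<exists>i j. j \<in> Q v i)" if "v \<in> verts (bub P)" for v
    using that
  proof (induction rule: B.bottom_up)
    case (step v)
    have up: "\<exists>i j. j \<in> Q v i" if c: "c \<in> set (inb P v)" "c \<notin> Vseam P \<or> inb P c \<noteq> []" for c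
    proof -
      obtain i j where "j \<in> Q c i" using step(2)[OF c(1)] c(2) by blast
      then show ?thesis using Q_mono[OF below_child[OF step(1) c(1)]] by blast
    qed
    consider "v \<in> Vcomp P" | "v \<in> Vseam P" | "v \<in> Vmark P" using step(1) verts_bub by blast
    then show ?case
    proof cases
      case 1
      then show ?thesis
      proof (cases rule: comp_cases)
        case (one \<beta>)
        then have "inb P \<beta> \<noteq> []" by auto
        then show ?thesis using up[of \<beta>] one(1) by simp
      next
        case two
        then show ?thesis using comp2_ex[OF 1] up by blast
      qed
    next
      case 2
      show ?thesis
      proof (cases "inb P v = []")
        case False
        then have h: "hd (inb P v) \<in> set (inb P v)" by simp
        then have "hd (inb P v) \<notin> Vseam P" using seam_children[OF 2 h] disj by blast
        then show ?thesis using up[OF h] by blast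
      qed (use 2 in blast)
    next
      case 3
      obtain i where "K (coh P v) = {i}" using K_leaf[OF coh_mark[OF 3]] by blast
      then show ?thesis using Q_mark[OF 3] by blast
    qed
  qed
  moreover assume "v \<in> nodes P"
  ultimately show ?thesis using node_verts disj by blast
qed

lemma brk_simps [simp]: "fst (brk P v) = K (coh P v)" "snd (brk P v) = Q v"
  by (simp_all add: brk_def)

lemma brk_mono: "below (bub P) x y \<Longrightarrow> tb_subset (brk P x) (brk P y)"
  unfolding tb_subset_def brk_simps using KL.l_mono[OF coh_mono] Q_mono by blast

lemma below_comp:
  assumes "x \<in> nodes P" "y \<in> Vcomp P" "below (bub P) x y" "x \<noteq> y"
  obtains \<beta> \<gamma> where "\<beta> \<in> set (inb P y)" "\<gamma> \<in> set (inb P \<beta>)" "below (bub P) x \<gamma>"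
    "\<beta> \<in> Vseam P" "\<gamma> \<in> nodes P"
proof -
  obtain \<beta> where b: "\<beta> \<in> set (inb P y)" "below (bub P) x \<beta>" using B.below_cases[OF assms(3,4)] by blast
  have bs: "\<beta> \<in> Vseam P" using comp_children assms(2) b(1) by blast
  then have "x \<noteq> \<beta>" using assms(1) disj by blast
  then obtain \<gamma> where g: "\<gamma> \<in> set (inb P \<beta>)" "below (bub P) x \<gamma>" using B.below_cases[OF b(2)] by blast
  show thesis using that b(1) g bs seam_children[OF bs g(1)] by blast
qed

lemma below_mark: "below (bub P) x \<mu> \<Longrightarrow> \<mu> \<in> Vmark P \<Longrightarrow> x = \<mu>"
  using B.below_leaf_eq marks_leaves by blast

lemma siblings_Q:
  assumes "v \<in> verts (bub P)" "c \<in> set (inb P v)" "d \<in> set (inb P v)" "j \<in> Q c i" "j \<in> Q d i"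
  shows "c = d"
proof -
  have "below (bub P) c d \<or> below (bub P) d c"
    using Q_meet[OF B.child_in[OF assms(1,2)] B.child_in[OF assms(1,3)]] assms(4,5) by blast
  then show ?thesis using B.siblings_not_below[OF assms(1)] assms(2,3) by metis
qed

text \<open>If \<open>y\<close> has a single seam, this seam has a second child beside the one above
  \<open>x\<close>, and some mark below that child lies below \<open>y\<close> but not below
  \<open>x\<close>. If \<open>y\<close> has several seams, the 1-bracket shrinks strictly from
  \<open>y\<close> to the seam on the way to \<open>x\<close>.\<close>

lemma brk_strict:
  assumes "x \<in> nodes P" "y \<in> Vcomp P" "below (bub P) x y" "x \<noteq> y"
  shows "\<not> tb_subset (brk P y) (brk P x)"
proof
  assume sub: "tb_subset (brk P y) (brk P x)"
  obtain \<beta> \<gamma> where bg: "\<beta> \<in> set (inb P y)" "\<gamma> \<in> set (inb P \<beta>)" "below (bub P) x \<gamma>"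
    "\<beta> \<in> Vseam P" "\<gamma> \<in> nodes P" by (rule below_comp[OF assms])
  have bv: "\<beta> \<in> verts (bub P)" using type_verts bg(4) by blast
  have yv: "y \<in> verts (bub P)" using type_verts assms(2) by blast
  show False using assms(2)
  proof (cases rule: comp_cases)
    case (one \<beta>')
    then have "\<beta>' = \<beta>" using bg(1) by simp
    then have "2 \<le> card (set (inb P \<beta>))" using one distinct_card[OF B.dist[OF bv]] by simp
    then have "\<not> set (inb P \<beta>) \<subseteq> {\<gamma>}" using card_mono[of "{\<gamma>}" "set (inb P \<beta>)"] by fastforce
    then obtain \<gamma>' where g': "\<gamma>' \<in> set (inb P \<beta>)" "\<gamma>' \<noteq> \<gamma>" by blast
    then have "\<gamma>' \<in> nodes P" using seam_children bg(4) by blast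
    then obtain i j where ij: "j \<in> Q \<gamma>' i" using node_ne by blast
    have "below (bub P) \<gamma>' y" using below_child[OF bv g'(1)] below_child[OF yv bg(1)] by (rule rtrancl_trans)
    then have "j \<in> Q y i" "i \<in> K (coh P y)" using Q_mono ij Q_supp[OF yv] by blast+
    then have "j \<in> Q x i" using sub by (auto simp: tb_subset_def)
    then have "j \<in> Q \<gamma> i" using Q_mono[OF bg(3)] by blast
    then show False using siblings_Q[OF bv bg(2) g'(1)] ij g'(2) by blast
  next
    case two
    have "coh P \<beta> \<in> set (ins P (coh P y))" using bg(1) two(2) by (metis image_eqI list.set_map)
    then have "below (stree P) (coh P \<beta>) (coh P y)" "coh P \<beta> \<noteq> coh P y"
      using below_child[OF coh_verts[OF yv]] S.child_neq[OF coh_verts[OF yv]] by auto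
    then have "\<not> K (coh P y) \<subseteq> K (coh P \<beta>)" by (rule K_strict)
    moreover have "K (coh P x) \<subseteq> K (coh P \<beta>)"
      using KL.l_mono[OF coh_mono[OF bg(3)]] coh_seam[OF bg(4,2)] by simp
    ultimately show False using sub by (auto simp: tb_subset_def)
  qed
qed

text \<open>A number below \<open>x\<close> occurs below \<open>y\<close> as well, so the two are
  comparable, and \<open>brk_strict\<close> rules out that \<open>y\<close> lies strictly below
  \<open>x\<close>. Together with \<open>brk_mono\<close> this makes \<open>brk\<close> an order
  embedding.\<close>

lemma brk_below:
  assumes "x \<in> nodes P" "y \<in> nodes P" "tb_subset (brk P x) (brk P y)"
  shows "below (bub P) x y"
proof -
  obtain i j where ij: "j \<in> Q x i" using node_ne[OF assms(1)] by blast
  have "i \<in> K (coh P x)" using Q_supp[OF node_verts[OF assms(1)] ij] .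
  then have "j \<in> Q y i" using assms(3) ij by (auto simp: tb_subset_def)
  then consider "below (bub P) x y" | "below (bub P) y x"
    using Q_meet[OF node_verts[OF assms(1)] node_verts[OF assms(2)], of i] ij by blast
  then show ?thesis
  proof cases
    case 2
    have "x = y"
    proof (rule ccontr)
      assume "x \<noteq> y"
      then have "x \<notin> Vmark P" using below_mark[OF 2] by blast
      then have "x \<in> Vcomp P" using assms(1) by blast
      then show False using brk_strict[OF assms(2) _ 2] assms(3) \<open>x \<noteq> y\<close> by blast
    qed
    then show ?thesis by simp
  qed
qed

lemma brk_inj: "x \<in> nodes P \<Longrightarrow> y \<in> nodes P \<Longrightarrow> brk P x = brk P y \<Longrightarrow> x = y"
  using brk_below B.below_antisym tb_subset_refl by metis

text \<open>Labels are nonempty, so nested nodes have a number in common; two nodes that are not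
  nested lie side by side.\<close>

lemma nodes_disjoint:
  assumes "x \<in> nodes P" "y \<in> nodes P"
  shows "(\<forall>i\<in>K (coh P x). Q x i \<inter> Q y i = {}) \<longleftrightarrow> left_of (bub P) x y \<or> left_of (bub P) y x"
proof
  assume "left_of (bub P) x y \<or> left_of (bub P) y x"
  then show "\<forall>i\<in>K (coh P x). Q x i \<inter> Q y i = {}" using Q_left_of slt_disjoint by blast
next
  assume d: "\<forall>i\<in>K (coh P x). Q x i \<inter> Q y i = {}"
  obtain i j where ij: "j \<in> Q x i" using node_ne[OF assms(1)] by blast
  have "i \<in> K (coh P x)" using Q_supp[OF node_verts[OF assms(1)] ij] .
  then have "\<not> below (bub P) x y" using Q_mono d ij by blast
  moreover obtain i' j' where ij': "j' \<in> Q y i'" using node_ne[OF assms(2)] by blast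
  have "\<not> below (bub P) y x"
  proof
    assume b: "below (bub P) y x"
    then have "j' \<in> Q x i'" using Q_mono ij' by blast
    then have "i' \<in> K (coh P x)" using Q_supp node_verts[OF assms(1)] by blast
    then show False using d ij' \<open>j' \<in> Q x i'\<close> by blast
  qed
  ultimately show "left_of (bub P) x y \<or> left_of (bub P) y x"
    using B.left_of_total[OF node_verts[OF assms(1)] node_verts[OF assms(2)]] by blast
qed

lemma brk_rt: "brk P (rt (bub P)) = full_bracket r n"
proof (rule prod_eqI)
  show "fst (brk P (rt (bub P))) = fst (full_bracket r n)"
    using K_rt coh_rt by (simp add: full_bracket_def)
  show "snd (brk P (rt (bub P))) = snd (full_bracket r n)"
    using Q_rt by (auto simp: full_bracket_def fun_eq_iff)
qed

lemma rt_node: "rt (bub P) \<in> nodes P"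
  using B.rt_in verts_bub rt_not_seam by blast

lemma brk_mark:
  assumes "\<mu> \<in> Vmark P" "j \<in> Q \<mu> i"
  shows "brk P \<mu> = point_bracket i j"
proof -
  have K: "K (coh P \<mu>) = {i}" using Q_mark[OF assms(1)] assms(2) by blast
  have "Q \<mu> = (\<lambda>m. if m = i then {j} else {})"
  proof
    fix m show "Q \<mu> m = (if m = i then {j} else {})"
      using Q_mark_single[OF assms] Q_mark[OF assms(1), of m] K by auto
  qed
  then show ?thesis using K by (simp add: brk_def point_bracket_def)
qed

lemma mark_point: "\<mu> \<in> Vmark P \<Longrightarrow> \<exists>i j. brk P \<mu> = point_bracket i j"
  using node_ne[of \<mu>] brk_mark by blast

lemma point_mark:
  assumes "i \<in> {1..r}" "j \<in> {1..n i}"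
  obtains \<mu> where "\<mu> \<in> Vmark P" "brk P \<mu> = point_bracket i j" "Q \<mu> i = {j}"
proof -
  have "j \<in> Q (rt (bub P)) i" using Q_rt[of i] assms by simp
  then obtain \<mu> where "\<mu> \<in> Vmark P" "Q \<mu> i = {j}" using Q_mark_below[OF B.rt_in] by blast
  then show thesis using that brk_mark by blast
qed

text \<open>First half of condition (4). Descent in the seam tree: from a node over the parent
  \<open>t\<close> whose bracket contains \<open>j\<close> in row \<open>i\<close>, follow the
  branches that contain this number. The path stays over \<open>t\<close> at components with one
  seam, and at the first component with several seams it passes to the child of \<open>t\<close>
  whose label contains \<open>i\<close>, which is \<open>s\<close>.\<close>

lemma node_cover:
  assumes "s \<in> verts (stree P)" "i \<in> K s" "j \<in> {1..n i}"
  shows "\<exists>x\<in>nodes P. coh P x = s \<and> j \<in> Q x i"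
  using assms
proof (induction rule: S.top_down)
  case root
  have "i \<in> {1..r}" using root.prems(1) K_rt by simp
  then have "j \<in> Q (rt (bub P)) i" using Q_rt[of i] root.prems(2) by simp
  then show ?case using rt_node coh_rt by blast
next
  case (step t s)
  have "i \<in> K t" using KL.l_child_mono[OF step.hyps] step.prems(1) by blast
  then obtain x where x: "x \<in> nodes P" "coh P x = t" "j \<in> Q x i" using step.IH step.prems(2) by blast
  \<comment> \<open>Inner induction in the bubble tree, downwards through the components over
    \<open>t\<close> that have a single seam.\<close>
  have "v \<in> nodes P \<longrightarrow> coh P v = t \<longrightarrow> j \<in> Q v i \<longrightarrow> (\<exists>x\<in>nodes P. coh P x = s \<and> j \<in> Q x i)"
    if "v \<in> verts (bub P)" for v
  proof (rule wf_induct_rule[OF B.wf_edges[THEN wf_trancl], of _ v])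
    fix v assume IH: "\<And>w. (w, v) \<in> (edges (bub P))\<^sup>+ \<Longrightarrow>
      w \<in> nodes P \<longrightarrow> coh P w = t \<longrightarrow> j \<in> Q w i \<longrightarrow> (\<exists>x\<in>nodes P. coh P x = s \<and> j \<in> Q x i)"
    show "v \<in> nodes P \<longrightarrow> coh P v = t \<longrightarrow> j \<in> Q v i \<longrightarrow> (\<exists>x\<in>nodes P. coh P x = s \<and> j \<in> Q x i)"
    proof (intro impI)
      assume v: "v \<in> nodes P" "coh P v = t" "j \<in> Q v i"
      have vv: "v \<in> verts (bub P)" using node_verts v(1) by blast
      have "v \<notin> Vmark P"
      proof
        assume "v \<in> Vmark P"
        then have "t \<in> leaves (stree P)" using coh_mark v(2) by blast
        then show False using step.hyps(2) by (simp add: leaves_def)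
      qed
      then have vc: "v \<in> Vcomp P" using v(1) by blast
      obtain \<beta> where b: "\<beta> \<in> set (inb P v)" "j \<in> Q \<beta> i" using Q_child[OF vv \<open>v \<notin> Vmark P\<close> v(3)] by blast
      have bs: "\<beta> \<in> Vseam P" using comp_children[OF vc b(1)] .
      have bv: "\<beta> \<in> verts (bub P)" using type_verts bs by blast
      have "\<beta> \<notin> Vmark P" using bs disj by blast
      then obtain \<gamma> where g: "\<gamma> \<in> set (inb P \<beta>)" "j \<in> Q \<gamma> i" using Q_child[OF bv _ b(2)] by blast
      have gn: "\<gamma> \<in> nodes P" using seam_children[OF bs g(1)] .
      have gb: "coh P \<gamma> = coh P \<beta>" using coh_seam[OF bs g(1)] .
      show "\<exists>x\<in>nodes P. coh P x = s \<and> j \<in> Q x i" using vc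
      proof (cases rule: comp_cases)
        case (one \<beta>')
        then have "coh P \<gamma> = t" using b(1) gb v(2) by simp
        moreover have "(\<gamma>, v) \<in> (edges (bub P))\<^sup>+"
          by (rule trancl.intros(2)[OF r_into_trancl[OF edgeI[OF bv g(1)]] edgeI[OF vv b(1)]])
        ultimately show ?thesis using IH gn g(2) by blast
      next
        case two
        have "coh P \<beta> \<in> set (ins P t)" using b(1) two(2) v(2) by (metis image_eqI list.set_map)
        moreover have "i \<in> K (coh P \<beta>)" using Q_supp[OF bv b(2)] .
        ultimately have "coh P \<beta> = s" using K_sibling[OF step.hyps(1) _ step.hyps(2)] step.prems(1) by blast
        then show ?thesis using gn gb g(2) by auto
      qed
    qed
  qed
  then show ?case using x node_verts by blast
qed

text \<open>Second half of condition (4). A smaller node over the same vertex of the seam tree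
  forces \<open>y\<close> to have a single seam, because the seams of any other component are mapped
  strictly below the image of \<open>y\<close>. The children of that seam then cover everything
  below \<open>y\<close>.\<close>

lemma node_subcover:
  assumes "x \<in> nodes P" "y \<in> nodes P" "coh P x = coh P y" "below (bub P) x y" "x \<noteq> y" "j \<in> Q y i"
  shows "\<exists>z\<in>nodes P. coh P z = coh P y \<and> below (bub P) z y \<and> z \<noteq> y \<and> j \<in> Q z i"
proof -
  have "y \<notin> Vmark P" using below_mark[OF assms(4)] assms(5) by blast
  then have yc: "y \<in> Vcomp P" using assms(2) by blast
  have yv: "y \<in> verts (bub P)" using type_verts yc by blast
  obtain \<beta> \<gamma> where bg: "\<beta> \<in> set (inb P y)" "\<gamma> \<in> set (inb P \<beta>)" "below (bub P) x \<gamma>"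
    "\<beta> \<in> Vseam P" "\<gamma> \<in> nodes P" by (rule below_comp[OF assms(1) yc assms(4,5)])
  have bv: "\<beta> \<in> verts (bub P)" using type_verts bg(4) by blast
  show ?thesis using yc
  proof (cases rule: comp_cases)
    case (one \<beta>')
    then have b': "\<beta>' = \<beta>" using bg(1) by simp
    obtain \<beta>'' where "\<beta>'' \<in> set (inb P y)" "j \<in> Q \<beta>'' i" using Q_child[OF yv \<open>y \<notin> Vmark P\<close> assms(6)] .
    then have jb: "j \<in> Q \<beta> i" using one(1) b' by simp
    have nm: "\<beta> \<notin> Vmark P" using bg(4) disj by blast
    obtain \<delta> where d: "\<delta> \<in> set (inb P \<beta>)" "j \<in> Q \<delta> i" by (rule Q_child[OF bv nm jb])
    have e: "(\<delta>, \<beta>) \<in> edges (bub P)" "(\<beta>, y) \<in> edges (bub P)" using edgeI[OF bv d(1)] edgeI[OF yv bg(1)] .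
    then have "(\<delta>, y) \<in> (edges (bub P))\<^sup>+" by (rule trancl.intros(2)[OF r_into_trancl])
    then have "below (bub P) \<delta> y" "\<delta> \<noteq> y" using B.acyc trancl_into_rtrancl by metis+
    moreover have "coh P \<delta> = coh P y" using coh_seam[OF bg(4) d(1)] one(3) b' by simp
    ultimately show ?thesis using seam_children[OF bg(4) d(1)] d(2) by blast
  next
    case two
    have c: "coh P \<beta> \<in> set (ins P (coh P y))" using bg(1) two(2) by (metis image_eqI list.set_map)
    have "below (stree P) (coh P y) (coh P \<beta>)"
      using coh_mono[OF bg(3)] coh_seam[OF bg(4,2)] assms(3) by simp
    then show ?thesis using S.not_above_child[OF coh_verts[OF yv] c] by blast
  qed
qed

text \<open>The vertex at which the branches of \<open>x\<close> and \<open>y\<close> separate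
  cannot be a component with several seams: these have distinct siblings as images, and the common
  image of \<open>x\<close> and \<open>y\<close> would lie below two of them.\<close>

lemma left_of_same_coh:
  assumes "left_of (bub P) x y" "coh P x = coh P y"
  obtains \<beta> i j where "\<beta> \<in> Vseam P" "i < j" "j < length (inb P \<beta>)"
    "below (bub P) x (inb P \<beta> ! i)" "below (bub P) y (inb P \<beta> ! j)"
proof -
  obtain v i j where v: "v \<in> verts (bub P)" "i < j" "j < length (inb P v)"
    "below (bub P) x (inb P v ! i)" "below (bub P) y (inb P v ! j)"
    using assms(1) unfolding left_of_def by blast
  have "v \<notin> Vmark P" using mark_leaf[of v] v(3) by auto
  moreover have "v \<notin> Vcomp P"
  proof
    assume vc: "v \<in> Vcomp P"
    then show False
    proof (cases rule: comp_cases)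
      case (one \<beta>)
      then show False using v(2,3) by simp
    next
      case two
      have len: "length (ins P (coh P v)) = length (inb P v)" using two(2) by (metis length_map)
      have nth: "ins P (coh P v) ! k = coh P (inb P v ! k)" if "k < length (inb P v)" for k
        using two(2) that by (metis nth_map)
      have cv: "coh P v \<in> verts (stree P)" using coh_verts v(1) by blast
      have "below (stree P) (coh P x) (ins P (coh P v) ! i)" "below (stree P) (coh P x) (ins P (coh P v) ! j)"
        using coh_mono[OF v(4)] coh_mono[OF v(5)] assms(2) nth v(2,3) by simp_all
      then have "ins P (coh P v) ! i = ins P (coh P v) ! j"
        using S.siblings_disjoint[OF cv] len v(2,3) by simp
      then show False using S.dist[OF cv] len v(2,3) by (simp add: nth_eq_iff_index_eq)
    qed
  qed
  ultimately have "v \<in> Vseam P" using v(1) verts_bub by blast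
  then show thesis using that v by blast
qed

lemma tb_ltI:
  "x \<in> nodes P \<Longrightarrow> y \<in> nodes P \<Longrightarrow> coh P x = coh P y \<Longrightarrow> left_of (bub P) x y \<Longrightarrow>
    (brk P x, brk P y) \<in> tb_lt (brackets P)"
  unfolding brackets_def by auto

lemma tb_ltE:
  assumes "(X, Y) \<in> tb_lt (brackets P)"
  obtains x y where "X = brk P x" "Y = brk P y" "x \<in> nodes P" "y \<in> nodes P" "coh P x = coh P y"
    "left_of (bub P) x y"
  using assms unfolding brackets_def by auto

lemma tb_lt_iff:
  "x \<in> nodes P \<Longrightarrow> y \<in> nodes P \<Longrightarrow>
    (brk P x, brk P y) \<in> tb_lt (brackets P) \<longleftrightarrow> coh P x = coh P y \<and> left_of (bub P) x y"
  using tb_ltI tb_ltE brk_inj by metis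

lemma over_brackets:
  assumes "X \<in> over (brk P ` nodes P) B"
  obtains x where "x \<in> nodes P" "X = brk P x" "K (coh P x) = B"
proof -
  have "X \<in> brk P ` nodes P" "fst X = B" using assms by (simp_all add: over_def)
  then obtain x where "x \<in> nodes P" "X = brk P x" by blast
  then show thesis using that[of x] \<open>fst X = B\<close> by simp
qed

lemma coh_node: "x \<in> nodes P \<Longrightarrow> coh P x \<in> verts (stree P)"
  using coh_verts node_verts by blast

lemma same_base: "x \<in> nodes P \<Longrightarrow> y \<in> nodes P \<Longrightarrow> K (coh P x) = K (coh P y) \<Longrightarrow> coh P x = coh P y"
  using K_inj coh_node by blast

theorem brackets_bracketing: "is_two_bracketing r n (brackets P)"
  unfolding is_two_bracketing_def Let_def brackets_simps
proof (intro conjI)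
  show "one_bracketing r (K ` verts (stree P))"
    unfolding one_bracketing_def
  proof (intro conjI ballI impI)
    fix B assume "B \<in> K ` verts (stree P)"
    then show "one_bracket r B"
      using K_ne K_sub KL.l_consecutive[OF K_rt] by (auto simp: one_bracket_def)
  next
    show "{1..r} \<in> K ` verts (stree P)" using K_rt S.rt_in by (metis image_eqI)
  next
    fix i assume "i \<in> {1..r}"
    then obtain x where "x \<in> leaves (stree P)" "K x = {i}"
      using KL.l_mark_below[OF S.rt_in, of i] K_rt by blast
    then show "{i} \<in> K ` verts (stree P)" by (auto simp: leaves_def image_iff)
  next
    fix B B' assume h: "B \<in> K ` verts (stree P)" "B' \<in> K ` verts (stree P)" "B \<inter> B' \<noteq> {}"
    then show "B \<subseteq> B' \<or> B' \<subseteq> B" using KL.l_meet KL.l_mono by blast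
  qed
  show "\<forall>X\<in>brk P ` nodes P. is_two_bracket r n X"
  proof
    fix X assume "X \<in> brk P ` nodes P"
    then obtain x where x: "x \<in> nodes P" "X = brk P x" by blast
    have xv: "x \<in> verts (bub P)" using node_verts x(1) by blast
    have s: "coh P x \<in> verts (stree P)" using coh_verts xv by blast
    have "one_bracket r (K (coh P x))"
      using K_ne[OF s] K_sub[OF s] KL.l_consecutive[OF K_rt s] by (simp add: one_bracket_def)
    moreover have "Q x i \<subseteq> {1..n i}" for i using Q_range[OF xv] by blast
    moreover have "\<exists>i\<in>K (coh P x). Q x i \<noteq> {}" using node_ne[OF x(1)] Q_supp[OF xv] by blast
    moreover have "\<forall>i. i \<notin> K (coh P x) \<longrightarrow> Q x i = {}" using Q_supp[OF xv] by blast
    ultimately show "is_two_bracket r n X"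
      unfolding is_two_bracket_def x(2) brk_simps using Q_consecutive[OF xv] by blast
  qed
  show "\<forall>X\<in>brk P ` nodes P. fst X \<in> K ` verts (stree P)"
    using coh_node by auto
  show "\<forall>X\<in>brk P ` nodes P. \<forall>X'\<in>brk P ` nodes P.
      (\<exists>i\<in>fst X \<inter> fst X'. snd X i \<inter> snd X' i \<noteq> {}) \<longrightarrow> tb_subset X X' \<or> tb_subset X' X"
  proof (intro ballI impI)
    fix X X' assume h: "X \<in> brk P ` nodes P" "X' \<in> brk P ` nodes P"
      "\<exists>i\<in>fst X \<inter> fst X'. snd X i \<inter> snd X' i \<noteq> {}"
    obtain x x' where x: "x \<in> nodes P" "X = brk P x" "x' \<in> nodes P" "X' = brk P x'" using h(1,2) by blast
    obtain i where "snd X i \<inter> snd X' i \<noteq> {}" using h(3) by blast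
    then have i: "Q x i \<inter> Q x' i \<noteq> {}" using x by simp
    show "tb_subset X X' \<or> tb_subset X' X"
      unfolding x(2,4) using Q_meet[OF node_verts[OF x(1)] node_verts[OF x(3)] i] brk_mono by blast
  qed
  show "full_bracket r n \<in> brk P ` nodes P" using brk_rt rt_node by (metis image_eqI)
  show "\<forall>i\<in>{1..r}. \<forall>j\<in>{1..n i}. point_bracket i j \<in> brk P ` nodes P"
  proof (intro ballI)
    fix i j assume "i \<in> {1..r}" "j \<in> {1..n i}"
    then obtain \<mu> where "\<mu> \<in> Vmark P" "brk P \<mu> = point_bracket i j" by (rule point_mark)
    then show "point_bracket i j \<in> brk P ` nodes P" by (metis UnI2 image_eqI)
  qed
  show "\<forall>B\<in>K ` verts (stree P). \<forall>i\<in>B. (\<Union>X\<in>over (brk P ` nodes P) B. snd X i) = {1..n i}"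
  proof (intro ballI set_eqI iffI)
    fix B i j assume h: "B \<in> K ` verts (stree P)" "i \<in> B" "j \<in> (\<Union>X\<in>over (brk P ` nodes P) B. snd X i)"
    then obtain x where "x \<in> nodes P" "j \<in> Q x i" by (auto simp: over_def)
    then show "j \<in> {1..n i}" using Q_range node_verts by blast
  next
    fix B i j assume h: "B \<in> K ` verts (stree P)" "i \<in> B" "j \<in> {1..n i}"
    then obtain s where "s \<in> verts (stree P)" "B = K s" by blast
    then obtain x where x: "x \<in> nodes P" "coh P x = s" "j \<in> Q x i" using node_cover h by blast
    have "brk P x \<in> over (brk P ` nodes P) B" using x(1,2) \<open>B = K s\<close> by (simp add: over_def)
    moreover have "j \<in> snd (brk P x) i" using x(3) by simp
    ultimately show "j \<in> (\<Union>X\<in>over (brk P ` nodes P) B. snd X i)" by blast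
  qed
  show "\<forall>B\<in>K ` verts (stree P). \<forall>X\<in>over (brk P ` nodes P) B.
      (\<exists>X'\<in>over (brk P ` nodes P) B. tb_psubset X' X) \<longrightarrow>
      (\<forall>i\<in>B. \<forall>j\<in>snd X i. \<exists>X''\<in>over (brk P ` nodes P) B. tb_psubset X'' X \<and> j \<in> snd X'' i)"
  proof (intro ballI impI)
    fix B X i j
    assume X: "X \<in> over (brk P ` nodes P) B" and X': "\<exists>X'\<in>over (brk P ` nodes P) B. tb_psubset X' X"
      and j: "j \<in> snd X i"
    obtain y where y: "y \<in> nodes P" "X = brk P y" "K (coh P y) = B" using X by (rule over_brackets)
    obtain X'' where X'': "X'' \<in> over (brk P ` nodes P) B" "tb_psubset X'' X" using X' by blast
    obtain x where x: "x \<in> nodes P" "X'' = brk P x" "K (coh P x) = B" using X''(1) by (rule over_brackets)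
    have "coh P x = coh P y" using same_base x y by simp
    moreover have "below (bub P) x y" using brk_below x y X''(2) by (simp add: tb_psubset_def)
    moreover have "x \<noteq> y" using X''(2) x y by (auto simp: tb_psubset_def)
    moreover have "j \<in> Q y i" using j y by simp
    ultimately obtain z where z: "z \<in> nodes P" "coh P z = coh P y" "below (bub P) z y" "z \<noteq> y" "j \<in> Q z i"
      using node_subcover[OF x(1) y(1)] by blast
    have "brk P z \<in> over (brk P ` nodes P) B" using z y by (simp add: over_def)
    moreover have "tb_psubset (brk P z) X"
      using brk_mono[OF z(3)] brk_inj[OF z(1) y(1)] z(4) y(2) by (auto simp: tb_psubset_def)
    ultimately show "\<exists>X''\<in>over (brk P ` nodes P) B. tb_psubset X'' X \<and> j \<in> snd X'' i"
      using z(5) by (intro bexI[of _ "brk P z"]) simp_all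
  qed
  show "tb_lt (brackets P) \<subseteq> (\<Union>B\<in>K ` verts (stree P). over (brk P ` nodes P) B \<times> over (brk P ` nodes P) B)"
  proof
    fix e assume e: "e \<in> tb_lt (brackets P)"
    obtain X Y where XY: "e = (X, Y)" by (cases e)
    obtain x y where x: "X = brk P x" "Y = brk P y" "x \<in> nodes P" "y \<in> nodes P" "coh P x = coh P y"
      using tb_ltE e XY by metis
    have "brk P x \<in> over (brk P ` nodes P) (K (coh P x))" "brk P y \<in> over (brk P ` nodes P) (K (coh P x))"
      using x by (simp_all add: over_def)
    then show "e \<in> (\<Union>B\<in>K ` verts (stree P). over (brk P ` nodes P) B \<times> over (brk P ` nodes P) B)"
      unfolding XY x(1,2) using coh_node[OF x(3)] by blast
  qed
  show "irrefl (tb_lt (brackets P))"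
  proof (rule irreflI)
    fix X show "(X, X) \<notin> tb_lt (brackets P)"
      using tb_ltE brk_inj B.left_of_irrefl by metis
  qed
  show "trans (tb_lt (brackets P))"
  proof (rule transI)
    fix X Y W assume h: "(X, Y) \<in> tb_lt (brackets P)" "(Y, W) \<in> tb_lt (brackets P)"
    obtain x y where x: "X = brk P x" "Y = brk P y" "x \<in> nodes P" "y \<in> nodes P" "coh P x = coh P y"
      "left_of (bub P) x y" using h(1) by (rule tb_ltE)
    obtain y' w where w: "Y = brk P y'" "W = brk P w" "y' \<in> nodes P" "w \<in> nodes P" "coh P y' = coh P w"
      "left_of (bub P) y' w" using h(2) by (rule tb_ltE)
    have "y = y'" using brk_inj x w by metis
    then show "(X, W) \<in> tb_lt (brackets P)" using tb_ltI x w B.left_of_trans by metis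
  qed
  show "\<forall>B\<in>K ` verts (stree P). \<forall>X\<in>over (brk P ` nodes P) B. \<forall>X'\<in>over (brk P ` nodes P) B.
      ((X, X') \<in> tb_lt (brackets P) \<or> (X', X) \<in> tb_lt (brackets P)) = (\<forall>i\<in>B. snd X i \<inter> snd X' i = {})"
  proof (intro ballI)
    fix B X X' assume h: "X \<in> over (brk P ` nodes P) B" "X' \<in> over (brk P ` nodes P) B"
    obtain x where x: "x \<in> nodes P" "X = brk P x" "K (coh P x) = B" using h(1) by (rule over_brackets)
    obtain y where y: "y \<in> nodes P" "X' = brk P y" "K (coh P y) = B" using h(2) by (rule over_brackets)
    have "coh P x = coh P y" using same_base x y by simp
    then show "((X, X') \<in> tb_lt (brackets P) \<or> (X', X) \<in> tb_lt (brackets P)) = (\<forall>i\<in>B. snd X i \<inter> snd X' i = {})"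
      using tb_lt_iff[OF x(1) y(1)] tb_lt_iff[OF y(1) x(1)] nodes_disjoint[OF x(1) y(1)] x y by simp
  qed
  show "\<forall>i\<in>{1..r}. \<forall>j\<in>{1..n i}. \<forall>j'\<in>{1..n i}.
      j < j' \<longrightarrow> (point_bracket i j, point_bracket i j') \<in> tb_lt (brackets P)"
  proof (intro ballI impI)
    fix i j j' assume h: "i \<in> {1..r}" "j \<in> {1..n i}" "j' \<in> {1..n i}" "j < j'"
    obtain \<mu> where m: "\<mu> \<in> Vmark P" "brk P \<mu> = point_bracket i j" "Q \<mu> i = {j}" using h(1,2) by (rule point_mark)
    obtain \<nu> where v: "\<nu> \<in> Vmark P" "brk P \<nu> = point_bracket i j'" "Q \<nu> i = {j'}" using h(1,3) by (rule point_mark)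
    have "K (coh P \<mu>) = {i}" "K (coh P \<nu>) = {i}" using Q_mark m v by blast+
    then have c: "coh P \<mu> = coh P \<nu>" using same_base[of \<mu> \<nu>] m(1) v(1) by simp
    have "\<mu> \<noteq> \<nu>" using m(3) v(3) h(4) by auto
    then have "left_of (bub P) \<mu> \<nu> \<or> left_of (bub P) \<nu> \<mu>" using B.leaves_total m(1) v(1) marks_leaves by blast
    moreover have "\<not> left_of (bub P) \<nu> \<mu>" using Q_left_of[of \<nu> \<mu> i] m(3) v(3) h(4) by (auto simp: slt_def)
    ultimately have "left_of (bub P) \<mu> \<nu>" by blast
    then show "(point_bracket i j, point_bracket i j') \<in> tb_lt (brackets P)"
      using tb_ltI[of \<mu> \<nu>] m(1,2) v(1,2) c by simp
  qed
  show "\<forall>B\<in>K ` verts (stree P). \<forall>B'\<in>K ` verts (stree P).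
      \<forall>X1\<in>over (brk P ` nodes P) B. \<forall>X2\<in>over (brk P ` nodes P) B.
      \<forall>Y1\<in>over (brk P ` nodes P) B'. \<forall>Y2\<in>over (brk P ` nodes P) B'.
        tb_subset Y1 X1 \<and> tb_subset Y2 X2 \<and> (X1, X2) \<in> tb_lt (brackets P) \<longrightarrow> (Y1, Y2) \<in> tb_lt (brackets P)"
  proof (intro ballI impI)
    fix B B' X1 X2 Y1 Y2
    assume X1: "X1 \<in> over (brk P ` nodes P) B" and X2: "X2 \<in> over (brk P ` nodes P) B"
      and Y1: "Y1 \<in> over (brk P ` nodes P) B'" and Y2: "Y2 \<in> over (brk P ` nodes P) B'"
      and h: "tb_subset Y1 X1 \<and> tb_subset Y2 X2 \<and> (X1, X2) \<in> tb_lt (brackets P)"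
    obtain x1 where x1: "x1 \<in> nodes P" "X1 = brk P x1" using X1 by (rule over_brackets)
    obtain x2 where x2: "x2 \<in> nodes P" "X2 = brk P x2" using X2 by (rule over_brackets)
    obtain y1 where y1: "y1 \<in> nodes P" "Y1 = brk P y1" "K (coh P y1) = B'" using Y1 by (rule over_brackets)
    obtain y2 where y2: "y2 \<in> nodes P" "Y2 = brk P y2" "K (coh P y2) = B'" using Y2 by (rule over_brackets)
    have "left_of (bub P) x1 x2" using h x1 x2 tb_lt_iff by blast
    moreover have "below (bub P) y1 x1" "below (bub P) y2 x2" using brk_below h x1 x2 y1 y2 by blast+
    ultimately have "left_of (bub P) y1 y2" using B.left_of_mono by blast
    moreover have "coh P y1 = coh P y2" using same_base y1 y2 by simp
    ultimately show "(Y1, Y2) \<in> tb_lt (brackets P)" using tb_ltI y1 y2 by blast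
  qed
qed

sublocale br: bracketing r n "brackets P" by standard (rule brackets_bracketing)

text \<open>Two comparable 2-brackets lie below siblings of a common seam, and condition (5) passes the order of
  the siblings on to them.\<close>

lemma tb_lt_local:
  assumes "is_two_bracketing r n Z" "twos (brackets P) \<subseteq> twos Z"
    and s: "\<And>\<beta>. \<beta> \<in> Vseam P \<Longrightarrow> sorted_wrt (\<lambda>x y. (brk P x, brk P y) \<in> tb_lt Z) (inb P \<beta>)"
  shows "tb_lt (brackets P) \<subseteq> tb_lt Z"
proof
  interpret Z: bracketing r n Z by standard (rule assms(1))
  fix e assume e: "e \<in> tb_lt (brackets P)"
  obtain X Y where XY: "e = (X, Y)" by (cases e)
  obtain x y where x: "X = brk P x" "Y = brk P y" "x \<in> nodes P" "y \<in> nodes P" "coh P x = coh P y"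
    "left_of (bub P) x y" using e unfolding XY by (rule tb_ltE)
  obtain \<beta> i j where b: "\<beta> \<in> Vseam P" "i < j" "j < length (inb P \<beta>)"
    "below (bub P) x (inb P \<beta> ! i)" "below (bub P) y (inb P \<beta> ! j)"
    using x(6,5) by (rule left_of_same_coh)
  have R: "(brk P (inb P \<beta> ! i), brk P (inb P \<beta> ! j)) \<in> tb_lt Z"
    using s[OF b(1)] b(2,3) by (simp add: sorted_wrt_iff_nth_less)
  have "X \<in> twos Z" "Y \<in> twos Z" using assms(2) x by auto
  then show "e \<in> tb_lt Z"
    using Z.R_inherit[OF R] brk_mono[OF b(4)] brk_mono[OF b(5)] x XY by simp
qed

end

text \<open>Whether two 2-brackets are comparable depends on the brackets alone. A pair related in
  the larger order is therefore already comparable in the smaller one, and asymmetry fixes the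
  direction. So inclusion of the orders implies that one is the restriction of the other.\<close>

lemma order_restrict:
  assumes "is_two_bracketing r n Z" "is_two_bracketing r n Z'" "twos Z \<subseteq> twos Z'" "tb_lt Z \<subseteq> tb_lt Z'"
  shows "tb_lt Z = tb_lt Z' \<inter> (twos Z \<times> twos Z)"
proof
  interpret Z: bracketing r n Z by standard (rule assms(1))
  interpret Z': bracketing r n Z' by standard (rule assms(2))
  show "tb_lt Z \<subseteq> tb_lt Z' \<inter> (twos Z \<times> twos Z)" using assms(4) Z.R_base by auto
  show "tb_lt Z' \<inter> (twos Z \<times> twos Z) \<subseteq> tb_lt Z"
  proof
    fix e assume e: "e \<in> tb_lt Z' \<inter> (twos Z \<times> twos Z)"
    obtain X Y where XY: "e = (X, Y)" by (cases e)
    have h: "(X, Y) \<in> tb_lt Z'" "X \<in> twos Z" "Y \<in> twos Z" using e XY by auto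
    have b: "fst X = fst Y" using Z'.R_base[OF h(1)] by blast
    then have "\<forall>i\<in>fst X. snd X i \<inter> snd Y i = {}" using Z'.R_iff[of X Y] h assms(3) by blast
    then have "(X, Y) \<in> tb_lt Z \<or> (Y, X) \<in> tb_lt Z" using Z.R_iff[OF h(2,3) b] by blast
    then show "e \<in> tb_lt Z" using XY Z'.R_asym[OF h(1)] assms(4) by blast
  qed
qed

lemma W_br_leI:
  assumes "is_two_bracketing r n Z" "is_two_bracketing r n Z'" "ones Z \<subseteq> ones Z'" "twos Z \<subseteq> twos Z'"
    "tb_lt Z \<subseteq> tb_lt Z'"
  shows "(Z', Z) \<in> W_br_le r n"
proof (cases "ones Z = ones Z' \<and> twos Z = twos Z'")
  case True
  have "tb_lt Z = tb_lt Z'"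
  proof -
    interpret Z': bracketing r n Z' by standard (rule assms(2))
    have "tb_lt Z' \<subseteq> twos Z \<times> twos Z" using Z'.R_base True by auto
    then show ?thesis using order_restrict[OF assms(1,2,4,5)] by blast
  qed
  then have "Z = Z'" using True by simp
  then show ?thesis using assms(1) by (auto simp: W_br_le_def W_br_def)
next
  case False
  then show ?thesis
    using assms order_restrict[OF assms(1,2,4,5)] unfolding W_br_le_def W_br_less_def W_br_def by blast
qed

lemma W_br_leD:
  assumes "(Z', Z) \<in> W_br_le r n"
  shows "is_two_bracketing r n Z" "is_two_bracketing r n Z'" "ones Z \<subseteq> ones Z'" "twos Z \<subseteq> twos Z'"
    "tb_lt Z \<subseteq> tb_lt Z'"
  using assms unfolding W_br_le_def W_br_less_def W_br_def by blast+

lemma W_br_partial_order: "partial_order_on (W_br r n) (W_br_le r n)"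
  unfolding partial_order_on_def preorder_on_def
proof (intro conjI)
  show "W_br_le r n \<subseteq> W_br r n \<times> W_br r n"
    unfolding W_br_le_def W_br_less_def by blast
  show "refl_on (W_br r n) (W_br_le r n)"
    unfolding refl_on_def W_br_le_def by blast
  show "trans (W_br_le r n)"
  proof (rule transI)
    fix X Y W assume "(X, Y) \<in> W_br_le r n" "(Y, W) \<in> W_br_le r n"
    note h = W_br_leD[OF this(1)] W_br_leD[OF this(2)]
    show "(X, W) \<in> W_br_le r n" by (rule W_br_leI) (use h in blast)+
  qed
  show "antisym (W_br_le r n)"
  proof (rule antisymI)
    fix X Y assume "(X, Y) \<in> W_br_le r n" "(Y, X) \<in> W_br_le r n"
    note h = W_br_leD[OF this(1)] W_br_leD[OF this(2)]
    have "ones X = ones Y" "twos X = twos Y" "tb_lt X = tb_lt Y" using h by blast+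
    then show "X = Y" by simp
  qed
qed


section \<open>Tree-pairs are isomorphic iff they have the same 2-bracketing\<close>

text \<open>Starting with the roots, equal keys are propagated from parents to lists of children, in
  both trees. Hence every key of one tree occurs in the other, and by injectivity equality of keys
  is a bijection.\<close>

lemma rrt_iso_of_keys:
  assumes "is_rrt T" "is_rrt T'" "inj_on key (verts T)" "inj_on key' (verts T')"
    and root: "key (rt T) = key' (rt T')"
    and step: "\<And>v v'. v \<in> verts T \<Longrightarrow> v' \<in> verts T' \<Longrightarrow> key v = key' v' \<Longrightarrow>
      map key (inc T v) = map key' (inc T' v')"
  obtains \<phi> where "rrt_iso \<phi> T T'" "\<And>v. v \<in> verts T \<Longrightarrow> key' (\<phi> v) = key v"
proof -
  interpret T: ribbon_tree T by standard (rule assms(1))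
  interpret T': ribbon_tree T' by standard (rule assms(2))
  have sub: "\<exists>v'\<in>verts T'. key' v' = key v" if "v \<in> verts T" for v
    using that
  proof (induction rule: T.top_down)
    case root
    then show ?case using assms(5) T'.rt_in by metis
  next
    case (step v c)
    obtain v' where v': "v' \<in> verts T'" "key' v' = key v" using step.IH by blast
    have "key c \<in> set (map key (inc T v))" using step.hyps(2) by simp
    then have "key c \<in> set (map key' (inc T' v'))" using assms(6)[OF step.hyps(1) v'(1)] v'(2) by simp
    then obtain c' where "c' \<in> set (inc T' v')" "key c = key' c'" by auto
    then show ?case using T'.child_in[OF v'(1)] by metis
  qed
  have sup: "\<exists>v\<in>verts T. key v = key' v'" if "v' \<in> verts T'" for v'
    using that
  proof (induction rule: T'.top_down)
    case root
    then show ?case using assms(5) T.rt_in by metis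
  next
    case (step v' c')
    obtain v where v: "v \<in> verts T" "key v = key' v'" using step.IH by blast
    have "key' c' \<in> set (map key' (inc T' v'))" using step.hyps(2) by simp
    then have "key' c' \<in> set (map key (inc T v))" using assms(6)[OF v(1) step.hyps(1)] v(2) by simp
    then obtain c where "c \<in> set (inc T v)" "key' c' = key c" by auto
    then show ?case using T.child_in[OF v(1)] by metis
  qed
  define \<phi> where "\<phi> v = inv_into (verts T') key' (key v)" for v
  have p: "\<phi> v \<in> verts T'" "key' (\<phi> v) = key v" if "v \<in> verts T" for v
  proof -
    have "key v \<in> key' ` verts T'" using sub[OF that] by (metis image_eqI)
    then show "\<phi> v \<in> verts T'" "key' (\<phi> v) = key v"
      unfolding \<phi>_def by (rule inv_into_into, rule f_inv_into_f)
  qed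
  have eqI: "\<phi> v = v'" if "v \<in> verts T" "v' \<in> verts T'" "key v = key' v'" for v v'
    using inj_onD[OF assms(4), of "\<phi> v" v'] p[OF that(1)] that by simp
  have "bij_betw \<phi> (verts T) (verts T')"
    unfolding bij_betw_def
  proof
    show "inj_on \<phi> (verts T)"
    proof (rule inj_onI)
      fix x y assume h: "x \<in> verts T" "y \<in> verts T" "\<phi> x = \<phi> y"
      then have "key x = key y" using p(2) by metis
      then show "x = y" using inj_onD[OF assms(3)] h by blast
    qed
    show "\<phi> ` verts T = verts T'"
    proof
      show "verts T' \<subseteq> \<phi> ` verts T" using sup eqI by (metis image_eqI subsetI)
    qed (use p in blast)
  qed
  moreover have "\<phi> (rt T) = rt T'" using eqI root by simp
  moreover have "inc T' (\<phi> v) = map \<phi> (inc T v)" if v: "v \<in> verts T" for v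
  proof -
    have m: "map key (inc T v) = map key' (inc T' (\<phi> v))" using step[OF v p(1)[OF v]] p(2)[OF v] by simp
    then have len: "length (inc T v) = length (inc T' (\<phi> v))" by (metis length_map)
    show ?thesis
    proof (rule nth_equalityI)
      fix i assume i: "i < length (inc T' (\<phi> v))"
      have "key (inc T v ! i) = key' (inc T' (\<phi> v) ! i)" using m i len by (metis nth_map)
      then have "\<phi> (inc T v ! i) = inc T' (\<phi> v) ! i"
        using eqI T.nth_in[OF v] T'.nth_in[OF p(1)[OF v]] i len by simp
      then show "inc T' (\<phi> v) ! i = map \<phi> (inc T v) ! i" using i len by simp
    qed (use len in simp)
  qed
  ultimately show thesis using that[of \<phi>] p by (auto simp: rrt_iso_def)
qed

text \<open>A seam is determined by the 2-bracket of its parent together with the 1-bracket below it.\<close>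

definition seam_parent_of :: "('v, 'w) tree_pair \<Rightarrow> 'v \<Rightarrow> 'v" where
  "seam_parent_of P \<beta> = (SOME \<alpha>. \<alpha> \<in> Vcomp P \<and> \<beta> \<in> set (inb P \<alpha>))"

text \<open>The labels of a seam itself would not identify it: a seam without children has empty
  mark labels, and the only seam of a component has the same labels as the component.\<close>

definition bub_key :: "('v, 'w) tree_pair \<Rightarrow> 'v \<Rightarrow> two_bracket \<times> nat set option" where
  "bub_key P v = (if v \<in> Vseam P then (brk P (seam_parent_of P v), Some (seam_label P (coh P v)))
     else (brk P v, None))"

section \<open>Reading off types and children from the 2-bracketing\<close>

context stable_pair
begin

lemma coh_inj_children:
  assumes "\<alpha> \<in> Vcomp P" "\<beta> \<in> set (inb P \<alpha>)" "\<beta>' \<in> set (inb P \<alpha>)" "coh P \<beta> = coh P \<beta>'"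
  shows "\<beta> = \<beta>'"
  using assms(1)
proof (cases rule: comp_cases)
  case (one b)
  then show ?thesis using assms(2,3) by simp
next
  case two
  have "coh P \<alpha> \<in> verts (stree P)" using coh_verts type_verts assms(1) by blast
  then have "distinct (map (coh P) (inb P \<alpha>))" using S.dist two(2) by simp
  then show ?thesis using assms(2-4) by (auto simp: distinct_map dest: inj_onD)
qed

lemma seam_parent_of:
  assumes "\<alpha> \<in> Vcomp P" "\<beta> \<in> set (inb P \<alpha>)"
  shows "seam_parent_of P \<beta> = \<alpha>"
  unfolding seam_parent_of_def
proof (rule some_equality)
  fix \<alpha>' assume "\<alpha>' \<in> Vcomp P \<and> \<beta> \<in> set (inb P \<alpha>')"
  then show "\<alpha>' = \<alpha>" using B.parent_unique[of \<alpha>' \<alpha> \<beta>] type_verts assms by blast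
qed (use assms in simp)

lemma bub_key_seam: "\<alpha> \<in> Vcomp P \<Longrightarrow> \<beta> \<in> set (inb P \<alpha>) \<Longrightarrow> bub_key P \<beta> = (brk P \<alpha>, Some (K (coh P \<beta>)))"
  using seam_parent_of comp_children by (simp add: bub_key_def)

lemma bub_key_node: "v \<in> nodes P \<Longrightarrow> bub_key P v = (brk P v, None)"
  using disj by (auto simp: bub_key_def)

lemma seam_or_node: "v \<in> verts (bub P) \<Longrightarrow> v \<in> Vseam P \<or> v \<in> nodes P"
  using verts_bub by blast

lemma bub_key_inj: "inj_on (bub_key P) (verts (bub P))"
proof (rule inj_onI)
  fix x y assume h: "x \<in> verts (bub P)" "y \<in> verts (bub P)" "bub_key P x = bub_key P y"
  have mixed: False if "u \<in> Vseam P" "w \<in> nodes P" "bub_key P u = bub_key P w" for u w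
    using that(3) bub_key_node[OF that(2)] that(1) by (simp add: bub_key_def)
  consider "x \<in> Vseam P" "y \<in> Vseam P" | "x \<in> nodes P" "y \<in> nodes P"
    using seam_or_node[OF h(1)] seam_or_node[OF h(2)] mixed[of x y] mixed[of y x] h(3) by fastforce
  then show "x = y"
  proof cases
    case 1
    obtain a where a: "a \<in> Vcomp P" "x \<in> set (inb P a)" using seam_parent 1(1) by blast
    obtain b where b: "b \<in> Vcomp P" "y \<in> set (inb P b)" using seam_parent 1(2) by blast
    have k: "brk P a = brk P b" "K (coh P x) = K (coh P y)"
      using h(3) bub_key_seam[OF a] bub_key_seam[OF b] by simp_all
    have "a = b" using brk_inj[of a b] a(1) b(1) k(1) by simp
    moreover have "coh P x = coh P y" using K_inj[OF coh_verts[OF h(1)] coh_verts[OF h(2)] k(2)] .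
    ultimately show ?thesis using coh_inj_children a b by blast
  next
    case 2
    then show ?thesis using bub_key_node h(3) brk_inj by simp
  qed
qed

lemma seam_sorted:
  assumes "\<beta> \<in> Vseam P"
  shows "sorted_wrt (\<lambda>x y. (brk P x, brk P y) \<in> tb_lt (brackets P)) (inb P \<beta>)"
  unfolding sorted_wrt_iff_nth_less
proof (intro allI impI)
  fix i j assume ij: "i < j" "j < length (inb P \<beta>)"
  have m: "inb P \<beta> ! i \<in> set (inb P \<beta>)" "inb P \<beta> ! j \<in> set (inb P \<beta>)" using ij by simp_all
  have "left_of (bub P) (inb P \<beta> ! i) (inb P \<beta> ! j)"
    by (rule B.left_of_child[OF type_verts(2)[OF assms] ij])
  moreover have "coh P (inb P \<beta> ! i) = coh P (inb P \<beta> ! j)"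
    using coh_seam[OF assms m(1)] coh_seam[OF assms m(2)] by simp
  ultimately show "(brk P (inb P \<beta> ! i), brk P (inb P \<beta> ! j)) \<in> tb_lt (brackets P)"
    using tb_ltI seam_children[OF assms m(1)] seam_children[OF assms m(2)] by blast
qed

lemma K_psubset: "below (stree P) s t \<Longrightarrow> s \<noteq> t \<Longrightarrow> K s \<subset> K t"
  using KL.l_mono K_strict by blast

text \<open>A 1-bracket between the label of a child and that of its parent would belong to a vertex
  between the two; conversely a smaller vertex that is maximal must equal the child above
  it.\<close>

lemma K_children_iff:
  assumes s: "s \<in> verts (stree P)"
  shows "B \<in> K ` set (ins P s) \<longleftrightarrow>
    B \<in> ones (brackets P) \<and> B \<subset> K s \<and> \<not> (\<exists>C\<in>ones (brackets P). B \<subset> C \<and> C \<subset> K s)"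
proof
  assume "B \<in> K ` set (ins P s)"
  then obtain c where c: "c \<in> set (ins P s)" "B = K c" by blast
  have cv: "c \<in> verts (stree P)" using S.child_in[OF s c(1)] .
  have "B \<subset> K s" unfolding c(2) using below_child[OF s c(1)] S.child_neq[OF s c(1)] by (rule K_psubset)
  moreover have "\<not> (\<exists>C\<in>ones (brackets P). B \<subset> C \<and> C \<subset> K s)"
  proof
    assume "\<exists>C\<in>ones (brackets P). B \<subset> C \<and> C \<subset> K s"
    then obtain t where t: "t \<in> verts (stree P)" "K c \<subset> K t" "K t \<subset> K s" using c(2) by auto
    have "below (stree P) c t" "c \<noteq> t" using K_below[OF cv t(1)] t(2) by auto
    then have "below (stree P) s t" using S.below_parent[OF c(1) s] by blast
    then show False using KL.l_mono t(3) by blast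
  qed
  ultimately show "B \<in> ones (brackets P) \<and> B \<subset> K s \<and> \<not> (\<exists>C\<in>ones (brackets P). B \<subset> C \<and> C \<subset> K s)"
    using c(2) cv by simp
next
  assume h: "B \<in> ones (brackets P) \<and> B \<subset> K s \<and> \<not> (\<exists>C\<in>ones (brackets P). B \<subset> C \<and> C \<subset> K s)"
  then obtain t where t: "t \<in> verts (stree P)" "B = K t" by auto
  then have "below (stree P) t s" "t \<noteq> s" using K_below[OF t(1) s] h by auto
  then obtain c where c: "c \<in> set (ins P s)" "below (stree P) t c" using S.below_cases by blast
  have "t = c"
  proof (rule ccontr)
    assume "t \<noteq> c"
    then have "B \<subset> K c" using K_psubset[OF c(2)] t(2) by blast
    moreover have "K c \<subset> K s" using below_child[OF s c(1)] S.child_neq[OF s c(1)] by (rule K_psubset)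
    moreover have "K c \<in> ones (brackets P)" using S.child_in[OF s c(1)] by simp
    ultimately show False using h by blast
  qed
  then show "B \<in> K ` set (ins P s)" using c(1) t(2) by blast
qed

lemma brk_psubset:
  assumes "x \<in> nodes P" "y \<in> nodes P"
  shows "tb_psubset (brk P x) (brk P y) \<longleftrightarrow> below (bub P) x y \<and> x \<noteq> y"
  using brk_below[OF assms] brk_mono brk_inj[OF assms] unfolding tb_psubset_def by blast

text \<open>Maximality is tested only among brackets over the image of \<open>\<beta>\<close>. A
  node below \<open>\<alpha>\<close> with that image lies below the seam \<open>\<beta>\<close>
  itself, since different seams of \<open>\<alpha>\<close> have different siblings as images; the
  greatest such nodes are the children of \<open>\<beta>\<close>.\<close>

lemma seam_children_iff:
  assumes "\<alpha> \<in> Vcomp P" "\<beta> \<in> set (inb P \<alpha>)"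
  shows "Y \<in> brk P ` set (inb P \<beta>) \<longleftrightarrow>
    Y \<in> twos (brackets P) \<and> fst Y = K (coh P \<beta>) \<and> tb_psubset Y (brk P \<alpha>) \<and>
    \<not> (\<exists>W\<in>twos (brackets P). fst W = K (coh P \<beta>) \<and> tb_psubset Y W \<and> tb_psubset W (brk P \<alpha>))"
proof
  have av: "\<alpha> \<in> verts (bub P)" using type_verts assms(1) by blast
  have bs: "\<beta> \<in> Vseam P" using comp_children assms by blast
  have bv: "\<beta> \<in> verts (bub P)" using type_verts bs by blast
  have an: "\<alpha> \<in> nodes P" using assms(1) by blast
  have gp: "tb_psubset (brk P \<gamma>) (brk P \<alpha>)" "\<gamma> \<in> nodes P" "coh P \<gamma> = coh P \<beta>"
    if g: "\<gamma> \<in> set (inb P \<beta>)" for \<gamma>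
  proof -
    show gn: "\<gamma> \<in> nodes P" using seam_children[OF bs g] .
    show "coh P \<gamma> = coh P \<beta>" using coh_seam[OF bs g] .
    have "below (bub P) \<gamma> \<alpha>" using below_child[OF bv g] below_child[OF av assms(2)] by (rule rtrancl_trans)
    moreover have "\<gamma> \<noteq> \<alpha>" using B.not_above_child[OF av assms(2)] below_child[OF bv g] by blast
    ultimately show "tb_psubset (brk P \<gamma>) (brk P \<alpha>)" using brk_psubset[OF gn an] by blast
  qed
  {
    assume "Y \<in> brk P ` set (inb P \<beta>)"
    then obtain \<gamma> where g: "\<gamma> \<in> set (inb P \<beta>)" "Y = brk P \<gamma>" by blast
    have "\<not> (\<exists>W\<in>twos (brackets P). fst W = K (coh P \<beta>) \<and> tb_psubset Y W \<and> tb_psubset W (brk P \<alpha>))"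
    proof
      assume "\<exists>W\<in>twos (brackets P). fst W = K (coh P \<beta>) \<and> tb_psubset Y W \<and> tb_psubset W (brk P \<alpha>)"
      then obtain W where W: "W \<in> brk P ` nodes P" "tb_psubset Y W" "tb_psubset W (brk P \<alpha>)"
        unfolding brackets_simps by blast
      then obtain w where w: "w \<in> nodes P" "W = brk P w" by blast
      have "below (bub P) \<gamma> w" "\<gamma> \<noteq> w" "below (bub P) w \<alpha>" "w \<noteq> \<alpha>"
        using W(2,3) g(2) w brk_psubset[OF gp(2)[OF g(1)] w(1)] brk_psubset[OF w(1) an] by auto
      moreover have "\<beta> \<noteq> w" using bs w(1) disj by blast
      ultimately have "below (bub P) \<alpha> w" using B.below_parent[OF g(1) bv] B.below_parent[OF assms(2) av] by blast
      then show False using B.below_antisym \<open>below (bub P) w \<alpha>\<close> \<open>w \<noteq> \<alpha>\<close> by blast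
    qed
    then show "Y \<in> twos (brackets P) \<and> fst Y = K (coh P \<beta>) \<and> tb_psubset Y (brk P \<alpha>) \<and>
        \<not> (\<exists>W\<in>twos (brackets P). fst W = K (coh P \<beta>) \<and> tb_psubset Y W \<and> tb_psubset W (brk P \<alpha>))"
      using gp[OF g(1)] g(2) by simp
  }
  assume h: "Y \<in> twos (brackets P) \<and> fst Y = K (coh P \<beta>) \<and> tb_psubset Y (brk P \<alpha>) \<and>
        \<not> (\<exists>W\<in>twos (brackets P). fst W = K (coh P \<beta>) \<and> tb_psubset Y W \<and> tb_psubset W (brk P \<alpha>))"
  then obtain y where y: "y \<in> nodes P" "Y = brk P y" unfolding brackets_simps by blast
  have yb: "below (bub P) y \<alpha>" "y \<noteq> \<alpha>" using h y brk_psubset[OF y(1) an] by auto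
  have cy: "coh P y = coh P \<beta>" using K_inj[OF coh_node[OF y(1)] coh_verts[OF bv]] h y(2) by simp
  obtain \<beta>' \<gamma> where bg: "\<beta>' \<in> set (inb P \<alpha>)" "\<gamma> \<in> set (inb P \<beta>')" "below (bub P) y \<gamma>"
    "\<beta>' \<in> Vseam P" "\<gamma> \<in> nodes P" by (rule below_comp[OF y(1) assms(1) yb])
  have "\<beta>' = \<beta>" using assms(1)
  proof (cases rule: comp_cases)
    case (one b)
    then show ?thesis using bg(1) assms(2) by simp
  next
    case two
    have "coh P \<beta>' \<in> set (ins P (coh P \<alpha>))" "coh P \<beta> \<in> set (ins P (coh P \<alpha>))"
      using bg(1) assms(2) two(2) by (metis image_eqI list.set_map)+
    moreover have "below (stree P) (coh P \<beta>) (coh P \<beta>')"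
      using coh_mono[OF bg(3)] coh_seam[OF bg(4,2)] cy by simp
    ultimately have "coh P \<beta> = coh P \<beta>'" using S.siblings_not_below[OF coh_verts[OF av]] by blast
    then show ?thesis using coh_inj_children[OF assms(1) bg(1) assms(2)] by simp
  qed
  then have g: "\<gamma> \<in> set (inb P \<beta>)" using bg(2) by simp
  have "y = \<gamma>"
  proof (rule ccontr)
    assume "y \<noteq> \<gamma>"
    then have "tb_psubset Y (brk P \<gamma>)" using brk_psubset[OF y(1) bg(5)] bg(3) y(2) by blast
    moreover have "brk P \<gamma> \<in> twos (brackets P)" using bg(5) by simp
    moreover have "fst (brk P \<gamma>) = K (coh P \<beta>)" using gp(3)[OF g] by simp
    ultimately show False using h gp(1)[OF g] by blast
  qed
  then show "Y \<in> brk P ` set (inb P \<beta>)" using g y(2) by blast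
qed

text \<open>Every point bracket is already taken by a mark, and different nodes have different
  brackets. So brackets distinguish components from marks.\<close>

lemma comp_not_point: "v \<in> Vcomp P \<Longrightarrow> brk P v \<noteq> point_bracket i j"
proof
  assume v: "v \<in> Vcomp P" "brk P v = point_bracket i j"
  have "Q v i = snd (point_bracket i j) i" using v(2) by (metis brk_simps(2))
  then have "j \<in> Q v i" by (simp add: point_bracket_def)
  then have "i \<in> {1..r} \<and> j \<in> {1..n i}" using Q_range type_verts v(1) by blast
  then obtain \<mu> where "\<mu> \<in> Vmark P" "brk P \<mu> = point_bracket i j" using point_mark by blast
  then have "v = \<mu>" using brk_inj[of v \<mu>] v by simp
  then show False using v(1) \<open>\<mu> \<in> Vmark P\<close> disj by blast
qed

text \<open>Below a component with several seams the image drops strictly, while the children of the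
  only seam of a component lie over the same vertex as the component. Hence the collection of
  brackets reveals which of the two kinds a component is.\<close>

lemma comp_one_iff:
  assumes "\<alpha> \<in> Vcomp P"
  shows "length (inb P \<alpha>) = 1 \<longleftrightarrow>
    (\<exists>Y\<in>twos (brackets P). fst Y = fst (brk P \<alpha>) \<and> tb_psubset Y (brk P \<alpha>))"
proof
  have an: "\<alpha> \<in> nodes P" using assms by blast
  have av: "\<alpha> \<in> verts (bub P)" using type_verts assms by blast
  {
    assume l: "length (inb P \<alpha>) = 1"
    show "\<exists>Y\<in>twos (brackets P). fst Y = fst (brk P \<alpha>) \<and> tb_psubset Y (brk P \<alpha>)"
      using assms
    proof (cases rule: comp_cases)
      case (one \<beta>)
      then obtain \<gamma> where "\<gamma> \<in> set (inb P \<beta>)" by (cases "inb P \<beta>") auto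
      then have g: "brk P \<gamma> \<in> brk P ` set (inb P \<beta>)" by blast
      have b: "\<beta> \<in> set (inb P \<alpha>)" using one(1) by simp
      note h = iffD1[OF seam_children_iff[OF assms b] g]
      show ?thesis
      proof (rule bexI[of _ "brk P \<gamma>"])
        show "brk P \<gamma> \<in> twos (brackets P)" using h by (rule conjunct1)
        show "fst (brk P \<gamma>) = fst (brk P \<alpha>) \<and> tb_psubset (brk P \<gamma>) (brk P \<alpha>)"
          using h[THEN conjunct2, THEN conjunct1] h[THEN conjunct2, THEN conjunct2, THEN conjunct1] one(3)
          by simp
      qed
    qed (use l in simp)
  }
  assume "\<exists>Y\<in>twos (brackets P). fst Y = fst (brk P \<alpha>) \<and> tb_psubset Y (brk P \<alpha>)"
  then obtain Y where Y: "Y \<in> brk P ` nodes P" "fst Y = fst (brk P \<alpha>)" "tb_psubset Y (brk P \<alpha>)"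
    unfolding brackets_simps by blast
  then obtain y where y: "y \<in> nodes P" "Y = brk P y" by blast
  have yb: "below (bub P) y \<alpha>" "y \<noteq> \<alpha>" using Y(3) y brk_psubset[OF y(1) an] by auto
  have cy: "coh P y = coh P \<alpha>" using same_base[OF y(1) an] Y(2) y(2) by simp
  obtain \<beta> \<gamma> where bg: "\<beta> \<in> set (inb P \<alpha>)" "\<gamma> \<in> set (inb P \<beta>)" "below (bub P) y \<gamma>"
    "\<beta> \<in> Vseam P" "\<gamma> \<in> nodes P" by (rule below_comp[OF y(1) assms yb])
  show "length (inb P \<alpha>) = 1" using assms
  proof (cases rule: comp_cases)
    case two
    have "coh P \<beta> \<in> set (ins P (coh P \<alpha>))" using bg(1) two(2) by (metis image_eqI list.set_map)
    moreover have "below (stree P) (coh P \<alpha>) (coh P \<beta>)"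
      using coh_mono[OF bg(3)] coh_seam[OF bg(4,2)] cy by simp
    ultimately show ?thesis using S.not_above_child[OF coh_verts[OF av]] by blast
  qed simp
qed

end

lemma K_children_eq:
  assumes "stable_pair r n P" "stable_pair r n P'" "brackets P = brackets P'"
    and "s \<in> verts (stree P)" "s' \<in> verts (stree P')" "seam_label P s = seam_label P' s'"
  shows "map (seam_label P) (ins P s) = map (seam_label P') (ins P' s')"
proof (rule sorted_wrt_unique)
  interpret P: stable_pair r n P by (rule assms(1))
  interpret P': stable_pair r n P' by (rule assms(2))
  show "sorted_wrt slt (map (seam_label P) (ins P s))"
    using P.KL.l_sorted[OF assms(4)] by (simp add: sorted_wrt_iff_nth_less)
  show "sorted_wrt slt (map (seam_label P') (ins P' s'))"
    using P'.KL.l_sorted[OF assms(5)] by (simp add: sorted_wrt_iff_nth_less)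
  show "set (map (seam_label P) (ins P s)) = set (map (seam_label P') (ins P' s'))"
    using P.K_children_iff[OF assms(4)] P'.K_children_iff[OF assms(5)] assms(3,6) by (simp add: set_eq_iff)
  fix A C assume "A \<in> set (map (seam_label P) (ins P s))" "C \<in> set (map (seam_label P) (ins P s))" "slt A C"
  then show "\<not> slt C A" using P.K_ne P.S.child_in[OF assms(4)] by (auto simp: slt_def) (metis all_not_in_conv less_asym)
qed

text \<open>The induction step for the reconstruction: the key of a vertex and the 2-bracketing
  determine its type, its image and the keys of its children. For a component the children come from
  the seam tree; for a seam they are maximal brackets, listed in the order of the
  2-bracketing.\<close>

lemma bub_key_step:
  assumes "stable_pair r n P" "stable_pair r n P'" "brackets P = brackets P'"
    and v: "v \<in> verts (bub P)" "v' \<in> verts (bub P')" "bub_key P v = bub_key P' v'"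
  shows "map (bub_key P) (inb P v) = map (bub_key P') (inb P' v')"
    and "v \<in> Vcomp P \<longleftrightarrow> v' \<in> Vcomp P'" "v \<in> Vseam P \<longleftrightarrow> v' \<in> Vseam P'" "v \<in> Vmark P \<longleftrightarrow> v' \<in> Vmark P'"
    and "seam_label P (coh P v) = seam_label P' (coh P' v')"
proof -
  interpret P: stable_pair r n P by (rule assms(1))
  interpret P': stable_pair r n P' by (rule assms(2))
  show se: "v \<in> Vseam P \<longleftrightarrow> v' \<in> Vseam P'"
    using v(3) by (simp add: bub_key_def split: if_splits)
  have c: "v \<in> Vcomp P \<longleftrightarrow> v' \<in> Vcomp P'" if "v \<notin> Vseam P"
  proof -
    have n: "v \<in> nodes P" "v' \<in> nodes P'" using P.seam_or_node[OF v(1)] P'.seam_or_node[OF v(2)] that se by blast+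
    have b: "brk P v = brk P' v'" using v(3) P.bub_key_node[OF n(1)] P'.bub_key_node[OF n(2)] by simp
    show ?thesis
    proof
      assume a: "v \<in> Vcomp P"
      have "v' \<notin> Vmark P'"
      proof
        assume "v' \<in> Vmark P'"
        then obtain i j where "brk P' v' = point_bracket i j" using P'.mark_point by blast
        then show False using P.comp_not_point[OF a, of i j] b by simp
      qed
      then show "v' \<in> Vcomp P'" using n by blast
    next
      assume a: "v' \<in> Vcomp P'"
      have "v \<notin> Vmark P"
      proof
        assume "v \<in> Vmark P"
        then obtain i j where "brk P v = point_bracket i j" using P.mark_point by blast
        then show False using P'.comp_not_point[OF a, of i j] b by simp
      qed
      then show "v \<in> Vcomp P" using n by blast
    qed
  qed
  show co: "v \<in> Vcomp P \<longleftrightarrow> v' \<in> Vcomp P'"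
  proof (cases "v \<in> Vseam P")
    case True
    then have "v' \<in> Vseam P'" using se by simp
    then show ?thesis using True P.disj(1) P'.disj(1) by blast
  qed (rule c)
  show "v \<in> Vmark P \<longleftrightarrow> v' \<in> Vmark P'"
    using se co P.seam_or_node[OF v(1)] P'.seam_or_node[OF v(2)] P.disj P'.disj by blast
  consider "v \<in> Vcomp P" | "v \<in> Vmark P" | "v \<in> Vseam P" using v(1) P.verts_bub by blast
  then have "map (bub_key P) (inb P v) = map (bub_key P') (inb P' v') \<and>
    seam_label P (coh P v) = seam_label P' (coh P' v')"
  proof cases
    case 1
    have vc': "v' \<in> Vcomp P'" using co 1 by simp
    have b: "brk P v = brk P' v'" using v(3) P.bub_key_node[of v] P'.bub_key_node[of v'] 1 vc' by simp
    then have Kb: "seam_label P (coh P v) = seam_label P' (coh P' v')" by (metis P.brk_simps(1) P'.brk_simps(1))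
    have m: "map (bub_key P) (inb P v) = map (\<lambda>B. (brk P v, Some B)) (map (\<lambda>\<beta>. seam_label P (coh P \<beta>)) (inb P v))"
      using P.bub_key_seam[OF 1] by simp
    have m': "map (bub_key P') (inb P' v') = map (\<lambda>B. (brk P' v', Some B)) (map (\<lambda>\<beta>. seam_label P' (coh P' \<beta>)) (inb P' v'))"
      using P'.bub_key_seam[OF vc'] by simp
    have one: "length (inb P v) = 1 \<longleftrightarrow> length (inb P' v') = 1"
      using P.comp_one_iff[OF 1] P'.comp_one_iff[OF vc'] assms(3) b by simp
    have "map (\<lambda>\<beta>. seam_label P (coh P \<beta>)) (inb P v) = map (\<lambda>\<beta>. seam_label P' (coh P' \<beta>)) (inb P' v')"
      using 1
    proof (cases rule: P.comp_cases)
      case (one \<beta>)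
      from vc' show ?thesis
      proof (cases rule: P'.comp_cases)
        case (one \<beta>')
        then show ?thesis using \<open>inb P v = [\<beta>]\<close> \<open>coh P \<beta> = coh P v\<close> Kb by simp
      next
        case two
        then show ?thesis using \<open>inb P v = [\<beta>]\<close> \<open>length (inb P v) = 1 \<longleftrightarrow> length (inb P' v') = 1\<close> by simp
      qed
    next
      case two
      from vc' show ?thesis
      proof (cases rule: P'.comp_cases)
        case (one \<beta>')
        then show ?thesis using two(1) \<open>length (inb P v) = 1 \<longleftrightarrow> length (inb P' v') = 1\<close> by simp
      next
        case two': two
        have "map (seam_label P) (map (coh P) (inb P v)) = map (seam_label P') (map (coh P') (inb P' v'))"
          unfolding two(2) two'(2)
          by (rule K_children_eq[OF assms(1-3) P.coh_verts[OF v(1)] P'.coh_verts[OF v(2)] Kb])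
        then show ?thesis by (simp add: comp_def)
      qed
    qed
    then show ?thesis using m m' b Kb by simp
  next
    case 2
    then have vm': "v' \<in> Vmark P'" using se co P'.seam_or_node[OF v(2)] P.disj by blast
    have "brk P v = brk P' v'" using v(3) P.bub_key_node[of v] P'.bub_key_node[of v'] 2 vm' by simp
    then have "seam_label P (coh P v) = seam_label P' (coh P' v')" by (metis P.brk_simps(1) P'.brk_simps(1))
    then show ?thesis using P.mark_leaf[OF 2] P'.mark_leaf[OF vm'] by simp
  next
    case 3
    then have vs': "v' \<in> Vseam P'" using se by simp
    obtain a where a: "a \<in> Vcomp P" "v \<in> set (inb P a)" using P.seam_parent 3 by blast
    obtain a' where a': "a' \<in> Vcomp P'" "v' \<in> set (inb P' a')" using P'.seam_parent vs' by blast
    have k: "brk P a = brk P' a'" "seam_label P (coh P v) = seam_label P' (coh P' v')"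
      using v(3) P.bub_key_seam[OF a] P'.bub_key_seam[OF a'] by simp_all
    have m: "map (bub_key P) (inb P v) = map (\<lambda>Y. (Y, None)) (map (brk P) (inb P v))"
      using P.bub_key_node P.seam_children[OF 3] by simp
    have m': "map (bub_key P') (inb P' v') = map (\<lambda>Y. (Y, None)) (map (brk P') (inb P' v'))"
      using P'.bub_key_node P'.seam_children[OF vs'] by simp
    have "map (brk P) (inb P v) = map (brk P') (inb P' v')"
    proof (rule sorted_wrt_unique)
      show "sorted_wrt (\<lambda>X Y. (X, Y) \<in> tb_lt (brackets P)) (map (brk P) (inb P v))"
        using P.seam_sorted[OF 3] by (simp add: sorted_wrt_map)
      show "sorted_wrt (\<lambda>X Y. (X, Y) \<in> tb_lt (brackets P)) (map (brk P') (inb P' v'))"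
        using P'.seam_sorted[OF vs'] assms(3) by (simp add: sorted_wrt_map)
      show "set (map (brk P) (inb P v)) = set (map (brk P') (inb P' v'))"
      proof (rule set_eqI)
        fix Y show "Y \<in> set (map (brk P) (inb P v)) \<longleftrightarrow> Y \<in> set (map (brk P') (inb P' v'))"
          unfolding set_map P.seam_children_iff[OF a] P'.seam_children_iff[OF a'] k assms(3) ..
      qed
      show "\<not> (Y, X) \<in> tb_lt (brackets P)" if "(X, Y) \<in> tb_lt (brackets P)" for X Y
        using P.br.R_asym[OF that] .
    qed
    then show ?thesis using m m' k(2) by simp
  qed
  then show "map (bub_key P) (inb P v) = map (bub_key P') (inb P' v')"
    "seam_label P (coh P v) = seam_label P' (coh P' v')" by blast+
qed

lemma same_brackets_iso:
  assumes "stable_tree_pair r n P" "stable_tree_pair r n P'" "brackets P = brackets P'"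
  shows "\<exists>\<phi> \<psi>. tree_pair_iso \<phi> \<psi> P P'"
proof -
  have sp: "stable_pair r n P" "stable_pair r n P'" using assms(1,2) by (simp_all add: stable_pair_def)
  interpret P: stable_pair r n P by (rule sp(1))
  interpret P': stable_pair r n P' by (rule sp(2))
  have r1: "bub_key P (rt (bub P)) = bub_key P' (rt (bub P'))"
    using P.bub_key_node[OF P.rt_node] P'.bub_key_node[OF P'.rt_node] P.brk_rt P'.brk_rt by simp
  obtain \<phi> where phi: "rrt_iso \<phi> (bub P) (bub P')" "\<And>v. v \<in> verts (bub P) \<Longrightarrow> bub_key P' (\<phi> v) = bub_key P v"
    using rrt_iso_of_keys[OF P.B.rrt P'.B.rrt P.bub_key_inj P'.bub_key_inj r1 bub_key_step(1)[OF sp assms(3)]]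
    by blast
  have injs: "inj_on (seam_label P) (verts (stree P))" "inj_on (seam_label P') (verts (stree P'))"
    using P.K_inj P'.K_inj by (auto intro!: inj_onI)
  have r2: "seam_label P (rt (stree P)) = seam_label P' (rt (stree P'))" using P.K_rt P'.K_rt by simp
  obtain \<psi> where psi: "rrt_iso \<psi> (stree P) (stree P')"
    "\<And>s. s \<in> verts (stree P) \<Longrightarrow> seam_label P' (\<psi> s) = seam_label P s"
    using rrt_iso_of_keys[OF P.S.rrt P'.S.rrt injs r2 K_children_eq[OF sp assms(3)]] by blast
  have bij: "bij_betw \<phi> (verts (bub P)) (verts (bub P'))" "bij_betw \<psi> (verts (stree P)) (verts (stree P'))"
    using phi(1) psi(1) by (simp_all add: rrt_iso_def)
  have pv: "\<phi> v \<in> verts (bub P')" if "v \<in> verts (bub P)" for v using bij(1) that by (rule bij_betwE[THEN bspec])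
  have psv: "\<psi> s \<in> verts (stree P')" if "s \<in> verts (stree P)" for s using bij(2) that by (rule bij_betwE[THEN bspec])
  note st = bub_key_step[OF sp assms(3) _ pv phi(2)[symmetric]]
  have surj: "\<exists>v\<in>verts (bub P). v' = \<phi> v" if "v' \<in> verts (bub P')" for v'
    using bij(1) that unfolding bij_betw_def by blast
  have im: "\<phi> ` A = A'" if "A \<subseteq> verts (bub P)" "A' \<subseteq> verts (bub P')" "\<And>v. v \<in> verts (bub P) \<Longrightarrow> v \<in> A \<longleftrightarrow> \<phi> v \<in> A'" for A A'
    using that surj by blast
  have "tree_pair_iso \<phi> \<psi> P P'"
    unfolding tree_pair_iso_def
  proof (intro conjI)
    show "\<phi> ` Vcomp P = Vcomp P'" by (rule im) (use P.type_verts P'.type_verts st(2) in blast)+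
    show "\<phi> ` Vseam P = Vseam P'" by (rule im) (use P.type_verts P'.type_verts st(3) in blast)+
    show "\<phi> ` Vmark P = Vmark P'" by (rule im) (use P.type_verts P'.type_verts st(4) in blast)+
    show "\<forall>(\<beta>, \<alpha>)\<in>edges (bub P). (\<beta>, \<alpha>) \<in> solid P \<longleftrightarrow> (\<phi> \<beta>, \<phi> \<alpha>) \<in> solid P'"
    proof (intro ballI, clarify)
      fix \<beta> \<alpha> assume "(\<beta>, \<alpha>) \<in> edges (bub P)"
      then have e: "\<alpha> \<in> verts (bub P)" "\<beta> \<in> set (inb P \<alpha>)" by (auto simp: edges_def)
      have "inb P' (\<phi> \<alpha>) = map \<phi> (inb P \<alpha>)" using phi(1) e(1) by (simp add: rrt_iso_def)
      then have "\<phi> \<beta> \<in> set (inb P' (\<phi> \<alpha>))" using e(2) by simp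
      then show "(\<beta>, \<alpha>) \<in> solid P \<longleftrightarrow> (\<phi> \<beta>, \<phi> \<alpha>) \<in> solid P'"
        unfolding P.solid_eq P'.solid_eq using st(2)[OF e(1) e(1) e(1)] e(2) by simp
    qed
    show "\<forall>\<alpha>\<in>verts (bub P). coh P' (\<phi> \<alpha>) = \<psi> (coh P \<alpha>)"
    proof
      fix v assume v: "v \<in> verts (bub P)"
      have "seam_label P' (coh P' (\<phi> v)) = seam_label P' (\<psi> (coh P v))"
        using st(5)[OF v v v] psi(2)[OF P.coh_verts[OF v]] by simp
      then show "coh P' (\<phi> v) = \<psi> (coh P v)"
        using P'.K_inj[OF P'.coh_verts[OF pv[OF v]] psv[OF P.coh_verts[OF v]]] by blast
    qed
  qed (use phi(1) psi(1) in auto)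
  then show ?thesis by blast
qed

lemma ilab_pull:
  assumes "rrt_iso \<phi> T T'" "ilab T' M' l" "\<phi> ` M = M'" "M \<subseteq> verts T"
  shows "ilab T M (\<lambda>v. l (\<phi> v))"
  unfolding ilab_def
proof (intro conjI ballI)
  have bij: "bij_betw \<phi> (verts T) (verts T')" using assms(1) by (simp add: rrt_iso_def)
  fix v assume v: "v \<in> verts T - M"
  have inc: "inc T' (\<phi> v) = map \<phi> (inc T v)" using assms(1) v by (simp add: rrt_iso_def)
  have "\<phi> v \<in> verts T'" using bij v by (auto simp: bij_betw_def)
  moreover have "\<phi> v \<notin> M'"
    using bij_betw_imp_inj_on[OF bij] v assms(3,4) by (auto dest!: inj_onD)
  ultimately have a: "l (\<phi> v) = (\<Union>c\<in>set (inc T' (\<phi> v)). l c) \<and>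
      sorted_wrt (\<lambda>x y. slt (l x) (l y)) (inc T' (\<phi> v))"
    using assms(2) unfolding ilab_def by blast
  show "l (\<phi> v) = (\<Union>c\<in>set (inc T v). l (\<phi> c))" using a unfolding inc by simp
  show "sorted_wrt (\<lambda>x y. slt (l (\<phi> x)) (l (\<phi> y))) (inc T v)" using a unfolding inc by (simp add: sorted_wrt_map)
next
  fix v assume "v \<in> M"
  then have "\<phi> v \<in> M'" using assms(3) by blast
  then show "l (\<phi> v) = {} \<or> (\<exists>k. l (\<phi> v) = {k})" using assms(2) unfolding ilab_def by blast
qed

text \<open>The labels of \<open>P'\<close> pulled back along the isomorphism satisfy the local
  conditions for \<open>P\<close>, so by uniqueness they are the labels of \<open>P\<close>. The
  orders are then compared below each seam.\<close>

lemma iso_same_brackets: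
  assumes "stable_tree_pair r n P" "stable_tree_pair r n P'" "tree_pair_iso \<phi> \<psi> P P'"
  shows "brackets P = brackets P'"
proof -
  interpret P: stable_pair r n P by standard (rule assms(1))
  interpret P': stable_pair r n P' by standard (rule assms(2))
  have iso: "rrt_iso \<phi> (bub P) (bub P')" "rrt_iso \<psi> (stree P) (stree P')"
    "\<phi> ` Vcomp P = Vcomp P'" "\<phi> ` Vseam P = Vseam P'" "\<phi> ` Vmark P = Vmark P'"
    "\<And>v. v \<in> verts (bub P) \<Longrightarrow> coh P' (\<phi> v) = \<psi> (coh P v)"
    using assms(3) by (auto simp: tree_pair_iso_def)
  have bij: "bij_betw \<phi> (verts (bub P)) (verts (bub P'))" "bij_betw \<psi> (verts (stree P)) (verts (stree P'))"
    using iso(1,2) by (simp_all add: rrt_iso_def)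
  have incb: "inb P' (\<phi> v) = map \<phi> (inb P v)" if "v \<in> verts (bub P)" for v
    using iso(1) that by (simp add: rrt_iso_def)
  have incs: "ins P' (\<psi> s) = map \<psi> (ins P s)" if "s \<in> verts (stree P)" for s
    using iso(2) that by (simp add: rrt_iso_def)
  have rts: "\<phi> (rt (bub P)) = rt (bub P')" "\<psi> (rt (stree P)) = rt (stree P')"
    using iso(1,2) by (simp_all add: rrt_iso_def)
  have lv: "\<psi> ` leaves (stree P) = leaves (stree P')"
  proof -
    have im: "\<psi> ` verts (stree P) = verts (stree P')" using bij(2) by (simp add: bij_betw_def)
    have e: "\<psi> s \<in> leaves (stree P') \<longleftrightarrow> s \<in> leaves (stree P)" if "s \<in> verts (stree P)" for s
    proof -
      have "\<psi> s \<in> verts (stree P')" using im that by blast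
      then show ?thesis using incs[OF that] that by (simp add: leaves_def)
    qed
    have sub: "leaves (stree P) \<subseteq> verts (stree P)" "leaves (stree P') \<subseteq> \<psi> ` verts (stree P)"
      unfolding im by (simp_all add: leaves_def)
    show ?thesis
    proof
      show "\<psi> ` leaves (stree P) \<subseteq> leaves (stree P')" using e sub(1) by blast
      show "leaves (stree P') \<subseteq> \<psi> ` leaves (stree P)"
      proof
        fix y assume y: "y \<in> leaves (stree P')"
        then obtain s where "s \<in> verts (stree P)" "y = \<psi> s" using sub(2) by blast
        then show "y \<in> \<psi> ` leaves (stree P)" using e y by blast
      qed
    qed
  qed
  let ?K = "\<lambda>s. seam_label P' (\<psi> s)" and ?Q = "\<lambda>v. bub_label P' (\<phi> v)"
  have l: "lbl r n P ?K ?Q"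
    unfolding lbl_def
  proof (intro conjI allI ballI)
    show "good P" by (rule P.good)
    show "ilab (stree P) (leaves (stree P)) ?K"
      by (rule ilab_pull[OF iso(2) P'.KL.ilab lv]) (auto simp: leaves_def)
    show "seam_label P' (\<psi> (rt (stree P))) = {1..r}" using rts P'.K_rt by simp
    show "seam_label P' (\<psi> x) \<noteq> {}" if "x \<in> leaves (stree P)" for x
    proof -
      have "\<psi> x \<in> leaves (stree P')" using lv that by blast
      then show ?thesis using P'.K_leaf by fastforce
    qed
    show "ilab (bub P) (Vmark P) (\<lambda>v. bub_label P' (\<phi> v) i)" for i
      by (rule ilab_pull[OF iso(1) labelled_tree.ilab[OF P'.QL] iso(5)]) (use P.type_verts in blast)
    show "bub_label P' (\<phi> (rt (bub P))) i = {1..if i \<in> {1..r} then n i else 0}" for i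
      using rts P'.Q_rt by simp
    show "bub_label P' (\<phi> \<mu>) i \<noteq> {} \<longleftrightarrow> seam_label P' (\<psi> (coh P \<mu>)) = {i}" if "\<mu> \<in> Vmark P" for \<mu> i
    proof -
      have "\<phi> \<mu> \<in> Vmark P'" using that iso(5) by blast
      then show ?thesis using P'.Q_mark[of "\<phi> \<mu>" i] iso(6) P.type_verts(3)[OF that] by simp
    qed
  qed
  have K: "seam_label P s = seam_label P' (\<psi> s)" if "s \<in> verts (stree P)" for s
    using lbl_unique(2)[OF l that] .
  have b: "brk P v = brk P' (\<phi> v)" if "v \<in> verts (bub P)" for v
    using lbl_unique(3)[OF l that] K[OF P.coh_verts[OF that]] iso(6)[OF that] by (simp add: brk_def)
  have o: "ones (brackets P) = ones (brackets P')"
  proof -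
    have "seam_label P ` verts (stree P) = seam_label P' ` \<psi> ` verts (stree P)"
      using K by (simp add: image_image)
    then show ?thesis using bij(2) by (simp add: bij_betw_def)
  qed
  have t: "twos (brackets P) = twos (brackets P')"
  proof -
    have "\<phi> ` nodes P = nodes P'" using iso(3,5) by (simp add: image_Un)
    moreover have "brk P ` nodes P = brk P' ` \<phi> ` nodes P"
      using b P.node_verts by (simp add: image_image)
    ultimately show ?thesis by simp
  qed
  have "tb_lt (brackets P) \<subseteq> tb_lt (brackets P')"
  proof (rule P.tb_lt_local[OF P'.brackets_bracketing])
    show "twos (brackets P) \<subseteq> twos (brackets P')" using t by simp
    fix \<beta> assume be: "\<beta> \<in> Vseam P"
    then have "\<phi> \<beta> \<in> Vseam P'" using iso(4) by blast
    from P'.seam_sorted[OF this]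
    have s: "sorted_wrt (\<lambda>x y. (brk P' (\<phi> x), brk P' (\<phi> y)) \<in> tb_lt (brackets P')) (inb P \<beta>)"
      unfolding incb[OF P.type_verts(2)[OF be]] by (simp add: sorted_wrt_map)
    have bb: "brk P x = brk P' (\<phi> x)" if "x \<in> set (inb P \<beta>)" for x
      using b P.B.child_in[OF P.type_verts(2)[OF be] that] by blast
    show "sorted_wrt (\<lambda>x y. (brk P x, brk P y) \<in> tb_lt (brackets P')) (inb P \<beta>)"
      by (rule sorted_wrt_mono_rel[OF _ s]) (simp add: bb)
  qed
  then have "tb_lt (brackets P) = tb_lt (brackets P')"
    using order_restrict[OF P.brackets_bracketing P'.brackets_bracketing] t P'.br.R_base by auto
  then show ?thesis using o t by simp
qed

lemma iso_rel_iff: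
  "(P, P') \<in> tree_pair_iso_rel r n \<longleftrightarrow>
    stable_tree_pair r n P \<and> stable_tree_pair r n P' \<and> brackets P = brackets P'"
  using same_brackets_iso iso_same_brackets unfolding tree_pair_iso_rel_def by blast


section \<open>Inserting a vertex into a tree\<close>

definition inserts :: "'v rrt \<Rightarrow> 'v rrt \<Rightarrow> 'v \<Rightarrow> nat \<Rightarrow> nat \<Rightarrow> 'v \<Rightarrow> bool" where
  "inserts T T' \<alpha> p l v \<longleftrightarrow>
     \<alpha> \<in> verts T \<and> 1 \<le> l \<and> p + l \<le> length (inc T \<alpha>) \<and> v \<notin> verts T \<and>
     verts T' = insert v (verts T) \<and> rt T' = rt T \<and>
     inc T' \<alpha> = replace_block p l v (inc T \<alpha>) \<and> inc T' v = block p l (inc T \<alpha>) \<and>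
     (\<forall>x\<in>verts T - {\<alpha>}. inc T' x = inc T x)"

text \<open>The block is consecutive, so whatever is separated from each of its labels on one side
  is separated from their union on the same side.\<close>

lemma sorted_replace_block:
  assumes "sorted_wrt (\<lambda>x y. slt (f x) (f y)) xs" "p + l \<le> length xs"
    and "\<forall>x\<in>set xs - set (block p l xs). f' x = f x" "distinct xs"
    and "f' y = (\<Union>x\<in>set (block p l xs). f x)"
  shows "sorted_wrt (\<lambda>x y. slt (f' x) (f' y)) (replace_block p l y xs)"
    and "(\<Union>x\<in>set (replace_block p l y xs). f' x) = (\<Union>x\<in>set xs. f x)"
proof -
  let ?t = "take p xs" and ?b = "block p l xs" and ?d = "drop (p + l) xs"
  have xs: "xs = ?t @ ?b @ ?d" using assms(2) by (rule block_split)
  have sd: "sorted_wrt (\<lambda>x y. slt (f x) (f y)) (?t @ ?b @ ?d)" "distinct (?t @ ?b @ ?d)"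
    using assms(1,4) xs by simp_all
  have sx: "set xs = set ?t \<union> set ?b \<union> set ?d" using xs by (metis set_append sup_assoc)
  have f': "f' x = f x" if "x \<in> set ?t \<union> set ?d" for x
    using that sd(2) sx by (intro assms(3)[rule_format]) auto
  have st: "sorted_wrt (\<lambda>x y. slt (f' x) (f' y)) ?t"
    using sd(1) f' by (auto simp: sorted_wrt_append intro: sorted_wrt_mono_rel[rotated])
  have sdr: "sorted_wrt (\<lambda>x y. slt (f' x) (f' y)) ?d"
    using sd(1) f' by (auto simp: sorted_wrt_append intro: sorted_wrt_mono_rel[rotated])
  have ty: "slt (f' x) (f' y)" if x: "x \<in> set ?t" for x
  proof -
    have "\<forall>z\<in>set ?b. slt (f x) (f z)" using sd(1) x by (simp add: sorted_wrt_append)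
    then show ?thesis using f' x unfolding assms(5) slt_def by simp
  qed
  have yd: "slt (f' y) (f' x)" if x: "x \<in> set ?d" for x
  proof -
    have "\<forall>z\<in>set ?b. slt (f z) (f x)" using sd(1) x by (simp add: sorted_wrt_append)
    then show ?thesis using f' x unfolding assms(5) slt_def by simp
  qed
  have td: "slt (f' x) (f' z)" if x: "x \<in> set ?t" "z \<in> set ?d" for x z
    using sd(1) x f' by (simp add: sorted_wrt_append)
  show "sorted_wrt (\<lambda>x y. slt (f' x) (f' y)) (replace_block p l y xs)"
    unfolding replace_block_def using st sdr ty yd td by (simp add: sorted_wrt_append)
  have "(\<Union>x\<in>set (replace_block p l y xs). f' x) = (\<Union>x\<in>set ?t. f' x) \<union> f' y \<union> (\<Union>x\<in>set ?d. f' x)"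
    by (auto simp: replace_block_def)
  also have "\<dots> = (\<Union>x\<in>set xs. f x)"
    unfolding assms(5) sx using f' by (simp add: UN_Un Un_assoc)
  finally show "(\<Union>x\<in>set (replace_block p l y xs). f' x) = (\<Union>x\<in>set xs. f x)" .
qed

lemma nth_replace_block:
  assumes "p + l \<le> length xs" "1 \<le> l"
  shows "k < p \<Longrightarrow> replace_block p l y xs ! k = xs ! k"
    and "replace_block p l y xs ! p = y"
    and "p + l \<le> k \<Longrightarrow> k < length xs \<Longrightarrow> replace_block p l y xs ! (k - l + 1) = xs ! k"
  using assms by (auto simp: replace_block_def nth_append)

locale insertion = ribbon_tree T for T :: "'v rrt" +
  fixes T' \<alpha> p l v
  assumes ins: "inserts T T' \<alpha> p l v"
begin

lemma ins_simps: "\<alpha> \<in> verts T" "1 \<le> l" "p + l \<le> length (inc T \<alpha>)" "v \<notin> verts T"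
  "verts T' = insert v (verts T)" "rt T' = rt T"
  "inc T' \<alpha> = replace_block p l v (inc T \<alpha>)" "inc T' v = block p l (inc T \<alpha>)"
  and inc_other: "x \<in> verts T \<Longrightarrow> x \<noteq> \<alpha> \<Longrightarrow> inc T' x = inc T x"
  using ins by (auto simp: inserts_def)

lemma block_below: "x \<in> set (block p l (inc T \<alpha>)) \<Longrightarrow> below T' x v"
  by (rule below_child) (simp_all add: ins_simps)

lemma v_edge: "(v, \<alpha>) \<in> edges T'"
  by (rule edgeI) (simp_all add: ins_simps replace_block_def)

lemma below_new: "below T x y \<Longrightarrow> below T' x y"
proof (induction rule: rtrancl_induct)
  case (step y z)
  then have z: "z \<in> verts T" "y \<in> set (inc T z)" by (auto simp: edges_def)
  have "below T' y z"
  proof (cases "z = \<alpha>")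
    case False
    then show ?thesis using z inc_other by (intro below_child) (simp_all add: ins_simps)
  next
    case True
    then have "y \<in> set (replace_block p l v (inc T \<alpha>)) \<union> set (block p l (inc T \<alpha>))"
      using set_replace_block[OF ins_simps(3), of v] z by blast
    then show ?thesis
    proof
      assume "y \<in> set (replace_block p l v (inc T \<alpha>))"
      then show ?thesis using z True by (intro below_child) (simp_all add: ins_simps)
    next
      assume "y \<in> set (block p l (inc T \<alpha>))"
      then have "below T' y v" by (rule block_below)
      then show ?thesis using v_edge True by (simp add: rtrancl_into_rtrancl)
    qed
  qed
  with step.IH show ?case by (rule rtrancl_trans)
qed simp

lemma ins_rrt: "is_rrt T'"
proof (rule is_rrtI)
  show "finite (verts T')" "rt T' \<in> verts T'" by (simp_all add: ins_simps)
  have vr: "v \<noteq> rt T" using ins_simps(4) rt_in by blast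
  have s: "(\<Sum>a\<in>verts T. mset (inc T a)) = mset (inc T \<alpha>) + (\<Sum>a\<in>verts T - {\<alpha>}. mset (inc T a))"
    using ins_simps(1) by (simp add: sum.remove)
  have "(\<Sum>a\<in>verts T'. mset (inc T' a)) = mset (inc T' v) + (\<Sum>a\<in>verts T. mset (inc T' a))"
    using ins_simps(4) by (simp add: ins_simps(5))
  also have "(\<Sum>a\<in>verts T. mset (inc T' a)) = mset (inc T' \<alpha>) + (\<Sum>a\<in>verts T - {\<alpha>}. mset (inc T' a))"
    using ins_simps(1) by (simp add: sum.remove)
  also have "(\<Sum>a\<in>verts T - {\<alpha>}. mset (inc T' a)) = (\<Sum>a\<in>verts T - {\<alpha>}. mset (inc T a))"
    by (rule sum.cong) (simp_all add: inc_other)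
  also have "mset (inc T' v) + (mset (inc T' \<alpha>) + (\<Sum>a\<in>verts T - {\<alpha>}. mset (inc T a)))
      = add_mset v (\<Sum>a\<in>verts T. mset (inc T a))"
  proof -
    let ?S = "\<Sum>a\<in>verts T - {\<alpha>}. mset (inc T a)"
    have "mset (inc T' v) + (mset (inc T' \<alpha>) + ?S) = (mset (inc T' \<alpha>) + mset (inc T' v)) + ?S"
      by (simp only: add_ac)
    also have "\<dots> = add_mset v (mset (inc T \<alpha>)) + ?S"
      using mset_replace_block[OF ins_simps(3), of v] by (simp only: ins_simps(7,8))
    finally show ?thesis unfolding s by simp
  qed
  also have "\<dots> = add_mset v (mset_set (verts T - {rt T}))" using mset_children[OF rrt] by simp
  also have "\<dots> = mset_set (insert v (verts T - {rt T}))" using ins_simps(4) by simp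
  also have "insert v (verts T - {rt T}) = verts T' - {rt T'}" using vr by (auto simp: ins_simps(5,6))
  finally show "(\<Sum>a\<in>verts T'. mset (inc T' a)) = mset_set (verts T' - {rt T'})" .
  fix x assume "x \<in> verts T'"
  then consider "x = v" | "x \<in> verts T" by (auto simp: ins_simps(5))
  then show "below T' x (rt T')"
  proof cases
    case 1
    have "below T' \<alpha> (rt T)" using below_new[OF below_rt[OF ins_simps(1)]] .
    then show ?thesis using v_edge 1 by (simp add: ins_simps(6) converse_rtrancl_into_rtrancl)
  next
    case 2
    then show ?thesis using below_new[OF below_rt] by (simp add: ins_simps(6))
  qed
qed

sublocale new: ribbon_tree T' by standard (rule ins_rrt)

lemma ins_left_of: "left_of T x y \<Longrightarrow> left_of T' x y"
proof -
  assume "left_of T x y"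
  then obtain w i j where w: "w \<in> verts T" "i < j" "j < length (inc T w)"
    "below T x (inc T w ! i)" "below T y (inc T w ! j)"
    unfolding left_of_def by blast
  have "left_of T' (inc T w ! i) (inc T w ! j)"
  proof (cases "w = \<alpha>")
    case False
    then show ?thesis using new.left_of_child[of w i j] w by (simp add: inc_other ins_simps(5))
  next
    case True
    let ?xs = "inc T \<alpha>" and ?ys = "replace_block p l v (inc T \<alpha>)"
    have ij: "i < j" "j < length ?xs" using w True by simp_all
    note nr = nth_replace_block[where y = v, OF ins_simps(3,2)]
    note lr = length_replace_block[OF ins_simps(3), of v]
    \<comment> \<open>\<open>g k\<close> is the position in the new list of the child number
      \<open>k\<close> or, if this child was moved into the block, that of \<open>v\<close>. It is
      constant on the block and strictly increasing otherwise, so two old siblings are separated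
      either at \<open>\<alpha>\<close> or, when both are in the block, at \<open>v\<close>.\<close>
    define g where "g k = (if k < p then k else if k < p + l then p else k - l + 1)" for k
    have g: "below T' (?xs ! k) (?ys ! g k)" "g k < length ?ys" if k: "k < length ?xs" for k
    proof -
      consider "k < p" | "p \<le> k" "k < p + l" | "p + l \<le> k" by linarith
      then show "below T' (?xs ! k) (?ys ! g k)"
      proof cases
        case 2
        then have "?xs ! k \<in> set (block p l ?xs)"
          unfolding set_block_conv[OF ins_simps(3)] by (intro image_eqI[of _ _ "k - p"]) auto
        then show ?thesis using block_below 2 nr(2) by (simp add: g_def)
      qed (use nr k in \<open>simp_all add: g_def\<close>)
      show "g k < length ?ys" using k ins_simps(2,3) unfolding g_def lr by auto
    qed
    show ?thesis
    proof (cases "p \<le> i \<and> j < p + l")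
      case True
      have "left_of T' (inc T' v ! (i - p)) (inc T' v ! (j - p))"
        by (rule new.left_of_child) (use True ij in \<open>auto simp: ins_simps(5,8) length_block[OF ins_simps(3)]\<close>)
      moreover have "inc T' v ! (i - p) = ?xs ! i" "inc T' v ! (j - p) = ?xs ! j"
      proof -
        have "i - p < l" "j - p < l" "p + (i - p) = i" "p + (j - p) = j" using True ij(1) by linarith+
        then show "inc T' v ! (i - p) = ?xs ! i" "inc T' v ! (j - p) = ?xs ! j"
          using nth_block[OF _ ins_simps(3), of "i - p"] nth_block[OF _ ins_simps(3), of "j - p"]
          by (simp_all only: ins_simps(8))
      qed
      ultimately show ?thesis using \<open>w = \<alpha>\<close> by simp
    next
      case False
      then have "g i < g j" using ij(1) ins_simps(2) unfolding g_def by auto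
      then have "left_of T' (?ys ! g i) (?ys ! g j)"
        using new.left_of_child[of \<alpha> "g i" "g j"] g(2)[OF ij(2)] by (simp add: ins_simps)
      moreover have "i < length ?xs" using ij by simp
      ultimately show ?thesis using new.left_of_mono[OF _ g(1)[of i] g(1)[OF ij(2)]] \<open>w = \<alpha>\<close> by simp
    qed
  qed
  then show ?thesis using new.left_of_mono below_new w(4,5) by blast
qed

lemma ins_leaves: "leaves T' = leaves T"
proof -
  have "inc T' v \<noteq> []" "inc T' \<alpha> \<noteq> []" "inc T \<alpha> \<noteq> []"
    using length_block[OF ins_simps(3)] ins_simps(2,3) by (auto simp: ins_simps(7,8) replace_block_def)
  moreover have "inc T' x = [] \<longleftrightarrow> inc T x = []" if "x \<in> verts T" for x
    using inc_other[OF that] calculation by (cases "x = \<alpha>") simp_all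
  ultimately show ?thesis unfolding leaves_def ins_simps(5) by blast
qed

lemma ins_ilab:
  assumes "ilab T M lb" "M \<subseteq> leaves T"
  shows "ilab T' M (lb(v := \<Union>x\<in>set (block p l (inc T \<alpha>)). lb x))"
    (is "ilab T' M ?lb")
  unfolding ilab_def
proof (intro conjI ballI)
  have bT: "x \<in> verts T" if "x \<in> set (block p l (inc T \<alpha>))" for x
    by (rule child_in[OF ins_simps(1) subsetD[OF set_block that]])
  have lb: "?lb x = lb x" if "x \<in> verts T" for x using that ins_simps(4) by auto
  have old: "lb x = (\<Union>c\<in>set (inc T x). lb c)" "sorted_wrt (\<lambda>x y. slt (lb x) (lb y)) (inc T x)"
    if "x \<in> verts T - M" for x
    using assms(1) that unfolding ilab_def by blast+
  have "inc T \<alpha> \<noteq> []" using ins_simps(2,3) by auto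
  then have aM: "\<alpha> \<in> verts T - M" using assms(2) ins_simps(1) by (auto simp: leaves_def)
  fix x assume x: "x \<in> verts T' - M"
  consider "x = v" | "x = \<alpha>" | "x \<in> verts T - M" "x \<noteq> \<alpha>" using x by (auto simp: ins_simps(5))
  then have "?lb x = (\<Union>c\<in>set (inc T' x). ?lb c) \<and> sorted_wrt (\<lambda>x y. slt (?lb x) (?lb y)) (inc T' x)"
  proof cases
    case 1
    have e: "?lb c = lb c" if "c \<in> set (block p l (inc T \<alpha>))" for c using lb[OF bT[OF that]] .
    have "sorted_wrt (\<lambda>x y. slt (lb x) (lb y)) (block p l (inc T \<alpha>))"
      using old(2)[OF aM] by (simp add: block_def sorted_wrt_take sorted_wrt_drop)
    then have "sorted_wrt (\<lambda>x y. slt (?lb x) (?lb y)) (block p l (inc T \<alpha>))"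
      by (rule sorted_wrt_mono_rel[rotated]) (simp only: e)
    moreover have "(\<Union>c\<in>set (block p l (inc T \<alpha>)). ?lb c) = ?lb v"
      using e by (simp only: fun_upd_same) (rule SUP_cong; simp)
    ultimately show ?thesis using 1 by (simp only: ins_simps(8))
  next
    case 2
    have e: "\<forall>c\<in>set (inc T \<alpha>) - set (block p l (inc T \<alpha>)). ?lb c = lb c"
      using lb child_in[OF ins_simps(1)] by blast
    have y: "?lb v = (\<Union>x\<in>set (block p l (inc T \<alpha>)). lb x)" by simp
    note s = sorted_replace_block[OF old(2)[OF aM] ins_simps(3) e dist[OF ins_simps(1)] y]
    show ?thesis using s old(1)[OF aM] lb[OF ins_simps(1)] unfolding 2 ins_simps(7) by simp
  next
    case 3
    have i: "inc T' x = inc T x" using 3 inc_other by blast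
    have e: "?lb c = lb c" if "c \<in> set (inc T x)" for c using lb child_in 3(1) that by blast
    have "sorted_wrt (\<lambda>x y. slt (?lb x) (?lb y)) (inc T x)"
      by (rule sorted_wrt_mono_rel[OF _ old(2)[OF 3(1)]]) (simp only: e)
    moreover have u: "(\<Union>c\<in>set (inc T x). ?lb c) = (\<Union>c\<in>set (inc T x). lb c)" using e by (rule SUP_cong[OF refl])
    have "?lb x = lb x" using 3(1) by (intro lb) blast
    then have "?lb x = (\<Union>c\<in>set (inc T x). ?lb c)" using old(1)[OF 3(1)] u by (simp only:)
    ultimately show ?thesis unfolding i by (rule conjI[rotated])
  qed
  then show "?lb x = (\<Union>c\<in>set (inc T' x). ?lb c)"
    "sorted_wrt (\<lambda>x y. slt (?lb x) (?lb y)) (inc T' x)" by blast+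
next
  fix x assume "x \<in> M"
  moreover have "M \<subseteq> verts T" using assms(2) by (auto simp: leaves_def)
  ultimately have "x \<noteq> v" using ins_simps(4) by blast
  then show "?lb x = {} \<or> (\<exists>k. ?lb x = {k})" using assms(1) \<open>x \<in> M\<close> unfolding ilab_def by simp
qed

end


section \<open>Splitting vertices of a tree\<close>

lemma sum_singletons:
  assumes "finite A" "inj_on f A"
  shows "(\<Sum>x\<in>A. {#f x#}) = mset_set (f ` A)"
proof -
  have "(\<Sum>x\<in>A. {#f x#}) = image_mset f (mset_set A)"
    using assms(1) by (induction A rule: finite_induct) auto
  then show ?thesis using image_mset_mset_set[OF assms(2)] by simp
qed

lemma mset_map_upt: "mset (map f [0..<k]) = (\<Sum>j<k. {#f j#})"
  by (induction k) simp_all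

lemma mset_concat_blocks:
  fixes q :: nat
  assumes "length xs = (\<Sum>j<q. c j)"
  shows "(\<Sum>j<q. mset (block (\<Sum>m<j. c m) (c j) xs)) = mset xs"
proof -
  have "(\<Sum>j<q. mset (block (\<Sum>m<j. c m) (c j) xs)) = mset (take (\<Sum>j<q. c j) xs)"
    by (induction q) (simp_all add: block_def take_add)
  then show ?thesis using assms by simp
qed

lemma set_concat_blocks:
  fixes q :: nat
  assumes "length xs = (\<Sum>j<q. c j)"
  shows "(\<Union>j<q. set (block (\<Sum>m<j. c m) (c j) xs)) = set xs"
proof -
  have "set (concat (map (\<lambda>j. block (\<Sum>m<j. c m) (c j) xs) [0..<q])) = set xs"
    using assms by (simp only: concat_blocks) simp
  then show ?thesis by (simp add: atLeast0LessThan)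
qed

lemma block_index:
  fixes c :: "nat \<Rightarrow> nat" and q :: nat
  assumes "i < (\<Sum>j<q. c j)"
  obtains j k where "j < q" "k < c j" "i = (\<Sum>m<j. c m) + k"
  using assms
proof (induction q arbitrary: thesis)
  case (Suc q)
  show ?case
  proof (cases "i < (\<Sum>j<q. c j)")
    case True
    then obtain j k where "j < q" "k < c j" "i = (\<Sum>m<j. c m) + k" using Suc.IH by blast
    then show ?thesis using Suc.prems(1)[of j k] by simp
  next
    case False
    then show ?thesis using Suc.prems(1)[of q "i - (\<Sum>j<q. c j)"] Suc.prems(2) by simp
  qed
qed simp

lemma sum_prefix_le:
  fixes c :: "nat \<Rightarrow> nat" and j :: nat
  shows "j < j' \<Longrightarrow> (\<Sum>m<j. c m) + c j \<le> (\<Sum>m<j'. c m)"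
proof -
  assume "j < j'"
  then have "(\<Sum>m<Suc j. c m) \<le> (\<Sum>m<j'. c m)" by (intro sum_mono2) auto
  then show ?thesis by simp
qed

text \<open>The part of the moves of type 2 and 3 that concerns the shape of the bubble tree only,
  without types and coherence map. The vertices of \<open>A\<close> will be components and the
  removed ones seams, which explains \<open>A_rm\<close>.\<close>

locale tree_split = ribbon_tree T for T :: "'v rrt" +
  fixes T' :: "'v rrt" and A :: "'v set" and p l :: nat and q :: "'v \<Rightarrow> nat"
    and b :: "'v \<Rightarrow> nat \<Rightarrow> nat \<Rightarrow> nat" and \<nu> :: "'v new_vertex \<Rightarrow> 'v" and rm :: "'v set"
  assumes A_verts: "A \<subseteq> verts T"
    and blk_len: "a \<in> A \<Longrightarrow> p + l \<le> length (inc T a)"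
    and rm_def: "rm = (\<Union>a\<in>A. set (block p l (inc T a)))"
    and A_rm: "A \<inter> rm = {}"
    and lens: "a \<in> A \<Longrightarrow> i < l \<Longrightarrow> length (inc T (inc T a ! (p + i))) = (\<Sum>j<q a. b a j i)"
    and inj_nu: "inj \<nu>" and nu_new: "range \<nu> \<inter> verts T = {}"
    and verts': "verts T' = (verts T - rm) \<union> {\<nu> (Eps a) | a. a \<in> A} \<union> {\<nu> (Del a j) | a j. a \<in> A \<and> j < q a} \<union>
      {\<nu> (Sub a j i) | a j i. a \<in> A \<and> j < q a \<and> i < l}"
    and rt': "rt T' = rt T"
    and inc_A: "a \<in> A \<Longrightarrow> inc T' a = replace_block p l (\<nu> (Eps a)) (inc T a)"
    and inc_Eps: "a \<in> A \<Longrightarrow> inc T' (\<nu> (Eps a)) = map (\<lambda>j. \<nu> (Del a j)) [0..<q a]"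
    and inc_Del: "a \<in> A \<Longrightarrow> j < q a \<Longrightarrow> inc T' (\<nu> (Del a j)) = map (\<lambda>i. \<nu> (Sub a j i)) [0..<l]"
    and inc_Sub: "a \<in> A \<Longrightarrow> j < q a \<Longrightarrow> i < l \<Longrightarrow> inc T' (\<nu> (Sub a j i)) =
      block (\<Sum>m<j. b a m i) (b a j i) (inc T (inc T a ! (p + i)))"
    and inc_old: "x \<in> verts T - rm - A \<Longrightarrow> inc T' x = inc T x"
begin

lemma nu_eq [simp]: "\<nu> x = \<nu> y \<longleftrightarrow> x = y"
  using inj_nu by (auto dest: injD)

lemma nu_notin: "\<nu> x \<notin> verts T"
  using nu_new by blast

lemma blk_nth: "a \<in> A \<Longrightarrow> i < l \<Longrightarrow> inc T a ! (p + i) \<in> set (block p l (inc T a))"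
  using set_block_conv[OF blk_len] by blast

lemma blk_nthE:
  assumes "a \<in> A" "x \<in> set (block p l (inc T a))"
  obtains i where "i < l" "x = inc T a ! (p + i)"
  using set_block_conv[OF blk_len[OF assms(1)]] assms(2) by blast

lemma A_child: "a \<in> A \<Longrightarrow> x \<in> set (block p l (inc T a)) \<Longrightarrow> a \<in> verts T \<and> x \<in> set (inc T a)"
proof -
  assume h: "a \<in> A" "x \<in> set (block p l (inc T a))"
  show ?thesis using subsetD[OF A_verts h(1)] subsetD[OF set_block h(2)] by (rule conjI)
qed

lemma rmE:
  assumes "x \<in> rm"
  obtains a where "a \<in> A" "x \<in> set (block p l (inc T a))"
  using assms unfolding rm_def by blast

lemma rm_verts: "rm \<subseteq> verts T"
proof
  fix x assume "x \<in> rm"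
  then obtain a where "a \<in> A" "x \<in> set (block p l (inc T a))" by (rule rmE)
  then show "x \<in> verts T" using A_child child_in by metis
qed

lemma rm_nth: "a \<in> A \<Longrightarrow> i < l \<Longrightarrow> inc T a ! (p + i) \<in> rm"
  using blk_nth unfolding rm_def by blast

lemma rm_child: "a \<in> A \<Longrightarrow> i < l \<Longrightarrow> inc T a ! (p + i) \<in> set (inc T a)"
  using blk_nth A_child by blast

lemma rt_notin_rm: "rt T \<notin> rm"
proof
  assume "rt T \<in> rm"
  then obtain a where "a \<in> A" "rt T \<in> set (block p l (inc T a))" by (rule rmE)
  then show False using A_child rt_not_child by metis
qed

lemma rm_parent: "c \<in> rm \<Longrightarrow> v \<in> verts T \<Longrightarrow> c \<in> set (inc T v) \<Longrightarrow> v \<in> A \<and> c \<in> set (block p l (inc T v))"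
proof -
  assume h: "c \<in> rm" "v \<in> verts T" "c \<in> set (inc T v)"
  then obtain a where a: "a \<in> A" "c \<in> set (block p l (inc T a))" by (metis rmE)
  then have "a = v" using parent_unique[of a v c] h A_child[OF a] by simp
  then show ?thesis using a by simp
qed

lemma finA: "finite A"
  using A_verts fin finite_subset by blast

lemma rm_inj: "inj_on (\<lambda>(a, i). inc T a ! (p + i)) (A \<times> {..<l})"
proof (rule inj_onI, clarify)
  fix a i a' i' assume h: "a \<in> A" "a' \<in> A" "i < l" "i' < l" "inc T a ! (p + i) = inc T a' ! (p + i')"
  have "a = a'" using parent_unique[of a a' "inc T a ! (p + i)"] rm_child h A_verts by (metis subsetD)
  moreover have "i = i'" using dist[of a] h blk_len[OF h(1)] A_verts \<open>a = a'\<close>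
    by (auto simp: nth_eq_iff_index_eq subset_eq)
  ultimately show "a = a' \<and> i = i'" by simp
qed

lemma rm_image: "rm = (\<lambda>(a, i). inc T a ! (p + i)) ` (A \<times> {..<l})"
  unfolding rm_def using set_block_conv[OF blk_len] by auto

definition blk where "blk a j i = block (\<Sum>m<j. b a m i) (b a j i) (inc T (inc T a ! (p + i)))"

lemma blk_Union: "a \<in> A \<Longrightarrow> i < l \<Longrightarrow> (\<Union>j<q a. set (blk a j i)) = set (inc T (inc T a ! (p + i)))"
  unfolding blk_def by (rule set_concat_blocks[OF lens])

lemma blk_sub: "set (blk a j i) \<subseteq> set (inc T (inc T a ! (p + i)))"
  unfolding blk_def by (rule set_block)

lemma new_in:
  "a \<in> A \<Longrightarrow> \<nu> (Eps a) \<in> verts T'"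
  "a \<in> A \<Longrightarrow> j < q a \<Longrightarrow> \<nu> (Del a j) \<in> verts T'"
  "a \<in> A \<Longrightarrow> j < q a \<Longrightarrow> i < l \<Longrightarrow> \<nu> (Sub a j i) \<in> verts T'"
  "x \<in> verts T \<Longrightarrow> x \<notin> rm \<Longrightarrow> x \<in> verts T'"
  unfolding verts' by blast+

lemma A_in: "a \<in> A \<Longrightarrow> a \<in> verts T'"
  using new_in(4) A_verts A_rm by blast

lemma edge_Eps: "a \<in> A \<Longrightarrow> below T' (\<nu> (Eps a)) a"
  by (rule below_child[OF A_in]) (simp_all add: inc_A replace_block_def)

lemma edge_Del: "a \<in> A \<Longrightarrow> j < q a \<Longrightarrow> below T' (\<nu> (Del a j)) (\<nu> (Eps a))"
  by (rule below_child[OF new_in(1)]) (auto simp: inc_Eps)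

lemma edge_Sub: "a \<in> A \<Longrightarrow> j < q a \<Longrightarrow> i < l \<Longrightarrow> below T' (\<nu> (Sub a j i)) (\<nu> (Del a j))"
  by (rule below_child[OF new_in(2)]) (auto simp: inc_Del)

lemma edge_blk: "a \<in> A \<Longrightarrow> j < q a \<Longrightarrow> i < l \<Longrightarrow> x \<in> set (blk a j i) \<Longrightarrow> below T' x (\<nu> (Sub a j i))"
  by (rule below_child[OF new_in(3)]) (simp_all add: inc_Sub blk_def)

lemma blk_below_Del: "a \<in> A \<Longrightarrow> j < q a \<Longrightarrow> i < l \<Longrightarrow> x \<in> set (blk a j i) \<Longrightarrow> below T' x (\<nu> (Del a j))"
  using edge_blk edge_Sub by (blast intro: rtrancl_trans)

text \<open>A path of the old tree through a removed vertex passes through the new vertex \<open>Eps\<close> instead.\<close>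

definition redirect where "redirect x = (if x \<in> rm then \<nu> (Eps (SOME a. a \<in> A \<and> x \<in> set (inc T a))) else x)"

lemma redirect_rm: "a \<in> A \<Longrightarrow> x \<in> set (block p l (inc T a)) \<Longrightarrow> redirect x = \<nu> (Eps a)"
proof -
  assume h: "a \<in> A" "x \<in> set (block p l (inc T a))"
  then have x: "x \<in> rm" unfolding rm_def by blast
  have "(SOME a. a \<in> A \<and> x \<in> set (inc T a)) = a"
  proof (rule some_equality)
    show "a \<in> A \<and> x \<in> set (inc T a)" using h A_child by blast
    fix a' assume "a' \<in> A \<and> x \<in> set (inc T a')"
    then show "a' = a" using parent_unique[of a' a x] A_child[OF h] A_verts by blast
  qed
  then show ?thesis using x by (simp add: redirect_def)
qed

lemma redirect_edge: "(x, y) \<in> edges T \<Longrightarrow> below T' (redirect x) (redirect y)"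
proof -
  assume "(x, y) \<in> edges T"
  then have y: "y \<in> verts T" "x \<in> set (inc T y)" by (auto simp: edges_def)
  show ?thesis
  proof (cases "x \<in> rm")
    case True
    then have a: "y \<in> A" "x \<in> set (block p l (inc T y))" using rm_parent y by blast+
    then have "y \<notin> rm" using A_rm by blast
    then show ?thesis using redirect_rm[OF a] edge_Eps[OF a(1)] by (simp add: redirect_def)
  next
    case False
    then have hx: "redirect x = x" by (simp add: redirect_def)
    show ?thesis
    proof (cases "y \<in> rm")
      case True
      then obtain a where a: "a \<in> A" "y \<in> set (block p l (inc T a))" unfolding rm_def by blast
      then obtain i where i: "i < l" "y = inc T a ! (p + i)" by (rule blk_nthE)
      then obtain j where j: "j < q a" "x \<in> set (blk a j i)" using blk_Union[OF a(1) i(1)] y(2) by blast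
      have "below T' x (\<nu> (Eps a))"
        using blk_below_Del[OF a(1) j(1) i(1) j(2)] edge_Del[OF a(1) j(1)] by (rule rtrancl_trans)
      then show ?thesis using hx redirect_rm[OF a] by simp
    next
      case yr: False
      then have hy: "redirect y = y" by (simp add: redirect_def)
      have "x \<in> set (inc T' y)"
      proof (cases "y \<in> A")
        case True
        have "x \<notin> set (block p l (inc T y))" using \<open>x \<notin> rm\<close> True unfolding rm_def by blast
        then show ?thesis
          using set_replace_block[OF blk_len[OF True], of "\<nu> (Eps y)"] y(2) inc_A[OF True] by auto
      next
        case False
        then show ?thesis using inc_old y yr by simp
      qed
      then have "below T' x y" using below_child[OF new_in(4)[OF y(1) yr]] by blast
      then show ?thesis using hx hy by simp
    qed
  qed
qed

lemma redirect_below: "below T x y \<Longrightarrow> below T' (redirect x) (redirect y)"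
  by (induction rule: rtrancl_induct) (auto intro: rtrancl_trans redirect_edge)

text \<open>The contributions are shifted by one generation: the lists at \<open>Eps\<close>
  vertices yield the \<open>Del\<close> vertices, those at \<open>Del\<close> vertices the
  \<open>Sub\<close> vertices, and those at \<open>Sub\<close> vertices the children of the removed
  vertices. In the lists at \<open>A\<close> the removed vertices are exchanged for the
  \<open>Eps\<close> vertices. Multiset subtraction is avoided by adding \<open>mset_set rm\<close>
  on both sides and cancelling it at the end.\<close>

lemma split_mset: "(\<Sum>a\<in>verts T'. mset (inc T' a)) = mset_set (verts T' - {rt T'})"
proof -
  let ?D = "SIGMA a:A. {..<q a}" and ?S = "SIGMA a:A. {..<q a} \<times> {..<l}"
  let ?eps = "\<lambda>a. \<nu> (Eps a)" and ?del = "\<lambda>(a, j). \<nu> (Del a j)" and ?sub = "\<lambda>(a, j, i). \<nu> (Sub a j i)"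
  have E: "{\<nu> (Eps a) | a. a \<in> A} = ?eps ` A" by blast
  have D: "{\<nu> (Del a j) | a j. a \<in> A \<and> j < q a} = ?del ` ?D" by (auto simp: image_iff)
  have S: "{\<nu> (Sub a j i) | a j i. a \<in> A \<and> j < q a \<and> i < l} = ?sub ` ?S" by (force simp: image_iff)
  have iE: "inj_on ?eps A" and iD: "inj_on ?del ?D" and iS: "inj_on ?sub ?S"
    by (auto intro!: inj_onI)
  have fD: "finite ?D" and fS: "finite ?S" using finA by auto
  let ?O = "verts T - rm - A"
  have frm: "finite rm" using rm_verts fin finite_subset by blast
  have V': "verts T' = ?O \<union> A \<union> (?eps ` A \<union> (?del ` ?D \<union> ?sub ` ?S))"
    using verts' A_verts A_rm unfolding E D S by blast
  have dj: "?eps ` A \<inter> (?del ` ?D \<union> ?sub ` ?S) = {}" "?del ` ?D \<inter> ?sub ` ?S = {}" by auto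
  have dj2: "(?O \<union> A) \<inter> (?eps ` A \<union> (?del ` ?D \<union> ?sub ` ?S)) = {}" "?O \<inter> A = {}"
    using nu_notin A_verts by auto
  have fO: "finite ?O" using fin by blast
  note fins = fO finA fD fS frm
  let ?m' = "\<lambda>x. mset (inc T' x)" and ?m = "\<lambda>x. mset (inc T x)"
  have "sum ?m' (verts T') = sum ?m' ?O + sum ?m' A + (sum ?m' (?eps ` A) + (sum ?m' (?del ` ?D) + sum ?m' (?sub ` ?S)))"
  proof -
    have "sum ?m' (verts T') = sum ?m' (?O \<union> A) + sum ?m' (?eps ` A \<union> (?del ` ?D \<union> ?sub ` ?S))"
      unfolding V' by (rule sum.union_disjoint[OF _ _ dj2(1)]) (use fins in auto)
    moreover have "sum ?m' (?O \<union> A) = sum ?m' ?O + sum ?m' A"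
      by (rule sum.union_disjoint[OF fO finA dj2(2)])
    moreover have "sum ?m' (?eps ` A \<union> (?del ` ?D \<union> ?sub ` ?S)) = sum ?m' (?eps ` A) + sum ?m' (?del ` ?D \<union> ?sub ` ?S)"
      by (rule sum.union_disjoint[OF _ _ dj(1)]) (use fins in auto)
    moreover have "sum ?m' (?del ` ?D \<union> ?sub ` ?S) = sum ?m' (?del ` ?D) + sum ?m' (?sub ` ?S)"
      by (rule sum.union_disjoint[OF _ _ dj(2)]) (use fins in auto)
    ultimately show ?thesis by (simp only:)
  qed
  also have "sum ?m' ?O = sum ?m ?O" by (rule sum.cong) (simp_all add: inc_old)
  also have "sum ?m' (?eps ` A) = mset_set (?del ` ?D)"
  proof -
    have "sum ?m' (?eps ` A) = (\<Sum>a\<in>A. mset (map (\<lambda>j. \<nu> (Del a j)) [0..<q a]))"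
      by (simp add: sum.reindex[OF iE] inc_Eps)
    also have "\<dots> = (\<Sum>a\<in>A. \<Sum>j<q a. {#\<nu> (Del a j)#})" by (simp only: mset_map_upt)
    also have "\<dots> = (\<Sum>x\<in>?D. {#?del x#})" using finA by (subst sum.Sigma) (auto intro!: sum.cong)
    also have "\<dots> = mset_set (?del ` ?D)" by (rule sum_singletons[OF fD iD])
    finally show ?thesis .
  qed
  also have "sum ?m' (?del ` ?D) = mset_set (?sub ` ?S)"
  proof -
    have "sum ?m' (?del ` ?D) = (\<Sum>(a, j)\<in>?D. mset (map (\<lambda>i. \<nu> (Sub a j i)) [0..<l]))"
      unfolding sum.reindex[OF iD] by (rule sum.cong) (auto simp: inc_Del)
    also have "\<dots> = (\<Sum>(a, j)\<in>?D. \<Sum>i<l. {#\<nu> (Sub a j i)#})" by (simp only: mset_map_upt)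
    also have "\<dots> = (\<Sum>a\<in>A. \<Sum>j<q a. \<Sum>i<l. {#\<nu> (Sub a j i)#})" using finA by (subst sum.Sigma) auto
    also have "\<dots> = (\<Sum>a\<in>A. \<Sum>(j, i)\<in>{..<q a} \<times> {..<l}. {#\<nu> (Sub a j i)#})"
      by (simp add: sum.cartesian_product)
    also have "\<dots> = (\<Sum>x\<in>?S. {#?sub x#})"
      using finA by (subst sum.Sigma) (auto intro!: sum.cong)
    also have "\<dots> = mset_set (?sub ` ?S)" by (rule sum_singletons[OF fS iS])
    finally show ?thesis .
  qed
  also have "sum ?m' (?sub ` ?S) = sum ?m rm"
  proof -
    have "sum ?m' (?sub ` ?S) = (\<Sum>(a, j, i)\<in>?S. mset (blk a j i))"
      unfolding sum.reindex[OF iS] by (rule sum.cong) (auto simp: inc_Sub blk_def)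
    also have "\<dots> = (\<Sum>a\<in>A. \<Sum>(j, i)\<in>{..<q a} \<times> {..<l}. mset (blk a j i))"
      using finA by (subst sum.Sigma) (auto intro!: sum.cong)
    also have "\<dots> = (\<Sum>a\<in>A. \<Sum>j<q a. \<Sum>i<l. mset (blk a j i))" by (simp add: sum.cartesian_product)
    also have "\<dots> = (\<Sum>a\<in>A. \<Sum>i<l. \<Sum>j<q a. mset (blk a j i))"
      by (intro sum.cong refl sum.swap)
    also have "\<dots> = (\<Sum>a\<in>A. \<Sum>i<l. ?m (inc T a ! (p + i)))"
      unfolding blk_def by (intro sum.cong refl mset_concat_blocks lens) auto
    also have "\<dots> = (\<Sum>(a, i)\<in>A \<times> {..<l}. ?m (inc T a ! (p + i)))" by (simp add: sum.cartesian_product)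
    also have "\<dots> = sum ?m rm"
      unfolding rm_image sum.reindex[OF rm_inj] by (rule sum.cong) auto
    finally show ?thesis .
  qed
  finally have 1: "sum ?m' (verts T') = sum ?m ?O + sum ?m' A + (mset_set (?del ` ?D) + (mset_set (?sub ` ?S) + sum ?m rm))" .
  have 2: "sum ?m' A + mset_set rm = sum ?m A + mset_set (?eps ` A)"
  proof -
    have "mset_set rm = (\<Sum>(a, i)\<in>A \<times> {..<l}. {#inc T a ! (p + i)#})"
      unfolding rm_image using sum_singletons[OF _ rm_inj] finA by (simp add: case_prod_unfold)
    also have "\<dots> = (\<Sum>a\<in>A. \<Sum>i<l. {#inc T a ! (p + i)#})" by (simp add: sum.cartesian_product)
    also have "\<dots> = (\<Sum>a\<in>A. mset (block p l (inc T a)))"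
      by (intro sum.cong refl) (simp only: block_conv_map[OF blk_len] mset_map_upt)
    finally have "sum ?m' A + mset_set rm = (\<Sum>a\<in>A. ?m' a + mset (block p l (inc T a)))"
      by (simp add: sum.distrib)
    also have "\<dots> = (\<Sum>a\<in>A. ?m a + {#\<nu> (Eps a)#})"
      by (intro sum.cong refl) (simp add: inc_A mset_replace_block[OF blk_len])
    also have "\<dots> = sum ?m A + mset_set (?eps ` A)"
      unfolding sum.distrib sum_singletons[OF finA iE] ..
    finally show ?thesis .
  qed
  have 3: "sum ?m ?O + sum ?m A + sum ?m rm = mset_set (verts T - {rt T})"
  proof -
    have "verts T = ?O \<union> A \<union> rm" using A_verts rm_verts by blast
    then have "sum ?m (verts T) = sum ?m (?O \<union> A \<union> rm)" by simp
    also have "\<dots> = sum ?m (?O \<union> A) + sum ?m rm"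
      by (rule sum.union_disjoint) (use fins A_rm in auto)
    also have "sum ?m (?O \<union> A) = sum ?m ?O + sum ?m A" by (rule sum.union_disjoint[OF fO finA dj2(2)])
    finally show ?thesis using mset_children[OF rrt] by simp
  qed
  have "sum ?m' (verts T') + mset_set rm = mset_set (verts T - {rt T}) +
      (mset_set (?eps ` A) + (mset_set (?del ` ?D) + mset_set (?sub ` ?S)))"
  proof -
    have "sum ?m' (verts T') + mset_set rm = sum ?m ?O + (sum ?m' A + mset_set rm) +
        (mset_set (?del ` ?D) + (mset_set (?sub ` ?S) + sum ?m rm))"
      unfolding 1 by (simp only: add_ac)
    also have "\<dots> = (sum ?m ?O + sum ?m A + sum ?m rm) +
        (mset_set (?eps ` A) + (mset_set (?del ` ?D) + mset_set (?sub ` ?S)))"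
      unfolding 2 by (simp only: add_ac)
    finally show ?thesis unfolding 3 .
  qed
  moreover have "mset_set (verts T' - {rt T'}) + mset_set rm = mset_set (verts T - {rt T}) +
      (mset_set (?eps ` A) + (mset_set (?del ` ?D) + mset_set (?sub ` ?S)))"
  proof -
    have "verts T' - {rt T'} = (verts T - {rt T} - rm) \<union> (?eps ` A \<union> (?del ` ?D \<union> ?sub ` ?S))"
    proof -
      have "x \<notin> range \<nu>" if "x \<in> verts T" for x using nu_new that by blast
      moreover have "?eps ` A \<union> (?del ` ?D \<union> ?sub ` ?S) \<subseteq> range \<nu>" by auto
      ultimately have rn: "rt T \<notin> ?eps ` A \<union> (?del ` ?D \<union> ?sub ` ?S)" using rt_in by blast
      have eq: "verts T - rm = ?O \<union> A" using A_verts A_rm by blast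
      have aux: "V = W \<union> N \<Longrightarrow> x \<notin> N \<Longrightarrow> V - {x} = (W - {x}) \<union> N" for V W N and x :: 'v by blast
      have "verts T' - {rt T} = (verts T - rm - {rt T}) \<union> (?eps ` A \<union> (?del ` ?D \<union> ?sub ` ?S))"
        by (rule aux[OF trans[OF V' arg_cong2[where f = "(\<union>)", OF eq[symmetric] refl]] rn])
      moreover have "verts T - rm - {rt T} = verts T - {rt T} - rm" by blast
      ultimately show ?thesis unfolding rt' by (simp only:)
    qed
    moreover have "(verts T - {rt T} - rm) \<inter> (?eps ` A \<union> (?del ` ?D \<union> ?sub ` ?S)) = {}"
    proof -
      have "?eps ` A \<union> (?del ` ?D \<union> ?sub ` ?S) \<subseteq> range \<nu>" by auto
      then show ?thesis using nu_new by blast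
    qed
    ultimately have "mset_set (verts T' - {rt T'}) = mset_set (verts T - {rt T} - rm) +
        (mset_set (?eps ` A) + (mset_set (?del ` ?D) + mset_set (?sub ` ?S)))"
      using fins dj by (simp add: mset_set_Union)
    moreover have "mset_set (verts T - {rt T}) = mset_set (verts T - {rt T} - rm) + mset_set rm"
    proof -
      have "verts T - {rt T} = (verts T - {rt T} - rm) \<union> rm" using rm_verts rt_notin_rm by blast
      then have "mset_set (verts T - {rt T}) = mset_set ((verts T - {rt T} - rm) \<union> rm)" by simp
      also have "\<dots> = mset_set (verts T - {rt T} - rm) + mset_set rm"
        using frm fin by (intro mset_set_Union) auto
      finally show ?thesis .
    qed
    ultimately show ?thesis by (simp add: add_ac)
  qed
  ultimately show ?thesis by (metis add_right_cancel)
qed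

lemma split_rrt: "is_rrt T'"
proof (rule is_rrtI)
  have "{\<nu> (Del a j) | a j. a \<in> A \<and> j < q a} = (\<lambda>(a, j). \<nu> (Del a j)) ` (SIGMA a:A. {..<q a})"
    by (auto simp: image_iff)
  moreover have "{\<nu> (Sub a j i) | a j i. a \<in> A \<and> j < q a \<and> i < l} =
      (\<lambda>(a, j, i). \<nu> (Sub a j i)) ` (SIGMA a:A. {..<q a} \<times> {..<l})" by (force simp: image_iff)
  ultimately show "finite (verts T')" unfolding verts' using finA fin by (simp add: setcompr_eq_image)
  show "rt T' \<in> verts T'" using new_in(4)[OF rt_in rt_notin_rm] by (simp add: rt')
  show "(\<Sum>a\<in>verts T'. mset (inc T' a)) = mset_set (verts T' - {rt T'})" by (rule split_mset)
  have old: "below T' x (rt T)" if "x \<in> verts T" "x \<notin> rm" for x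
    using redirect_below[OF below_rt[OF that(1)]] that(2) rt_notin_rm by (simp add: redirect_def)
  have eps: "below T' (\<nu> (Eps a)) (rt T)" if "a \<in> A" for a
    using edge_Eps[OF that] old[of a] that A_verts A_rm by (blast intro: rtrancl_trans)
  have del: "below T' (\<nu> (Del a j)) (rt T)" if "a \<in> A" "j < q a" for a j
    using edge_Del[OF that] eps[OF that(1)] by (rule rtrancl_trans)
  have sub: "below T' (\<nu> (Sub a j i)) (rt T)" if "a \<in> A" "j < q a" "i < l" for a j i
    using edge_Sub[OF that] del[OF that(1,2)] by (rule rtrancl_trans)
  fix x assume "x \<in> verts T'"
  then show "below T' x (rt T')" unfolding verts' rt' using old eps del sub by blast
qed

sublocale new: ribbon_tree T' by standard (rule split_rrt)

text \<open>Only the children of a removed vertex change their parent. Two of them either stay in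
  one piece and remain siblings, or fall into pieces \<open>j1 < j2\<close> and are separated by the
  corresponding \<open>Del\<close> vertices; prefix sums exclude the opposite order.\<close>

lemma split_siblings:
  assumes "v \<in> verts T" "v \<notin> A" "i < j" "j < length (inc T v)"
  shows "left_of T' (inc T v ! i) (inc T v ! j)"
proof (cases "v \<in> rm")
  case False
  then show ?thesis using new.left_of_child[OF new_in(4)[OF assms(1) False] assms(3)] inc_old assms by simp
next
  case True
  then obtain a where a: "a \<in> A" "v \<in> set (block p l (inc T a))" unfolding rm_def by blast
  then obtain m where m: "m < l" "v = inc T a ! (p + m)" by (rule blk_nthE)
  have len: "length (inc T v) = (\<Sum>j<q a. b a j m)" using lens[OF a(1) m(1)] m(2) by simp
  obtain j1 k1 where 1: "j1 < q a" "k1 < b a j1 m" "i = (\<Sum>s<j1. b a s m) + k1"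
    using block_index[of i "\<lambda>j. b a j m" "q a"] len assms(3,4) by (metis less_trans)
  obtain j2 k2 where 2: "j2 < q a" "k2 < b a j2 m" "j = (\<Sum>s<j2. b a s m) + k2"
    using block_index[of j "\<lambda>j. b a j m" "q a"] len assms(4) by metis
  have bl: "(\<Sum>s<j'. b a s m) + b a j' m \<le> length (inc T v)" if "j' < q a" for j'
    using sum_prefix_le[OF that, of "\<lambda>j. b a j m"] len by simp
  have nth: "blk a j' m ! k = inc T v ! ((\<Sum>s<j'. b a s m) + k)" "length (blk a j' m) = b a j' m"
    if "j' < q a" "k < b a j' m" for j' k
    using nth_block[OF that(2) bl[OF that(1)]] length_block[OF bl[OF that(1)]] m(2) by (simp_all add: blk_def)
  consider "j1 = j2" "k1 < k2" | "j1 < j2" | "j2 < j1" | "j1 = j2" "k2 \<le> k1" by linarith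
  then show ?thesis
  proof cases
    case c: 1
    have "left_of T' (inc T' (\<nu> (Sub a j1 m)) ! k1) (inc T' (\<nu> (Sub a j1 m)) ! k2)"
      by (rule new.left_of_child[OF new_in(3)[OF a(1) 1(1) m(1)] c(2)])
        (use 1 2 nth c m a in \<open>simp add: inc_Sub blk_def[symmetric]\<close>)
    then show ?thesis using nth(1) 1 2 c(1) inc_Sub[OF a(1) 1(1) m(1)] by (simp add: blk_def)
  next
    case c: 2
    have "left_of T' (inc T' (\<nu> (Eps a)) ! j1) (inc T' (\<nu> (Eps a)) ! j2)"
      by (rule new.left_of_child[OF new_in(1)[OF a(1)] c]) (use 2 a in \<open>simp add: inc_Eps\<close>)
    then have "left_of T' (\<nu> (Del a j1)) (\<nu> (Del a j2))" using 1 2 inc_Eps[OF a(1)] by simp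
    moreover have "below T' (inc T v ! i) (\<nu> (Del a j1))"
      using blk_below_Del[OF a(1) 1(1) m(1)] nth[OF 1(1,2)] 1(2,3) by (metis nth_mem)
    moreover have "below T' (inc T v ! j) (\<nu> (Del a j2))"
      using blk_below_Del[OF a(1) 2(1) m(1)] nth[OF 2(1,2)] 2(2,3) by (metis nth_mem)
    ultimately show ?thesis using new.left_of_mono by blast
  next
    case 3
    then have "j < i" using sum_prefix_le[OF 3, of "\<lambda>j. b a j m"] 1 2 by linarith
    then show ?thesis using assms(3) by simp
  next
    case 4
    then show ?thesis using 1 2 assms(3) by simp
  qed
qed

definition split_label :: "('v \<Rightarrow> nat set) \<Rightarrow> 'v \<Rightarrow> nat set" where
  "split_label lb x = (if x \<in> range \<nu> then (case inv \<nu> x of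
      Eps a \<Rightarrow> (\<Union>c\<in>set (block p l (inc T a)). lb c)
    | Del a j \<Rightarrow> (\<Union>i<l. \<Union>c\<in>set (blk a j i). lb c)
    | Sub a j i \<Rightarrow> (\<Union>c\<in>set (blk a j i). lb c)) else lb x)"

lemma split_label_simps [simp]:
  "split_label lb (\<nu> (Eps a)) = (\<Union>c\<in>set (block p l (inc T a)). lb c)"
  "split_label lb (\<nu> (Del a j)) = (\<Union>i<l. \<Union>c\<in>set (blk a j i). lb c)"
  "split_label lb (\<nu> (Sub a j i)) = (\<Union>c\<in>set (blk a j i). lb c)"
  by (simp_all add: split_label_def inv_f_f[OF inj_nu])

lemma split_label_old: "x \<in> verts T \<Longrightarrow> split_label lb x = lb x"
  using nu_new by (auto simp: split_label_def)

text \<open>The label of a \<open>Del\<close> vertex is a union over all columns \<open>i\<close> of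
  the block. Pieces in one column are separated in the order of \<open>j\<close>, but pieces in
  different columns need not be. The hypothesis \<open>single\<close> says that in the row under
  consideration only one column carries numbers at all, since different seams of a component have
  disjoint 1-brackets.\<close>

lemma split_ilab:
  assumes "ilab T M lb" "M \<subseteq> leaves T" "rm \<inter> M = {}" "1 \<le> l"
    and single: "\<And>a i i'. a \<in> A \<Longrightarrow> i < l \<Longrightarrow> i' < l \<Longrightarrow> i \<noteq> i' \<Longrightarrow>
      lb (inc T a ! (p + i)) = {} \<or> lb (inc T a ! (p + i')) = {}"
  shows "ilab T' M (split_label lb)"
proof -
  let ?lb = "split_label lb"
  have Mv: "M \<subseteq> verts T" using assms(2) by (auto simp: leaves_def)
  have old: "lb x = (\<Union>c\<in>set (inc T x). lb c)" "sorted_wrt (\<lambda>x y. slt (lb x) (lb y)) (inc T x)"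
    if "x \<in> verts T" "x \<notin> M" for x
    using assms(1) that unfolding ilab_def by blast+
  have AM: "a \<notin> M" if "a \<in> A" for a
    using blk_len[OF that] assms(2,4) by (auto simp: leaves_def)
  have rmv: "inc T a ! (p + i) \<in> verts T" "inc T a ! (p + i) \<notin> M" if "a \<in> A" "i < l" for a i
    using rm_nth[OF that] rm_verts assms(3) by blast+
  have blk_lb: "(\<Union>j<q a. \<Union>c\<in>set (blk a j i). lb c) = lb (inc T a ! (p + i))" if "a \<in> A" "i < l" for a i
  proof -
    have "(\<Union>j<q a. \<Union>c\<in>set (blk a j i). lb c) = (\<Union>c\<in>(\<Union>j<q a. set (blk a j i)). lb c)" by blast
    then show ?thesis unfolding blk_Union[OF that] using old(1)[OF rmv[OF that]] by simp
  qed
  have blk_sub_lb: "(\<Union>c\<in>set (blk a j i). lb c) \<subseteq> lb (inc T a ! (p + i))" if "a \<in> A" "i < l" for a j i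
    using blk_sub[of a j i] old(1)[OF rmv[OF that]] by blast
  have blkv: "c \<in> verts T" if "a \<in> A" "i < l" "c \<in> set (blk a j i)" for a i j c
    using blk_sub child_in[OF rmv(1)[OF that(1,2)]] that(3) by blast
  have blk_lt: "slt (\<Union>c\<in>set (blk a j i). lb c) (\<Union>c\<in>set (blk a j' i). lb c)"
    if "a \<in> A" "i < l" "j < j'" "j' < q a" for a i j j'
    unfolding slt_def
  proof (intro ballI)
    let ?v = "inc T a ! (p + i)"
    have bl: "(\<Sum>s<k. b a s i) + b a k i \<le> length (inc T ?v)" if "k < q a" for k
      using sum_prefix_le[OF that, of "\<lambda>j. b a j i"] lens[OF \<open>a \<in> A\<close> \<open>i < l\<close>] by simp
    have jq: "j < q a" using that(3,4) by simp
    note blq' = bl[OF that(4)]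
    fix x y assume "x \<in> (\<Union>c\<in>set (blk a j i). lb c)" "y \<in> (\<Union>c\<in>set (blk a j' i). lb c)"
    then obtain c d where cd: "c \<in> set (blk a j i)" "x \<in> lb c" "d \<in> set (blk a j' i)" "y \<in> lb d" by blast
    obtain k where k: "k < b a j i" "c = inc T ?v ! ((\<Sum>s<j. b a s i) + k)"
      using cd(1) unfolding blk_def set_block_conv[OF bl[OF jq]] by blast
    obtain k' where k': "k' < b a j' i" "d = inc T ?v ! ((\<Sum>s<j'. b a s i) + k')"
      using cd(3) unfolding blk_def set_block_conv[OF blq'] by blast
    have "(\<Sum>s<j. b a s i) + k < (\<Sum>s<j'. b a s i) + k'"
      using sum_prefix_le[OF that(3), of "\<lambda>j. b a j i"] k(1) by linarith
    moreover have "(\<Sum>s<j'. b a s i) + k' < length (inc T ?v)" using bl[OF that(4)] k'(1) by linarith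
    ultimately have "slt (lb c) (lb d)"
      using old(2)[OF rmv[OF that(1,2)]] k(2) k'(2) by (simp add: sorted_wrt_iff_nth_less)
    then show "x < y" using cd by (simp add: slt_def)
  qed
  have "?lb x = (\<Union>c\<in>set (inc T' x). ?lb c) \<and> sorted_wrt (\<lambda>x y. slt (?lb x) (?lb y)) (inc T' x)"
    if x: "x \<in> verts T' - M" for x
  proof -
    consider "x \<in> verts T" "x \<notin> rm" "x \<notin> A" | "x \<in> A" | a where "a \<in> A" "x = \<nu> (Eps a)"
      | a j where "a \<in> A" "j < q a" "x = \<nu> (Del a j)"
      | a j i where "a \<in> A" "j < q a" "i < l" "x = \<nu> (Sub a j i)"
      using x unfolding verts' by blast
    then show ?thesis
    proof cases
      case 1
      have i: "inc T' x = inc T x" using 1 inc_old by blast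
      have e: "?lb c = lb c" if "c \<in> set (inc T x)" for c
        using split_label_old child_in[OF 1(1) that] by blast
      have xM: "x \<notin> M" using x by blast
      have "sorted_wrt (\<lambda>x y. slt (?lb x) (?lb y)) (inc T x)"
        by (rule sorted_wrt_mono_rel[OF _ old(2)[OF 1(1) xM]]) (simp only: e)
      moreover have u: "(\<Union>c\<in>set (inc T x). ?lb c) = (\<Union>c\<in>set (inc T x). lb c)" using e by (rule SUP_cong[OF refl])
      have "?lb x = (\<Union>c\<in>set (inc T x). ?lb c)"
        using old(1)[OF 1(1) xM] split_label_old[OF 1(1)] u by (simp only:)
      ultimately show ?thesis unfolding i by (rule conjI[rotated])
    next
      case 2
      then have xv: "x \<in> verts T" using A_verts by blast
      have e: "\<forall>c\<in>set (inc T x) - set (block p l (inc T x)). ?lb c = lb c"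
      proof
        fix c assume "c \<in> set (inc T x) - set (block p l (inc T x))"
        then show "?lb c = lb c" using split_label_old[OF child_in[OF xv, of c]] by simp
      qed
      note s = sorted_replace_block[OF old(2)[OF xv AM[OF 2]] blk_len[OF 2] e dist[OF xv] split_label_simps(1)]
      have "?lb x = (\<Union>c\<in>set (inc T' x). ?lb c)"
        unfolding inc_A[OF 2] s(2) split_label_old[OF xv] by (rule old(1)[OF xv AM[OF 2]])
      then show ?thesis using s(1) unfolding inc_A[OF 2] by (rule conjI)
    next
      case (3 a)
      have "(\<Union>c\<in>set (inc T' x). ?lb c) = (\<Union>j<q a. \<Union>i<l. \<Union>c\<in>set (blk a j i). lb c)"
        by (simp add: 3(2) inc_Eps[OF 3(1)] atLeast0LessThan)
      also have "\<dots> = (\<Union>i<l. \<Union>j<q a. \<Union>c\<in>set (blk a j i). lb c)" by blast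
      also have "\<dots> = (\<Union>i<l. lb (inc T a ! (p + i)))" using blk_lb[OF 3(1)] by simp
      also have "\<dots> = ?lb x" unfolding 3(2) split_label_simps set_block_conv[OF blk_len[OF 3(1)]] by blast
      finally have u: "?lb x = (\<Union>c\<in>set (inc T' x). ?lb c)" ..
      have "slt (\<Union>i<l. \<Union>c\<in>set (blk a j i). lb c) (\<Union>i<l. \<Union>c\<in>set (blk a j' i). lb c)"
        if jj: "j < j'" "j' < q a" for j j'
        unfolding slt_def
      proof (intro ballI)
        fix s t assume "s \<in> (\<Union>i<l. \<Union>c\<in>set (blk a j i). lb c)" "t \<in> (\<Union>i<l. \<Union>c\<in>set (blk a j' i). lb c)"
        then obtain i i' where ii: "i < l" "s \<in> (\<Union>c\<in>set (blk a j i). lb c)" "i' < l" "t \<in> (\<Union>c\<in>set (blk a j' i'). lb c)"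
          by blast
        have "lb (inc T a ! (p + i)) \<noteq> {}" "lb (inc T a ! (p + i')) \<noteq> {}"
          using ii blk_sub_lb[OF 3(1)] by blast+
        then have "i = i'" using single[OF 3(1) ii(1,3)] by blast
        then show "s < t" using blk_lt[OF 3(1) ii(1) jj] ii(2,4) unfolding slt_def by blast
      qed
      then have "sorted_wrt (\<lambda>x y. slt (?lb x) (?lb y)) (inc T' x)"
        unfolding 3(2) inc_Eps[OF 3(1)] by (simp add: sorted_wrt_iff_nth_less)
      then show ?thesis using u by blast
    next
      case (4 a j)
      have u: "?lb x = (\<Union>c\<in>set (inc T' x). ?lb c)"
        by (simp add: 4(3) inc_Del[OF 4(1,2)] atLeast0LessThan)
      have "slt (\<Union>c\<in>set (blk a j i). lb c) (\<Union>c\<in>set (blk a j i'). lb c)" if ii: "i < i'" "i' < l" for i i'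
      proof -
        have il: "i < l" using ii by simp
        have "lb (inc T a ! (p + i)) = {} \<or> lb (inc T a ! (p + i')) = {}"
          by (rule single[OF 4(1) il ii(2)]) (use ii in simp)
        then show ?thesis using blk_sub_lb[OF 4(1) il, of j] blk_sub_lb[OF 4(1) ii(2), of j] unfolding slt_def by blast
      qed
      then have "sorted_wrt (\<lambda>x y. slt (?lb x) (?lb y)) (inc T' x)"
        unfolding 4(3) inc_Del[OF 4(1,2)] by (simp add: sorted_wrt_iff_nth_less)
      then show ?thesis using u by blast
    next
      case (5 a j i)
      have i: "inc T' x = blk a j i" using inc_Sub[OF 5(1-3)] by (simp add: blk_def 5(4))
      have e: "?lb c = lb c" if "c \<in> set (blk a j i)" for c
        using split_label_old blkv[OF 5(1,3) that] by blast
      have "sorted_wrt (\<lambda>x y. slt (lb x) (lb y)) (blk a j i)"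
        using old(2)[OF rmv[OF 5(1,3)]] by (simp add: blk_def block_def sorted_wrt_take sorted_wrt_drop)
      then have "sorted_wrt (\<lambda>x y. slt (?lb x) (?lb y)) (blk a j i)"
        by (rule sorted_wrt_mono_rel[rotated]) (simp only: e)
      moreover have "(\<Union>c\<in>set (blk a j i). ?lb c) = (\<Union>c\<in>set (blk a j i). lb c)" using e by (rule SUP_cong[OF refl])
      ultimately show ?thesis unfolding i by (simp add: 5(4))
    qed
  qed
  moreover have "?lb x = {} \<or> (\<exists>k. ?lb x = {k})" if "x \<in> M" for x
    using assms(1) that split_label_old Mv unfolding ilab_def by (metis subsetD)
  ultimately show ?thesis unfolding ilab_def by blast
qed

end


section \<open>Moves refine the 2-bracketing\<close>

text \<open>What remains to be shown for each kind of move: labels of the new pair that agree with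
  the old ones at old vertices, and the preservation of the order of siblings below old seams.
  \<open>tb_lt_local\<close> extends the latter to the whole order.\<close>

lemma refine_le:
  assumes "stable_tree_pair r n P" "lbl r n P' K' Q'"
    and st: "verts (stree P) \<subseteq> verts (stree P')" "\<And>s. s \<in> verts (stree P) \<Longrightarrow> K' s = seam_label P s"
    and nd: "nodes P \<subseteq> nodes P'" "\<And>v. v \<in> nodes P \<Longrightarrow> coh P' v = coh P v \<and> Q' v = bub_label P v"
    and sib: "\<And>\<beta> i j. \<beta> \<in> Vseam P \<Longrightarrow> i < j \<Longrightarrow> j < length (inb P \<beta>) \<Longrightarrow>
      left_of (bub P') (inb P \<beta> ! i) (inb P \<beta> ! j)"
  shows "(brackets P', brackets P) \<in> W_br_le r n"
    and "v \<in> nodes P \<Longrightarrow> brk P' v = brk P v"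
proof -
  interpret P: stable_pair r n P by standard (rule assms(1))
  interpret P': stable_pair r n P' by standard (rule lbl_unique(1)[OF assms(2)])
  have K: "seam_label P' s = seam_label P s" if "s \<in> verts (stree P)" for s
    using lbl_unique(2)[OF assms(2)] st that by (metis subsetD)
  show b: "brk P' v = brk P v" if v: "v \<in> nodes P" for v
  proof -
    have "bub_label P' v = bub_label P v"
      using lbl_unique(3)[OF assms(2) P'.node_verts] nd v by (metis subsetD)
    then show ?thesis using nd(2)[OF v] K[OF P.coh_node[OF v]] by (simp add: brk_def)
  qed
  have twos: "twos (brackets P) \<subseteq> twos (brackets P')"
  proof
    fix X assume "X \<in> twos (brackets P)"
    then obtain v where "v \<in> nodes P" "X = brk P v" unfolding brackets_simps by blast
    then show "X \<in> twos (brackets P')" using b nd(1) unfolding brackets_simps by (metis image_eqI subsetD)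
  qed
  show "(brackets P', brackets P) \<in> W_br_le r n"
  proof (rule W_br_leI[OF P.brackets_bracketing P'.brackets_bracketing _ twos])
    show "ones (brackets P) \<subseteq> ones (brackets P')"
    proof
      fix B assume "B \<in> ones (brackets P)"
      then obtain s where "s \<in> verts (stree P)" "B = seam_label P s" unfolding brackets_simps by blast
      then show "B \<in> ones (brackets P')" using K st(1) unfolding brackets_simps by (metis image_eqI subsetD)
    qed
    show "tb_lt (brackets P) \<subseteq> tb_lt (brackets P')"
    proof (rule P.tb_lt_local[OF P'.brackets_bracketing twos])
      fix \<beta> assume be: "\<beta> \<in> Vseam P"
      show "sorted_wrt (\<lambda>x y. (brk P x, brk P y) \<in> tb_lt (brackets P')) (inb P \<beta>)"
        unfolding sorted_wrt_iff_nth_less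
      proof (intro allI impI)
        fix i j assume ij: "i < j" "j < length (inb P \<beta>)"
        let ?x = "inb P \<beta> ! i" and ?y = "inb P \<beta> ! j"
        have m: "?x \<in> set (inb P \<beta>)" "?y \<in> set (inb P \<beta>)" using ij by simp_all
        have xn: "?x \<in> nodes P" "?y \<in> nodes P" using P.seam_children[OF be] m by blast+
        have "coh P ?x = coh P ?y" using P.coh_seam[OF be m(1)] P.coh_seam[OF be m(2)] by simp
        then have "coh P' ?x = coh P' ?y" using nd(2) xn by simp
        then have "(brk P' ?x, brk P' ?y) \<in> tb_lt (brackets P')"
          using P'.tb_ltI[of ?x ?y] xn nd(1) sib[OF be ij] by blast
        then show "(brk P ?x, brk P ?y) \<in> tb_lt (brackets P')" using b xn by simp
      qed
    qed
  qed
qed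

section \<open>Moves of type 1\<close>

definition move1_data :: "('v, 'w) tree_pair \<Rightarrow> ('v, 'w) tree_pair \<Rightarrow> 'v \<Rightarrow> 'v \<Rightarrow> nat \<Rightarrow> nat \<Rightarrow> 'v \<Rightarrow> 'v \<Rightarrow> bool" where
  "move1_data P P' \<alpha> \<beta> p l \<delta> \<epsilon> \<longleftrightarrow>
        \<alpha> \<in> Vcomp P \<and> \<beta> \<in> set (inb P \<alpha>) \<and>
        2 \<le> l \<and> p + l \<le> length (inb P \<beta>) \<and>
        (length (inb P \<alpha>) = 1 \<longrightarrow> l < length (inb P \<beta>)) \<and>
        \<delta> \<notin> verts (bub P) \<and> \<epsilon> \<notin> verts (bub P) \<and> \<delta> \<noteq> \<epsilon> \<and>
        verts (bub P') = verts (bub P) \<union> {\<delta>, \<epsilon>} \<and>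
        rt (bub P') = rt (bub P) \<and>
        inb P' \<beta> = replace_block p l \<delta> (inb P \<beta>) \<and>
        inb P' \<delta> = [\<epsilon>] \<and>
        inb P' \<epsilon> = block p l (inb P \<beta>) \<and>
        (\<forall>x\<in>verts (bub P) - {\<beta>}. inb P' x = inb P x) \<and>
        solid P' = solid P \<union> {(\<epsilon>, \<delta>)} \<and>
        Vcomp P' = Vcomp P \<union> {\<delta>} \<and>
        Vseam P' = Vseam P \<union> {\<epsilon>} \<and>
        Vmark P' = Vmark P \<and>
        stree P' = stree P \<and>
        coh P' \<delta> = coh P \<beta> \<and> coh P' \<epsilon> = coh P \<beta> \<and>
        (\<forall>x\<in>verts (bub P). coh P' x = coh P x)"

lemma move1_iff: "move1 P P' \<longleftrightarrow> (\<exists>\<alpha> \<beta> p l \<delta> \<epsilon>. move1_data P P' \<alpha> \<beta> p l \<delta> \<epsilon>)"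
  by (simp only: move1_def move1_data_def)

locale move1_pair = stable_pair r n P for r n and P :: "('v, 'w) tree_pair" +
  fixes P' \<alpha> \<beta> p l \<delta> \<epsilon>
  assumes data: "move1_data P P' \<alpha> \<beta> p l \<delta> \<epsilon>"
begin

lemma mv: "\<alpha> \<in> Vcomp P" "\<beta> \<in> set (inb P \<alpha>)" "2 \<le> l" "p + l \<le> length (inb P \<beta>)"
  "length (inb P \<alpha>) = 1 \<Longrightarrow> l < length (inb P \<beta>)"
  "\<delta> \<notin> verts (bub P)" "\<epsilon> \<notin> verts (bub P)" "\<delta> \<noteq> \<epsilon>"
  "verts (bub P') = verts (bub P) \<union> {\<delta>, \<epsilon>}" "rt (bub P') = rt (bub P)"
  "inb P' \<beta> = replace_block p l \<delta> (inb P \<beta>)" "inb P' \<delta> = [\<epsilon>]" "inb P' \<epsilon> = block p l (inb P \<beta>)"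
  "solid P' = solid P \<union> {(\<epsilon>, \<delta>)}" "Vcomp P' = Vcomp P \<union> {\<delta>}" "Vseam P' = Vseam P \<union> {\<epsilon>}"
  "Vmark P' = Vmark P" "stree P' = stree P" "coh P' \<delta> = coh P \<beta>" "coh P' \<epsilon> = coh P \<beta>"
  and mv_inc: "x \<in> verts (bub P) \<Longrightarrow> x \<noteq> \<beta> \<Longrightarrow> inb P' x = inb P x"
  and mv_coh: "x \<in> verts (bub P) \<Longrightarrow> coh P' x = coh P x"
  using data by (auto simp: move1_data_def)

lemma bs: "\<beta> \<in> Vseam P" using comp_children mv(1,2) .
lemma bv: "\<beta> \<in> verts (bub P)" using type_verts(2) bs .

text \<open>The move is the insertion of \<open>\<epsilon>\<close> above the block, followed by that of \<open>\<delta>\<close> above \<open>\<epsilon>\<close>.\<close>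

definition "mid = \<lparr>verts = insert \<epsilon> (verts (bub P)), rt = rt (bub P),
  inc = (inb P)(\<beta> := replace_block p l \<epsilon> (inb P \<beta>), \<epsilon> := block p l (inb P \<beta>))\<rparr>"

lemma be: "\<beta> \<noteq> \<epsilon>" "\<beta> \<noteq> \<delta>" using bv mv(6,7) by blast+

lemma ins1: "inserts (bub P) mid \<beta> p l \<epsilon>"
  unfolding inserts_def mid_def using bv mv(3,4,7) be by auto

lemma mid_block: "block p 1 (inc mid \<beta>) = [\<epsilon>]"
  using mv(3,4) be by (simp add: mid_def block_def replace_block_def)

lemma ins2: "inserts mid (bub P') \<beta> p 1 \<delta>"
  unfolding inserts_def
proof (intro conjI)
  show "p + 1 \<le> length (inc mid \<beta>)" using mv(3,4) be by (simp add: mid_def length_replace_block)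
  show "inb P' \<delta> = block p 1 (inc mid \<beta>)" unfolding mid_block by (rule mv(12))
  show "inb P' \<beta> = replace_block p 1 \<delta> (inc mid \<beta>)"
    using mv(3,4) be by (simp add: mv(11) mid_def replace_block_def)
  show "\<forall>x\<in>verts mid - {\<beta>}. inb P' x = inc mid x"
    using mv_inc mv(7,13) be by (auto simp: mid_def)
qed (use mv bv in \<open>auto simp: mid_def\<close>)

sublocale I1: insertion "bub P" mid \<beta> p l \<epsilon> by standard (rule ins1)
sublocale I2: insertion mid "bub P'" \<beta> p 1 \<delta> by standard (rule I1.ins_rrt, rule ins2)

definition "Q' v = (if v = \<delta> \<or> v = \<epsilon> then (\<lambda>i. \<Union>\<gamma>\<in>set (block p l (inb P \<beta>)). Q \<gamma> i) else Q v)"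

lemma Q'_ilab: "ilab (bub P') (Vmark P) (\<lambda>v. Q' v i)"
proof -
  let ?U = "\<Union>\<gamma>\<in>set (block p l (inb P \<beta>)). Q \<gamma> i"
  have "ilab mid (Vmark P) ((\<lambda>v. Q v i)(\<epsilon> := ?U))"
    by (rule I1.ins_ilab[OF labelled_tree.ilab[OF QL] marks_leaves])
  then have "ilab (bub P') (Vmark P) (((\<lambda>v. Q v i)(\<epsilon> := ?U))(\<delta> := \<Union>x\<in>set (block p 1 (inc mid \<beta>)). ((\<lambda>v. Q v i)(\<epsilon> := ?U)) x))"
    by (rule I2.ins_ilab) (use marks_leaves I1.ins_leaves in simp)
  moreover have "((\<lambda>v. Q v i)(\<epsilon> := ?U))(\<delta> := \<Union>x\<in>set (block p 1 (inc mid \<beta>)). ((\<lambda>v. Q v i)(\<epsilon> := ?U)) x) = (\<lambda>v. Q' v i)"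
    unfolding mid_block by (auto simp: Q'_def fun_eq_iff)
  ultimately show ?thesis by simp
qed

lemma blk_sub: "\<gamma> \<in> set (block p l (inb P \<beta>)) \<Longrightarrow> \<gamma> \<in> set (inb P \<beta>)"
  by (rule subsetD[OF set_block])

lemma set_b: "set (inb P' \<beta>) = insert \<delta> (set (inb P \<beta>) - set (block p l (inb P \<beta>)))"
  unfolding mv(11) by (rule set_replace_block_distinct[OF mv(4) B.dist[OF bv]]) (use B.child_in[OF bv] mv(6) in blast)

lemma comp_not_b: "a \<in> Vcomp P \<Longrightarrow> a \<noteq> \<beta>" "\<mu> \<in> Vmark P \<Longrightarrow> \<mu> \<noteq> \<beta>"
  using bs disj by blast+

lemma inb_comp: "a \<in> Vcomp P \<Longrightarrow> inb P' a = inb P a"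
  using mv_inc type_verts comp_not_b by blast

lemma coh_children: "v \<in> verts (bub P) \<Longrightarrow> c \<in> set (inb P v) \<Longrightarrow> coh P' c = coh P c"
  using mv_coh B.child_in by blast

lemma good': "good P'"
  unfolding good_def
proof (intro conjI ballI allI impI)
  show "is_rrt (bub P')" by (rule I2.ins_rrt)
  show "is_rrt (stree P')" unfolding mv(18) by (rule S.rrt)
  have new: "\<delta> \<notin> Vcomp P" "\<delta> \<notin> Vseam P" "\<delta> \<notin> Vmark P" "\<epsilon> \<notin> Vcomp P" "\<epsilon> \<notin> Vseam P" "\<epsilon> \<notin> Vmark P"
    using mv(6,7) verts_bub by blast+
  show "verts (bub P') = Vcomp P' \<union> Vseam P' \<union> Vmark P'"
    unfolding mv(9,15-17) using verts_bub by blast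
  show "Vcomp P' \<inter> Vseam P' = {}" "Vcomp P' \<inter> Vmark P' = {}" "Vseam P' \<inter> Vmark P' = {}"
    unfolding mv(15-17) using disj new mv(8) by blast+
  show "rt (bub P') \<notin> Vseam P'" unfolding mv(10,16) using rt_not_seam B.rt_in mv(7) by blast
  show "solid P' = {(b, a). a \<in> Vcomp P' \<and> b \<in> set (inb P' a)}"
  proof (rule set_eqI)
    fix e :: "'v \<times> 'v"
    obtain b a where e: "e = (b, a)" by (cases e)
    show "e \<in> solid P' \<longleftrightarrow> e \<in> {(b, a). a \<in> Vcomp P' \<and> b \<in> set (inb P' a)}"
      unfolding mv(14,15) e solid_eq using inb_comp mv(12) new by (cases "a = \<delta>") auto
  qed
  show "inb P' a \<noteq> []" if "a \<in> Vcomp P'" for a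
    using that inb_comp mv(12) comp_ne unfolding mv(15) by auto
  show "set (inb P' a) \<subseteq> Vseam P'" if "a \<in> Vcomp P'" for a
    using that inb_comp mv(12) comp_children unfolding mv(15,16) by auto
  show "set (inb P' s) \<subseteq> Vcomp P' \<union> Vmark P'" if s: "s \<in> Vseam P'" for s
  proof -
    consider "s = \<epsilon>" | "s = \<beta>" | "s \<in> Vseam P" "s \<noteq> \<beta>" using s unfolding mv(16) by blast
    then show ?thesis
    proof cases
      case 1
      then show ?thesis using seam_children[OF bs blk_sub] mv(13) unfolding mv(15,17) by auto
    next
      case 2
      then show ?thesis using seam_children[OF bs] set_b unfolding mv(15,17) by auto
    next
      case 3
      then show ?thesis using seam_children mv_inc[OF type_verts(2)] unfolding mv(15,17) by auto
    qed
  qed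
  show "inb P' \<mu> = []" if "\<mu> \<in> Vmark P'" for \<mu>
    using that mark_leaf mv_inc type_verts(3) comp_not_b unfolding mv(17) by metis
  have one: "2 \<le> length (inb P' b) \<and> coh P' b = coh P' a" if a: "a \<in> Vcomp P'" "inb P' a = [b]" for a b
  proof (cases "a = \<delta>")
    case True
    then have "b = \<epsilon>" using a(2) mv(12) by simp
    then show ?thesis using True mv(3,13,19,20) length_block[OF mv(4)] by simp
  next
    case False
    then have ac: "a \<in> Vcomp P" using a(1) unfolding mv(15) by blast
    then have ib: "inb P a = [b]" using a(2) inb_comp by simp
    have av: "a \<in> verts (bub P)" using type_verts ac by blast
    have bv': "b \<in> verts (bub P)" using B.child_in[OF av] ib by simp
    have c: "coh P' b = coh P' a" using comp1[OF ac ib] mv_coh av bv' by simp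
    show ?thesis
    proof (cases "b = \<beta>")
      case True
      then have "a = \<alpha>" using B.parent_unique[of a \<alpha> \<beta>] av type_verts mv(1,2) ib by simp
      \<comment> \<open>As \<open>\<beta>\<close> is the only seam of \<open>\<alpha>\<close>, the
        block is not the entire list; at least one vertex remains beside \<open>\<delta>\<close>, as
        stability of \<open>\<alpha>\<close> demands.\<close>
      then have "l < length (inb P \<beta>)" using mv(5) ib by simp
      then show ?thesis using c True by (simp add: mv(11) length_replace_block[OF mv(4)])
    next
      case False
      then show ?thesis using c mv_inc[OF bv'] comp1[OF ac ib] by simp
    qed
  qed
  show "2 \<le> length (inb P' b)" "coh P' b = coh P' a" if a: "a \<in> Vcomp P'" "inb P' a = [b]" for a b
    using one[OF a] by blast+
  show "\<exists>b\<in>set (inb P' a). inb P' b \<noteq> []" if a: "a \<in> Vcomp P'" "2 \<le> length (inb P' a)" for a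
  proof -
    have "a \<noteq> \<delta>" using a(2) mv(12) by auto
    then have ac: "a \<in> Vcomp P" using a(1) unfolding mv(15) by blast
    then have i: "inb P' a = inb P a" by (rule inb_comp)
    then obtain b where b: "b \<in> set (inb P a)" "inb P b \<noteq> []" using comp2_ex[OF ac] a(2) by auto
    have "inb P' b \<noteq> []"
    proof (cases "b = \<beta>")
      case True
      then show ?thesis by (simp add: mv(11) replace_block_def)
    next
      case False
      then show ?thesis using mv_inc[OF B.child_in[OF type_verts(1)[OF ac] b(1)]] b(2) by simp
    qed
    then show ?thesis using i b(1) by auto
  qed
  show "map (coh P') (inb P' a) = ins P' (coh P' a)" if a: "a \<in> Vcomp P'" "2 \<le> length (inb P' a)" for a
  proof -
    have "a \<noteq> \<delta>" using a(2) mv(12) by auto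
    then have ac: "a \<in> Vcomp P" using a(1) unfolding mv(15) by blast
    then have i: "inb P' a = inb P a" by (rule inb_comp)
    have e: "map (coh P') (inb P a) = map (coh P) (inb P a)"
      using coh_children[OF type_verts(1)[OF ac]] by simp
    have "2 \<le> length (inb P a)" using a(2) i by simp
    then show ?thesis unfolding i e mv(18) mv_coh[OF type_verts(1)[OF ac]] by (rule comp2_map[OF ac])
  qed
  show "coh P' \<gamma> = coh P' s" if s: "s \<in> Vseam P'" "\<gamma> \<in> set (inb P' s)" for s \<gamma>
  proof -
    consider "s = \<epsilon>" | "s = \<beta>" | "s \<in> Vseam P" "s \<noteq> \<beta>" using s(1) unfolding mv(16) by blast
    then show ?thesis
    proof cases
      case 1
      then have g: "\<gamma> \<in> set (inb P \<beta>)" using s(2) mv(13) blk_sub by simp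
      then show ?thesis using coh_seam[OF bs g] coh_children[OF bv g] 1 mv(20) by simp
    next
      case 2
      then consider "\<gamma> = \<delta>" | "\<gamma> \<in> set (inb P \<beta>)" using s(2) set_b by blast
      then show ?thesis
        using coh_seam[OF bs] coh_children[OF bv] 2 mv(19) mv_coh[OF bv] by cases simp_all
    next
      case 3
      then have "\<gamma> \<in> set (inb P s)" using s(2) mv_inc[OF type_verts(2)[OF 3(1)]] by simp
      then show ?thesis using coh_seam[OF 3(1)] coh_children[OF type_verts(2)[OF 3(1)]] mv_coh[OF type_verts(2)[OF 3(1)]] by simp
    qed
  qed
  show "coh P' (rt (bub P')) = rt (stree P')" using mv_coh[OF B.rt_in] coh_rt by (simp add: mv(10,18))
  show "coh P' ` Vmark P' \<subseteq> leaves (stree P')"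
    using coh_mark mv_coh[OF type_verts(3)] unfolding mv(17,18) by auto
  show "length (ins P' s) \<noteq> 1" if "s \<in> verts (stree P')" for s
    using that seam_tree_stable unfolding mv(18) by blast
qed

lemma lbl': "lbl r n P' K Q'"
  unfolding lbl_def
proof (intro conjI allI ballI)
  show "good P'" by (rule good')
  show "ilab (stree P') (leaves (stree P')) K" unfolding mv(18) by (rule KL.ilab)
  show "K (rt (stree P')) = {1..r}" unfolding mv(18) by (rule K_rt)
  show "K x \<noteq> {}" if "x \<in> leaves (stree P')" for x using K_leaf[of x] that unfolding mv(18) by auto
  show "ilab (bub P') (Vmark P') (\<lambda>v. Q' v i)" for i unfolding mv(17) by (rule Q'_ilab)
  show "Q' (rt (bub P')) i = {1..if i \<in> {1..r} then n i else 0}" for i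
  proof -
    have "rt (bub P) \<noteq> \<delta>" "rt (bub P) \<noteq> \<epsilon>" using mv(6,7) B.rt_in by blast+
    then show ?thesis using Q_rt[of i] by (simp add: Q'_def mv(10))
  qed
  fix \<mu> i assume "\<mu> \<in> Vmark P'"
  then have mu: "\<mu> \<in> Vmark P" "\<mu> \<in> verts (bub P)" using type_verts unfolding mv(17) by blast+
  then have "\<mu> \<noteq> \<delta>" "\<mu> \<noteq> \<epsilon>" using mv(6,7) by blast+
  then show "Q' \<mu> i \<noteq> {} \<longleftrightarrow> K (coh P' \<mu>) = {i}" using Q_mark[OF mu(1)] mv_coh[OF mu(2)] by (simp add: Q'_def)
qed

lemma result:
  shows "(brackets P', brackets P) \<in> W_br_le r n" "v \<in> nodes P \<Longrightarrow> brk P' v = brk P v"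
    and "brk P' \<delta> = (K (coh P \<beta>), \<lambda>i. \<Union>\<gamma>\<in>set (block p l (inb P \<beta>)). Q \<gamma> i)"
proof -
  have old: "nodes P \<subseteq> nodes P'" unfolding mv(15,17) by blast
  have lab: "coh P' v = coh P v \<and> Q' v = Q v" if "v \<in> nodes P" for v
  proof -
    have "v \<noteq> \<delta>" "v \<noteq> \<epsilon>" using node_verts[OF that] mv(6,7) by blast+
    then show ?thesis using mv_coh[OF node_verts[OF that]] by (simp add: Q'_def)
  qed
  have sib: "left_of (bub P') (inb P b ! i) (inb P b ! j)" if "b \<in> Vseam P" "i < j" "j < length (inb P b)" for b i j
    using I2.ins_left_of[OF I1.ins_left_of[OF B.left_of_child[OF type_verts(2)[OF that(1)] that(2,3)]]] .
  have sub: "verts (stree P) \<subseteq> verts (stree P')" by (simp add: mv(18))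
  note r = refine_le[OF stable lbl' sub refl old lab sib]
  show "(brackets P', brackets P) \<in> W_br_le r n" by (rule r(1))
  show "v \<in> nodes P \<Longrightarrow> brk P' v = brk P v" by (rule r(2))
  have dv: "\<delta> \<in> verts (bub P')" by (simp add: mv(9))
  have "coh P \<beta> \<in> verts (stree P')" using coh_verts[OF bv] by (simp add: mv(18))
  then have "seam_label P' (coh P \<beta>) = K (coh P \<beta>)" by (rule lbl_unique(2)[OF lbl'])
  then show "brk P' \<delta> = (K (coh P \<beta>), \<lambda>i. \<Union>\<gamma>\<in>set (block p l (inb P \<beta>)). Q \<gamma> i)"
    using lbl_unique(3)[OF lbl' dv] by (simp add: brk_def mv(19) Q'_def)
qed

end

text \<open>A common frame for moves of types 2 and 3. Here \<open>g a\<close> is the image of the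
  new vertices \<open>Eps\<close> and \<open>Del\<close> at \<open>a\<close>: the inserted vertex of
  the seam tree for type 2, and the image of \<open>a\<close> itself for type 3. \<open>K'\<close>
  labels the new seam tree. In \<open>kind\<close> the first alternative is type 2, where
  \<open>a\<close> keeps several seams, and the second is type 3, where \<open>a\<close> is left
  with the single seam \<open>Eps\<close>.\<close>

locale split_move = stable_pair r n P for r n and P :: "('v, 'w) tree_pair" +
  fixes P' :: "('v, 'w) tree_pair" and A p l q b \<nu> and g :: "'v \<Rightarrow> 'w" and K' :: "'w \<Rightarrow> nat set"
  assumes sb: "split_bubble P P' A p l q b \<nu>"
    and A2: "A \<subseteq> Vcomp2 P" and l2: "2 \<le> l"
    and pl: "a \<in> A \<Longrightarrow> p + l \<le> length (inb P a)"
    and sd: "a \<in> A \<Longrightarrow> splitting_data P a p l (q a) (b a)"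
    and cE: "a \<in> A \<Longrightarrow> coh P' (\<nu> (Eps a)) = g a"
    and cD: "a \<in> A \<Longrightarrow> j < q a \<Longrightarrow> coh P' (\<nu> (Del a j)) = g a"
    and cS: "a \<in> A \<Longrightarrow> j < q a \<Longrightarrow> i < l \<Longrightarrow> coh P' (\<nu> (Sub a j i)) = coh P (inb P a ! (p + i))"
    and s_rrt: "is_rrt (stree P')" and s_leaves: "leaves (stree P') = leaves (stree P)"
    and s_rt: "rt (stree P') = rt (stree P)" and s_sub: "verts (stree P) \<subseteq> verts (stree P')"
    and s_one: "s \<in> verts (stree P') \<Longrightarrow> length (ins P' s) \<noteq> 1"
    and K'_ilab: "ilab (stree P') (leaves (stree P')) K'"
    and K'_old: "s \<in> verts (stree P) \<Longrightarrow> K' s = seam_label P s"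
    and g_in: "a \<in> A \<Longrightarrow> g a \<in> verts (stree P')"
    and ins_other: "x \<in> Vcomp2 P \<Longrightarrow> x \<notin> A \<Longrightarrow> ins P' (coh P x) = ins P (coh P x)"
    and ins_g: "a \<in> A \<Longrightarrow> ins P' (g a) = map (coh P) (block p l (inb P a))"
    and kind: "a \<in> A \<Longrightarrow>
      l < length (inb P a) \<and> ins P' (coh P a) = replace_block p l (g a) (ins P (coh P a)) \<or>
      l = length (inb P a) \<and> 2 \<le> q a \<and> g a = coh P a"
begin

definition "rm = (\<Union>a\<in>A. set (block p l (inb P a)))"

lemma A_comp: "a \<in> A \<Longrightarrow> a \<in> Vcomp P" "a \<in> A \<Longrightarrow> 2 \<le> length (inb P a)"
  using A2 unfolding Vcomp2_def by blast+

lemma removed_eq: "{inb P a ! (p + i) | a i. a \<in> A \<and> i < l} = rm"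
  unfolding rm_def using set_block_conv[OF pl] by auto

lemmas sb' = sb[unfolded split_bubble_def Let_def removed_eq]

lemmas inj_nu = sb'[THEN conjunct1]
  and nu_new = sb'[THEN conjunct2, THEN conjunct1]
  and verts' = sb'[THEN conjunct2, THEN conjunct2, THEN conjunct1]
  and rt' = sb'[THEN conjunct2, THEN conjunct2, THEN conjunct2, THEN conjunct1]
  and inc_all = sb'[THEN conjunct2, THEN conjunct2, THEN conjunct2, THEN conjunct2, THEN conjunct1]
  and inc_old_all = sb'[THEN conjunct2, THEN conjunct2, THEN conjunct2, THEN conjunct2, THEN conjunct2, THEN conjunct1]
  and solid' = sb'[THEN conjunct2, THEN conjunct2, THEN conjunct2, THEN conjunct2, THEN conjunct2, THEN conjunct2, THEN conjunct1]
  and comp' = sb'[THEN conjunct2, THEN conjunct2, THEN conjunct2, THEN conjunct2, THEN conjunct2, THEN conjunct2, THEN conjunct2, THEN conjunct1]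
  and seam' = sb'[THEN conjunct2, THEN conjunct2, THEN conjunct2, THEN conjunct2, THEN conjunct2, THEN conjunct2, THEN conjunct2, THEN conjunct2, THEN conjunct1]
  and mark' = sb'[THEN conjunct2, THEN conjunct2, THEN conjunct2, THEN conjunct2, THEN conjunct2, THEN conjunct2, THEN conjunct2, THEN conjunct2, THEN conjunct2, THEN conjunct1]
  and coh_all = sb'[THEN conjunct2, THEN conjunct2, THEN conjunct2, THEN conjunct2, THEN conjunct2, THEN conjunct2, THEN conjunct2, THEN conjunct2, THEN conjunct2, THEN conjunct2]

lemma inc_A: "a \<in> A \<Longrightarrow> inb P' a = replace_block p l (\<nu> (Eps a)) (inb P a)"
  and inc_Eps: "a \<in> A \<Longrightarrow> inb P' (\<nu> (Eps a)) = map (\<lambda>j. \<nu> (Del a j)) [0..<q a]"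
  and inc_Del: "a \<in> A \<Longrightarrow> j < q a \<Longrightarrow> inb P' (\<nu> (Del a j)) = map (\<lambda>i. \<nu> (Sub a j i)) [0..<l]"
  and inc_Sub: "a \<in> A \<Longrightarrow> j < q a \<Longrightarrow> i < l \<Longrightarrow> inb P' (\<nu> (Sub a j i)) =
    block (\<Sum>m<j. b a m i) (b a j i) (inb P (inb P a ! (p + i)))"
  and inc_old: "x \<in> verts (bub P) - rm - A \<Longrightarrow> inb P' x = inb P x"
  and coh_old: "x \<in> verts (bub P) - rm \<Longrightarrow> coh P' x = coh P x"
proof -
  {
    assume a: "a \<in> A"
    note h = inc_all[THEN bspec, OF a]
    show "inb P' a = replace_block p l (\<nu> (Eps a)) (inb P a)" by (rule h[THEN conjunct1])
    show "inb P' (\<nu> (Eps a)) = map (\<lambda>j. \<nu> (Del a j)) [0..<q a]" by (rule h[THEN conjunct2, THEN conjunct1])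
    assume j: "j < q a"
    note h2 = h[THEN conjunct2, THEN conjunct2, rule_format, OF j]
    show "inb P' (\<nu> (Del a j)) = map (\<lambda>i. \<nu> (Sub a j i)) [0..<l]" by (rule h2[THEN conjunct1])
    assume i: "i < l"
    show "inb P' (\<nu> (Sub a j i)) = block (\<Sum>m<j. b a m i) (b a j i) (inb P (inb P a ! (p + i)))"
      by (rule h2[THEN conjunct2, rule_format, OF i])
  }
  show "x \<in> verts (bub P) - rm - A \<Longrightarrow> inb P' x = inb P x" by (rule inc_old_all[THEN bspec])
  show "x \<in> verts (bub P) - rm \<Longrightarrow> coh P' x = coh P x" by (rule coh_all[THEN bspec])
qed

lemma rm_seam: "rm \<subseteq> Vseam P"
proof
  fix x assume "x \<in> rm"
  then obtain a where a: "a \<in> A" "x \<in> set (block p l (inb P a))" unfolding rm_def by blast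
  show "x \<in> Vseam P" using comp_children[OF A_comp(1)[OF a(1)] subsetD[OF set_block a(2)]] .
qed

sublocale tree_split "bub P" "bub P'" A p l q b \<nu> rm
proof
  show "A \<subseteq> verts (bub P)" using A_comp type_verts by blast
  show "A \<inter> rm = {}" using A_comp(1) rm_seam disj by blast
  show "length (inb P (inb P a ! (p + i))) = (\<Sum>j<q a. b a j i)" if "a \<in> A" "i < l" for a i
    using sd[OF that(1)] that(2) unfolding splitting_data_def by blast
qed (use pl rm_def inj_nu nu_new verts' rt' inc_A inc_Eps inc_Del inc_Sub inc_old in \<open>simp_all\<close>)

lemma comp_not_rm: "a \<in> Vcomp P \<Longrightarrow> a \<notin> rm" "a \<in> Vmark P \<Longrightarrow> a \<notin> rm"
  using rm_seam disj by blast+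

lemma set_inc_A: "a \<in> A \<Longrightarrow> set (inb P' a) = insert (\<nu> (Eps a)) (set (inb P a) - rm)"
proof -
  assume a: "a \<in> A"
  have av: "a \<in> verts (bub P)" using A_verts a by blast
  have "set (inb P' a) = insert (\<nu> (Eps a)) (set (inb P a) - set (block p l (inb P a)))"
    unfolding inc_A[OF a] by (rule set_replace_block_distinct[OF pl[OF a] B.dist[OF av]])
      (use B.child_in[OF av] nu_notin in blast)
  moreover have "x \<in> rm \<longleftrightarrow> x \<in> set (block p l (inb P a))" if "x \<in> set (inb P a)" for x
    using rm_parent[OF _ av that] a unfolding rm_def by blast
  ultimately show ?thesis by blast
qed

lemma inc_other: "x \<in> verts (bub P) \<Longrightarrow> x \<notin> rm \<Longrightarrow> x \<notin> A \<Longrightarrow> inb P' x = inb P x"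
  using inc_old by blast

lemma child_not_rm: "x \<in> verts (bub P) \<Longrightarrow> x \<notin> A \<Longrightarrow> c \<in> set (inb P x) \<Longrightarrow> c \<notin> rm"
  using rm_parent by blast

lemma coh_old': "x \<in> verts (bub P) \<Longrightarrow> x \<notin> rm \<Longrightarrow> coh P' x = coh P x"
  using coh_old by blast

lemma seam_cases:
  assumes "s \<in> Vseam P'"
  obtains (old) "s \<in> Vseam P" "s \<notin> rm" "inb P' s = inb P s" "coh P' s = coh P s"
  | (eps) a where "a \<in> A" "s = \<nu> (Eps a)" "inb P' s = map (\<lambda>j. \<nu> (Del a j)) [0..<q a]" "coh P' s = g a"
  | (sub) a j i where "a \<in> A" "j < q a" "i < l" "s = \<nu> (Sub a j i)" "inb P' s = blk a j i"
      "coh P' s = coh P (inb P a ! (p + i))" "inb P a ! (p + i) \<in> Vseam P"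
proof -
  consider "s \<in> Vseam P" "s \<notin> rm" | a where "a \<in> A" "s = \<nu> (Eps a)"
    | a j i where "a \<in> A" "j < q a" "i < l" "s = \<nu> (Sub a j i)"
    using assms unfolding seam' by blast
  then show thesis
  proof cases
    case 1
    have "s \<notin> A" using A_comp(1) disj 1(1) by blast
    then show ?thesis using old 1 inc_other coh_old' type_verts(2)[OF 1(1)] by blast
  next
    case (2 a)
    then show ?thesis using eps inc_Eps cE by blast
  next
    case (3 a j i)
    have "inb P a ! (p + i) \<in> Vseam P" using rm_nth[OF 3(1,3)] rm_seam by blast
    then show ?thesis using sub[of a j i] 3 inc_Sub[OF 3(1-3)] cS[OF 3(1-3)] by (simp add: blk_def)
  qed
qed

lemma comp_in_old: "a \<in> Vcomp P \<Longrightarrow> a \<in> verts (bub P)" by (rule type_verts(1))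

lemma coh_comp_child: "a \<in> Vcomp P \<Longrightarrow> c \<in> set (inb P a) \<Longrightarrow> c \<notin> rm \<Longrightarrow> coh P' c = coh P c"
  using coh_old' B.child_in[OF comp_in_old] by blast

lemma coh_node_old: "v \<in> nodes P \<Longrightarrow> coh P' v = coh P v"
  using coh_old' node_verts comp_not_rm by blast

lemma good': "good P'"
  unfolding good_def
proof (intro conjI ballI allI impI)
  have nu: "\<nu> x \<notin> Vcomp P" "\<nu> x \<notin> Vseam P" "\<nu> x \<notin> Vmark P" for x
    using nu_notin verts_bub by blast+
  show "is_rrt (bub P')" by (rule split_rrt)
  show "is_rrt (stree P')" by (rule s_rrt)
  show "verts (bub P') = Vcomp P' \<union> Vseam P' \<union> Vmark P'"
  proof -
    have "verts (bub P) - rm = Vcomp P \<union> (Vseam P - rm) \<union> Vmark P"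
      unfolding verts_bub using comp_not_rm by blast
    then show ?thesis unfolding verts' comp' seam' mark' by blast
  qed
  show "Vcomp P' \<inter> Vseam P' = {}"
  proof (rule ccontr)
    assume "Vcomp P' \<inter> Vseam P' \<noteq> {}"
    then obtain x where x: "x \<in> Vcomp P'" "x \<in> Vseam P'" by blast
    from x(1) consider "x \<in> Vcomp P" | a j where "x = \<nu> (Del a j)" unfolding comp' by blast
    then show False using x(2) nu disj unfolding seam' by cases auto
  qed
  show "Vcomp P' \<inter> Vmark P' = {}" unfolding comp' mark' using disj nu by blast
  show "Vseam P' \<inter> Vmark P' = {}" unfolding seam' mark' using disj nu by blast
  have "rt (bub P) \<noteq> \<nu> x" for x using B.rt_in nu_notin[of x] by metis
  then show "rt (bub P') \<notin> Vseam P'" unfolding rt' seam' using rt_not_seam by blast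
  have comp_cases': thesis if x: "x \<in> Vcomp P'"
    and "x \<in> Vcomp P \<Longrightarrow> x \<notin> A \<Longrightarrow> inb P' x = inb P x \<Longrightarrow> thesis"
    and "x \<in> A \<Longrightarrow> thesis"
    and "\<And>a j. a \<in> A \<Longrightarrow> j < q a \<Longrightarrow> x = \<nu> (Del a j) \<Longrightarrow> thesis" for x thesis
  proof -
    consider "x \<in> Vcomp P" "x \<notin> A" | "x \<in> A" | a j where "a \<in> A" "j < q a" "x = \<nu> (Del a j)"
      using x unfolding comp' by blast
    then show thesis
    proof cases
      case 1
      then show ?thesis using that(2) inc_other[OF comp_in_old comp_not_rm(1)] by blast
    qed (use that(3,4) in blast)+
  qed
  show "solid P' = {(x, y). y \<in> Vcomp P' \<and> x \<in> set (inb P' y)}"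
  proof (intro set_eqI iffI)
    fix e assume e: "e \<in> solid P'"
    then consider x y where "e = (x, y)" "y \<in> Vcomp P" "x \<in> set (inb P y)" "x \<notin> rm"
      | a where "e = (\<nu> (Eps a), a)" "a \<in> A" | a j i where "e = (\<nu> (Sub a j i), \<nu> (Del a j))" "a \<in> A" "j < q a" "i < l"
      unfolding solid' solid_eq by blast
    then show "e \<in> {(x, y). y \<in> Vcomp P' \<and> x \<in> set (inb P' y)}"
    proof cases
      case (1 x y)
      have "x \<in> set (inb P' y)"
        using 1(3,4) set_inc_A[of y] inc_other[OF comp_in_old comp_not_rm(1), OF 1(2) 1(2)] by (cases "y \<in> A") auto
      then show ?thesis using 1(1,2) by (simp add: comp')
    next
      case (2 a)
      then show ?thesis using set_inc_A[of a] A_comp(1)[of a] by (simp add: comp')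
    next
      case (3 a j i)
      then show ?thesis using inc_Del[OF 3(2,3)] by (auto simp: comp')
    qed
  next
    fix e assume "e \<in> {(x, y). y \<in> Vcomp P' \<and> x \<in> set (inb P' y)}"
    then obtain x y where e: "e = (x, y)" "y \<in> Vcomp P'" "x \<in> set (inb P' y)" by blast
    from e(2) show "e \<in> solid P'"
    proof (rule comp_cases')
      assume y: "y \<in> Vcomp P" "y \<notin> A" "inb P' y = inb P y"
      then have "x \<notin> rm" using child_not_rm[OF comp_in_old] e(3) by simp
      then show ?thesis using y e unfolding solid' solid_eq by simp
    next
      assume y: "y \<in> A"
      then have "x = \<nu> (Eps y) \<or> x \<in> set (inb P y) \<and> x \<notin> rm" using set_inc_A e(3) by blast
      then show ?thesis using y A_comp(1)[OF y] e(1) unfolding solid' solid_eq by blast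
    next
      fix a j assume y: "a \<in> A" "j < q a" "y = \<nu> (Del a j)"
      then obtain i where "i < l" "x = \<nu> (Sub a j i)" using e(3) inc_Del[OF y(1,2)] by auto
      then show ?thesis using y e(1) unfolding solid' by blast
    qed
  qed
  show "inb P' x \<noteq> []" if x: "x \<in> Vcomp P'" for x
    using x
  proof (rule comp_cases')
    show "x \<in> Vcomp P \<Longrightarrow> x \<notin> A \<Longrightarrow> inb P' x = inb P x \<Longrightarrow> inb P' x \<noteq> []" using comp_ne by simp
    show "x \<in> A \<Longrightarrow> inb P' x \<noteq> []" by (simp add: inc_A replace_block_def)
    show "\<And>a j. a \<in> A \<Longrightarrow> j < q a \<Longrightarrow> x = \<nu> (Del a j) \<Longrightarrow> inb P' x \<noteq> []" using l2 by (simp add: inc_Del)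
  qed
  show "set (inb P' x) \<subseteq> Vseam P'" if x: "x \<in> Vcomp P'" for x
    using x
  proof (rule comp_cases')
    assume "x \<in> Vcomp P" "x \<notin> A" "inb P' x = inb P x"
    then show ?thesis using comp_children child_not_rm[OF comp_in_old] unfolding seam' by auto
  next
    assume "x \<in> A"
    then show ?thesis using set_inc_A comp_children[OF A_comp(1)] unfolding seam' by blast
  next
    fix a j assume "a \<in> A" "j < q a" "x = \<nu> (Del a j)"
    then show ?thesis unfolding seam' by (auto simp: inc_Del)
  qed
  have blk_node: "c \<in> nodes P \<and> coh P c = coh P (inb P a ! (p + i))" if "a \<in> A" "i < l" "c \<in> set (blk a j i)" for a i j c
  proof -
    have s: "inb P a ! (p + i) \<in> Vseam P" using rm_nth[OF that(1,2)] rm_seam by blast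
    have "c \<in> set (inb P (inb P a ! (p + i)))" using subsetD[OF blk_sub that(3)] .
    then show ?thesis using seam_children[OF s] coh_seam[OF s] by blast
  qed
  show "set (inb P' s) \<subseteq> Vcomp P' \<union> Vmark P'" if s: "s \<in> Vseam P'" for s
    using s
  proof (cases rule: seam_cases)
    case old
    then show ?thesis using seam_children unfolding comp' mark' by auto
  next
    case (eps a)
    then show ?thesis unfolding comp' by auto
  next
    case (sub a j i)
    then show ?thesis using blk_node[OF sub(1,3)] unfolding comp' mark' by auto
  qed
  show "inb P' \<mu> = []" if "\<mu> \<in> Vmark P'" for \<mu>
  proof -
    have m: "\<mu> \<in> Vmark P" using that by (simp add: mark')
    then have "\<mu> \<notin> A" using A_comp(1) disj by blast
    then show ?thesis using inc_other[OF type_verts(3)[OF m] comp_not_rm(2)[OF m]] mark_leaf[OF m] by simp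
  qed
  have lenA: "length (inb P' a) = length (inb P a) - l + 1" if "a \<in> A" for a
    using length_replace_block[OF pl[OF that]] by (simp add: inc_A[OF that])
  have one: "2 \<le> length (inb P' y) \<and> coh P' y = coh P' x" if x: "x \<in> Vcomp P'" "inb P' x = [y]" for x y
    using x(1)
  proof (rule comp_cases')
    assume h: "x \<in> Vcomp P" "x \<notin> A" "inb P' x = inb P x"
    then have i: "inb P x = [y]" using x(2) by simp
    have y: "y \<in> Vseam P" "y \<notin> rm" using comp_children[OF h(1)] child_not_rm[OF comp_in_old h(2)] h(1) i by auto
    then have "y \<notin> A" using A_comp(1) disj by blast
    then show ?thesis
      using comp1[OF h(1) i] inc_other[OF type_verts(2)[OF y(1)] y(2)] coh_old'[OF type_verts(2)[OF y(1)] y(2)]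
        coh_old'[OF comp_in_old[OF h(1)] comp_not_rm(1)[OF h(1)]] by simp
  next
    assume a: "x \<in> A"
    \<comment> \<open>One remaining seam means that the whole list was replaced, so the move is of
      type 3. Its condition that \<open>q\<close> is at least 2 is then the stability of
      \<open>x\<close>.\<close>
    have nl: "\<not> l < length (inb P x)" using lenA[OF a] x(2) by auto
    then have k: "2 \<le> q x" "g x = coh P x" using kind[OF a] by blast+
    have "y = \<nu> (Eps x)"
    proof -
      have "\<nu> (Eps x) \<in> set (inb P' x)" using set_inc_A[OF a] by blast
      then show ?thesis using x(2) by simp
    qed
    then show ?thesis using k cE[OF a] inc_Eps[OF a] coh_node_old[of x] A_comp(1)[OF a] by simp
  next
    fix a j assume "a \<in> A" "j < q a" "x = \<nu> (Del a j)"
    then have "length (inb P' x) = l" by (simp add: inc_Del)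
    then show ?thesis using x(2) l2 by simp
  qed
  show "2 \<le> length (inb P' y)" "coh P' y = coh P' x" if x: "x \<in> Vcomp P'" "inb P' x = [y]" for x y
    using one[OF x] by blast+
  show "\<exists>y\<in>set (inb P' x). inb P' y \<noteq> []" if x: "x \<in> Vcomp P'" "2 \<le> length (inb P' x)" for x
    using x(1)
  proof (rule comp_cases')
    assume h: "x \<in> Vcomp P" "x \<notin> A" "inb P' x = inb P x"
    then obtain y where y: "y \<in> set (inb P x)" "inb P y \<noteq> []" using comp2_ex x(2) by auto
    have "y \<in> Vseam P" "y \<notin> rm" using comp_children[OF h(1) y(1)] child_not_rm[OF comp_in_old[OF h(1)] h(2) y(1)] by auto
    then have "y \<notin> A" "y \<in> verts (bub P)" using A_comp(1) disj type_verts by blast+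
    then show ?thesis using y h(3) inc_other[of y] \<open>y \<notin> rm\<close> by (intro bexI[of _ y]) simp_all
  next
    assume a: "x \<in> A"
    obtain y where y: "y \<in> set (inb P x)" "inb P y \<noteq> []" using comp2_ex A_comp[OF a] by blast
    show ?thesis
    proof (cases "y \<in> rm")
      case True
      then have "y \<in> set (block p l (inb P x))" using rm_parent y(1) A_verts a by blast
      then obtain i where i: "i < l" "y = inb P x ! (p + i)" using a by (metis blk_nthE)
      \<comment> \<open>The children of the removed seam \<open>y\<close> have to go somewhere, so
        there is at least one \<open>Del\<close> vertex, and the new seam \<open>Eps\<close> has
        children in place of \<open>y\<close>.\<close>
      then have "length (inb P (inb P x ! (p + i))) \<noteq> 0" using y(2) by simp
      then have "(\<Sum>j<q x. b x j i) \<noteq> 0" unfolding lens[OF a i(1)] .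
      then have "q x \<noteq> 0" by (intro notI) simp
      then have "inb P' (\<nu> (Eps x)) \<noteq> []" using inc_Eps[OF a] by simp
      then show ?thesis using set_inc_A[OF a] by blast
    next
      case False
      have "y \<in> Vseam P" using comp_children[OF A_comp(1)[OF a] y(1)] .
      then have "y \<notin> A" "y \<in> verts (bub P)" using A_comp(1) disj type_verts by blast+
      then have "inb P' y \<noteq> []" using inc_other False y(2) by simp
      then show ?thesis using set_inc_A[OF a] y(1) False by blast
    qed
  next
    fix a j assume h: "a \<in> A" "j < q a" "x = \<nu> (Del a j)"
    then obtain i where i: "i < l" "b a j i \<noteq> 0" using sd unfolding splitting_data_def by blast
    have "b a j i \<le> (\<Sum>j<q a. b a j i)" using h(2) by (intro member_le_sum) auto
    moreover have "(\<Sum>m<j. b a m i) + b a j i \<le> length (inb P (inb P a ! (p + i)))"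
      using sum_prefix_le[OF h(2), of "\<lambda>j. b a j i"] lens[OF h(1) i(1)] by simp
    ultimately have "length (inb P' (\<nu> (Sub a j i))) = b a j i"
      using inc_Sub[OF h(1,2) i(1)] by (simp add: length_block)
    then have "inb P' (\<nu> (Sub a j i)) \<noteq> []" using i(2) by auto
    moreover have "\<nu> (Sub a j i) \<in> set (inb P' x)" using inc_Del[OF h(1,2)] h(3) i(1) by simp
    ultimately show ?thesis by blast
  qed
  show "map (coh P') (inb P' x) = ins P' (coh P' x)" if x: "x \<in> Vcomp P'" "2 \<le> length (inb P' x)" for x
    using x(1)
  proof (rule comp_cases')
    assume h: "x \<in> Vcomp P" "x \<notin> A" "inb P' x = inb P x"
    have "map (coh P') (inb P x) = map (coh P) (inb P x)"
      using coh_comp_child[OF h(1)] child_not_rm[OF comp_in_old[OF h(1)] h(2)] by simp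
    also have "\<dots> = ins P (coh P x)" using comp2_map[OF h(1)] x(2) h(3) by simp
    also have "\<dots> = ins P' (coh P x)" using ins_other[of x] h x(2) by (simp add: Vcomp2_def)
    finally show ?thesis using h coh_node_old[of x] by simp
  next
    assume a: "x \<in> A"
    have "l < length (inb P x)" using lenA[OF a] x(2) pl[OF a] by linarith
    then have k: "ins P' (coh P x) = replace_block p l (g x) (ins P (coh P x))" using kind[OF a] by auto
    have nd: "\<forall>y\<in>set (take p (inb P x)) \<union> set (drop (p + l) (inb P x)). coh P' y = coh P y"
    proof
      fix y assume y: "y \<in> set (take p (inb P x)) \<union> set (drop (p + l) (inb P x))"
      have "y \<in> set (inb P' x)" using y unfolding inc_A[OF a] replace_block_def by auto
      moreover have yc: "y \<in> set (inb P x)" using y by (auto dest: in_set_takeD in_set_dropD)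
      moreover have "y \<noteq> \<nu> (Eps x)" using B.child_in[OF comp_in_old[OF A_comp(1)[OF a]] yc] nu_notin by blast
      ultimately have "y \<notin> rm" using set_inc_A[OF a] by blast
      then show "coh P' y = coh P y" using coh_comp_child[OF A_comp(1)[OF a] yc] by blast
    qed
    have "map (coh P') (inb P' x) = replace_block p l (g x) (map (coh P) (inb P x))"
      using nd cE[OF a] unfolding inc_A[OF a] replace_block_def by (simp add: take_map drop_map)
    also have "\<dots> = ins P' (coh P x)" using k comp2_map[OF A_comp[OF a]] by simp
    finally show ?thesis using coh_node_old[of x] A_comp(1)[OF a] by simp
  next
    fix a j assume h: "a \<in> A" "j < q a" "x = \<nu> (Del a j)"
    have "map (coh P') (inb P' x) = map (\<lambda>i. coh P (inb P a ! (p + i))) [0..<l]"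
      unfolding h(3) inc_Del[OF h(1,2)] using cS[OF h(1,2)] by simp
    also have "\<dots> = map (coh P) (block p l (inb P a))" by (simp add: block_conv_map[OF pl[OF h(1)]])
    finally show ?thesis using ins_g[OF h(1)] cD[OF h(1,2)] h(3) by simp
  qed
  show "coh P' c = coh P' s" if s: "s \<in> Vseam P'" "c \<in> set (inb P' s)" for s c
    using s(1)
  proof (cases rule: seam_cases)
    case old
    then have c: "c \<in> set (inb P s)" using s(2) by simp
    then show ?thesis using coh_node_old[OF seam_children[OF old(1) c]] coh_seam[OF old(1) c] old(4) by simp
  next
    case (eps a)
    then obtain j where "j < q a" "c = \<nu> (Del a j)" using s(2) by auto
    then show ?thesis using eps cD by simp
  next
    case (sub a j i)
    then have "c \<in> set (blk a j i)" using s(2) by simp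
    then show ?thesis using blk_node[OF sub(1,3)] coh_node_old sub(6) by simp
  qed
  show "coh P' (rt (bub P')) = rt (stree P')" using coh_node_old[OF rt_node] coh_rt by (simp add: rt' s_rt)
  show "coh P' ` Vmark P' \<subseteq> leaves (stree P')"
    using coh_mark coh_node_old unfolding mark' s_leaves by auto
  show "length (ins P' s) \<noteq> 1" if "s \<in> verts (stree P')" for s using s_one[OF that] .
qed

definition "Q' v i = split_label (\<lambda>v. Q v i) v"

lemma Q'_old: "v \<in> verts (bub P) \<Longrightarrow> Q' v = Q v"
  using split_label_old by (auto simp: Q'_def)

lemma Q'_ilab: "ilab (bub P') (Vmark P) (\<lambda>v. Q' v m)"
  unfolding Q'_def
proof (rule split_ilab[OF labelled_tree.ilab[OF QL] marks_leaves])
  show "rm \<inter> Vmark P = {}" using comp_not_rm(2) by blast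
  show "1 \<le> l" using l2 by simp
  fix a i i' assume h: "a \<in> A" "i < l" "i' < l" "i \<noteq> i'"
  let ?x = "inb P a ! (p + i)" and ?y = "inb P a ! (p + i')"
  show "Q ?x m = {} \<or> Q ?y m = {}"
  proof (rule ccontr)
    assume n: "\<not> (Q ?x m = {} \<or> Q ?y m = {})"
    have a: "a \<in> Vcomp P" "a \<in> verts (bub P)" using A_comp(1)[OF h(1)] type_verts by blast+
    have xy: "?x \<in> set (inb P a)" "?y \<in> set (inb P a)" using rm_child h by blast+
    \<comment> \<open>Two distinct seams of \<open>a\<close> are mapped to distinct siblings in the
      seam tree, and the row index \<open>m\<close> lies in the label of at most one
      sibling.\<close>
    have "m \<in> K (coh P ?x)" "m \<in> K (coh P ?y)" using n Q_supp B.child_in[OF a(2)] xy by blast+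
    moreover have "coh P ?x \<in> set (ins P (coh P a))" "coh P ?y \<in> set (ins P (coh P a))"
      using xy comp2_map[OF A_comp[OF h(1)]] by (metis image_eqI list.set_map)+
    ultimately have "coh P ?x = coh P ?y" using K_sibling[OF coh_verts[OF a(2)]] by blast
    then have "?x = ?y" using coh_inj_children[OF a(1) xy] by blast
    moreover have "p + i < length (inb P a)" "p + i' < length (inb P a)" using pl[OF h(1)] h(2,3) by linarith+
    ultimately show False using B.dist[OF a(2)] h(4) by (simp add: nth_eq_iff_index_eq)
  qed
qed

lemma lbl': "lbl r n P' K' Q'"
  unfolding lbl_def
proof (intro conjI allI ballI)
  show "good P'" by (rule good')
  show "ilab (stree P') (leaves (stree P')) K'" by (rule K'_ilab)
  show "K' (rt (stree P')) = {1..r}" using K_rt K'_old[OF S.rt_in] by (simp add: s_rt)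
  show "K' x \<noteq> {}" if "x \<in> leaves (stree P')" for x
  proof -
    have x: "x \<in> leaves (stree P)" using that by (simp add: s_leaves)
    then have "x \<in> verts (stree P)" by (simp add: leaves_def)
    then show ?thesis using K_leaf[OF x] K'_old by auto
  qed
  show "ilab (bub P') (Vmark P') (\<lambda>v. Q' v i)" for i unfolding mark' by (rule Q'_ilab)
  show "Q' (rt (bub P')) i = {1..if i \<in> {1..r} then n i else 0}" for i
    using Q_rt[of i] Q'_old[OF B.rt_in] by (simp add: rt')
  fix \<mu> i assume "\<mu> \<in> Vmark P'"
  then have mu: "\<mu> \<in> Vmark P" by (simp add: mark')
  then show "Q' \<mu> i \<noteq> {} \<longleftrightarrow> K' (coh P' \<mu>) = {i}"
    using Q_mark[OF mu] coh_node_old[of \<mu>] K'_old[OF coh_node[of \<mu>]] Q'_old[OF type_verts(3)[OF mu]] by simp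
qed

lemma result:
  shows "(brackets P', brackets P) \<in> W_br_le r n" "v \<in> nodes P \<Longrightarrow> brk P' v = brk P v"
    and "a \<in> A \<Longrightarrow> j < q a \<Longrightarrow>
      brk P' (\<nu> (Del a j)) = (K' (g a), \<lambda>m. \<Union>i<l. \<Union>c\<in>set (blk a j i). Q c m)"
    and "s \<in> verts (stree P') \<Longrightarrow> seam_label P' s = K' s"
proof -
  have old: "nodes P \<subseteq> nodes P'" unfolding comp' mark' by blast
  have lab: "coh P' v = coh P v \<and> Q' v = Q v" if "v \<in> nodes P" for v
    using coh_node_old[OF that] Q'_old[OF node_verts[OF that]] by blast
  have sib: "left_of (bub P') (inb P b ! i) (inb P b ! j)" if "b \<in> Vseam P" "i < j" "j < length (inb P b)" for b i j
  proof -
    have "b \<notin> A" using that(1) A_comp(1) disj by blast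
    then show ?thesis by (rule split_siblings[OF type_verts(2)[OF that(1)] _ that(2,3)])
  qed
  note r = refine_le[OF stable lbl' s_sub K'_old old lab sib]
  show "(brackets P', brackets P) \<in> W_br_le r n" by (rule r(1))
  show "v \<in> nodes P \<Longrightarrow> brk P' v = brk P v" by (rule r(2))
  show K: "seam_label P' s = K' s" if "s \<in> verts (stree P')" for s by (rule lbl_unique(2)[OF lbl' that])
  assume a: "a \<in> A" "j < q a"
  have "bub_label P' (\<nu> (Del a j)) = Q' (\<nu> (Del a j))" by (rule lbl_unique(3)[OF lbl' new_in(2)[OF a]])
  then show "brk P' (\<nu> (Del a j)) = (K' (g a), \<lambda>m. \<Union>i<l. \<Union>c\<in>set (blk a j i). Q c m)"
    using K[OF g_in[OF a(1)]] cD[OF a] by (simp add: brk_def Q'_def[abs_def])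
qed

end


section \<open>Moves of types 2 and 3 as instances of the common frame\<close>

definition move2_data where
  "move2_data P P' \<alpha> p l v A q b \<nu> \<longleftrightarrow>
        \<alpha> \<in> interior (stree P) \<and>
        2 \<le> l \<and> l < length (ins P \<alpha>) \<and> p + l \<le> length (ins P \<alpha>) \<and>
        v \<notin> verts (stree P) \<and>
        verts (stree P') = verts (stree P) \<union> {v} \<and>
        rt (stree P') = rt (stree P) \<and>
        ins P' \<alpha> = replace_block p l v (ins P \<alpha>) \<and>
        ins P' v = block p l (ins P \<alpha>) \<and>
        (\<forall>x\<in>verts (stree P) - {\<alpha>}. ins P' x = ins P x) \<and>
        A = {a \<in> Vcomp2 P. coh P a = \<alpha>} \<and>
        (\<forall>a\<in>A. splitting_data P a p l (q a) (b a)) \<and>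
        split_bubble P P' A p l q b \<nu> \<and>
        (\<forall>a\<in>A.
           coh P' (\<nu> (Eps a)) = v \<and>
           (\<forall>j<q a.
              coh P' (\<nu> (Del a j)) = v \<and>
              (\<forall>i<l. coh P' (\<nu> (Sub a j i)) = ins P \<alpha> ! (p + i))))"

lemma move2_iff: "move2 P P' \<longleftrightarrow> (\<exists>\<alpha> p l v A q b \<nu>. move2_data P P' \<alpha> p l v A q b \<nu>)"
  by (simp only: move2_def move2_data_def)

definition move3_data where
  "move3_data P P' \<alpha> k q b \<nu> \<longleftrightarrow>
        \<alpha> \<in> Vcomp2 P \<and> k = length (inb P \<alpha>) \<and> 2 \<le> q \<and>
        splitting_data P \<alpha> 0 k q b \<and>
        split_bubble P P' {\<alpha>} 0 k (\<lambda>_. q) (\<lambda>_. b) \<nu> \<and>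
        stree P' = stree P \<and>
        coh P' (\<nu> (Eps \<alpha>)) = coh P \<alpha> \<and>
        (\<forall>j<q.
           coh P' (\<nu> (Del \<alpha> j)) = coh P \<alpha> \<and>
           (\<forall>i<k. coh P' (\<nu> (Sub \<alpha> j i)) = coh P (inb P \<alpha> ! i)))"

lemma move3_iff: "move3 P P' \<longleftrightarrow> (\<exists>\<alpha> k q b \<nu>. move3_data P P' \<alpha> k q b \<nu>)"
  by (simp only: move3_def move3_data_def)

context stable_pair
begin

definition insert_label :: "'w \<Rightarrow> nat \<Rightarrow> nat \<Rightarrow> 'w \<Rightarrow> 'w \<Rightarrow> nat set" where
  "insert_label \<alpha> p l v = K(v := \<Union>s\<in>set (block p l (ins P \<alpha>)). K s)"

lemma move2_split:
  assumes "move2_data P P' \<alpha> p l v A q b \<nu>"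
  shows "split_move r n P P' A p l q b \<nu> (\<lambda>_. v) (insert_label \<alpha> p l v)"
proof -
  note d = assms[unfolded move2_data_def]
  note d14 = d[THEN conjunct2, THEN conjunct2, THEN conjunct2, THEN conjunct2, THEN conjunct2, THEN conjunct2, THEN conjunct2, THEN conjunct2, THEN conjunct2, THEN conjunct2, THEN conjunct2, THEN conjunct2, THEN conjunct2, THEN bspec]
  note m = d[THEN conjunct1]
    d[THEN conjunct2, THEN conjunct1]
    d[THEN conjunct2, THEN conjunct2, THEN conjunct1]
    d[THEN conjunct2, THEN conjunct2, THEN conjunct2, THEN conjunct1]
    d[THEN conjunct2, THEN conjunct2, THEN conjunct2, THEN conjunct2, THEN conjunct1]
    d[THEN conjunct2, THEN conjunct2, THEN conjunct2, THEN conjunct2, THEN conjunct2, THEN conjunct1]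
    d[THEN conjunct2, THEN conjunct2, THEN conjunct2, THEN conjunct2, THEN conjunct2, THEN conjunct2, THEN conjunct1]
    d[THEN conjunct2, THEN conjunct2, THEN conjunct2, THEN conjunct2, THEN conjunct2, THEN conjunct2, THEN conjunct2, THEN conjunct1]
    d[THEN conjunct2, THEN conjunct2, THEN conjunct2, THEN conjunct2, THEN conjunct2, THEN conjunct2, THEN conjunct2, THEN conjunct2, THEN conjunct1]
    d[THEN conjunct2, THEN conjunct2, THEN conjunct2, THEN conjunct2, THEN conjunct2, THEN conjunct2, THEN conjunct2, THEN conjunct2, THEN conjunct2, THEN conjunct1, THEN bspec]
    d[THEN conjunct2, THEN conjunct2, THEN conjunct2, THEN conjunct2, THEN conjunct2, THEN conjunct2, THEN conjunct2, THEN conjunct2, THEN conjunct2, THEN conjunct2, THEN conjunct1]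
    d[THEN conjunct2, THEN conjunct2, THEN conjunct2, THEN conjunct2, THEN conjunct2, THEN conjunct2, THEN conjunct2, THEN conjunct2, THEN conjunct2, THEN conjunct2, THEN conjunct2, THEN conjunct1, THEN bspec]
    d[THEN conjunct2, THEN conjunct2, THEN conjunct2, THEN conjunct2, THEN conjunct2, THEN conjunct2, THEN conjunct2, THEN conjunct2, THEN conjunct2, THEN conjunct2, THEN conjunct2, THEN conjunct2, THEN conjunct1] d14[THEN conjunct1] d14[THEN conjunct2, rule_format, THEN conjunct1] d14[THEN conjunct2, rule_format, THEN conjunct2, rule_format]
  have av: "\<alpha> \<in> verts (stree P)" using m(1) by (simp add: interior_def)
  have i: "inserts (stree P) (stree P') \<alpha> p l v"
    unfolding inserts_def using av m(2,4-10) by simp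
  interpret I: insertion "stree P" "stree P'" \<alpha> p l v by standard (rule i)
  have A: "map (coh P) (inb P a) = ins P \<alpha>" "length (inb P a) = length (ins P \<alpha>)" if "a \<in> A" for a
  proof -
    show e: "map (coh P) (inb P a) = ins P \<alpha>"
      using comp2_map[of a] that m(11) unfolding Vcomp2_def by simp
    show "length (inb P a) = length (ins P \<alpha>)" using arg_cong[OF e, of length] by simp
  qed
  show ?thesis
  proof (unfold_locales)
    show "split_bubble P P' A p l q b \<nu>" by (rule m(13))
    show "A \<subseteq> Vcomp2 P" using m(11) by blast
    show "2 \<le> l" by (rule m(2))
    show "p + l \<le> length (inb P a)" if "a \<in> A" for a using A(2)[OF that] m(4) by simp
    show "coh P' (\<nu> (Sub a j i)) = coh P (inb P a ! (p + i))" if "a \<in> A" "j < q a" "i < l" for a j i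
    proof -
      have "p + i < length (inb P a)" using A(2)[OF that(1)] m(4) that(3) by linarith
      then have "coh P (inb P a ! (p + i)) = ins P \<alpha> ! (p + i)" using A(1)[OF that(1)] by (metis nth_map)
      then show ?thesis using m(16)[OF that] by simp
    qed
    show "is_rrt (stree P')" by (rule I.ins_rrt)
    show "leaves (stree P') = leaves (stree P)" by (rule I.ins_leaves)
    show "length (ins P' s) \<noteq> 1" if s: "s \<in> verts (stree P')" for s
    proof -
      consider "s = v" | "s = \<alpha>" | "s \<in> verts (stree P)" "s \<noteq> \<alpha>" using s m(6) by blast
      then show ?thesis
      proof cases
        case 1
        then show ?thesis using m(2) length_block[OF m(4)] by (simp add: m(9))
      next
        case 2
        then show ?thesis using m(3) length_replace_block[OF m(4)] by (simp add: m(8))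
      next
        case 3
        then show ?thesis using m(10) seam_tree_stable by simp
      qed
    qed
    show "ilab (stree P') (leaves (stree P')) (insert_label \<alpha> p l v)"
      unfolding insert_label_def I.ins_leaves by (rule I.ins_ilab[OF KL.ilab]) simp
    show "insert_label \<alpha> p l v s = K s" if "s \<in> verts (stree P)" for s
      using that m(5) by (auto simp: insert_label_def)
    show "ins P' (coh P x) = ins P (coh P x)" if "x \<in> Vcomp2 P" "x \<notin> A" for x
    proof -
      have "coh P x \<noteq> \<alpha>" using that m(11) by blast
      moreover have "coh P x \<in> verts (stree P)" using that(1) coh_node[of x] by (simp add: Vcomp2_def)
      ultimately show ?thesis using m(10) by blast
    qed
    show "ins P' v = map (coh P) (block p l (inb P a))" if "a \<in> A" for a
      using A(1)[OF that] by (simp add: map_block m(9))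
    show "l < length (inb P a) \<and> ins P' (coh P a) = replace_block p l v (ins P (coh P a)) \<or>
        l = length (inb P a) \<and> 2 \<le> q a \<and> v = coh P a" if "a \<in> A" for a
    proof -
      have "coh P a = \<alpha>" using that m(11) by blast
      then show ?thesis using A(2)[OF that] m(3,8) by simp
    qed
  qed (use m in auto)
qed

lemma move3_split:
  assumes "move3_data P P' \<alpha> k q b \<nu>"
  shows "split_move r n P P' {\<alpha>} 0 k (\<lambda>_. q) (\<lambda>_. b) \<nu> (\<lambda>_. coh P \<alpha>) K"
proof -
  note d = assms[unfolded move3_data_def]
  note d8 = d[THEN conjunct2, THEN conjunct2, THEN conjunct2, THEN conjunct2, THEN conjunct2, THEN conjunct2, THEN conjunct2, rule_format]
  note m = d[THEN conjunct1]
    d[THEN conjunct2, THEN conjunct1]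
    d[THEN conjunct2, THEN conjunct2, THEN conjunct1]
    d[THEN conjunct2, THEN conjunct2, THEN conjunct2, THEN conjunct1]
    d[THEN conjunct2, THEN conjunct2, THEN conjunct2, THEN conjunct2, THEN conjunct1]
    d[THEN conjunct2, THEN conjunct2, THEN conjunct2, THEN conjunct2, THEN conjunct2, THEN conjunct1]
    d[THEN conjunct2, THEN conjunct2, THEN conjunct2, THEN conjunct2, THEN conjunct2, THEN conjunct2, THEN conjunct1] d8[THEN conjunct1] d8[THEN conjunct2, rule_format]
  have a: "\<alpha> \<in> Vcomp P" "2 \<le> k" using m(1,2) unfolding Vcomp2_def by simp_all
  show ?thesis
  proof (unfold_locales)
    show "ins P' (coh P \<alpha>) = map (coh P) (block 0 k (inb P a))" if "a \<in> {\<alpha>}" for a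
      using comp2_map[OF a(1)] a(2) m(2,6) that by (simp add: block_def)
    show "is_rrt (stree P')" unfolding m(6) by (rule S.rrt)
    show "ilab (stree P') (leaves (stree P')) K" unfolding m(6) by (rule KL.ilab)
    show "length (ins P' s) \<noteq> 1" if "s \<in> verts (stree P')" for s
      using that seam_tree_stable unfolding m(6) by blast
    show "coh P \<alpha> \<in> verts (stree P')" unfolding m(6) using coh_node[of \<alpha>] a(1) by blast
  qed (use m a in auto)
qed

lemma move_le:
  assumes "move P P'"
  shows "(brackets P', brackets P) \<in> W_br_le r n"
proof -
  consider "move1 P P'" | "move2 P P'" | "move3 P P'" using assms unfolding move_def by blast
  then show ?thesis
  proof cases
    case 1
    then obtain \<alpha> \<beta> p l \<delta> \<epsilon> where "move1_data P P' \<alpha> \<beta> p l \<delta> \<epsilon>" unfolding move1_iff by blast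
    then interpret M: move1_pair r n P P' \<alpha> \<beta> p l \<delta> \<epsilon> by unfold_locales
    show ?thesis by (rule M.result(1))
  next
    case 2
    then obtain \<alpha> p l v A q b \<nu> where d: "move2_data P P' \<alpha> p l v A q b \<nu>" unfolding move2_iff by blast
    interpret M: split_move r n P P' A p l q b \<nu> "\<lambda>_. v" "insert_label \<alpha> p l v" by (rule move2_split[OF d])
    show ?thesis by (rule M.result(1))
  next
    case 3
    then obtain \<alpha> k q b \<nu> where d: "move3_data P P' \<alpha> k q b \<nu>" unfolding move3_iff by blast
    interpret M: split_move r n P P' "{\<alpha>}" 0 k "\<lambda>_. q" "\<lambda>_. b" \<nu> "\<lambda>_. coh P \<alpha>" K by (rule move3_split[OF d])
    show ?thesis by (rule M.result(1))
  qed
qed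

end


section \<open>Realizing a finer 2-bracketing by a move\<close>

text \<open>A concrete solution of \<open>split_bubble\<close>. Its functions decode a new vertex
  through \<open>inv \<nu>\<close> and fall back to the old values elsewhere, so that a move is
  specified by the cutting vectors, \<open>g\<close> and the seam tree alone.\<close>

definition split_pair ::
  "('v, 'w) tree_pair \<Rightarrow> 'v set \<Rightarrow> nat \<Rightarrow> nat \<Rightarrow> ('v \<Rightarrow> nat) \<Rightarrow> ('v \<Rightarrow> nat \<Rightarrow> nat \<Rightarrow> nat) \<Rightarrow>
   ('v new_vertex \<Rightarrow> 'v) \<Rightarrow> ('v \<Rightarrow> 'w) \<Rightarrow> 'w rrt \<Rightarrow> ('v, 'w) tree_pair" where
  "split_pair P A p l q b \<nu> g st =
     (let removed = {inb P a ! (p + i) | a i. a \<in> A \<and> i < l};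
          new_eps = {\<nu> (Eps a) | a. a \<in> A};
          new_del = {\<nu> (Del a j) | a j. a \<in> A \<and> j < q a};
          new_sub = {\<nu> (Sub a j i) | a j i. a \<in> A \<and> j < q a \<and> i < l}
      in \<lparr>bub = \<lparr>verts = (verts (bub P) - removed) \<union> new_eps \<union> new_del \<union> new_sub,
            rt = rt (bub P),
            inc = (\<lambda>x. if x \<in> range \<nu> then (case inv \<nu> x of
                Eps a \<Rightarrow> map (\<lambda>j. \<nu> (Del a j)) [0..<q a]
              | Del a j \<Rightarrow> map (\<lambda>i. \<nu> (Sub a j i)) [0..<l]
              | Sub a j i \<Rightarrow> block (\<Sum>m<j. b a m i) (b a j i) (inb P (inb P a ! (p + i))))
              else if x \<in> A then replace_block p l (\<nu> (Eps x)) (inb P x) else inb P x)\<rparr>,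
          solid = {(x, y) \<in> solid P. x \<notin> removed} \<union> {(\<nu> (Eps a), a) | a. a \<in> A} \<union>
            {(\<nu> (Sub a j i), \<nu> (Del a j)) | a j i. a \<in> A \<and> j < q a \<and> i < l},
          Vcomp = Vcomp P \<union> new_del,
          Vseam = (Vseam P - removed) \<union> new_eps \<union> new_sub,
          Vmark = Vmark P,
          stree = st,
          coh = (\<lambda>x. if x \<in> range \<nu> then (case inv \<nu> x of
                Eps a \<Rightarrow> g a | Del a j \<Rightarrow> g a | Sub a j i \<Rightarrow> coh P (inb P a ! (p + i))) else coh P x)\<rparr>)"

lemma split_pair_bubble:
  assumes "inj \<nu>" "range \<nu> \<inter> verts (bub P) = {}" "A \<subseteq> verts (bub P)"
  shows "split_bubble P (split_pair P A p l q b \<nu> g st) A p l q b \<nu>"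
    and "coh (split_pair P A p l q b \<nu> g st) (\<nu> (Eps a)) = g a"
    and "coh (split_pair P A p l q b \<nu> g st) (\<nu> (Del a j)) = g a"
    and "coh (split_pair P A p l q b \<nu> g st) (\<nu> (Sub a j i)) = coh P (inb P a ! (p + i))"
    and "stree (split_pair P A p l q b \<nu> g st) = st"
proof -
  have i: "inv \<nu> (\<nu> x) = x" for x using assms(1) by (rule inv_f_f)
  have n: "x \<notin> range \<nu>" if "x \<in> verts (bub P)" for x using that assms(2) by blast
  have nA: "x \<notin> range \<nu>" if "x \<in> A" for x using that assms(2,3) by blast
  let ?P = "split_pair P A p l q b \<nu> g st"
  show "split_bubble P ?P A p l q b \<nu>"
    unfolding split_bubble_def Let_def
    by (intro conjI ballI allI impI) (use assms n nA in \<open>auto simp: split_pair_def Let_def i\<close>)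
  show "coh ?P (\<nu> (Eps a)) = g a" "coh ?P (\<nu> (Del a j)) = g a"
    "coh ?P (\<nu> (Sub a j i)) = coh P (inb P a ! (p + i))" "stree ?P = st"
    by (simp_all add: split_pair_def Let_def i)
qed

text \<open>The codes of the three kinds of new vertices are lists of lengths 1, 2 and 3, so
  \<open>list_encode\<close> keeps them apart, and the shift moves them beyond \<open>V\<close>.
  Inserting 0 gives the maximum a meaning when \<open>V\<close> is empty.\<close>

lemma fresh_names:
  assumes "finite (V :: nat set)"
  obtains \<nu> :: "nat new_vertex \<Rightarrow> nat" where "inj \<nu>" "range \<nu> \<inter> V = {}"
proof -
  define \<nu> :: "nat new_vertex \<Rightarrow> nat" where
    "\<nu> x = Suc (Max (insert 0 V)) + list_encode (case x of Eps a \<Rightarrow> [a] | Del a j \<Rightarrow> [a, j] | Sub a j i \<Rightarrow> [a, j, i])" for x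
  have "inj \<nu>"
    by (rule injI) (auto simp: \<nu>_def split: new_vertex.splits)
  moreover have "\<nu> x \<notin> V" for x
  proof
    assume "\<nu> x \<in> V"
    then have "\<nu> x \<le> Max (insert 0 V)" using assms by simp
    then show False by (simp add: \<nu>_def)
  qed
  ultimately show thesis using that[of \<nu>] by blast
qed

text \<open>Sort by the number of predecessors: by transitivity and irreflexivity this number grows
  strictly along the relation.\<close>

lemma sorted_list_exists:
  assumes "finite S" "trans R" "irrefl R" "\<And>x y. x \<in> S \<Longrightarrow> y \<in> S \<Longrightarrow> x \<noteq> y \<Longrightarrow> (x, y) \<in> R \<or> (y, x) \<in> R"
  obtains xs where "set xs = S" "sorted_wrt (\<lambda>x y. (x, y) \<in> R) xs" "distinct xs"
proof -
  obtain ys where ys: "set ys = S" "distinct ys" using finite_distinct_list[OF assms(1)] by blast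
  define f where "f x = card {y \<in> S. (y, x) \<in> R}" for x
  have less: "f x < f y" if "x \<in> S" "(x, y) \<in> R" for x y
    unfolding f_def
  proof (rule psubset_card_mono)
    show "finite {z \<in> S. (z, y) \<in> R}" using assms(1) by simp
    have "(x, x) \<notin> R" using assms(3) by (simp add: irrefl_def)
    moreover have "(z, y) \<in> R" if "(z, x) \<in> R" for z using transD[OF assms(2) that \<open>(x, y) \<in> R\<close>] .
    ultimately show "{z \<in> S. (z, x) \<in> R} \<subset> {z \<in> S. (z, y) \<in> R}" using that by blast
  qed
  define xs where "xs = sort_key f ys"
  have xs: "set xs = S" "distinct xs" "sorted (map f xs)" using ys by (simp_all add: xs_def)
  have "sorted_wrt (\<lambda>x y. (x, y) \<in> R) xs"
    unfolding sorted_wrt_iff_nth_less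
  proof (intro allI impI)
    fix i j assume ij: "i < j" "j < length xs"
    have m: "xs ! i \<in> S" "xs ! j \<in> S" using ij xs(1) by auto
    have "xs ! i \<noteq> xs ! j" using xs(2) ij by (simp add: nth_eq_iff_index_eq)
    moreover have "f (xs ! i) \<le> f (xs ! j)" using xs(3) ij by (simp add: sorted_iff_nth_mono)
    then have "(xs ! j, xs ! i) \<notin> R" using less[OF m(2)] by (meson not_le)
    ultimately show "(xs ! i, xs ! j) \<in> R" using assms(4)[OF m] by blast
  qed
  then show thesis using that xs by blast
qed

section \<open>Finiteness of 2-bracketings and maximal 2-brackets\<close>

context bracketing
begin

text \<open>A size that grows strictly along proper inclusion of 2-brackets with the same base; a
  bracket of greatest size is then maximal.\<close>

definition vol :: "two_bracket \<Rightarrow> nat" where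
  "vol X = card (SIGMA i:fst X. snd X i)"

lemma base_sub: "X \<in> twos Z \<Longrightarrow> fst X \<subseteq> {1..r}"
  using twos_bracket[of X] by (simp add: is_two_bracket_def one_bracket_def)

lemma vol_finite: "X \<in> twos Z \<Longrightarrow> finite (SIGMA i:fst X. snd X i)"
proof (rule finite_SigmaI)
  assume X: "X \<in> twos Z"
  show "finite (fst X)" using base_sub[OF X] by (rule finite_subset) simp
  show "finite (snd X i)" for i
    by (rule finite_subset[of _ "{1..n i}"]) (use bracket_range[OF X] in auto)
qed

lemma vol_less:
  assumes "X \<in> twos Z" "Y \<in> twos Z" "tb_subset X Y" "fst X = fst Y" "X \<noteq> Y"
  shows "vol X < vol Y"
  unfolding vol_def
proof (rule psubset_card_mono)
  show "finite (SIGMA i:fst Y. snd Y i)" by (rule vol_finite[OF assms(2)])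
  have sub: "(SIGMA i:fst X. snd X i) \<subseteq> (SIGMA i:fst Y. snd Y i)"
    using assms(3) by (auto simp: tb_subset_def)
  moreover have "(SIGMA i:fst X. snd X i) \<noteq> (SIGMA i:fst Y. snd Y i)"
  proof
    assume e: "(SIGMA i:fst X. snd X i) = (SIGMA i:fst Y. snd Y i)"
    have "snd X i = snd Y i" if i: "i \<in> fst X" for i
    proof (rule set_eqI)
      fix j
      have "j \<in> snd X i \<longleftrightarrow> (i, j) \<in> (SIGMA i:fst X. snd X i)" using i by simp
      also have "\<dots> \<longleftrightarrow> j \<in> snd Y i" unfolding e using i assms(4) by simp
      finally show "j \<in> snd X i \<longleftrightarrow> j \<in> snd Y i" .
    qed
    then show False using bracket_ext[OF assms(1,2,4)] assms(5) by blast
  qed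
  ultimately show "(SIGMA i:fst X. snd X i) \<subset> (SIGMA i:fst Y. snd Y i)" by blast
qed

lemma finite_ones: "finite (ones Z)"
proof (rule finite_subset)
  show "ones Z \<subseteq> Pow {1..r}" using ones_one by (auto simp: one_bracketing_def one_bracket_def)
qed simp

text \<open>A family is empty outside of its base, so a 2-bracket is encoded by its base and a
  finite set of pairs; the codes range over a finite set.\<close>

lemma finite_twos: "finite (twos Z)"
proof -
  let ?f = "\<lambda>X :: two_bracket. (fst X, SIGMA i:fst X. snd X i)"
  have "inj_on ?f (twos Z)"
  proof (rule inj_onI)
    fix X Y assume h: "X \<in> twos Z" "Y \<in> twos Z" "?f X = ?f Y"
    have b: "fst X = fst Y" and e: "(SIGMA i:fst X. snd X i) = (SIGMA i:fst Y. snd Y i)"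
      using h(3) unfolding prod.inject by (rule conjunct1, rule conjunct2)
    show "X = Y"
    proof (rule bracket_ext[OF h(1,2) b], rule set_eqI)
      fix i j assume i: "i \<in> fst X"
      have "j \<in> snd X i \<longleftrightarrow> (i, j) \<in> (SIGMA i:fst X. snd X i)" using i by simp
      also have "\<dots> \<longleftrightarrow> j \<in> snd Y i" unfolding e using i b by simp
      finally show "j \<in> snd X i \<longleftrightarrow> j \<in> snd Y i" .
    qed
  qed
  moreover have "?f ` twos Z \<subseteq> Pow {1..r} \<times> Pow (SIGMA i:{1..r}. {1..n i})"
  proof (rule image_subsetI)
    fix X assume X: "X \<in> twos Z"
    show "?f X \<in> Pow {1..r} \<times> Pow (SIGMA i:{1..r}. {1..n i})"
      using base_sub[OF X] bracket_range[OF X] by auto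
  qed
  then have "finite (?f ` twos Z)" by (rule finite_subset) simp
  ultimately show ?thesis by (rule finite_imageD[rotated])
qed

lemma maximal_above:
  assumes "\<Y> \<subseteq> twos Z" "\<And>Y. Y \<in> \<Y> \<Longrightarrow> fst Y = B" "Y \<in> \<Y>"
  obtains D where "D \<in> \<Y>" "tb_subset Y D" "\<And>W. W \<in> \<Y> \<Longrightarrow> tb_subset D W \<Longrightarrow> W = D"
proof -
  let ?S = "{W \<in> \<Y>. tb_subset Y W}"
  have fin: "finite ?S" using finite_subset[OF assms(1) finite_twos] by simp
  have ne: "Y \<in> ?S" using assms(3) tb_subset_refl by blast
  have "Max (vol ` ?S) \<in> vol ` ?S" using fin ne by (intro Max_in finite_imageI) blast+
  then obtain D where D': "Max (vol ` ?S) = vol D" "D \<in> ?S" by (rule imageE)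
  note D = D'(2) D'(1)[symmetric]
  show thesis
  proof (rule that)
    show "D \<in> \<Y>" "tb_subset Y D" using D(1) by blast+
    fix W assume W: "W \<in> \<Y>" "tb_subset D W"
    then have "W \<in> ?S" using tb_subset_trans D(1) by blast
    then have "vol W \<le> vol D" unfolding D(2) using fin by simp
    show "W = D"
    proof (rule ccontr)
      assume "W \<noteq> D"
      then have "vol D < vol W" using vol_less[of D W] assms(1,2) D(1) W by blast
      then show False using \<open>vol W \<le> vol D\<close> by simp
    qed
  qed
qed

end

locale refined_pair = stable_pair r n P + Z: bracketing r n Z
  for r n and P :: "('v, 'w) tree_pair" and Z +
  assumes ones_sub: "ones (brackets P) \<subseteq> ones Z" and twos_sub: "twos (brackets P) \<subseteq> twos Z"
    and tb_lt_sub: "tb_lt (brackets P) \<subseteq> tb_lt Z"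
begin

lemma node_in_Z: "x \<in> nodes P \<Longrightarrow> brk P x \<in> twos Z"
  using twos_sub unfolding brackets_simps by blast

lemma seam_sorted_Z: "\<beta> \<in> Vseam P \<Longrightarrow> sorted_wrt (\<lambda>x y. (brk P x, brk P y) \<in> tb_lt Z) (inb P \<beta>)"
  by (rule sorted_wrt_mono_rel[OF _ seam_sorted]) (use tb_lt_sub in blast)

text \<open>The maximal brackets \<open>D\<close> of \<open>\<Y>\<close> are pairwise comparable, and each 2-bracket below the block of seams
  lies in exactly one of them. By condition (5) those in a fixed \<open>D\<close> are consecutive, and this yields the
  vectors \<open>b\<close> of a move of type 2 or 3.\<close>

lemma grouping:
  assumes a: "a \<in> Vcomp P" and pl: "p + l \<le> length (inb P a)"
    and big: "\<And>i. i < l \<Longrightarrow> \<not> B \<subseteq> K (coh P (inb P a ! (p + i)))"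
    and Y: "\<Y> \<subseteq> twos Z" "\<And>Y. Y \<in> \<Y> \<Longrightarrow> fst Y = B" "\<And>Y. Y \<in> \<Y> \<Longrightarrow> tb_subset Y (brk P a)"
    and cov: "\<And>i \<gamma> m j. i < l \<Longrightarrow> \<gamma> \<in> set (inb P (inb P a ! (p + i))) \<Longrightarrow> j \<in> Q \<gamma> m \<Longrightarrow> \<exists>Y\<in>\<Y>. j \<in> snd Y m"
    and B: "\<And>\<beta> m. \<beta> \<in> set (inb P a) \<Longrightarrow> m \<in> B \<Longrightarrow> m \<in> K (coh P \<beta>) \<Longrightarrow> \<beta> \<in> set (block p l (inb P a))"
  shows "\<exists>Ds b. set Ds \<subseteq> \<Y> \<and> (\<forall>Y\<in>\<Y>. \<exists>D\<in>set Ds. tb_subset Y D) \<and>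
    sorted_wrt (\<lambda>X Y. (X, Y) \<in> tb_lt Z) Ds \<and> splitting_data P a p l (length Ds) b \<and>
    (\<forall>j m. j < length Ds \<longrightarrow> snd (Ds ! j) m =
      (\<Union>i<l. \<Union>c\<in>set (block (\<Sum>m<j. b m i) (b j i) (inb P (inb P a ! (p + i)))). Q c m))"
proof -
  define \<D> where "\<D> = {D \<in> \<Y>. \<forall>W\<in>\<Y>. tb_subset D W \<longrightarrow> W = D}"
  have DY: "\<D> \<subseteq> \<Y>" unfolding \<D>_def by blast
  have finD: "finite \<D>" using finite_subset[OF subset_trans[OF DY Y(1)] Z.finite_twos] .
  have above: "\<exists>D\<in>\<D>. tb_subset W D" if W: "W \<in> \<Y>" for W
  proof -
    obtain D where "D \<in> \<Y>" "tb_subset W D" "\<And>W. W \<in> \<Y> \<Longrightarrow> tb_subset D W \<Longrightarrow> W = D"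
      using Z.maximal_above[OF Y(1,2) W] by blast
    then show ?thesis unfolding \<D>_def by blast
  qed
  \<comment> \<open>By condition (2) brackets that share a number are nested, and nested maximal
    ones coincide.\<close>
  have D_eq: "D = D'" if "D \<in> \<D>" "D' \<in> \<D>" "j \<in> snd D m" "j \<in> snd D' m" for D D' j m
  proof -
    have in_Z: "D \<in> twos Z" "D' \<in> twos Z" using that DY Y(1) by blast+
    have "m \<in> fst D" "m \<in> fst D'" using Z.bracket_supp in_Z that(3,4) by blast+
    then have "tb_subset D D' \<or> tb_subset D' D" using Z.nested[OF in_Z] that(3,4) by blast
    then show ?thesis using that(1,2) unfolding \<D>_def by blast
  qed
  have comp: "(D, D') \<in> tb_lt Z \<or> (D', D) \<in> tb_lt Z" if "D \<in> \<D>" "D' \<in> \<D>" "D \<noteq> D'" for D D'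
  proof -
    have in_Z: "D \<in> twos Z" "D' \<in> twos Z" using that DY Y(1) by blast+
    have "fst D = fst D'" using that DY Y(2) by (metis subsetD)
    moreover have "\<forall>i\<in>fst D. snd D i \<inter> snd D' i = {}" using D_eq[OF that(1,2)] that(3) by blast
    ultimately show ?thesis using Z.R_iff[OF in_Z] by blast
  qed
  obtain Ds where Ds: "set Ds = \<D>" "sorted_wrt (\<lambda>X Y. (X, Y) \<in> tb_lt Z) Ds" "distinct Ds"
    using sorted_list_exists[OF finD Z.R_trans Z.R_irrefl comp] by blast
  let ?q = "length Ds"
  let ?\<beta> = "\<lambda>i. inb P a ! (p + i)"
  have av: "a \<in> verts (bub P)" using type_verts a by blast
  have bs: "?\<beta> i \<in> Vseam P" "?\<beta> i \<in> set (inb P a)" if "i < l" for i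
  proof -
    show "?\<beta> i \<in> set (inb P a)" using that pl by simp
    then show "?\<beta> i \<in> Vseam P" by (rule comp_children[OF a])
  qed
  have idx: "\<exists>j<?q. tb_subset (brk P \<gamma>) (Ds ! j)" if il: "i < l" and gm: "\<gamma> \<in> set (inb P (?\<beta> i))" for i \<gamma>
  proof -
    note that = il gm
    have gn: "\<gamma> \<in> nodes P" using seam_children[OF bs(1)[OF that(1)] that(2)] .
    obtain m j0 where j0: "j0 \<in> Q \<gamma> m" using node_ne[OF gn] by blast
    obtain W where W: "W \<in> \<Y>" "j0 \<in> snd W m" using cov[OF il gm j0] by blast
    obtain D where D: "D \<in> \<D>" "tb_subset W D" using above[OF W(1)] by blast
    have DZ: "D \<in> twos Z" "fst D = B" using D(1) DY Y(1,2) by blast+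
    have "m \<in> fst W" using Z.bracket_supp W Y(1) by blast
    then have jD: "j0 \<in> snd D m" "m \<in> fst D" using D(2) W(2) unfolding tb_subset_def by blast+
    have "m \<in> fst (brk P \<gamma>)" "j0 \<in> snd (brk P \<gamma>) m" using Q_supp[OF node_verts[OF gn] j0] j0 by simp_all
    then have "tb_subset D (brk P \<gamma>) \<or> tb_subset (brk P \<gamma>) D"
      using Z.nested[OF DZ(1) node_in_Z[OF gn] jD(2) _ jD(1)] by blast
    \<comment> \<open>The hypothesis \<open>big\<close> decides between the two nestings: the base
      \<open>B\<close> of \<open>D\<close> does not fit into the 1-bracket of the seam above
      \<open>\<gamma>\<close>.\<close>
    moreover have "\<not> tb_subset D (brk P \<gamma>)"
      using big[OF that(1)] coh_seam[OF bs(1)[OF that(1)] that(2)] DZ(2) by (simp add: tb_subset_def)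
    ultimately have "tb_subset (brk P \<gamma>) D" by blast
    then show ?thesis using D(1) Ds(1) by (metis in_set_conv_nth)
  qed
  define gi where "gi \<gamma> = (SOME j. j < ?q \<and> tb_subset (brk P \<gamma>) (Ds ! j))" for \<gamma>
  have gi: "gi \<gamma> < ?q" "tb_subset (brk P \<gamma>) (Ds ! gi \<gamma>)" if "i < l" "\<gamma> \<in> set (inb P (?\<beta> i))" for i \<gamma>
    using someI_ex[OF idx[OF that]] unfolding gi_def[symmetric] by blast+
  have gi_in: "j0 \<in> snd (Ds ! gi \<gamma>) m" if "i < l" "\<gamma> \<in> set (inb P (?\<beta> i))" "j0 \<in> Q \<gamma> m" for i \<gamma> j0 m
  proof -
    have gn: "\<gamma> \<in> nodes P" using seam_children[OF bs(1)[OF that(1)] that(2)] .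
    show ?thesis using gi(2)[OF that(1,2)] Q_supp[OF node_verts[OF gn] that(3)] that(3)
      unfolding tb_subset_def brk_simps by blast
  qed
  have gi_eq: "gi \<gamma> = j" if "i < l" "\<gamma> \<in> set (inb P (?\<beta> i))" "j0 \<in> Q \<gamma> m" "j < ?q" "j0 \<in> snd (Ds ! j) m" for i \<gamma> j0 m j
  proof -
    have "Ds ! gi \<gamma> \<in> \<D>" "Ds ! j \<in> \<D>" using gi(1)[OF that(1,2)] that(4) Ds(1) by (metis nth_mem)+
    then have "Ds ! gi \<gamma> = Ds ! j" using D_eq gi_in[OF that(1-3)] that(5) by blast
    then show ?thesis using Ds(3) gi(1)[OF that(1,2)] that(4) by (simp add: nth_eq_iff_index_eq)
  qed
  define b where "b j i = length (filter (\<lambda>\<gamma>. gi \<gamma> = j) (inb P (?\<beta> i)))" for j i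
  \<comment> \<open>If two children of a seam fell into groups in reversed order, condition (5)
    would pass the order of the groups on to the children and contradict their order below the
    seam.\<close>
  have srt: "sorted (map gi (inb P (?\<beta> i)))" if i: "i < l" for i
    unfolding sorted_iff_nth_mono_less length_map
  proof (intro allI impI)
    fix s t assume st: "s < t" "t < length (inb P (?\<beta> i))"
    let ?x = "inb P (?\<beta> i) ! s" and ?y = "inb P (?\<beta> i) ! t"
    have xy: "?x \<in> set (inb P (?\<beta> i))" "?y \<in> set (inb P (?\<beta> i))" using st by simp_all
    have n: "?x \<in> nodes P" "?y \<in> nodes P" using seam_children[OF bs(1)[OF i]] xy by blast+
    have R: "(brk P ?x, brk P ?y) \<in> tb_lt Z"
      using seam_sorted_Z[OF bs(1)[OF i]] st by (simp add: sorted_wrt_iff_nth_less)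
    have "gi ?x \<le> gi ?y"
    proof (rule ccontr)
      assume "\<not> gi ?x \<le> gi ?y"
      then have "(Ds ! gi ?y, Ds ! gi ?x) \<in> tb_lt Z"
        using Ds(2) gi(1)[OF i xy(1)] by (simp add: sorted_wrt_iff_nth_less)
      then have "(brk P ?y, brk P ?x) \<in> tb_lt Z"
        using Z.R_inherit[OF _ node_in_Z[OF n(2)] node_in_Z[OF n(1)] _ gi(2)[OF i xy(2)] gi(2)[OF i xy(1)]]
          coh_seam[OF bs(1)[OF i] xy(1)] coh_seam[OF bs(1)[OF i] xy(2)] by simp
      then show False using Z.R_asym[OF R] by blast
    qed
    then show "map gi (inb P (?\<beta> i)) ! s \<le> map gi (inb P (?\<beta> i)) ! t" using st by simp
  qed
  have cc: "concat (map (\<lambda>j. filter (\<lambda>\<gamma>. gi \<gamma> = j) (inb P (?\<beta> i))) [0..<?q]) = inb P (?\<beta> i)" if "i < l" for i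
    by (rule concat_filter_sorted[OF srt[OF that]]) (use gi(1)[OF that] in blast)
  have bl: "block (\<Sum>m<j. b m i) (b j i) (inb P (?\<beta> i)) = filter (\<lambda>\<gamma>. gi \<gamma> = j) (inb P (?\<beta> i))"
    if "i < l" "j < ?q" for i j
    by (rule blocks_of_concat[OF cc[OF that(1), symmetric] _ that(2)]) (simp add: b_def)
  \<comment> \<open>Conversely each number of a group is found below the block: the path to its mark
    leads through a seam whose 1-bracket contains the row \<open>m\<close> in \<open>B\<close>, and
    the hypothesis on \<open>B\<close> places this seam in the block.\<close>
  have find: "\<exists>i<l. \<exists>\<gamma>\<in>set (inb P (?\<beta> i)). gi \<gamma> = j \<and> j0 \<in> Q \<gamma> m" if "j < ?q" "j0 \<in> snd (Ds ! j) m" for j j0 m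
  proof -
    have D: "Ds ! j \<in> \<Y>" using that(1) Ds(1) DY by (metis nth_mem subsetD)
    have m: "m \<in> fst (Ds ! j)" "m \<in> B" using Z.bracket_supp[OF _ that(2)] D Y(1,2) by blast+
    have "j0 \<in> Q a m" using Y(3)[OF D] that(2) m(1) unfolding tb_subset_def brk_simps by blast
    moreover have "a \<notin> Vmark P" using a disj by blast
    ultimately obtain \<beta> where b: "\<beta> \<in> set (inb P a)" "j0 \<in> Q \<beta> m" using Q_child[OF av] by blast
    have bss: "\<beta> \<in> Vseam P" using comp_children[OF a b(1)] .
    have "\<beta> \<in> set (block p l (inb P a))" using B[OF b(1) m(2)] Q_supp[OF type_verts(2)[OF bss] b(2)] by blast
    then obtain i where i: "i < l" "\<beta> = ?\<beta> i" unfolding set_block_conv[OF pl] by blast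
    have "\<beta> \<notin> Vmark P" using bss disj by blast
    then obtain \<gamma> where g: "\<gamma> \<in> set (inb P \<beta>)" "j0 \<in> Q \<gamma> m" using Q_child[OF type_verts(2)[OF bss] _ b(2)] by blast
    have "gi \<gamma> = j" using gi_eq[OF i(1) _ g(2) that] g(1) i(2) by blast
    then show ?thesis using i g by blast
  qed
  show ?thesis
  proof (rule exI[of _ Ds], rule exI[of _ b], intro conjI allI impI)
    show "set Ds \<subseteq> \<Y>" using Ds(1) DY by blast
    show "\<forall>Y\<in>\<Y>. \<exists>D\<in>set Ds. tb_subset Y D" using above Ds(1) by blast
    show "sorted_wrt (\<lambda>X Y. (X, Y) \<in> tb_lt Z) Ds" by (rule Ds(2))
    show "splitting_data P a p l ?q b"
      unfolding splitting_data_def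
    proof (intro conjI allI impI)
      fix i assume i: "i < l"
      have "length (inb P (?\<beta> i)) = length (concat (map (\<lambda>j. filter (\<lambda>\<gamma>. gi \<gamma> = j) (inb P (?\<beta> i))) [0..<?q]))"
        using cc[OF i] by simp
      also have "\<dots> = (\<Sum>j<?q. b j i)"
        by (simp add: length_concat comp_def b_def interv_sum_list_conv_sum_set_nat atLeast0LessThan)
      finally show "length (inb P (?\<beta> i)) = (\<Sum>j<?q. b j i)" .
    next
      fix j assume j: "j < ?q"
      \<comment> \<open>A 2-bracket is nonempty, so each group receives a child; this is the
        requirement that no vector \<open>b\<close> be zero.\<close>
      have "Ds ! j \<in> twos Z" using j Ds(1) DY Y(1) by (metis nth_mem subsetD)
      then obtain m j0 where "j0 \<in> snd (Ds ! j) m" using Z.bracket_ne by blast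
      then obtain i \<gamma> where i: "i < l" "\<gamma> \<in> set (inb P (?\<beta> i))" "gi \<gamma> = j" using find[OF j] by blast
      then have "\<gamma> \<in> set (filter (\<lambda>\<gamma>. gi \<gamma> = j) (inb P (?\<beta> i)))" by simp
      then have "b j i \<noteq> 0" unfolding b_def by (metis length_pos_if_in_set less_numeral_extra(3))
      then show "\<exists>i<l. b j i \<noteq> 0" using i(1) by blast
    qed
    fix j m assume j: "j < ?q"
    have "(\<Union>i<l. \<Union>c\<in>set (block (\<Sum>m<j. b m i) (b j i) (inb P (?\<beta> i))). Q c m) =
        (\<Union>i<l. \<Union>c\<in>set (filter (\<lambda>\<gamma>. gi \<gamma> = j) (inb P (?\<beta> i))). Q c m)"
      by (intro SUP_cong refl) (simp add: bl j)
    also have "\<dots> = snd (Ds ! j) m"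
    proof (intro set_eqI iffI)
      fix j0 assume "j0 \<in> (\<Union>i<l. \<Union>c\<in>set (filter (\<lambda>\<gamma>. gi \<gamma> = j) (inb P (?\<beta> i))). Q c m)"
      then obtain i c where "i < l" "c \<in> set (inb P (?\<beta> i))" "gi c = j" "j0 \<in> Q c m" by auto
      then show "j0 \<in> snd (Ds ! j) m" using gi_in by blast
    next
      fix j0 assume "j0 \<in> snd (Ds ! j) m"
      then obtain i c where "i < l" "c \<in> set (inb P (?\<beta> i))" "gi c = j" "j0 \<in> Q c m" using find[OF j] by blast
      then show "j0 \<in> (\<Union>i<l. \<Union>c\<in>set (filter (\<lambda>\<gamma>. gi \<gamma> = j) (inb P (?\<beta> i))). Q c m)" by auto
    qed
    finally show "snd (Ds ! j) m = (\<Union>i<l. \<Union>c\<in>set (block (\<Sum>m<j. b m i) (b j i) (inb P (?\<beta> i))). Q c m)" ..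
  qed
qed

text \<open>The only new 2-brackets of \<open>P'\<close> are the labels of the \<open>Del\<close>
  vertices, and the hypotheses identify them with the brackets \<open>Ds a ! j\<close> of
  \<open>Z\<close>. For the order it is enough to look below seams: at an \<open>Eps\<close> vertex
  the list \<open>Ds a\<close> is sorted by assumption, and the list at a \<open>Sub\<close> vertex
  is a piece of an old sorted list.\<close>

lemma split_refines:
  assumes "split_move r n P P' A p l q b \<nu> g K'"
    and Ds: "\<And>a. a \<in> A \<Longrightarrow> length (Ds a) = q a"
      "\<And>a. a \<in> A \<Longrightarrow> set (Ds a) \<subseteq> twos Z"
      "\<And>a D. a \<in> A \<Longrightarrow> D \<in> set (Ds a) \<Longrightarrow> fst D = K' (g a)"
      "\<And>a. a \<in> A \<Longrightarrow> sorted_wrt (\<lambda>X Y. (X, Y) \<in> tb_lt Z) (Ds a)"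
      "\<And>a j m. a \<in> A \<Longrightarrow> j < q a \<Longrightarrow> snd (Ds a ! j) m =
        (\<Union>i<l. \<Union>c\<in>set (block (\<Sum>m<j. b a m i) (b a j i) (inb P (inb P a ! (p + i)))). Q c m)"
    and K': "\<And>s. s \<in> verts (stree P') \<Longrightarrow> K' s \<in> ones Z"
  shows "(Z, brackets P') \<in> W_br_le r n" "stable_tree_pair r n P'"
proof -
  interpret M: split_move r n P P' A p l q b \<nu> g K' by (rule assms(1))
  show st: "stable_tree_pair r n P'" by (rule lbl_unique(1)[OF M.lbl'])
  interpret P': stable_pair r n P' by standard (rule st)
  have del: "brk P' (\<nu> (Del a j)) = Ds a ! j" if "a \<in> A" "j < q a" for a j
  proof (rule prod_eqI)
    have "Ds a ! j \<in> set (Ds a)" using that Ds(1) by simp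
    then show "fst (brk P' (\<nu> (Del a j))) = fst (Ds a ! j)"
      using M.result(3)[OF that] Ds(3)[OF that(1)] by simp
    show "snd (brk P' (\<nu> (Del a j))) = snd (Ds a ! j)"
      using M.result(3)[OF that] Ds(5)[OF that] by (simp add: M.blk_def fun_eq_iff)
  qed
  have twos: "twos (brackets P') \<subseteq> twos Z"
  proof
    fix X assume "X \<in> twos (brackets P')"
    then obtain x where x: "x \<in> nodes P'" "X = brk P' x" unfolding brackets_simps by blast
    then consider "x \<in> nodes P" | a j where "a \<in> A" "j < q a" "x = \<nu> (Del a j)"
      unfolding M.comp' M.mark' by blast
    then show "X \<in> twos Z"
    proof cases
      case 1
      then show ?thesis using M.result(2) node_in_Z x(2) by simp
    next
      case (2 a j)
      then show ?thesis using del Ds(1,2)[OF 2(1)] x(2) by (metis nth_mem subsetD)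
    qed
  qed
  show "(Z, brackets P') \<in> W_br_le r n"
  proof (rule W_br_leI[OF P'.brackets_bracketing Z.bracketing _ twos])
    show "ones (brackets P') \<subseteq> ones Z"
      unfolding brackets_simps using M.result(4) K' by auto
    show "tb_lt (brackets P') \<subseteq> tb_lt Z"
    proof (rule P'.tb_lt_local[OF Z.bracketing twos])
      have sub: "sorted_wrt (\<lambda>x y. (brk P' x, brk P' y) \<in> tb_lt Z) (inb P s)" if s: "s \<in> Vseam P" for s
        by (rule sorted_wrt_mono_rel[OF _ seam_sorted_Z[OF s]])
          (simp add: M.result(2)[OF seam_children[OF s]])
      fix s assume "s \<in> Vseam P'"
      then show "sorted_wrt (\<lambda>x y. (brk P' x, brk P' y) \<in> tb_lt Z) (inb P' s)"
      proof (cases rule: M.seam_cases)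
        case old
        then show ?thesis using sub by simp
      next
        case (eps a)
        have "(brk P' (\<nu> (Del a i)), brk P' (\<nu> (Del a j))) \<in> tb_lt Z" if "i < j" "j < q a" for i j
          using Ds(4)[OF eps(1)] Ds(1)[OF eps(1)] that del[OF eps(1)] by (simp add: sorted_wrt_iff_nth_less)
        then show ?thesis using eps(3) by (simp add: sorted_wrt_iff_nth_less)
      next
        case (sub a j i)
        then show ?thesis using \<open>\<And>s. s \<in> Vseam P \<Longrightarrow> sorted_wrt (\<lambda>x y. (brk P' x, brk P' y) \<in> tb_lt Z) (inb P s)\<close>[OF sub(7)]
          by (simp add: M.blk_def block_def sorted_wrt_take sorted_wrt_drop)
      qed
    qed
  qed
qed

end


lemma (in stable_pair) seam_of_base:
  assumes "\<alpha> \<in> Vcomp P" "\<beta> \<in> set (inb P \<alpha>)" "\<beta>' \<in> set (inb P \<alpha>)" "m \<in> K (coh P \<beta>)" "m \<in> K (coh P \<beta>')"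
  shows "\<beta> = \<beta>'"
  using assms(1)
proof (cases rule: comp_cases)
  case (one b)
  then show ?thesis using assms(2,3) by simp
next
  case two
  have "coh P \<beta> \<in> set (ins P (coh P \<alpha>))" "coh P \<beta>' \<in> set (ins P (coh P \<alpha>))"
    using assms(2,3) two(2) by (metis image_eqI list.set_map)+
  then have "coh P \<beta> = coh P \<beta>'" using K_sibling[OF coh_verts[OF type_verts(1)[OF assms(1)]]] assms(4,5) by blast
  then show ?thesis using coh_inj_children assms(1-3) by blast
qed

text \<open>Labels of different nodes differ, and the old nodes keep theirs, so the label of an
  additional node is a new bracket.\<close>

lemma new_node_brackets:
  assumes "stable_tree_pair r n P'" "nodes P \<subseteq> nodes P'" "\<And>v. v \<in> nodes P \<Longrightarrow> brk P' v = brk P v"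
    and "x \<in> nodes P'" "x \<notin> nodes P"
  shows "brackets P' \<noteq> brackets P"
proof
  interpret P': stable_pair r n P' by standard (rule assms(1))
  assume "brackets P' = brackets P"
  then have "brk P' ` nodes P' = brk P ` nodes P" by (metis brackets_simps(2))
  then obtain y where "y \<in> nodes P" "brk P' x = brk P y" using assms(4) by blast
  then have "x = y" using P'.brk_inj[of x y] assms by auto
  then show False using assms(5) \<open>y \<in> nodes P\<close> by blast
qed

section \<open>A move towards a strictly finer 2-bracketing\<close>

locale refined_nat = refined_pair r n P Z
  for r n and P :: "(nat, nat) tree_pair" and Z
begin

definition "progress P' \<longleftrightarrow> move P P' \<and> stable_tree_pair r n P' \<and> (Z, brackets P') \<in> W_br_le r n \<and> brackets P' \<noteq> brackets P"

text \<open>Take the smallest vertex \<open>\<alpha>\<close> of the seam tree whose label contains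
  \<open>B\<close>. A child whose label meets \<open>B\<close> is nested with \<open>B\<close> and
  does not contain it, so its label lies in \<open>B\<close>; hence \<open>B\<close> is the union of
  the labels of some children, and these are consecutive because \<open>B\<close> is. A move of type
  2 at this block creates \<open>B\<close>. Over each component the 2-brackets of \<open>Z\<close>
  with base \<open>B\<close> tell how to cut.\<close>

lemma new_one:
  assumes B: "B \<in> ones Z" "B \<notin> ones (brackets P)"
  shows "\<exists>P'. progress P'"
proof -
  have Bb: "one_bracket r B" using Z.ones_one B(1) by (auto simp: one_bracketing_def)
  then have Bne: "B \<noteq> {}" and Br: "B \<subseteq> {1..r}" and Bc: "consecutive B" by (auto simp: one_bracket_def)
  have "\<exists>s. s \<in> verts (stree P) \<and> B \<subseteq> K s" using S.rt_in Br K_rt by blast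
  then obtain \<alpha> where al: "\<alpha> \<in> verts (stree P)" "B \<subseteq> K \<alpha>"
    and least: "\<And>s. s \<in> verts (stree P) \<Longrightarrow> B \<subseteq> K s \<Longrightarrow> card (K \<alpha>) \<le> card (K s)"
    using ex_has_least_nat[of "\<lambda>s. s \<in> verts (stree P) \<and> B \<subseteq> K s" _ "\<lambda>s. card (K s)"] by blast
  have BK: "B \<noteq> K \<alpha>" using B(2) al(1) by auto
  have fK: "finite (K s)" if "s \<in> verts (stree P)" for s
    using K_sub[OF that] finite_subset by blast
  let ?xs = "ins P \<alpha>"
  let ?k = "length ?xs"
  have child: "\<not> B \<subseteq> K c" if c: "c \<in> set ?xs" for c
  proof
    assume "B \<subseteq> K c"
    then have "card (K \<alpha>) \<le> card (K c)" using least S.child_in[OF al(1) c] by blast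
    moreover have "K c \<subset> K \<alpha>" using K_psubset[OF below_child[OF al(1) c] S.child_neq[OF al(1) c]] .
    ultimately show False using psubset_card_mono[OF fK[OF al(1)]] by (meson not_le)
  qed
  have nleaf: "\<alpha> \<notin> leaves (stree P)"
  proof
    assume "\<alpha> \<in> leaves (stree P)"
    then obtain i where "K \<alpha> = {i}" using K_leaf by blast
    then show False using al(2) Bne BK by (metis subset_singletonD)
  qed
  then have int: "\<alpha> \<in> interior (stree P)" using al(1) by (simp add: interior_def leaves_def)
  have Kal: "K \<alpha> = (\<Union>c\<in>set ?xs. K c)" by (rule KL.l_children[OF al(1) nleaf])
  have sub: "K c \<subseteq> B" if c: "c \<in> set ?xs" "i \<in> K c" "i \<in> B" for c i
  proof -
    have "K c \<in> ones Z" using ones_sub S.child_in[OF al(1) c(1)] unfolding brackets_simps by blast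
    then have "K c \<subseteq> B \<or> B \<subseteq> K c" using Z.ones_nested B(1) c(2,3) by blast
    then show ?thesis using child[OF c(1)] by blast
  qed
  define I where "I = {i. i < ?k \<and> K (?xs ! i) \<inter> B \<noteq> {}}"
  have "I \<subseteq> {..<?k}" unfolding I_def by blast
  moreover have "I \<noteq> {}"
  proof -
    obtain x where x: "x \<in> B" using Bne by blast
    then obtain c where "c \<in> set ?xs" "x \<in> K c" using al(2) Kal by blast
    then obtain i where "i < ?k" "x \<in> K (?xs ! i)" by (metis in_set_conv_nth)
    then show ?thesis using x unfolding I_def by blast
  qed
  moreover have "b \<in> I" if h: "a \<in> I" "c \<in> I" "a < b" "b < c" for a b c
  proof -
    obtain x z where x: "x \<in> K (?xs ! a)" "x \<in> B" and z: "z \<in> K (?xs ! c)" "z \<in> B" using h(1,2) unfolding I_def by blast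
    have bk: "b < ?k" "c < ?k" using h unfolding I_def by auto
    obtain y where y: "y \<in> K (?xs ! b)" using K_ne[OF S.nth_in[OF al(1) bk(1)]] by blast
    have "x < y" using KL.l_sorted[OF al(1) h(3) bk(1)] x y unfolding slt_def by blast
    moreover have "y < z" using KL.l_sorted[OF al(1) h(4) bk(2)] z y unfolding slt_def by blast
    ultimately have "y \<in> B" using consecutive_between[OF Bc x(2) z(2)] by simp
    then show ?thesis using y bk unfolding I_def by blast
  qed
  ultimately obtain p l where pl: "I = {p..<p + l}" "1 \<le> l" "p + l \<le> ?k" using convex_index_set[of I ?k] by metis
  have blkI: "set (block p l ?xs) = (\<lambda>i. ?xs ! i) ` I"
  proof -
    have "I = (\<lambda>i. p + i) ` {..<l}" unfolding pl(1) by (simp add: lessThan_atLeast0 add.commute)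
    then show ?thesis unfolding set_block_conv[OF pl(3)] by (simp add: image_image)
  qed
  have BU: "B = (\<Union>s\<in>set (block p l ?xs). K s)"
  proof (rule set_eqI, rule iffI)
    fix x assume x: "x \<in> B"
    then obtain c where c: "c \<in> set ?xs" "x \<in> K c" using al(2) Kal by blast
    then obtain i where i: "i < ?k" "c = ?xs ! i" by (metis in_set_conv_nth)
    then have "i \<in> I" using c x unfolding I_def by blast
    then show "x \<in> (\<Union>s\<in>set (block p l ?xs). K s)" unfolding blkI using c i by blast
  next
    fix x assume "x \<in> (\<Union>s\<in>set (block p l ?xs). K s)"
    then obtain i where i: "i \<in> I" "x \<in> K (?xs ! i)" unfolding blkI by blast
    then have "?xs ! i \<in> set ?xs" unfolding I_def by simp
    then show "x \<in> B" using sub i unfolding I_def by blast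
  qed
  \<comment> \<open>Blocks of one child or of all children would give \<open>B\<close> as an old
    label, that of the child or that of \<open>\<alpha>\<close>. So newness of \<open>B\<close>
    supplies both side conditions of the move.\<close>
  have l2: "2 \<le> l"
  proof (rule ccontr)
    assume "\<not> 2 \<le> l"
    then have "l = 1" using pl(2) by simp
    then have "set (block p l ?xs) = {?xs ! p}" unfolding blkI pl(1) by simp
    then have "B = K (?xs ! p)" using BU by simp
    moreover have "?xs ! p \<in> verts (stree P)" using S.nth_in[OF al(1)] pl(2,3) by simp
    ultimately show False using B(2) by simp
  qed
  have lk: "l < ?k"
  proof (rule ccontr)
    assume "\<not> l < ?k"
    then have "p = 0" "l = ?k" using pl(3) by simp_all
    then have "B = K \<alpha>" using BU Kal by (simp add: block_def)
    then show False using BK by blast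
  qed
  define A where "A = {a \<in> Vcomp2 P. coh P a = \<alpha>}"
  have Ac: "a \<in> Vcomp P" "coh P a = \<alpha>" "length (inb P a) = ?k" "\<And>i. i < ?k \<Longrightarrow> coh P (inb P a ! i) = ?xs ! i" if "a \<in> A" for a
  proof -
    show c: "a \<in> Vcomp P" "coh P a = \<alpha>" using that unfolding A_def Vcomp2_def by blast+
    have e: "map (coh P) (inb P a) = ?xs" using comp2_map[OF c(1)] that c(2) unfolding A_def Vcomp2_def by simp
    show len: "length (inb P a) = ?k" using arg_cong[OF e, of length] by simp
    show "coh P (inb P a ! i) = ?xs ! i" if "i < ?k" for i using e len that by (metis nth_map)
  qed
  let ?\<Phi> = "\<lambda>a Ds b. set Ds \<subseteq> {Y \<in> twos Z. fst Y = B \<and> tb_subset Y (brk P a)} \<and>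
    sorted_wrt (\<lambda>X Y. (X, Y) \<in> tb_lt Z) Ds \<and> splitting_data P a p l (length Ds) b \<and>
    (\<forall>j m. j < length Ds \<longrightarrow> snd (Ds ! j) m =
      (\<Union>i<l. \<Union>c\<in>set (block (\<Sum>m<j. b m i) (b j i) (inb P (inb P a ! (p + i)))). Q c m))"
  \<comment> \<open>Each component over \<open>\<alpha>\<close> gets its own list of brackets and
    its own vectors from \<open>grouping\<close>; they are chosen simultaneously afterwards. A list
    may be empty, in accordance with the values of \<open>q\<close> that type 2 admits.\<close>
  have ex: "\<forall>a\<in>A. \<exists>x. ?\<Phi> a (fst x) (snd x)"
  proof
    fix a assume a: "a \<in> A"
    have ac: "a \<in> Vcomp P" using Ac(1)[OF a] .
    have av: "a \<in> verts (bub P)" using type_verts ac by blast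
    have pla: "p + l \<le> length (inb P a)" using pl(3) Ac(3)[OF a] by simp
    have bch: "inb P a ! (p + i) \<in> set (inb P a)" if "i < l" for i using pla that by simp
    have bcoh: "coh P (inb P a ! (p + i)) = ?xs ! (p + i)" "?xs ! (p + i) \<in> set (block p l ?xs)"
      "?xs ! (p + i) \<in> set ?xs" if "i < l" for i
    proof -
      have "p + i < ?k" using pl(3) that by simp
      then show "coh P (inb P a ! (p + i)) = ?xs ! (p + i)" "?xs ! (p + i) \<in> set ?xs" using Ac(4)[OF a] by simp_all
      show "?xs ! (p + i) \<in> set (block p l ?xs)" unfolding set_block_conv[OF pl(3)] using that by blast
    qed
    let ?Y = "{Y \<in> twos Z. fst Y = B \<and> tb_subset Y (brk P a)}"
    have big: "\<not> B \<subseteq> K (coh P (inb P a ! (p + i)))" if "i < l" for i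
      using child[OF bcoh(3)[OF that]] unfolding bcoh(1)[OF that] .
    have cov: "\<exists>Y\<in>?Y. j \<in> snd Y m" if h: "i < l" "\<gamma> \<in> set (inb P (inb P a ! (p + i)))" "j \<in> Q \<gamma> m" for i \<gamma> m j
    proof -
      have bs: "inb P a ! (p + i) \<in> Vseam P" using comp_children[OF ac bch[OF h(1)]] .
      have gn: "\<gamma> \<in> nodes P" using seam_children[OF bs h(2)] .
      have "m \<in> K (?xs ! (p + i))"
        using Q_supp[OF node_verts[OF gn] h(3)] coh_seam[OF bs h(2)] bcoh(1)[OF h(1)] by simp
      then have mB: "m \<in> B" using BU bcoh(2)[OF h(1)] by blast
      obtain X where X: "X \<in> twos Z" "fst X = B" "j \<in> snd X m"
        using Z.cover[OF B(1) mB] Q_range[OF node_verts[OF gn] h(3)] by blast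
      have "below (bub P) \<gamma> a"
        using below_child[OF type_verts(2)[OF bs] h(2)] below_child[OF av bch[OF h(1)]] by (rule rtrancl_trans)
      then have ja: "j \<in> Q a m" using Q_mono h(3) by blast
      have "m \<in> fst X" "m \<in> fst (brk P a)" "j \<in> snd (brk P a) m"
        using X(2) mB ja Q_supp[OF av ja] by simp_all
      then have "tb_subset X (brk P a) \<or> tb_subset (brk P a) X"
        using Z.nested[OF X(1) node_in_Z[of a]] ac X(3) by blast
      \<comment> \<open>The base of the bracket of \<open>a\<close> is the label of
        \<open>\<alpha>\<close>, which properly contains the base \<open>B\<close> of
        \<open>X\<close>.\<close>
      moreover have "\<not> tb_subset (brk P a) X"
        using X(2) Ac(2)[OF a] al(2) BK unfolding tb_subset_def brk_simps by blast
      ultimately show ?thesis using X by blast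
    qed
    have Bblk: "\<beta> \<in> set (block p l (inb P a))" if h: "\<beta> \<in> set (inb P a)" "m \<in> B" "m \<in> K (coh P \<beta>)" for \<beta> m
    proof -
      obtain i where i: "i < length (inb P a)" "\<beta> = inb P a ! i" using h(1) by (metis in_set_conv_nth)
      then have "i \<in> I" using h(2,3) Ac(3,4)[OF a] unfolding I_def by auto
      then obtain i' where "i' < l" "i = p + i'" unfolding pl(1) by (metis atLeastLessThan_iff le_Suc_ex nat_add_left_cancel_less)
      then show ?thesis unfolding set_block_conv[OF pla] i(2) by blast
    qed
    have "\<exists>Ds b. set Ds \<subseteq> ?Y \<and> (\<forall>Y\<in>?Y. \<exists>D\<in>set Ds. tb_subset Y D) \<and>
      sorted_wrt (\<lambda>X Y. (X, Y) \<in> tb_lt Z) Ds \<and> splitting_data P a p l (length Ds) b \<and>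
      (\<forall>j m. j < length Ds \<longrightarrow> snd (Ds ! j) m =
        (\<Union>i<l. \<Union>c\<in>set (block (\<Sum>m<j. b m i) (b j i) (inb P (inb P a ! (p + i)))). Q c m))"
    proof (rule grouping)
      show "\<And>i. i < l \<Longrightarrow> \<not> B \<subseteq> K (coh P (inb P a ! (p + i)))" by (rule big)
      show "\<And>i \<gamma> m j. i < l \<Longrightarrow> \<gamma> \<in> set (inb P (inb P a ! (p + i))) \<Longrightarrow> j \<in> Q \<gamma> m \<Longrightarrow> \<exists>Y\<in>?Y. j \<in> snd Y m"
        by (rule cov)
      show "\<And>\<beta> m. \<beta> \<in> set (inb P a) \<Longrightarrow> m \<in> B \<Longrightarrow> m \<in> K (coh P \<beta>) \<Longrightarrow> \<beta> \<in> set (block p l (inb P a))"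
        by (rule Bblk)
    qed (use ac pla in auto)
    then obtain Ds b where "?\<Phi> a Ds b" by (elim exE conjE) blast
    then show "\<exists>x. ?\<Phi> a (fst x) (snd x)" by (intro exI[of _ "(Ds, b)"]) (unfold fst_conv snd_conv)
  qed
  obtain f where f: "\<forall>a\<in>A. ?\<Phi> a (fst (f a)) (snd (f a))" using bchoice[OF ex] by blast
  obtain v where v: "v \<notin> verts (stree P)" using ex_new_if_finite[OF infinite_UNIV_nat S.fin] by blast
  obtain \<nu> :: "nat new_vertex \<Rightarrow> nat" where nu: "inj \<nu>" "range \<nu> \<inter> verts (bub P) = {}"
    using fresh_names[OF B.fin] by blast
  define st where "st = \<lparr>verts = verts (stree P) \<union> {v}, rt = rt (stree P),
    inc = (ins P)(\<alpha> := replace_block p l v ?xs, v := block p l ?xs)\<rparr>"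
  let ?q = "\<lambda>a. length (fst (f a))" and ?b = "\<lambda>a. snd (f a)"
  define P' where "P' = split_pair P A p l ?q ?b \<nu> (\<lambda>_. v) st"
  have Av: "A \<subseteq> verts (bub P)" using Ac(1) type_verts by blast
  note sp = split_pair_bubble[OF nu Av, of p l ?q ?b "\<lambda>_. v" st, folded P'_def]
  have va: "v \<noteq> \<alpha>" using v al(1) by blast
  have data: "move2_data P P' \<alpha> p l v A ?q ?b \<nu>"
    unfolding move2_data_def sp(2-4)
  proof (intro conjI ballI allI impI)
    show "ins P' \<alpha> = replace_block p l v ?xs" "ins P' v = block p l ?xs"
      using va by (simp_all add: sp(5) st_def)
    show "\<And>x. x \<in> verts (stree P) - {\<alpha>} \<Longrightarrow> ins P' x = ins P x" using v by (auto simp: sp(5) st_def)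
    show "coh P (inb P a ! (p + i)) = ?xs ! (p + i)" if "a \<in> A" "i < l" for a i
      using Ac(4)[OF that(1)] pl(3) that(2) by simp
    show "splitting_data P a p l (?q a) (?b a)" if "a \<in> A" for a using f that by blast
    show "split_bubble P P' A p l ?q ?b \<nu>" by (rule sp(1))
    show "A = {a \<in> Vcomp2 P. coh P a = \<alpha>}" by (rule A_def)
  qed (use int l2 lk pl(3) v in \<open>simp_all add: sp(5) st_def\<close>)
  have sm: "split_move r n P P' A p l ?q ?b \<nu> (\<lambda>_. v) (insert_label \<alpha> p l v)" by (rule move2_split[OF data])
  interpret M: split_move r n P P' A p l ?q ?b \<nu> "\<lambda>_. v" "insert_label \<alpha> p l v" by (rule sm)
  have Kv: "insert_label \<alpha> p l v v = B" unfolding insert_label_def using BU by simp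
  have vs: "verts (stree P') = verts (stree P) \<union> {v}" by (simp add: sp(5) st_def)
  have o: "insert_label \<alpha> p l v s \<in> ones Z" if "s \<in> verts (stree P')" for s
  proof (cases "s = v")
    case True
    then show ?thesis using Kv B(1) by simp
  next
    case False
    then have "s \<in> verts (stree P)" using that vs by blast
    then show ?thesis using M.K'_old ones_sub unfolding brackets_simps by (metis image_eqI subsetD)
  qed
  have h: "set (fst (f a)) \<subseteq> {Y \<in> twos Z. fst Y = B \<and> tb_subset Y (brk P a)}"
    "sorted_wrt (\<lambda>X Y. (X, Y) \<in> tb_lt Z) (fst (f a))"
    "\<And>j m. j < ?q a \<Longrightarrow> snd (fst (f a) ! j) m =
      (\<Union>i<l. \<Union>c\<in>set (block (\<Sum>m<j. ?b a m i) (?b a j i) (inb P (inb P a ! (p + i)))). Q c m)"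
    if "a \<in> A" for a
    using f that by blast+
  have "(Z, brackets P') \<in> W_br_le r n"
  proof (rule split_refines(1)[OF sm, where Ds = "\<lambda>a. fst (f a)"])
    show "\<And>a. a \<in> A \<Longrightarrow> set (fst (f a)) \<subseteq> twos Z" using h(1) by blast
    show "\<And>a D. a \<in> A \<Longrightarrow> D \<in> set (fst (f a)) \<Longrightarrow> fst D = insert_label \<alpha> p l v v" using h(1) Kv by blast
  qed (use h(2,3) o in simp_all)
  moreover have "stable_tree_pair r n P'" by (rule lbl_unique(1)[OF M.lbl'])
  moreover have "move P P'" using data unfolding move_def move2_iff by blast
  moreover have "brackets P' \<noteq> brackets P"
  proof
    assume e: "brackets P' = brackets P"
    have "v \<in> verts (stree P')" using vs by blast
    then have "B \<in> ones (brackets P')" using M.result(4) Kv unfolding brackets_simps by (metis image_eqI)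
    then show False using B(2) e by simp
  qed
  ultimately show ?thesis unfolding progress_def by blast
qed

text \<open>Since \<open>Y\<close> is a proper sub-bracket with the same base, condition (4) says
  that the proper sub-brackets over this base cover the bracket of \<open>\<alpha>\<close>. The
  maximal ones among them become the new components. There are at least two, because a single one
  would have to contain, hence equal, the bracket of \<open>\<alpha>\<close>.\<close>

lemma new_two_move3:
  assumes Y: "Y \<in> twos Z" "Y \<notin> twos (brackets P)"
    and a: "\<alpha> \<in> Vcomp P" "2 \<le> length (inb P \<alpha>)" "fst Y = K (coh P \<alpha>)" "tb_subset Y (brk P \<alpha>)"
  shows "\<exists>P'. progress P'"
proof -
  let ?k = "length (inb P \<alpha>)" and ?B = "K (coh P \<alpha>)"
  let ?Y = "{W \<in> twos Z. fst W = ?B \<and> tb_psubset W (brk P \<alpha>)}"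
  have an: "\<alpha> \<in> nodes P" using a(1) by blast
  have av: "\<alpha> \<in> verts (bub P)" using type_verts a(1) by blast
  have sv: "coh P \<alpha> \<in> verts (stree P)" using coh_verts[OF av] .
  have "Y \<noteq> brk P \<alpha>" using Y(2) an by auto
  then have YY: "Y \<in> ?Y" using Y(1) a(3,4) by (simp add: tb_psubset_def)
  have big: "\<not> ?B \<subseteq> K (coh P (inb P \<alpha> ! (0 + i)))" if "i < ?k" for i
  proof -
    have "inb P \<alpha> ! i \<in> set (inb P \<alpha>)" using that by simp
    then have "coh P (inb P \<alpha> ! i) \<in> set (ins P (coh P \<alpha>))" using comp2_map[OF a(1,2)] by (metis image_eqI list.set_map)
    then show ?thesis using K_strict[OF below_child[OF sv] S.child_neq[OF sv]] by simp
  qed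
  have cov: "\<exists>W\<in>?Y. j \<in> snd W m" if h: "j \<in> Q \<alpha> m" for j m
  proof -
    have "m \<in> fst (brk P \<alpha>)" "j \<in> snd (brk P \<alpha>) m" using Q_supp[OF av h] h by simp_all
    moreover have "fst Y = fst (brk P \<alpha>)" "tb_psubset Y (brk P \<alpha>)" using a(3) YY by simp_all
    ultimately obtain W where "W \<in> twos Z" "fst W = fst (brk P \<alpha>)" "tb_psubset W (brk P \<alpha>)" "j \<in> snd W m"
      using Z.subcover[OF node_in_Z[OF an] Y(1)] by blast
    then show ?thesis by (intro bexI[of _ W]) simp_all
  qed
  have covg: "\<exists>W\<in>?Y. j \<in> snd W m" if h: "i < ?k" "\<gamma> \<in> set (inb P (inb P \<alpha> ! (0 + i)))" "j \<in> Q \<gamma> m" for i \<gamma> m j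
  proof -
    have b: "inb P \<alpha> ! i \<in> set (inb P \<alpha>)" using h(1) by simp
    have bv: "inb P \<alpha> ! i \<in> verts (bub P)" using B.child_in[OF av b] .
    have "\<gamma> \<in> set (inb P (inb P \<alpha> ! i))" using h(2) by simp
    then have "below (bub P) \<gamma> \<alpha>" using below_child[OF bv] below_child[OF av b] by (meson rtrancl_trans)
    then have "j \<in> Q \<alpha> m" using Q_mono h(3) by blast
    then show ?thesis by (rule cov)
  qed
  have blk: "\<beta> \<in> set (block 0 ?k (inb P \<alpha>))" if "\<beta> \<in> set (inb P \<alpha>)" "m \<in> ?B" "m \<in> K (coh P \<beta>)" for \<beta> m
    using that by (simp add: block_def)
  have sub1: "?Y \<subseteq> twos Z" and sub2: "\<And>W. W \<in> ?Y \<Longrightarrow> fst W = ?B" and sub3: "\<And>W. W \<in> ?Y \<Longrightarrow> tb_subset W (brk P \<alpha>)"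
    by (auto simp: tb_psubset_def)
  have "\<exists>Ds b. set Ds \<subseteq> ?Y \<and> (\<forall>Y\<in>?Y. \<exists>D\<in>set Ds. tb_subset Y D) \<and>
    sorted_wrt (\<lambda>X Y. (X, Y) \<in> tb_lt Z) Ds \<and> splitting_data P \<alpha> 0 ?k (length Ds) b \<and>
    (\<forall>j m. j < length Ds \<longrightarrow> snd (Ds ! j) m =
      (\<Union>i<?k. \<Union>c\<in>set (block (\<Sum>m<j. b m i) (b j i) (inb P (inb P \<alpha> ! (0 + i)))). Q c m))"
  proof (rule grouping)
    show "\<And>i. i < ?k \<Longrightarrow> \<not> ?B \<subseteq> K (coh P (inb P \<alpha> ! (0 + i)))" by (rule big)
    show "\<And>i \<gamma> m j. i < ?k \<Longrightarrow> \<gamma> \<in> set (inb P (inb P \<alpha> ! (0 + i))) \<Longrightarrow> j \<in> Q \<gamma> m \<Longrightarrow> \<exists>Y\<in>?Y. j \<in> snd Y m"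
      by (rule covg)
    show "\<And>\<beta> m. \<beta> \<in> set (inb P \<alpha>) \<Longrightarrow> m \<in> ?B \<Longrightarrow> m \<in> K (coh P \<beta>) \<Longrightarrow> \<beta> \<in> set (block 0 ?k (inb P \<alpha>))"
      by (rule blk)
    show "?Y \<subseteq> twos Z" by (rule sub1)
    show "\<And>W. W \<in> ?Y \<Longrightarrow> fst W = ?B" by (rule sub2)
    show "\<And>W. W \<in> ?Y \<Longrightarrow> tb_subset W (brk P \<alpha>)" by (rule sub3)
  qed (use a(1) in simp_all)
  then obtain Ds b where D0: "set Ds \<subseteq> ?Y" "\<forall>Y\<in>?Y. \<exists>D\<in>set Ds. tb_subset Y D"
    "sorted_wrt (\<lambda>X Y. (X, Y) \<in> tb_lt Z) Ds" "splitting_data P \<alpha> 0 ?k (length Ds) b"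
    "\<forall>j m. j < length Ds \<longrightarrow> snd (Ds ! j) m =
      (\<Union>i<?k. \<Union>c\<in>set (block (\<Sum>m<j. b m i) (b j i) (inb P (inb P \<alpha> ! (0 + i)))). Q c m)"
    by (elim exE conjE)
  note D = D0(1) D0(2)[rule_format] D0(3,4) D0(5)[rule_format]
  have "Ds \<noteq> []" using D(2)[OF YY] by auto
  moreover have "length Ds \<noteq> 1"
  proof
    assume "length Ds = 1"
    then obtain D0 where D0: "Ds = [D0]" by (auto simp: length_Suc_conv)
    have DY: "D0 \<in> ?Y" using D(1) D0 by simp
    have "tb_subset (brk P \<alpha>) D0"
      unfolding tb_subset_def
    proof (intro conjI ballI subsetI)
      show "\<And>i. i \<in> fst (brk P \<alpha>) \<Longrightarrow> i \<in> fst D0" using DY by simp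
      fix m j assume mj: "m \<in> fst (brk P \<alpha>)" "j \<in> snd (brk P \<alpha>) m"
      then obtain W where W: "W \<in> ?Y" "j \<in> snd W m" using cov[of j m] by auto
      then have "tb_subset W D0" using D(2)[OF W(1)] D0 by simp
      moreover have "m \<in> fst W" using W(1) mj(1) by simp
      ultimately show "j \<in> snd D0 m" using W(2) unfolding tb_subset_def by blast
    qed
    then have "D0 = brk P \<alpha>" using Z.tb_subset_antisym[of D0 "brk P \<alpha>"] DY node_in_Z[OF an] by (simp add: tb_psubset_def)
    then show False using DY by (simp add: tb_psubset_def)
  qed
  ultimately have q2: "2 \<le> length Ds" by (cases Ds; cases "tl Ds") auto
  obtain \<nu> :: "nat new_vertex \<Rightarrow> nat" where nu: "inj \<nu>" "range \<nu> \<inter> verts (bub P) = {}"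
    using fresh_names[OF B.fin] by blast
  define P' where "P' = split_pair P {\<alpha>} 0 ?k (\<lambda>_. length Ds) (\<lambda>_. b) \<nu> (\<lambda>_. coh P \<alpha>) (stree P)"
  have Av: "{\<alpha>} \<subseteq> verts (bub P)" using av by simp
  note sp = split_pair_bubble[OF nu Av, of 0 ?k "\<lambda>_. length Ds" "\<lambda>_. b" "\<lambda>_. coh P \<alpha>" "stree P", folded P'_def]
  have data: "move3_data P P' \<alpha> ?k (length Ds) b \<nu>"
    unfolding move3_data_def sp(2-5) using a(1,2) q2 D(4) sp(1) by (simp add: Vcomp2_def)
  have sm: "split_move r n P P' {\<alpha>} 0 ?k (\<lambda>_. length Ds) (\<lambda>_. b) \<nu> (\<lambda>_. coh P \<alpha>) K" by (rule move3_split[OF data])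
  interpret M: split_move r n P P' "{\<alpha>}" 0 ?k "\<lambda>_. length Ds" "\<lambda>_. b" \<nu> "\<lambda>_. coh P \<alpha>" K by (rule sm)
  have ref: "(Z, brackets P') \<in> W_br_le r n" "stable_tree_pair r n P'"
  proof -
    have o: "K s \<in> ones Z" if "s \<in> verts (stree P')" for s using that ones_sub unfolding sp(5) brackets_simps by blast
    have s1: "set Ds \<subseteq> twos Z" and s2: "\<And>D. D \<in> set Ds \<Longrightarrow> fst D = ?B" using D(1) by auto
    show "(Z, brackets P') \<in> W_br_le r n"
      by (rule split_refines(1)[OF sm, where Ds = "\<lambda>_. Ds"]) (use s1 s2 D(3,5) o in simp_all)
    show "stable_tree_pair r n P'" by (rule lbl_unique(1)[OF M.lbl'])
  qed
  moreover have "move P P'" using data unfolding move_def move3_iff by blast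
  moreover have "brackets P' \<noteq> brackets P"
  proof (rule new_node_brackets[OF ref(2)])
    show "nodes P \<subseteq> nodes P'" unfolding M.comp' M.mark' by blast
    show "\<And>v. v \<in> nodes P \<Longrightarrow> brk P' v = brk P v" by (rule M.result(2))
    show "\<nu> (Del \<alpha> 0) \<in> nodes P'" unfolding M.comp' using q2 by force
    show "\<nu> (Del \<alpha> 0) \<notin> nodes P" using M.nu_notin node_verts by blast
  qed
  ultimately show ?thesis unfolding progress_def by blast
qed

text \<open>By \<open>min\<close> a child of \<open>\<beta>\<close> that meets \<open>Y\<close> lies
  inside \<open>Y\<close>, so \<open>Y\<close> is made up of brackets of children. Any other child
  is comparable with \<open>Y\<close>; condition (5) compares it with a child inside
  \<open>Y\<close>, and the order below \<open>\<beta>\<close> then decides on which side of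
  \<open>Y\<close> it stands. Hence the children inside \<open>Y\<close> are consecutive, and the
  new vertex takes a correct place among the remaining ones.\<close>

lemma new_two_move1:
  assumes Y: "Y \<in> twos Z" "Y \<notin> twos (brackets P)"
    and a: "\<alpha> \<in> Vcomp P" "\<beta> \<in> set (inb P \<alpha>)" "fst Y = K (coh P \<beta>)" "tb_subset Y (brk P \<alpha>)"
    and min: "\<And>\<gamma> j m. \<gamma> \<in> set (inb P \<beta>) \<Longrightarrow> j \<in> Q \<gamma> m \<Longrightarrow> j \<in> snd Y m \<Longrightarrow> tb_subset (brk P \<gamma>) Y"
  shows "\<exists>P'. progress P'"
proof -
  let ?xs = "inb P \<beta>"
  let ?k = "length ?xs"
  have av: "\<alpha> \<in> verts (bub P)" using type_verts a(1) by blast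
  have bs: "\<beta> \<in> Vseam P" using comp_children[OF a(1,2)] .
  have bv: "\<beta> \<in> verts (bub P)" using type_verts bs by blast
  have aM: "\<alpha> \<notin> Vmark P" "\<beta> \<notin> Vmark P" using a(1) bs disj by blast+
  have xn: "?xs ! i \<in> nodes P" "coh P (?xs ! i) = coh P \<beta>" "?xs ! i \<in> set ?xs" if "i < ?k" for i
    using seam_children[OF bs] coh_seam[OF bs] that by simp_all
  have cov: "\<exists>i<?k. j \<in> Q (?xs ! i) m" if h: "j \<in> snd Y m" for j m
  proof -
    have m: "m \<in> fst Y" using Z.bracket_supp[OF Y(1) h] .
    have "j \<in> Q \<alpha> m" using a(4) m h unfolding tb_subset_def brk_simps by blast
    then obtain \<beta>' where b': "\<beta>' \<in> set (inb P \<alpha>)" "j \<in> Q \<beta>' m" using Q_child[OF av aM(1)] by blast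
    have "m \<in> K (coh P \<beta>')" using Q_supp[OF B.child_in[OF av b'(1)] b'(2)] .
    then have "\<beta>' = \<beta>" using seam_of_base[OF a(1) b'(1) a(2)] m a(3) by simp
    then obtain \<gamma> where "\<gamma> \<in> set ?xs" "j \<in> Q \<gamma> m" using Q_child[OF bv aM(2)] b'(2) by blast
    then show ?thesis by (metis in_set_conv_nth)
  qed
  have R: "(brk P (?xs ! s), brk P (?xs ! t)) \<in> tb_lt Z" if "s < t" "t < ?k" for s t
    using seam_sorted_Z[OF bs] that by (simp add: sorted_wrt_iff_nth_less)
  define I where "I = {i. i < ?k \<and> (\<exists>j m. j \<in> Q (?xs ! i) m \<and> j \<in> snd Y m)}"
  have inI: "tb_subset (brk P (?xs ! i)) Y" if "i \<in> I" for i
    using that min[OF xn(3)] unfolding I_def by blast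
  have cmp: "(Y, brk P (?xs ! i)) \<in> tb_lt Z \<or> (brk P (?xs ! i), Y) \<in> tb_lt Z" if i: "i < ?k" "i \<notin> I" for i
  proof -
    have "fst Y = fst (brk P (?xs ! i))" using a(3) xn(2)[OF i(1)] by simp
    moreover have "\<forall>m\<in>fst Y. snd Y m \<inter> snd (brk P (?xs ! i)) m = {}" using i unfolding I_def by auto
    ultimately show ?thesis using Z.R_iff[OF Y(1) node_in_Z[OF xn(1)[OF i(1)]]] by blast
  qed
  have before: "(brk P (?xs ! i), Y) \<in> tb_lt Z" if h: "i < ?k" "i \<notin> I" "c \<in> I" "i < c" for i c
  proof (rule ccontr)
    assume "(brk P (?xs ! i), Y) \<notin> tb_lt Z"
    then have Yi: "(Y, brk P (?xs ! i)) \<in> tb_lt Z" using cmp[OF h(1,2)] by blast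
    have c: "c < ?k" using h(3) unfolding I_def by blast
    have "(brk P (?xs ! c), brk P (?xs ! i)) \<in> tb_lt Z"
      by (rule Z.R_inherit[OF Yi node_in_Z[OF xn(1)[OF c]] node_in_Z[OF xn(1)[OF h(1)]] _ inI[OF h(3)] tb_subset_refl])
        (simp add: xn(2) c h(1))
    then show False using Z.R_asym[OF R[OF h(4) c]] by blast
  qed
  have after: "(Y, brk P (?xs ! i)) \<in> tb_lt Z" if h: "i < ?k" "i \<notin> I" "c \<in> I" "c < i" for i c
  proof (rule ccontr)
    assume "(Y, brk P (?xs ! i)) \<notin> tb_lt Z"
    then have Yi: "(brk P (?xs ! i), Y) \<in> tb_lt Z" using cmp[OF h(1,2)] by blast
    have c: "c < ?k" using h(3) unfolding I_def by blast
    have "(brk P (?xs ! i), brk P (?xs ! c)) \<in> tb_lt Z"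
      by (rule Z.R_inherit[OF Yi node_in_Z[OF xn(1)[OF h(1)]] node_in_Z[OF xn(1)[OF c]] _ tb_subset_refl inI[OF h(3)]])
        (simp add: xn(2) c h(1))
    then show False using Z.R_asym[OF R[OF h(4,1)]] by blast
  qed
  obtain m0 j0 where j0: "j0 \<in> snd Y m0" using Z.bracket_ne[OF Y(1)] by blast
  have Isub: "I \<subseteq> {..<?k}" unfolding I_def by blast
  have Ine: "I \<noteq> {}" using cov[OF j0] j0 unfolding I_def by blast
  have conv: "s \<in> I" if h: "c \<in> I" "d \<in> I" "c < s" "s < d" for c s d
  proof (rule ccontr)
    assume n: "s \<notin> I"
    have s: "s < ?k" using h Isub by auto
    show False using Z.R_asym[OF before[OF s n h(2,4)]] after[OF s n h(1,3)] by blast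
  qed
  obtain p l where pl: "I = {p..<p + l}" "1 \<le> l" "p + l \<le> ?k" by (rule convex_index_set[OF Isub Ine conv])
  have pI: "p \<in> I" using pl(1,2) by simp
  have blkI: "x \<in> set (block p l ?xs) \<longleftrightarrow> (\<exists>i\<in>I. x = ?xs ! i)" for x
  proof
    assume "x \<in> set (block p l ?xs)"
    then obtain i where "i < l" "x = ?xs ! (p + i)" unfolding set_block_conv[OF pl(3)] by blast
    then show "\<exists>i\<in>I. x = ?xs ! i" unfolding pl(1) by (intro bexI[of _ "p + i"]) auto
  next
    assume "\<exists>i\<in>I. x = ?xs ! i"
    then obtain i where i: "p \<le> i" "i < p + l" "x = ?xs ! i" unfolding pl(1) by auto
    then have "i - p < l" "p + (i - p) = i" by linarith+
    then show "x \<in> set (block p l ?xs)" unfolding set_block_conv[OF pl(3)] using i(3) by (intro image_eqI[of _ _ "i - p"]) auto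
  qed
  have Yparts: "snd Y m = (\<Union>\<gamma>\<in>set (block p l ?xs). Q \<gamma> m)" for m
  proof (intro set_eqI iffI)
    fix j assume j: "j \<in> snd Y m"
    then obtain i where i: "i < ?k" "j \<in> Q (?xs ! i) m" using cov by blast
    then have "i \<in> I" using j unfolding I_def by blast
    then show "j \<in> (\<Union>\<gamma>\<in>set (block p l ?xs). Q \<gamma> m)" using blkI i(2) by blast
  next
    fix j assume "j \<in> (\<Union>\<gamma>\<in>set (block p l ?xs). Q \<gamma> m)"
    then obtain \<gamma> where g: "\<gamma> \<in> set (block p l ?xs)" "j \<in> Q \<gamma> m" by blast
    obtain i0 where "i0 \<in> I" "\<gamma> = ?xs ! i0" using iffD1[OF blkI g(1)] by blast
    then obtain i where i: "i \<in> I" "j \<in> Q (?xs ! i) m" using g(2) by blast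
    then have ik: "i < ?k" using Isub by blast
    have "m \<in> K (coh P (?xs ! i))" using Q_supp[OF node_verts[OF xn(1)[OF ik]] i(2)] .
    then show "j \<in> snd Y m" using inI[OF i(1)] i(2) unfolding tb_subset_def brk_simps by blast
  qed
  have l2: "2 \<le> l"
  proof (rule ccontr)
    assume "\<not> 2 \<le> l"
    then have "I = {p}" using pl(1,2) by auto
    then have "set (block p l ?xs) = {?xs ! p}" using blkI by blast
    then have "snd Y = Q (?xs ! p)" using Yparts by auto
    moreover have pk: "p < ?k" using pI Isub by blast
    then have "fst Y = K (coh P (?xs ! p))" using a(3) xn(2) by simp
    ultimately have "Y = brk P (?xs ! p)" by (simp add: prod_eq_iff)
    then show False using Y(2) xn(1)[OF pk] by simp
  qed
  \<comment> \<open>If \<open>\<beta>\<close> is the only seam of \<open>\<alpha>\<close>, a block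
    of all its children would make \<open>Y\<close> the bracket of \<open>\<alpha>\<close>. For
    several seams the entire list is a legitimate block, as the base of \<open>Y\<close> is then
    smaller than that of \<open>\<alpha>\<close>.\<close>
  have lk: "l < ?k" if one: "length (inb P \<alpha>) = 1"
  proof (rule ccontr)
    assume "\<not> l < ?k"
    then have "p = 0" "l = ?k" using pl(3) by simp_all
    then have all: "set (block p l ?xs) = set ?xs" by (simp add: block_def)
    have ia: "inb P \<alpha> = [\<beta>]" using one a(2) by (auto simp: length_Suc_conv)
    have "Q \<alpha> m = snd Y m" for m
      using Q_children[OF av aM(1), of m] Q_children[OF bv aM(2), of m] ia all Yparts[of m] by simp
    then have "snd Y = Q \<alpha>" by (simp add: fun_eq_iff)
    moreover have "fst Y = K (coh P \<alpha>)" using comp1[OF a(1) ia] a(3) by simp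
    ultimately have "Y = brk P \<alpha>" by (simp add: prod_eq_iff)
    then show False using Y(2) a(1) by simp
  qed
  obtain \<delta> where d: "\<delta> \<notin> verts (bub P)" using ex_new_if_finite[OF infinite_UNIV_nat B.fin] by blast
  have "finite (insert \<delta> (verts (bub P)))" by simp
  then obtain \<epsilon> where "\<epsilon> \<notin> insert \<delta> (verts (bub P))" using ex_new_if_finite[OF infinite_UNIV_nat] by blast
  then have e: "\<epsilon> \<notin> verts (bub P)" "\<delta> \<noteq> \<epsilon>" by blast+
  define P' where "P' = \<lparr>bub = \<lparr>verts = verts (bub P) \<union> {\<delta>, \<epsilon>}, rt = rt (bub P),
      inc = (inb P)(\<beta> := replace_block p l \<delta> ?xs, \<delta> := [\<epsilon>], \<epsilon> := block p l ?xs)\<rparr>,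
    solid = solid P \<union> {(\<epsilon>, \<delta>)}, Vcomp = Vcomp P \<union> {\<delta>}, Vseam = Vseam P \<union> {\<epsilon>}, Vmark = Vmark P,
    stree = stree P, coh = (coh P)(\<delta> := coh P \<beta>, \<epsilon> := coh P \<beta>)\<rparr>"
  have bde: "\<beta> \<noteq> \<delta>" "\<beta> \<noteq> \<epsilon>" using bv d e by blast+
  have data: "move1_data P P' \<alpha> \<beta> p l \<delta> \<epsilon>"
    unfolding move1_data_def using a(1,2) l2 pl(3) lk d e bde by (auto simp: P'_def)
  interpret M: move1_pair r n P P' \<alpha> \<beta> p l \<delta> \<epsilon> by standard (rule data)
  have st: "stable_tree_pair r n P'" by (rule lbl_unique(1)[OF M.lbl'])
  interpret P': stable_pair r n P' by standard (rule st)
  have bd: "brk P' \<delta> = Y" using M.result(3) a(3) Yparts by (simp add: prod_eq_iff fun_eq_iff)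
  have twos: "twos (brackets P') \<subseteq> twos Z"
  proof
    fix X assume "X \<in> twos (brackets P')"
    then obtain x where x: "x \<in> nodes P'" "X = brk P' x" unfolding brackets_simps by blast
    then consider "x \<in> nodes P" | "x = \<delta>" unfolding M.mv(15,17) by blast
    then show "X \<in> twos Z" using x(2) bd Y(1) M.result(2) node_in_Z by cases simp_all
  qed
  have "(Z, brackets P') \<in> W_br_le r n"
  proof (rule W_br_leI[OF P'.brackets_bracketing Z.bracketing _ twos])
    show "ones (brackets P') \<subseteq> ones Z"
    proof
      fix B assume "B \<in> ones (brackets P')"
      then obtain s where s: "s \<in> verts (stree P')" "B = seam_label P' s" unfolding brackets_simps by blast
      then have "B = K s" "s \<in> verts (stree P)" using lbl_unique(2)[OF M.lbl' s(1)] M.mv(18) by simp_all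
      then show "B \<in> ones Z" using ones_sub unfolding brackets_simps by blast
    qed
    show "tb_lt (brackets P') \<subseteq> tb_lt Z"
    proof (rule P'.tb_lt_local[OF Z.bracketing twos])
      have old: "sorted_wrt (\<lambda>x y. (brk P' x, brk P' y) \<in> tb_lt Z) (inb P s)" if s: "s \<in> Vseam P" for s
        by (rule sorted_wrt_mono_rel[OF _ seam_sorted_Z[OF s]]) (simp add: M.result(2)[OF seam_children[OF s]])
      fix s assume "s \<in> Vseam P'"
      then consider "s = \<epsilon>" | "s = \<beta>" | "s \<in> Vseam P" "s \<noteq> \<beta>" unfolding M.mv(16) by blast
      then show "sorted_wrt (\<lambda>x y. (brk P' x, brk P' y) \<in> tb_lt Z) (inb P' s)"
      proof cases
        case 1
        then show ?thesis using old[OF bs] by (simp add: M.mv(13) block_def sorted_wrt_take sorted_wrt_drop)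
      next
        case 2
        let ?R = "\<lambda>x y. (brk P' x, brk P' y) \<in> tb_lt Z"
        have xs: "sorted_wrt ?R (take p ?xs @ block p l ?xs @ drop (p + l) ?xs)"
          using old[OF bs] block_split[OF pl(3)] by simp
        have t: "?R x \<delta>" if x: "x \<in> set (take p ?xs)" for x
        proof -
          obtain i where i: "i < p" "i < ?k" "x = ?xs ! i" using x by (auto simp: in_set_conv_nth)
          have "i \<notin> I" using i(1) unfolding pl(1) by simp
          then show ?thesis using before[OF i(2) _ pI i(1)] M.result(2)[OF xn(1)[OF i(2)]] bd i(3) by simp
        qed
        have u: "?R \<delta> x" if x: "x \<in> set (drop (p + l) ?xs)" for x
        proof -
          obtain i0 where i0: "i0 < length (drop (p + l) ?xs)" "x = drop (p + l) ?xs ! i0"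
            using x by (metis in_set_conv_nth)
          define i where "i = p + l + i0"
          have i: "p + l \<le> i" "i < ?k" "x = ?xs ! i" using i0 by (simp_all add: i_def)
          have "i \<notin> I" using i(1) unfolding pl(1) by simp
          moreover have "p < i" using i(1) pl(2) by simp
          ultimately show ?thesis using after[OF i(2) _ pI] M.result(2)[OF xn(1)[OF i(2)]] bd i(3) by simp
        qed
        show ?thesis unfolding 2 M.mv(11) replace_block_def
          using xs t u by (simp add: sorted_wrt_append)
      next
        case 3
        then show ?thesis using old M.mv_inc[OF type_verts(2)] by simp
      qed
    qed
  qed
  moreover have "move P P'" using data unfolding move_def move1_iff by blast
  moreover have "brackets P' \<noteq> brackets P"
  proof (rule new_node_brackets[OF st])
    show "nodes P \<subseteq> nodes P'" unfolding M.mv(15,17) by blast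
    show "\<And>v. v \<in> nodes P \<Longrightarrow> brk P' v = brk P v" by (rule M.result(2))
    show "\<delta> \<in> nodes P'" unfolding M.mv(15) by blast
    show "\<delta> \<notin> nodes P" using d node_verts by blast
  qed
  ultimately show ?thesis unfolding progress_def using st by blast
qed

text \<open>Let \<open>\<alpha>\<close> be minimal with \<open>Y\<close> inside its bracket and
  \<open>\<beta>\<close> a seam of \<open>\<alpha>\<close> that carries a number of
  \<open>Y\<close>. By minimality the children of \<open>\<beta>\<close> that meet \<open>Y\<close>
  lie inside \<open>Y\<close>, so the base of \<open>Y\<close> is between the 1-brackets of
  \<open>\<beta>\<close> and \<open>\<alpha>\<close>. All 1-brackets of \<open>Z\<close> being old,
  the base is the label of a vertex of the seam tree, hence one of these two. The 1-bracket of
  \<open>\<beta>\<close> leads to type 1, that of a component with several seams to type 3.\<close>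

lemma new_two:
  assumes "ones Z \<subseteq> ones (brackets P)" and Y: "Y \<in> twos Z" "Y \<notin> twos (brackets P)"
  shows "\<exists>P'. progress P'"
proof -
  let ?S = "{x \<in> nodes P. tb_subset Y (brk P x)}"
  have "tb_subset Y (brk P (rt (bub P)))"
    unfolding brk_rt tb_subset_def full_bracket_def using Z.base_sub[OF Y(1)] Z.bracket_range[OF Y(1)] by auto
  then have "rt (bub P) \<in> ?S" using rt_node by blast
  then have "\<exists>z\<in>?S. \<forall>y. (y, z) \<in> (edges (bub P))\<^sup>+ \<longrightarrow> y \<notin> ?S"
    by (rule wf_trancl[OF B.wf_edges, unfolded wf_eq_minimal, rule_format])
  then obtain \<alpha> where al: "\<alpha> \<in> ?S" and min': "\<forall>x. (x, \<alpha>) \<in> (edges (bub P))\<^sup>+ \<longrightarrow> x \<notin> ?S"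
    by (rule bexE)
  note min = min'[rule_format]
  have an: "\<alpha> \<in> nodes P" "tb_subset Y (brk P \<alpha>)" using al by blast+
  obtain m0 j0 where j0: "m0 \<in> fst Y" "j0 \<in> snd Y m0" using Z.bracket_ne[OF Y(1)] by blast
  have j0a: "m0 \<in> K (coh P \<alpha>)" "j0 \<in> Q \<alpha> m0" using an(2) j0 unfolding tb_subset_def brk_simps by blast+
  \<comment> \<open>A point bracket has no proper sub-bracket, so inside the bracket of a mark
    \<open>Y\<close> would be an old bracket.\<close>
  have "\<alpha> \<notin> Vmark P"
  proof
    assume "\<alpha> \<in> Vmark P"
    then obtain i j where p: "brk P \<alpha> = point_bracket i j" using mark_point by blast
    have "fst (brk P \<alpha>) = {i}" "\<And>m. snd (brk P \<alpha>) m \<subseteq> (if m = i then {j} else {})"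
      unfolding p point_bracket_def by simp_all
    then have K: "K (coh P \<alpha>) = {i}" "\<And>m. Q \<alpha> m \<subseteq> (if m = i then {j} else {})" by simp_all
    then have "m0 = i" "j0 = j" using j0a K(2)[of m0] by auto
    then have "tb_subset (brk P \<alpha>) Y" using j0 K(1) K(2)[of i] unfolding tb_subset_def brk_simps by auto
    then have "Y = brk P \<alpha>" using Z.tb_subset_antisym[OF Y(1) node_in_Z[OF an(1)] an(2)] by blast
    then show False using Y(2) an(1) by simp
  qed
  then have ac: "\<alpha> \<in> Vcomp P" using an(1) by blast
  have av: "\<alpha> \<in> verts (bub P)" using type_verts ac by blast
  have low: "tb_subset (brk P \<gamma>) Y" if h: "\<beta> \<in> set (inb P \<alpha>)" "\<gamma> \<in> set (inb P \<beta>)" "j \<in> Q \<gamma> m" "j \<in> snd Y m" for \<beta> \<gamma> j m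
  proof -
    have bs: "\<beta> \<in> Vseam P" using comp_children[OF ac h(1)] .
    have gn: "\<gamma> \<in> nodes P" using seam_children[OF bs h(2)] .
    have "(\<gamma>, \<alpha>) \<in> (edges (bub P))\<^sup>+"
      by (rule trancl.intros(2)[OF r_into_trancl[OF edgeI[OF type_verts(2)[OF bs] h(2)]] edgeI[OF av h(1)]])
    then have "\<not> tb_subset Y (brk P \<gamma>)" using min gn by blast
    moreover have "m \<in> fst (brk P \<gamma>)" "j \<in> snd (brk P \<gamma>) m" using Q_supp[OF node_verts[OF gn] h(3)] h(3) by simp_all
    moreover have "m \<in> fst Y" using Z.bracket_supp[OF Y(1) h(4)] .
    ultimately show ?thesis using Z.nested[OF Y(1) node_in_Z[OF gn]] h(4) by blast
  qed
  obtain \<beta> where b: "\<beta> \<in> set (inb P \<alpha>)" "j0 \<in> Q \<beta> m0" using Q_child[OF av \<open>\<alpha> \<notin> Vmark P\<close> j0a(2)] by blast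
  have bs: "\<beta> \<in> Vseam P" using comp_children[OF ac b(1)] .
  then have bM: "\<beta> \<notin> Vmark P" "\<beta> \<in> verts (bub P)" using disj type_verts by blast+
  obtain \<gamma> where g: "\<gamma> \<in> set (inb P \<beta>)" "j0 \<in> Q \<gamma> m0" using Q_child[OF bM(2,1) b(2)] by blast
  have lo: "K (coh P \<beta>) \<subseteq> fst Y"
    using low[OF b(1) g j0(2)] coh_seam[OF bs g(1)] by (simp add: tb_subset_def)
  have hi: "fst Y \<subseteq> K (coh P \<alpha>)" using an(2) by (simp add: tb_subset_def)
  have m1: "\<exists>P'. progress P'" if "fst Y = K (coh P \<beta>)"
    by (rule new_two_move1[OF Y ac b(1) that an(2)]) (use low[OF b(1)] in blast)
  from ac show ?thesis
  proof (cases rule: comp_cases)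
    case (one \<beta>')
    then have "coh P \<beta> = coh P \<alpha>" using b(1) by simp
    then show ?thesis using m1 lo hi by simp
  next
    case two
    show ?thesis
    proof (cases "fst Y = K (coh P \<alpha>)")
      case True
      then show ?thesis using new_two_move3[OF Y ac two(1) _ an(2)] by blast
    next
      case False
      have "fst Y \<in> ones (brackets P)" using assms(1) Z.base_in[OF Y(1)] by blast
      then obtain s where s: "s \<in> verts (stree P)" "fst Y = K s" unfolding brackets_simps by blast
      have cv: "coh P \<alpha> \<in> verts (stree P)" "coh P \<beta> \<in> verts (stree P)" using coh_verts av bM(2) by blast+
      have c: "coh P \<beta> \<in> set (ins P (coh P \<alpha>))" using b(1) two(2) by (metis image_eqI list.set_map)
      have bl: "below (stree P) (coh P \<beta>) s" "below (stree P) s (coh P \<alpha>)"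
        using K_below[OF cv(2) s(1)] K_below[OF s(1) cv(1)] lo hi s(2) by simp_all
      have "coh P \<beta> = s"
      proof (rule ccontr)
        assume "coh P \<beta> \<noteq> s"
        then have "below (stree P) (coh P \<alpha>) s" using S.below_parent[OF c cv(1) bl(1)] by blast
        then have "s = coh P \<alpha>" using S.below_antisym bl(2) by blast
        then show False using False s(2) by simp
      qed
      then show ?thesis using m1 s(2) by simp
    qed
  qed
qed

lemma progress_exists:
  assumes "Z \<noteq> brackets P"
  shows "\<exists>P'. progress P'"
proof (cases "ones Z \<subseteq> ones (brackets P)")
  case False
  then show ?thesis using new_one by blast
next
  case o: True
  show ?thesis
  proof (cases "twos Z \<subseteq> twos (brackets P)")
    case False
    then show ?thesis using new_two[OF o] by blast
  next
    case True
    then have t: "twos Z = twos (brackets P)" using twos_sub by blast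
    \<comment> \<open>With equal collections of brackets the restriction is no restriction, and the
      orders agree as well.\<close>
    have "tb_lt (brackets P) = tb_lt Z \<inter> (twos (brackets P) \<times> twos (brackets P))"
      by (rule order_restrict[OF brackets_bracketing Z.bracketing twos_sub tb_lt_sub])
    moreover have "tb_lt Z \<subseteq> twos (brackets P) \<times> twos (brackets P)" using Z.R_base t by auto
    ultimately have "tb_lt (brackets P) = tb_lt Z" by blast
    then have "Z = brackets P" using t o ones_sub by (intro two_bracketing.equality) auto
    then show ?thesis using assms by blast
  qed
qed

end


section \<open>The maximal tree-pair\<close>

lemma (in bracketing) R_points:
  "i \<in> {1..r} \<Longrightarrow> j \<in> {1..n i} \<Longrightarrow> j' \<in> {1..n i} \<Longrightarrow> j < j' \<Longrightarrow>
    (point_bracket i j, point_bracket i j') \<in> tb_lt Z"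
proof -
  have "\<forall>i\<in>{1..r}. \<forall>j\<in>{1..n i}. \<forall>j'\<in>{1..n i}.
      j < j' \<longrightarrow> (point_bracket i j, point_bracket i j') \<in> tb_lt Z"
    using bracketing unfolding is_two_bracketing_def Let_def by (elim conjE)
  then show "i \<in> {1..r} \<Longrightarrow> j \<in> {1..n i} \<Longrightarrow> j' \<in> {1..n i} \<Longrightarrow> j < j' \<Longrightarrow>
    (point_bracket i j, point_bracket i j') \<in> tb_lt Z" by blast
qed

text \<open>Such a pair has only those brackets that every 2-bracketing must contain, and it relates
  only point brackets of the same row, whose order condition (5) prescribes.\<close>

lemma (in stable_pair) top_le:
  assumes comp: "Vcomp P \<subseteq> {rt (bub P)}" and st: "verts (stree P) \<subseteq> insert (rt (stree P)) (leaves (stree P))"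
    and Z: "is_two_bracketing r n Z"
  shows "(Z, brackets P) \<in> W_br_le r n"
proof -
  interpret Z: bracketing r n Z by standard (rule Z)
  have cases: "brk P x = full_bracket r n \<or> (\<exists>i\<in>{1..r}. \<exists>j\<in>{1..n i}. brk P x = point_bracket i j)"
    if x: "x \<in> nodes P" for x
  proof (cases "x \<in> Vmark P")
    case True
    obtain i j where ij: "j \<in> Q x i" using node_ne[OF x] by blast
    then show ?thesis using brk_mark[OF True ij] Q_range[OF node_verts[OF x] ij] by blast
  next
    case False
    then show ?thesis using x comp brk_rt by blast
  qed
  have twos: "twos (brackets P) \<subseteq> twos Z"
  proof
    fix X assume "X \<in> twos (brackets P)"
    then obtain x where "x \<in> nodes P" "X = brk P x" unfolding brackets_simps by blast
    then show "X \<in> twos Z" using cases[of x] Z.full_in Z.points_in by auto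
  qed
  show ?thesis
  proof (rule W_br_leI[OF brackets_bracketing Z _ twos])
    show "ones (brackets P) \<subseteq> ones Z"
    proof
      fix B assume "B \<in> ones (brackets P)"
      then obtain s where s: "s \<in> verts (stree P)" "B = K s" unfolding brackets_simps by blast
      show "B \<in> ones Z"
      proof (cases "s \<in> leaves (stree P)")
        case True
        then obtain i where "K s = {i}" using K_leaf by blast
        then show ?thesis using s(2) K_sub[OF s(1)] Z.ones_one by (auto simp: one_bracketing_def)
      next
        case False
        then have "s = rt (stree P)" using st s(1) by blast
        then show ?thesis using s(2) K_rt Z.ones_one by (simp add: one_bracketing_def)
      qed
    qed
    show "tb_lt (brackets P) \<subseteq> tb_lt Z"
    proof
      fix e assume e: "e \<in> tb_lt (brackets P)"
      obtain X Y where XY: "e = (X, Y)" by (cases e)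
      obtain x y where x: "X = brk P x" "Y = brk P y" "x \<in> nodes P" "y \<in> nodes P" "coh P x = coh P y"
        "left_of (bub P) x y" using e unfolding XY by (rule tb_ltE)
      have nrt: "z \<noteq> rt (bub P)" if "z = x \<or> z = y" for z
        using that B.left_of_not_below[OF x(6)] B.below_rt[OF node_verts[OF x(3)]] B.below_rt[OF node_verts[OF x(4)]]
        by blast
      have m: "x \<in> Vmark P" "y \<in> Vmark P" using nrt x(3,4) comp by blast+
      obtain i j where ij: "j \<in> Q x i" using node_ne[OF x(3)] by blast
      obtain i' j' where ij': "j' \<in> Q y i'" using node_ne[OF x(4)] by blast
      have X: "X = point_bracket i j" "i \<in> {1..r}" "j \<in> {1..n i}"
        using brk_mark[OF m(1) ij] Q_range[OF node_verts[OF x(3)] ij] x(1) by blast+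
      have Y: "Y = point_bracket i' j'" "i' \<in> {1..r}" "j' \<in> {1..n i'}"
        using brk_mark[OF m(2) ij'] Q_range[OF node_verts[OF x(4)] ij'] x(2) by blast+
      have "K (coh P x) = {i}" "K (coh P y) = {i'}" using Q_mark m ij ij' by blast+
      then have ii: "i' = i" using x(5) by simp
      have "j < j'" using Q_left_of[OF x(6), of i] ij ij' ii unfolding slt_def by blast
      then show "e \<in> tb_lt Z" using Z.R_points X Y ii XY by simp
    qed
  qed
qed

text \<open>The root \<open>(0, 0)\<close> has the children \<open>(s, 0)\<close> for
  \<open>s\<close> from 1 to \<open>r\<close>, and \<open>(s, 0)\<close> has the children
  \<open>(s, j)\<close> for \<open>j\<close> from 1 to \<open>c s\<close>; the pairs are encoded as
  natural numbers. For \<open>c = 0\<close> this is the corolla with \<open>r\<close> leaves, which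
  serves as seam tree when \<open>r\<close> is at least 2.\<close>

definition broom :: "nat \<Rightarrow> (nat \<Rightarrow> nat) \<Rightarrow> nat rrt" where
  "broom r c = \<lparr>verts = insert (prod_encode (0, 0)) {prod_encode (s, j) | s j. s \<in> {1..r} \<and> j \<le> c s},
     rt = prod_encode (0, 0),
     inc = (\<lambda>x. case prod_decode x of (s, j) \<Rightarrow>
       if s = 0 then map (\<lambda>s. prod_encode (s, 0)) [1..<Suc r]
       else if j = 0 then map (\<lambda>j. prod_encode (s, j)) [1..<Suc (c s)] else [])\<rparr>"

lemma broom_simps [simp]:
  "rt (broom r c) = prod_encode (0, 0)"
  "inc (broom r c) (prod_encode (0, j)) = map (\<lambda>s. prod_encode (s, 0)) [1..<Suc r]"
  "0 < s \<Longrightarrow> inc (broom r c) (prod_encode (s, 0)) = map (\<lambda>j. prod_encode (s, j)) [1..<Suc (c s)]"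
  "0 < s \<Longrightarrow> 0 < j \<Longrightarrow> inc (broom r c) (prod_encode (s, j)) = []"
  by (simp_all add: broom_def)

lemma broom_verts:
  "x \<in> verts (broom r c) \<longleftrightarrow> x = prod_encode (0, 0) \<or> (\<exists>s j. x = prod_encode (s, j) \<and> 1 \<le> s \<and> s \<le> r \<and> j \<le> c s)"
  by (auto simp: broom_def)

lemma broom_edges:
  "(x, y) \<in> edges (broom r c) \<longleftrightarrow>
    (\<exists>s. 1 \<le> s \<and> s \<le> r \<and> x = prod_encode (s, 0) \<and> y = prod_encode (0, 0)) \<or>
    (\<exists>s j. 1 \<le> s \<and> s \<le> r \<and> 1 \<le> j \<and> j \<le> c s \<and> x = prod_encode (s, j) \<and> y = prod_encode (s, 0))"
  (is "_ \<longleftrightarrow> ?R")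
proof
  assume "(x, y) \<in> edges (broom r c)"
  then have y: "y \<in> verts (broom r c)" "x \<in> set (inc (broom r c) y)" by (auto simp: edges_def)
  from y(1) show ?R unfolding broom_verts
  proof (elim disjE exE conjE)
    assume "y = prod_encode (0, 0)"
    then show ?R using y(2) by auto
  next
    fix s j assume s: "y = prod_encode (s, j)" "1 \<le> s" "s \<le> r" "j \<le> c s"
    then show ?R using y(2) by (cases "j = 0") auto
  qed
next
  assume ?R
  then show "(x, y) \<in> edges (broom r c)"
    unfolding edges_def broom_verts by (elim disjE exE conjE) (auto simp: less_Suc_eq_le)
qed

lemma broom_rrt: "is_rrt (broom r c)"
  unfolding is_rrt_def
proof (intro conjI ballI allI)
  have "verts (broom r c) \<subseteq> insert (prod_encode (0, 0)) (\<Union>s\<in>{1..r}. (\<lambda>j. prod_encode (s, j)) ` {..c s})"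
    by (auto simp: broom_def)
  then show "finite (verts (broom r c))" by (rule finite_subset) simp
  show "rt (broom r c) \<in> verts (broom r c)" by (simp add: broom_verts)
  show "(rt (broom r c), \<alpha>) \<notin> edges (broom r c)" for \<alpha> unfolding broom_edges by auto
  fix v assume v: "v \<in> verts (broom r c)"
  then consider "v = prod_encode (0, 0)" | s where "v = prod_encode (s, 0)" "1 \<le> s" "s \<le> r"
    | s j where "v = prod_encode (s, j)" "1 \<le> s" "s \<le> r" "1 \<le> j" "j \<le> c s"
    unfolding broom_verts by (metis One_nat_def Suc_leI neq0_conv)
  note cs = this
  show "distinct (inc (broom r c) v)"
    using cs by cases (auto simp: distinct_map inj_on_def)
  show "set (inc (broom r c) v) \<subseteq> verts (broom r c)"
    using cs by cases (auto simp: broom_verts less_Suc_eq_le)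
  show "below (broom r c) v (rt (broom r c))"
    using cs
  proof cases
    case 1
    then show ?thesis by simp
  next
    case (2 s)
    then have "(v, rt (broom r c)) \<in> edges (broom r c)" unfolding broom_edges by auto
    then show ?thesis by (rule r_into_rtrancl)
  next
    case (3 s j)
    then have "(v, prod_encode (s, 0)) \<in> edges (broom r c)" "(prod_encode (s, 0), rt (broom r c)) \<in> edges (broom r c)"
      unfolding broom_edges by auto
    then show ?thesis by (meson converse_rtrancl_into_rtrancl r_into_rtrancl)
  qed
next
  fix v assume v: "v \<in> verts (broom r c) - {rt (broom r c)}"
  then consider s where "v = prod_encode (s, 0)" "1 \<le> s" "s \<le> r"
    | s j where "v = prod_encode (s, j)" "1 \<le> s" "s \<le> r" "1 \<le> j" "j \<le> c s"
    unfolding broom_verts Diff_iff by (metis One_nat_def Suc_leI neq0_conv broom_simps(1) insert_iff)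
  then show "\<exists>!\<alpha>. (v, \<alpha>) \<in> edges (broom r c)"
  proof cases
    case (1 s)
    then show ?thesis unfolding broom_edges by (intro ex1I[of _ "prod_encode (0, 0)"]) auto
  next
    case (2 s j)
    then show ?thesis unfolding broom_edges by (intro ex1I[of _ "prod_encode (s, 0)"]) auto
  qed
qed

text \<open>One component at the root, whose seam number \<open>s\<close> has \<open>c s\<close>
  marks. This is the shape of the greatest tree-pair except when there is only one seam leaf with
  only one mark.\<close>

definition broom_pair :: "nat \<Rightarrow> (nat \<Rightarrow> nat) \<Rightarrow> nat rrt \<Rightarrow> (nat \<Rightarrow> nat) \<Rightarrow> (nat, nat) tree_pair" where
  "broom_pair r c st f = \<lparr>bub = broom r c,
     solid = {(prod_encode (s, 0), prod_encode (0, 0)) | s. 1 \<le> s \<and> s \<le> r},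
     Vcomp = {prod_encode (0, 0)}, Vseam = {prod_encode (s, 0) | s. 1 \<le> s \<and> s \<le> r},
     Vmark = {prod_encode (s, j) | s j. 1 \<le> s \<and> s \<le> r \<and> 1 \<le> j \<and> j \<le> c s},
     stree = st, coh = f\<rparr>"

lemma broom_pair_good:
  assumes "1 \<le> r" "is_rrt st" "\<And>s. s \<in> verts st \<Longrightarrow> length (inc st s) \<noteq> 1"
    and "f (prod_encode (0, 0)) = rt st"
    and "\<And>s j. 1 \<le> s \<Longrightarrow> s \<le> r \<Longrightarrow> 1 \<le> j \<Longrightarrow> j \<le> c s \<Longrightarrow> f (prod_encode (s, j)) = f (prod_encode (s, 0))"
    and "\<And>s. 1 \<le> s \<Longrightarrow> s \<le> r \<Longrightarrow> f (prod_encode (s, 0)) \<in> leaves st"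
    and one: "r = 1 \<Longrightarrow> 2 \<le> c 1 \<and> f (prod_encode (1, 0)) = rt st"
    and two: "2 \<le> r \<Longrightarrow> (\<exists>s. 1 \<le> s \<and> s \<le> r \<and> c s \<noteq> 0) \<and> map (\<lambda>s. f (prod_encode (s, 0))) [1..<Suc r] = inc st (rt st)"
  shows "good (broom_pair r c st f)"
  unfolding good_def
proof (intro conjI ballI allI impI)
  let ?P = "broom_pair r c st f"
  note simps = broom_pair_def
  show "is_rrt (bub ?P)" "is_rrt (stree ?P)" using broom_rrt assms(2) by (simp_all add: simps)
  show "verts (bub ?P) = Vcomp ?P \<union> Vseam ?P \<union> Vmark ?P"
  proof (rule set_eqI)
    fix x
    show "x \<in> verts (bub ?P) \<longleftrightarrow> x \<in> Vcomp ?P \<union> Vseam ?P \<union> Vmark ?P"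
      by (auto simp: simps broom_verts)
  qed
  show "solid ?P = {(\<beta>, \<alpha>). \<alpha> \<in> Vcomp ?P \<and> \<beta> \<in> set (inb ?P \<alpha>)}"
    by (auto simp: simps less_Suc_eq_le simp del: upt_Suc)
  show "inb ?P \<alpha> \<noteq> []" if "\<alpha> \<in> Vcomp ?P" for \<alpha> using that assms(1) by (auto simp: simps)
  show "set (inb ?P \<alpha>) \<subseteq> Vseam ?P" if "\<alpha> \<in> Vcomp ?P" for \<alpha> using that by (auto simp: simps less_Suc_eq_le)
  show "set (inb ?P \<alpha>) \<subseteq> Vcomp ?P \<union> Vmark ?P" if "\<alpha> \<in> Vseam ?P" for \<alpha>
    using that by (auto simp: simps less_Suc_eq_le)
  show "2 \<le> length (inb ?P \<beta>)" "coh ?P \<beta> = coh ?P \<alpha>" if h: "\<alpha> \<in> Vcomp ?P" "inb ?P \<alpha> = [\<beta>]" for \<alpha> \<beta>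
  proof -
    have a: "\<alpha> = prod_encode (0, 0)" using h(1) by (simp add: simps)
    have e: "map (\<lambda>s. prod_encode (s, 0)) [1..<Suc r] = [\<beta>]" using h(2) unfolding a by (simp add: simps del: upt_Suc)
    then have "length [1..<Suc r] = 1" by (metis length_map length_Cons list.size(3) One_nat_def)
    then have r: "r = 1" by (simp only: length_upt)
    then have b: "\<beta> = prod_encode (1, 0)" using e by simp
    show "2 \<le> length (inb ?P \<beta>)" "coh ?P \<beta> = coh ?P \<alpha>" using one[OF r] assms(4) unfolding a b by (simp_all add: simps)
  qed
  show "\<exists>\<beta>\<in>set (inb ?P \<alpha>). inb ?P \<beta> \<noteq> []" if h: "\<alpha> \<in> Vcomp ?P" "2 \<le> length (inb ?P \<alpha>)" for \<alpha>
  proof -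
    have a: "\<alpha> = prod_encode (0, 0)" using h(1) by (simp add: simps)
    have "2 \<le> r" using h(2) unfolding a by (simp add: simps del: upt_Suc)
    then obtain s where s: "1 \<le> s" "s \<le> r" "c s \<noteq> 0" using two by blast
    have "prod_encode (s, 0) \<in> set (inb ?P \<alpha>)" using s unfolding a by (auto simp: simps less_Suc_eq_le)
    moreover have "inb ?P (prod_encode (s, 0)) \<noteq> []" using s by (simp add: simps)
    ultimately show ?thesis by blast
  qed
  show "map (coh ?P) (inb ?P \<alpha>) = ins ?P (coh ?P \<alpha>)" if h: "\<alpha> \<in> Vcomp ?P" "2 \<le> length (inb ?P \<alpha>)" for \<alpha>
  proof -
    have a: "\<alpha> = prod_encode (0, 0)" using h(1) by (simp add: simps)
    have "2 \<le> r" using h(2) unfolding a by (simp add: simps del: upt_Suc)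
    then have "map (\<lambda>s. f (prod_encode (s, 0))) [1..<Suc r] = inc st (rt st)" using two by blast
    then show ?thesis unfolding a by (simp add: simps assms(4) comp_def del: upt_Suc)
  qed
  show "coh ?P \<gamma> = coh ?P \<beta>" if h: "\<beta> \<in> Vseam ?P" "\<gamma> \<in> set (inb ?P \<beta>)" for \<beta> \<gamma>
  proof -
    obtain s where s: "1 \<le> s" "s \<le> r" "\<beta> = prod_encode (s, 0)" using h(1) by (auto simp: simps)
    then obtain j where "1 \<le> j" "j \<le> c s" "\<gamma> = prod_encode (s, j)" using h(2) by (auto simp: simps less_Suc_eq_le)
    then show ?thesis using assms(5) s by (simp add: simps)
  qed
  show "coh ?P ` Vmark ?P \<subseteq> leaves (stree ?P)" using assms(5,6) by (auto simp: simps)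
qed (use assms(3,4) in \<open>auto simp: broom_pair_def\<close>)

definition single :: "nat rrt" where
  "single = \<lparr>verts = {0}, rt = 0, inc = (\<lambda>_. [])\<rparr>"

lemma single_rrt: "is_rrt single"
  by (auto simp: is_rrt_def single_def edges_def)

lemma single_leaves: "leaves single = {0}"
  by (auto simp: leaves_def single_def)

lemma single_leaf_no: "leaf_no single 0 = 1"
proof -
  interpret ribbon_tree single by standard (rule single_rrt)
  have "leaf_rank single (leaves single) ` leaves single = {1..card (leaves single)}" by (rule leaf_rank_image) simp
  then show ?thesis by (simp add: single_leaves leaf_no_eq)
qed

text \<open>A component with a single seam needs at least two vertices below that seam, so for
  \<open>r = 1\<close> and one mark the pair consists of the mark alone. For \<open>r = 1\<close>
  and several marks all of them hang on one seam over the one-vertex seam tree. For larger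
  \<open>r\<close> the root component lies over the root of a corolla.\<close>

lemma top_exists:
  assumes "1 \<le> r" "\<exists>i\<in>{1..r}. n i \<noteq> 0"
  obtains P :: "(nat, nat) tree_pair" where "stable_tree_pair r n P"
    "\<And>Z. is_two_bracketing r n Z \<Longrightarrow> (Z, brackets P) \<in> W_br_le r n"
proof -
  have "\<exists>P :: (nat, nat) tree_pair. stable_tree_pair r n P \<and> Vcomp P \<subseteq> {rt (bub P)} \<and>
      verts (stree P) \<subseteq> insert (rt (stree P)) (leaves (stree P))"
  proof (cases "r = 1")
    case r: True
    show ?thesis
    proof (cases "n 1 = 1")
      case True
      let ?P = "\<lparr>bub = single, solid = {}, Vcomp = {}, Vseam = {}, Vmark = {0}, stree = single, coh = (\<lambda>_. 0)\<rparr> :: (nat, nat) tree_pair"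
      have "{\<mu>. \<mu> = 0} = {0 :: nat}" by blast
      then have "stable_tree_pair r n ?P"
        unfolding stable_iff good_def using single_rrt single_leaves single_leaf_no r True
        by (auto simp: single_def)
      then show ?thesis using single_leaves by (intro exI[of _ ?P]) (auto simp: single_def)
    next
      case False
      then have n2: "2 \<le> n 1" using assms(2) r by auto
      let ?P = "broom_pair r n single (\<lambda>_. 0)"
      have "good ?P"
        by (rule broom_pair_good) (use r n2 single_rrt single_leaves in \<open>auto simp: single_def\<close>)
      moreover have "card {\<mu> \<in> Vmark ?P. coh ?P \<mu> = 0} = n 1"
      proof -
        have "{\<mu> \<in> Vmark ?P. coh ?P \<mu> = 0} = (\<lambda>j. prod_encode (1, j)) ` {1..n 1}"
          using r by (auto simp: broom_pair_def)
        moreover have "inj_on (\<lambda>j. prod_encode (1, j)) {1..n 1}" by (auto intro!: inj_onI)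
        ultimately show ?thesis by (simp only: card_image card_atLeastAtMost diff_Suc_1)
      qed
      moreover have "stree ?P = single" by (simp add: broom_pair_def)
      ultimately have "stable_tree_pair r n ?P"
        unfolding stable_iff by (simp add: single_leaves single_leaf_no r)
      moreover have "Vcomp ?P \<subseteq> {rt (bub ?P)}" by (simp add: broom_pair_def)
      moreover have "verts (stree ?P) \<subseteq> insert (rt (stree ?P)) (leaves (stree ?P))"
        by (simp add: broom_pair_def single_def)
      ultimately show ?thesis by blast
    qed
  next
    case False
    then have r2: "2 \<le> r" using assms(1) by simp
    let ?st = "broom r (\<lambda>_. 0)"
    interpret St: ribbon_tree ?st by standard (rule broom_rrt)
    have lv: "leaves ?st = (\<lambda>s. prod_encode (s, 0)) ` {1..r}"
    proof (rule set_eqI)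
      fix x
      show "x \<in> leaves ?st \<longleftrightarrow> x \<in> (\<lambda>s. prod_encode (s, 0)) ` {1..r}"
        using r2 by (auto simp: leaves_def broom_verts)
    qed
    have cl: "card (leaves ?st) = r"
    proof -
      have "inj_on (\<lambda>s. prod_encode (s, 0)) {1..r}" by (auto intro!: inj_onI)
      then show ?thesis unfolding lv by (simp only: card_image card_atLeastAtMost diff_Suc_1)
    qed
    \<comment> \<open>The leaf numbers of the corolla are not evaluated: each seam gets its number
      of marks through \<open>leaf_no\<close> itself, and the counting condition holds by
      construction. Surjectivity of the numbering then yields a seam with marks, as stability
      requires.\<close>
    let ?c = "\<lambda>s. n (leaf_no ?st (prod_encode (s, 0)))"
    let ?f = "\<lambda>x. prod_encode (fst (prod_decode x), 0)"
    let ?P = "broom_pair r ?c ?st ?f"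
    obtain i where i: "i \<in> {1..r}" "n i \<noteq> 0" using assms(2) by blast
    have "leaf_rank ?st (leaves ?st) ` leaves ?st = {1..r}" using St.leaf_rank_image[of "leaves ?st"] cl by simp
    then obtain x where "x \<in> leaves ?st" "leaf_no ?st x = i" using i(1) unfolding leaf_no_eq by (metis imageE)
    then obtain s0 where s0: "1 \<le> s0" "s0 \<le> r" "?c s0 \<noteq> 0" using i(2) unfolding lv by auto
    have g: "good ?P"
    proof (rule broom_pair_good)
      show "length (inc ?st s) \<noteq> 1" if "s \<in> verts ?st" for s
        using that r2 by (auto simp: broom_verts)
      show "?f (prod_encode (s, 0)) \<in> leaves ?st" if "1 \<le> s" "s \<le> r" for s using that by (simp add: lv)
      show "(\<exists>s. 1 \<le> s \<and> s \<le> r \<and> ?c s \<noteq> 0) \<and> map (\<lambda>s. ?f (prod_encode (s, 0))) [1..<Suc r] = inc ?st (rt ?st)"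
        using s0 by (auto simp del: upt_Suc)
    qed (use assms(1) r2 broom_rrt in simp_all)
    have cnt: "card {\<mu> \<in> Vmark ?P. coh ?P \<mu> = x} = n (leaf_no (stree ?P) x)" if x: "x \<in> leaves (stree ?P)" for x
    proof -
      obtain s where s: "1 \<le> s" "s \<le> r" "x = prod_encode (s, 0)" using x lv by (auto simp: broom_pair_def)
      have "{\<mu> \<in> Vmark ?P. coh ?P \<mu> = x} = (\<lambda>j. prod_encode (s, j)) ` {1..?c s}"
        using s by (auto simp: broom_pair_def)
      moreover have "inj_on (\<lambda>j. prod_encode (s, j)) {1..?c s}" by (auto intro!: inj_onI)
      ultimately have "card {\<mu> \<in> Vmark ?P. coh ?P \<mu> = x} = ?c s"
        by (simp only: card_image card_atLeastAtMost diff_Suc_1)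
      then show ?thesis using s(3) by (simp add: broom_pair_def)
    qed
    have "stable_tree_pair r n ?P"
      unfolding stable_iff using g cnt cl by (simp add: broom_pair_def)
    moreover have "Vcomp ?P \<subseteq> {rt (bub ?P)}" by (simp add: broom_pair_def)
    moreover have "verts (stree ?P) \<subseteq> insert (rt (stree ?P)) (leaves (stree ?P))"
      using lv by (auto simp: broom_pair_def broom_verts)
    ultimately show ?thesis by blast
  qed
  then obtain P :: "(nat, nat) tree_pair" where P: "stable_tree_pair r n P" "Vcomp P \<subseteq> {rt (bub P)}"
    "verts (stree P) \<subseteq> insert (rt (stree P)) (leaves (stree P))" by blast
  interpret stable_pair r n P by standard (rule P(1))
  show thesis using that[OF P(1)] top_le[OF P(2,3)] by blast
qed


section \<open>The isomorphism of posets\<close>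

definition bracket_count :: "two_bracketing \<Rightarrow> nat" where
  "bracket_count Z = card (ones Z) + card (twos Z)"

lemma bracket_count_mono:
  assumes "(Z', Z) \<in> W_br_le r n"
  shows "bracket_count Z \<le> bracket_count Z'" "Z' \<noteq> Z \<Longrightarrow> bracket_count Z < bracket_count Z'"
proof -
  note h = W_br_leD[OF assms]
  interpret Z': bracketing r n Z' by standard (rule h(2))
  have le: "card (ones Z) \<le> card (ones Z')" "card (twos Z) \<le> card (twos Z')"
    using h(3,4) Z'.finite_ones Z'.finite_twos by (simp_all add: card_mono)
  then show "bracket_count Z \<le> bracket_count Z'" by (simp add: bracket_count_def)
  assume "Z' \<noteq> Z"
  then have "ones Z \<noteq> ones Z' \<or> twos Z \<noteq> twos Z'"
    using assms unfolding W_br_le_def W_br_less_def by blast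
  then have "card (ones Z) < card (ones Z') \<or> card (twos Z) < card (twos Z')"
    using h(3,4) Z'.finite_ones Z'.finite_twos psubset_card_mono by (metis psubsetI)
  then show "bracket_count Z < bracket_count Z'" using le by (auto simp: bracket_count_def)
qed

lemma W_br_le_trans: "(X, Y) \<in> W_br_le r n \<Longrightarrow> (Y, W) \<in> W_br_le r n \<Longrightarrow> (X, W) \<in> W_br_le r n"
  using W_br_partial_order[of r n] unfolding partial_order_on_def preorder_on_def by (meson transD)

definition iso_class :: "nat \<Rightarrow> (nat \<Rightarrow> nat) \<Rightarrow> (nat, nat) tree_pair \<Rightarrow> (nat, nat) tree_pair set" where
  "iso_class r n P = tree_pair_iso_rel r n `` {P}"

lemma iso_class_iff:
  "P' \<in> iso_class r n P \<longleftrightarrow> stable_tree_pair r n P \<and> stable_tree_pair r n P' \<and> brackets P = brackets P'"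
  unfolding iso_class_def by (simp add: iso_rel_iff)

lemma W_tree_iff: "X \<in> W_tree r n \<longleftrightarrow> (\<exists>P. stable_tree_pair r n P \<and> X = iso_class r n P)"
  unfolding W_tree_def quotient_def iso_class_def by blast

lemma iso_class_eq_iff:
  "stable_tree_pair r n P \<Longrightarrow> stable_tree_pair r n P' \<Longrightarrow>
    iso_class r n P = iso_class r n P' \<longleftrightarrow> brackets P = brackets P'"
  using iso_class_iff by (auto simp: set_eq_iff)

text \<open>Induction on the number of brackets of \<open>Z\<close> that are still missing. A move
  towards \<open>Z\<close> changes the brackets and refines them, so the count grows strictly while
  remaining bounded by that of \<open>Z\<close>.\<close>

lemma reach:
  assumes "stable_tree_pair r n P" "(Z, brackets P) \<in> W_br_le r n"
  shows "\<exists>P'. stable_tree_pair r n P' \<and> brackets P' = Z \<and> (iso_class r n P', iso_class r n P) \<in> (W_tree_step r n)\<^sup>*"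
  using assms
proof (induction "bracket_count Z - bracket_count (brackets P)" arbitrary: P rule: less_induct)
  case less
  show ?case
  proof (cases "Z = brackets P")
    case True
    then show ?thesis using less.prems(1) by blast
  next
    case False
    note h = W_br_leD[OF less.prems(2)]
    interpret R: refined_nat r n P Z
      by unfold_locales (use less.prems(1) h in auto)
    obtain P1 where "R.progress P1" using R.progress_exists[OF False] by blast
    then have P1: "move P P1" "stable_tree_pair r n P1" "(Z, brackets P1) \<in> W_br_le r n" "brackets P1 \<noteq> brackets P"
      unfolding R.progress_def by blast+
    have "bracket_count (brackets P) < bracket_count (brackets P1)"
      by (rule bracket_count_mono(2)[OF R.move_le[OF P1(1)] P1(4)])
    moreover have "bracket_count (brackets P1) \<le> bracket_count Z" by (rule bracket_count_mono(1)[OF P1(3)])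
    ultimately have "bracket_count Z - bracket_count (brackets P1) < bracket_count Z - bracket_count (brackets P)"
      by linarith
    then obtain P' where P': "stable_tree_pair r n P'" "brackets P' = Z"
      "(iso_class r n P', iso_class r n P1) \<in> (W_tree_step r n)\<^sup>*"
      using less.hyps[OF _ P1(2,3)] by blast
    have "P \<in> iso_class r n P" "P1 \<in> iso_class r n P1" using less.prems(1) P1(2) by (simp_all add: iso_class_iff)
    then have "(iso_class r n P1, iso_class r n P) \<in> W_tree_step r n"
      unfolding W_tree_step_def using P1(1,2) less.prems(1) W_tree_iff by blast
    with P'(3) have "(iso_class r n P', iso_class r n P) \<in> (W_tree_step r n)\<^sup>*" by (rule rtrancl_into_rtrancl)
    then show ?thesis using P'(1,2) by blast
  qed
qed

text \<open>Each move refines the brackets, and brackets depend on the isomorphism class only.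
  Conversely \<open>reach\<close> arrives at some pair with the brackets of \<open>P'\<close>, and
  this pair is isomorphic to \<open>P'\<close>.\<close>

lemma W_tree_le_iff:
  assumes "stable_tree_pair r n P" "stable_tree_pair r n P'"
  shows "(iso_class r n P', iso_class r n P) \<in> W_tree_le r n \<longleftrightarrow> (brackets P', brackets P) \<in> W_br_le r n"
proof
  assume "(iso_class r n P', iso_class r n P) \<in> W_tree_le r n"
  then have "(iso_class r n P', iso_class r n P) \<in> (W_tree_step r n)\<^sup>*" by (simp add: W_tree_le_def)
  \<comment> \<open>The steps relate classes, and a step may use other representatives than the
    previous one; the claim is therefore made for all representatives of the class.\<close>
  then have "\<forall>R. stable_tree_pair r n R \<longrightarrow> iso_class r n R = iso_class r n P' \<longrightarrow> (brackets R, brackets P) \<in> W_br_le r n"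
  proof (induction rule: converse_rtrancl_induct)
    case base
    show ?case
    proof (intro allI impI)
      fix R assume R: "stable_tree_pair r n R" "iso_class r n R = iso_class r n P"
      interpret stable_pair r n P by standard (rule assms(1))
      have "brackets R = brackets P" using R assms(1) iso_class_eq_iff by blast
      then show "(brackets R, brackets P) \<in> W_br_le r n"
        using W_br_leI[OF brackets_bracketing brackets_bracketing] by simp
    qed
  next
    case (step X Y)
    show ?case
    proof (intro allI impI)
      fix R assume R: "stable_tree_pair r n R" "iso_class r n R = X"
      obtain A A' where A: "A \<in> Y" "A' \<in> X" "move A A'" "Y \<in> W_tree r n"
        using step.hyps(1) unfolding W_tree_step_def by blast
      obtain S where S: "stable_tree_pair r n S" "Y = iso_class r n S" using A(4) unfolding W_tree_iff by blast
      have b: "brackets A = brackets S" "stable_tree_pair r n A" using A(1) unfolding S(2) iso_class_iff by simp_all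
      have b': "brackets A' = brackets R" using A(2) unfolding R(2)[symmetric] iso_class_iff by simp
      interpret stable_pair r n A by standard (rule b(2))
      have "(brackets R, brackets S) \<in> W_br_le r n" using move_le[OF A(3)] b b' by simp
      moreover have "(brackets S, brackets P) \<in> W_br_le r n" using step.IH S by blast
      ultimately show "(brackets R, brackets P) \<in> W_br_le r n" by (rule W_br_le_trans)
    qed
  qed
  then show "(brackets P', brackets P) \<in> W_br_le r n" using assms(2) by blast
next
  assume "(brackets P', brackets P) \<in> W_br_le r n"
  then obtain R where R: "stable_tree_pair r n R" "brackets R = brackets P'"
    "(iso_class r n R, iso_class r n P) \<in> (W_tree_step r n)\<^sup>*"
    using reach[OF assms(1)] by blast
  have "iso_class r n R = iso_class r n P'" using R(1,2) assms(2) iso_class_eq_iff by blast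
  then show "(iso_class r n P', iso_class r n P) \<in> W_tree_le r n"
    using R(3) assms unfolding W_tree_le_def W_tree_iff by auto
qed

text \<open>Antisymmetry of the order generated by the moves is obtained in this way, from that of
  the inclusion order on 2-bracketings.\<close>

lemma partial_order_pull:
  assumes "partial_order_on B le'" "inj_on \<phi> A" "\<phi> ` A \<subseteq> B" "le \<subseteq> A \<times> A"
    and iff: "\<And>x y. x \<in> A \<Longrightarrow> y \<in> A \<Longrightarrow> (x, y) \<in> le \<longleftrightarrow> (\<phi> x, \<phi> y) \<in> le'"
  shows "partial_order_on A le"
proof -
  have le': "refl_on B le'" "trans le'" "antisym le'"
    using assms(1) by (auto simp: partial_order_on_def preorder_on_def)
  show ?thesis
    unfolding partial_order_on_def preorder_on_def
  proof (intro conjI)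
    show "le \<subseteq> A \<times> A" by (rule assms(4))
    show "refl_on A le"
    proof (rule refl_onI)
      fix x assume x: "x \<in> A"
      then have "(\<phi> x, \<phi> x) \<in> le'" using refl_onD[OF le'(1)] assms(3) by blast
      then show "(x, x) \<in> le" using iff x by blast
    qed
    show "trans le"
    proof (rule transI)
      fix x y z assume h: "(x, y) \<in> le" "(y, z) \<in> le"
      then have m: "x \<in> A" "y \<in> A" "z \<in> A" using assms(4) by blast+
      then have "(\<phi> x, \<phi> z) \<in> le'" using transD[OF le'(2)] h iff by blast
      then show "(x, z) \<in> le" using iff m by blast
    qed
    show "antisym le"
    proof (rule antisymI)
      fix x y assume h: "(x, y) \<in> le" "(y, x) \<in> le"
      then have m: "x \<in> A" "y \<in> A" using assms(4) by blast+
      then have "\<phi> x = \<phi> y" using antisymD[OF le'(3)] h iff by blast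
      then show "x = y" using inj_onD[OF assms(2)] m by blast
    qed
  qed
qed

theorem theorem3p17:
  fixes r :: nat and n :: "nat \<Rightarrow> nat"
  assumes "r \<ge> 1"
    and "\<exists>i\<in>{1..r}. n i \<noteq> 0"
  shows "poset_isomorphic (W_tree r n) (W_tree_le r n) (W_br r n) (W_br_le r n)"
proof -
  \<comment> \<open>Any representative gives the same value, because isomorphic pairs have the same
    brackets.\<close>
  define \<phi> where "\<phi> X = brackets (SOME P. P \<in> X)" for X :: "(nat, nat) tree_pair set"
  have \<phi>: "\<phi> (iso_class r n P) = brackets P" if "stable_tree_pair r n P" for P
  proof -
    have "P \<in> iso_class r n P" using that by (simp add: iso_class_iff)
    then have "(SOME P'. P' \<in> iso_class r n P) \<in> iso_class r n P" by (rule someI)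
    then show ?thesis unfolding \<phi>_def
      by (rule iso_class_iff[THEN iffD1, THEN conjunct2, THEN conjunct2, symmetric])
  qed
  have inj: "inj_on \<phi> (W_tree r n)"
  proof (rule inj_onI)
    fix X Y assume h: "X \<in> W_tree r n" "Y \<in> W_tree r n" "\<phi> X = \<phi> Y"
    then obtain P P' where P: "stable_tree_pair r n P" "X = iso_class r n P" "stable_tree_pair r n P'" "Y = iso_class r n P'"
      unfolding W_tree_iff by blast
    then show "X = Y" using h(3) \<phi> iso_class_eq_iff by simp
  qed
  have im: "\<phi> ` W_tree r n = W_br r n"
  proof
    show "\<phi> ` W_tree r n \<subseteq> W_br r n"
    proof (rule image_subsetI)
      fix X assume "X \<in> W_tree r n"
      then obtain P where P: "stable_tree_pair r n P" "X = iso_class r n P" unfolding W_tree_iff by blast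
      interpret stable_pair r n P by standard (rule P(1))
      show "\<phi> X \<in> W_br r n" using \<phi> P brackets_bracketing by (simp add: W_br_def)
    qed
    show "W_br r n \<subseteq> \<phi> ` W_tree r n"
    proof
      fix Z assume "Z \<in> W_br r n"
      then have Z: "is_two_bracketing r n Z" by (simp add: W_br_def)
      obtain P :: "(nat, nat) tree_pair" where P: "stable_tree_pair r n P"
        "\<And>Z. is_two_bracketing r n Z \<Longrightarrow> (Z, brackets P) \<in> W_br_le r n"
        using top_exists[OF assms] by blast
      obtain P' :: "(nat, nat) tree_pair" where P': "stable_tree_pair r n P'" "brackets P' = Z"
        using reach[OF P(1) P(2)[OF Z]] by blast
      then have "iso_class r n P' \<in> W_tree r n" "\<phi> (iso_class r n P') = Z" using \<phi> W_tree_iff by auto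
      then show "Z \<in> \<phi> ` W_tree r n" by blast
    qed
  qed
  have iff: "(X, Y) \<in> W_tree_le r n \<longleftrightarrow> (\<phi> X, \<phi> Y) \<in> W_br_le r n" if h: "X \<in> W_tree r n" "Y \<in> W_tree r n" for X Y
  proof -
    obtain P P' where P: "stable_tree_pair r n P" "X = iso_class r n P" "stable_tree_pair r n P'" "Y = iso_class r n P'"
      using h unfolding W_tree_iff by blast
    show ?thesis unfolding P(2,4) \<phi>[OF P(1)] \<phi>[OF P(3)] by (rule W_tree_le_iff[OF P(3,1)])
  qed
  have "W_tree_le r n \<subseteq> W_tree r n \<times> W_tree r n" unfolding W_tree_le_def by blast
  then have "partial_order_on (W_tree r n) (W_tree_le r n)"
    using partial_order_pull[OF W_br_partial_order inj _ _ iff] im by blast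
  then show ?thesis
    unfolding poset_isomorphic_def bij_betw_def using W_br_partial_order inj im iff by blast
qed

end
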